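(* Let $X$ be the random field on the torus described in the context, and suppose it satisfies Assumptions A1 and B (both stated in the context). For $N=2^{j+2}$ let $S_N,U_N$ be the skewness and kurtosis statistics and let $\widehat\sigma_{S_N}^2$, $\widehat\sigma_{U_N}^2$ be the estimators of their variances defined in the context. Then, as $N=2^{j+2}\to\infty$, $$\Big(\frac{S_N}{\widehat\sigma_{S_N}},\ \frac{U_N}{\widehat\sigma_{U_N}}\Big)\ \longrightarrow\ N(0,I_2)\quad\text{in distribution},$$ where $I_2$ is the $2\times 2$ identity matrix.
   Context: **Field.** $X$ is a real-valued, zero-mean, stationary (isotropic) random field on the torus $[0,2\pi]$, $X(\vartheta)=\sum_{l\in\mathbb Z}w_l e^{il\vartheta}$, where the $w_l$ are complex random variables with $w_0=0$, $w_{-l}=\overline{w_l}$, $E w_l=0$, $E[w_l\overline{w_{l'}}]=0$ for $l\ne l'$, $E|w_l|^2=C_l$ (so $C_{-l}=C_l$), and $\sum_l C_l<\infty$. **Assumption A1.** There are constants $0<c_1\le c_2<\infty$, a real $\alpha>1$ and a function $g:\mathbb N\to[c_1,c_2]$, the restriction to $\mathbb N$ of a function in $W_1^R$ for some integer $R\ge0$ ($W_1^R$: functions with integrable weak derivative of order $R$), such that $C_l=g(l)l^{-\alpha}$ for all $l\in\mathbb N$, $l\ge1$. **Assumption B.** The field $X$ is Gaussian (the $w_l$ are jointly Gaussian). **Wavelets.** Let $\phi:\mathbb R\to[0,1]$ be an even $C^\infty$ function supported in $\{|\xi|\le1\}$ with $\phi(\xi)=1$ for $|\xi|\le\frac12$.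 Let $a\ge0$ be defined by $a^2(\xi)=\phi(\xi/2)-\phi(\xi)\ge 0$; $\phi$ is chosen so that $a$ is $C^\infty$. Thus $a$ is even and vanishes unless $\frac12\le|\xi|\le2$. For $N=2^{j+2}$, $j\in\mathbb N$, put $\tau=2\pi/N$ and $$\psi_N(t)=\frac1{\sqrt N}\sum_{l\in\mathbb Z}a(\tfrac{4l}N)e^{ilt},\qquad \psi_{Nk}(t)=\psi_N(t-k\tau),\qquad \beta_{Nk}=\frac1{2\pi}\int_{-\pi}^{\pi}X(\vartheta)\psi_{Nk}(\vartheta)\,d\vartheta,\quad k\in\mathbb Z .$$ Let $$\sigma_N^2=E[\beta_{Nk}^2]=\frac1N\sum_{N/8\le|l|\le N/2}C_l\,a^2(\tfrac{4l}N),\qquad \widehat\beta_{Nk}=\beta_{Nk}/\sigma_N .$$ **Statistics.** $$S_N=\frac1{\sqrt N}\sum_{k=1}^N\widehat\beta_{Nk}^3,\qquad U_N=\frac1{\sqrt N}\sum_{k=1}^N(\widehat\beta_{Nk}^4-3).$$ **Estimators.** Let $K_N(t)=\frac1{2\pi N}\big|\sum_{k=1}^Ne^{itk}\big|^2$ (Fejér's kernel), let $$\delta_{l_1\dots l_p}=E\Big(\prod_{i=1}^p\frac{|w_{l_i}|^2}{C_{l_i}}\Big)$$ (under Gaussianity, the product of $m!$ over the multiplicities $m$ of the distinct values among $|l_1|,\dots,|l_p|$), and $$\widehat\sigma_N^2=\frac2N\sum_{N/8\le l\le N/2}|w_l|^2a^2(\tfrac{4l}N).$$ With all remaining sums over nonzero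 integers, $$\widehat\sigma_{S_N}^2=\frac{12\pi}{N^3\widehat\sigma_N^6}\sum_{l_1,l_2,l_3}\frac1{\delta_{l_1l_2l_3}}\Big(\prod_{i=1}^3|w_{l_i}|^2a^2(\tfrac{4l_i}N)\Big)K_N(\tfrac{2\pi}N(l_1+l_2+l_3)),$$ $$\widehat\sigma_{1U_N}^2=\frac{72}{\widehat\sigma_N^4}\frac{2\pi}{N^2}\sum_{l_1,l_2}\frac1{\delta_{l_1l_2}}\Big(\prod_{i=1}^2|w_{l_i}|^2a^2(\tfrac{4l_i}N)\Big)K_N(\tfrac{2\pi}N(l_1+l_2)),$$ $$\widehat\sigma_{2U_N}^2=\frac{24}{\widehat\sigma_N^8}\frac{2\pi}{N^4}\sum_{l_1,l_2,l_3,l_4}\frac1{\delta_{l_1l_2l_3l_4}}\Big(\prod_{i=1}^4|w_{l_i}|^2a^2(\tfrac{4l_i}N)\Big)K_N(\tfrac{2\pi}N(l_1+l_2+l_3+l_4)),$$ and $\widehat\sigma_{U_N}^2=\widehat\sigma_{1U_N}^2+\widehat\sigma_{2U_N}^2$. *)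

theory Defs
  imports "HOL-Probability.Probability"
begin

section \<open>Smooth functions and functions with an integrable weak derivative\<close>

definition smooth :: "(real \<Rightarrow> real) \<Rightarrow> bool" where
  "smooth f \<longleftrightarrow> (\<forall>n. (deriv ^^ n) f differentiable_on UNIV)"

definition test_function :: "(real \<Rightarrow> real) \<Rightarrow> bool" where
  "test_function \<eta> \<longleftrightarrow> smooth \<eta> \<and> (\<exists>K. \<forall>x. \<bar>x\<bar> > K \<longrightarrow> \<eta> x = 0)"

definition locally_integrable :: "(real \<Rightarrow> real) \<Rightarrow> bool" where
  "locally_integrable f \<longleftrightarrow> (\<forall>a b. set_integrable lborel {a..b} f)"

definition weak_derivative :: "nat \<Rightarrow> (real \<Rightarrow> real) \<Rightarrow> (real \<Rightarrow> real) \<Rightarrow> bool" where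
  "weak_derivative R f h \<longleftrightarrow>
     locally_integrable f \<and> locally_integrable h \<and>
     (\<forall>\<eta>. test_function \<eta> \<longrightarrow>
        (LINT x|lborel. f x * (deriv ^^ R) \<eta> x) = (-1) ^ R * (LINT x|lborel. h x * \<eta> x))"

text \<open>
  For \<open>R \<ge> 1\<close> the elements of this class have a continuous representative, and it is this
  representative that can be restricted to the integers.
\<close>
definition W1 :: "nat \<Rightarrow> (real \<Rightarrow> real) set" where
  "W1 R = {f. (\<exists>h. integrable lborel h \<and> weak_derivative R f h) \<and>
              (R \<ge> 1 \<longrightarrow> continuous_on UNIV f)}"


section \<open>The random field\<close>

text \<open>
  A function on the torus is a \<open>2\<pi>\<close>-periodic function on the reals. The Fourier series of the
  field converges in mean square over the probability space, for every point of the torus. Joint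
  measurability is what gives a meaning to the integrals of the paths that define the wavelet
  coefficients.
\<close>
definition torus_field ::
  "'a measure \<Rightarrow> (real \<Rightarrow> 'a \<Rightarrow> real) \<Rightarrow> (int \<Rightarrow> 'a \<Rightarrow> complex) \<Rightarrow> (int \<Rightarrow> real) \<Rightarrow> bool" where
  "torus_field M X w C \<longleftrightarrow>
     (\<lambda>(\<theta>, \<omega>). X \<theta> \<omega>) \<in> borel_measurable (borel \<Otimes>\<^sub>M M) \<and>
     (\<forall>\<theta> \<omega>. X (\<theta> + 2 * pi) \<omega> = X \<theta> \<omega>) \<and>
     (\<forall>\<theta>. integrable M (\<lambda>\<omega>. (X \<theta> \<omega>)\<^sup>2)) \<and>
     (\<forall>\<theta>. (LINT \<omega>|M. X \<theta> \<omega>) = 0) \<and>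
     (\<forall>\<theta> \<theta>' h. (LINT \<omega>|M. X (\<theta> + h) \<omega> * X (\<theta>' + h) \<omega>) = (LINT \<omega>|M. X \<theta> \<omega> * X \<theta>' \<omega>)) \<and>
     (\<forall>\<theta>. (\<lambda>n::nat. LINT \<omega>|M.
             (cmod (complex_of_real (X \<theta> \<omega>) - (\<Sum>l\<in>{- int n..int n}. w l \<omega> * cis (of_int l * \<theta>))))\<^sup>2)
           \<longlonglongrightarrow> 0) \<and>
     (\<forall>l. w l \<in> borel_measurable M) \<and>
     (\<forall>l. integrable M (\<lambda>\<omega>. (cmod (w l \<omega>))\<^sup>2)) \<and>
     (AE \<omega> in M. w 0 \<omega> = 0) \<and>
     (\<forall>l. AE \<omega> in M. w (- l) \<omega> = cnj (w l \<omega>)) \<and>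
     (\<forall>l. (LINT \<omega>|M. w l \<omega>) = 0) \<and>
     (\<forall>l l'. l \<noteq> l' \<longrightarrow> (LINT \<omega>|M. w l \<omega> * cnj (w l' \<omega>)) = 0) \<and>
     (\<forall>l. (LINT \<omega>|M. (cmod (w l \<omega>))\<^sup>2) = C l) \<and>
     C summable_on UNIV"

definition assumption_A1 :: "(int \<Rightarrow> real) \<Rightarrow> bool" where
  "assumption_A1 C \<longleftrightarrow>
     (\<exists>c1 c2 \<alpha> (g :: nat \<Rightarrow> real) R f.
        0 < c1 \<and> c1 \<le> c2 \<and> \<alpha> > 1 \<and>
        (\<forall>n. g n \<in> {c1..c2}) \<and>
        f \<in> W1 R \<and> (\<forall>n. g n = f (real n)) \<and>
        (\<forall>l\<ge>1. C (int l) = g l * real l powr (- \<alpha>)))"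

text \<open>A Gaussian variable may be degenerate, i.e. almost surely constant.\<close>
definition gaussian_variable :: "'a measure \<Rightarrow> ('a \<Rightarrow> real) \<Rightarrow> bool" where
  "gaussian_variable M Y \<longleftrightarrow>
     Y \<in> borel_measurable M \<and>
     (\<exists>\<mu> \<sigma>. (\<sigma> > 0 \<and> distributed M lborel Y (\<lambda>x. ennreal (normal_density \<mu> \<sigma> x))) \<or>
            (AE \<omega> in M. Y \<omega> = \<mu>))"

text \<open>
  Since \<open>Re ((p - \<i> q) z) = p Re z + q Im z\<close>, the sums below are exactly the finite real
  linear combinations of the real and imaginary parts of the family.
\<close>
definition jointly_gaussian :: "'a measure \<Rightarrow> (int \<Rightarrow> 'a \<Rightarrow> complex) \<Rightarrow> bool" where
  "jointly_gaussian M w \<longleftrightarrow>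
     (\<forall>F c. finite F \<longrightarrow> gaussian_variable M (\<lambda>\<omega>. \<Sum>l\<in>F. Re (c l * w l \<omega>)))"


section \<open>Wavelets and wavelet coefficients\<close>

definition wavelet_a :: "(real \<Rightarrow> real) \<Rightarrow> real \<Rightarrow> real" where
  "wavelet_a \<phi> \<xi> = sqrt (\<phi> (\<xi> / 2) - \<phi> \<xi>)"

definition wavelet_cutoff :: "(real \<Rightarrow> real) \<Rightarrow> bool" where
  "wavelet_cutoff \<phi> \<longleftrightarrow>
     (\<forall>\<xi>. \<phi> \<xi> \<in> {0..1}) \<and>
     (\<forall>\<xi>. \<phi> (- \<xi>) = \<phi> \<xi>) \<and>
     smooth \<phi> \<and>
     (\<forall>\<xi>. \<bar>\<xi>\<bar> > 1 \<longrightarrow> \<phi> \<xi> = 0) \<and>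
     (\<forall>\<xi>. \<bar>\<xi>\<bar> \<le> 1 / 2 \<longrightarrow> \<phi> \<xi> = 1) \<and>
     (\<forall>\<xi>. \<phi> (\<xi> / 2) - \<phi> \<xi> \<ge> 0) \<and>
     smooth (wavelet_a \<phi>)"

text \<open>
  The series has finitely many nonzero terms, and it is real because \<open>a\<close> is even
  (lemma \<open>psi_series_real\<close>); \<open>Re\<close> only changes its type.
\<close>
definition psi :: "(real \<Rightarrow> real) \<Rightarrow> nat \<Rightarrow> real \<Rightarrow> real" where
  "psi \<phi> N t =
     1 / sqrt (real N) *
     Re (\<Sum>\<^sub>\<infinity>l\<in>(UNIV :: int set).
           complex_of_real (wavelet_a \<phi> (4 * of_int l / real N)) * cis (of_int l * t))"

lemma psi_series_real:
  assumes "wavelet_cutoff \<phi>"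
  shows "Im (\<Sum>\<^sub>\<infinity>l\<in>(UNIV :: int set).
           complex_of_real (wavelet_a \<phi> (4 * of_int l / real N)) * cis (of_int l * t)) = 0"
proof -
  let ?f = "\<lambda>l::int. complex_of_real (wavelet_a \<phi> (4 * of_int l / real N)) * cis (of_int l * t)"
  have even: "\<phi> (- \<xi>) = \<phi> \<xi>" for \<xi>
    using assms by (auto simp: wavelet_cutoff_def)
  have "wavelet_a \<phi> (- \<xi>) = wavelet_a \<phi> \<xi>" for \<xi>
    using even[of \<xi>] even[of "\<xi> / 2"] by (simp add: wavelet_a_def)
  then have sym: "cnj (?f l) = ?f (- l)" for l
    by (simp flip: cis_cnj)
  have "cnj (infsum ?f UNIV) = (\<Sum>\<^sub>\<infinity>l. cnj (?f l))"
    by (rule infsum_cnj[symmetric])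
  also have "\<dots> = infsum (?f \<circ> uminus) UNIV"
    unfolding sym comp_def ..
  also have "\<dots> = infsum ?f (range uminus)"
    by (rule infsum_reindex[symmetric]) simp
  also have "range (uminus :: int \<Rightarrow> int) = UNIV"
    by (auto intro: image_eqI[of _ _ "- x" for x])
  finally have "Im (cnj (infsum ?f UNIV)) = Im (infsum ?f UNIV)"
    by (rule arg_cong)
  then show ?thesis
    by simp
qed

definition beta :: "(real \<Rightarrow> 'a \<Rightarrow> real) \<Rightarrow> (real \<Rightarrow> real) \<Rightarrow> nat \<Rightarrow> int \<Rightarrow> 'a \<Rightarrow> real" where
  "beta X \<phi> N k \<omega> =
     1 / (2 * pi) *
     (LINT \<theta>:{-pi..pi}|lborel. X \<theta> \<omega> * psi \<phi> N (\<theta> - of_int k * (2 * pi / real N)))"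

definition sigma2 ::
  "'a measure \<Rightarrow> (real \<Rightarrow> 'a \<Rightarrow> real) \<Rightarrow> (real \<Rightarrow> real) \<Rightarrow> nat \<Rightarrow> int \<Rightarrow> real" where
  "sigma2 M X \<phi> N k = (LINT \<omega>|M. (beta X \<phi> N k \<omega>)\<^sup>2)"

definition beta_hat ::
  "'a measure \<Rightarrow> (real \<Rightarrow> 'a \<Rightarrow> real) \<Rightarrow> (real \<Rightarrow> real) \<Rightarrow> nat \<Rightarrow> int \<Rightarrow> 'a \<Rightarrow> real" where
  "beta_hat M X \<phi> N k \<omega> = beta X \<phi> N k \<omega> / sqrt (sigma2 M X \<phi> N k)"


section \<open>The statistics and the estimators of their variances\<close>

definition skewness_stat ::
  "'a measure \<Rightarrow> (real \<Rightarrow> 'a \<Rightarrow> real) \<Rightarrow> (real \<Rightarrow> real) \<Rightarrow> nat \<Rightarrow> 'a \<Rightarrow> real" where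
  "skewness_stat M X \<phi> N \<omega> =
     1 / sqrt (real N) * (\<Sum>k\<in>{1..int N}. (beta_hat M X \<phi> N k \<omega>) ^ 3)"

definition kurtosis_stat ::
  "'a measure \<Rightarrow> (real \<Rightarrow> 'a \<Rightarrow> real) \<Rightarrow> (real \<Rightarrow> real) \<Rightarrow> nat \<Rightarrow> 'a \<Rightarrow> real" where
  "kurtosis_stat M X \<phi> N \<omega> =
     1 / sqrt (real N) * (\<Sum>k\<in>{1..int N}. ((beta_hat M X \<phi> N k \<omega>) ^ 4 - 3))"

definition fejer :: "nat \<Rightarrow> real \<Rightarrow> real" where
  "fejer N t = 1 / (2 * pi * real N) * (cmod (\<Sum>k\<in>{1..int N}. cis (t * of_int k)))\<^sup>2"

definition delta ::
  "'a measure \<Rightarrow> (int \<Rightarrow> 'a \<Rightarrow> complex) \<Rightarrow> (int \<Rightarrow> real) \<Rightarrow> int list \<Rightarrow> real" where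
  "delta M w C ls = (LINT \<omega>|M. (\<Prod>l\<leftarrow>ls. (cmod (w l \<omega>))\<^sup>2 / C l))"

definition sigma2_hat ::
  "(int \<Rightarrow> 'a \<Rightarrow> complex) \<Rightarrow> (real \<Rightarrow> real) \<Rightarrow> nat \<Rightarrow> 'a \<Rightarrow> real" where
  "sigma2_hat w \<phi> N \<omega> =
     2 / real N *
     (\<Sum>l\<in>{l::int. real N / 8 \<le> of_int l \<and> of_int l \<le> real N / 2}.
        (cmod (w l \<omega>))\<^sup>2 * (wavelet_a \<phi> (4 * of_int l / real N))\<^sup>2)"

text \<open>
  The sum over \<open>p\<close>-tuples \<open>(l\<^sub>1, \<dots>, l\<^sub>p)\<close> of nonzero integers that is common to the
  estimators, the tuples being lists of length \<open>p\<close>. It has finitely many nonzero terms.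
\<close>
definition tuple_sum ::
  "'a measure \<Rightarrow> (int \<Rightarrow> 'a \<Rightarrow> complex) \<Rightarrow> (int \<Rightarrow> real) \<Rightarrow> (real \<Rightarrow> real) \<Rightarrow> nat \<Rightarrow> nat \<Rightarrow> 'a \<Rightarrow> real"
  where
  "tuple_sum M w C \<phi> N p \<omega> =
     (\<Sum>\<^sub>\<infinity>ls\<in>{ls :: int list. length ls = p \<and> 0 \<notin> set ls}.
        1 / delta M w C ls *
        (\<Prod>l\<leftarrow>ls. (cmod (w l \<omega>))\<^sup>2 * (wavelet_a \<phi> (4 * of_int l / real N))\<^sup>2) *
        fejer N (2 * pi / real N * of_int (sum_list ls)))"

definition var_skewness_hat ::
  "'a measure \<Rightarrow> (int \<Rightarrow> 'a \<Rightarrow> complex) \<Rightarrow> (int \<Rightarrow> real) \<Rightarrow> (real \<Rightarrow> real) \<Rightarrow> nat \<Rightarrow> 'a \<Rightarrow> real"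
  where
  "var_skewness_hat M w C \<phi> N \<omega> =
     12 * pi / (real N ^ 3 * (sigma2_hat w \<phi> N \<omega>) ^ 3) * tuple_sum M w C \<phi> N 3 \<omega>"

definition var_kurtosis1_hat ::
  "'a measure \<Rightarrow> (int \<Rightarrow> 'a \<Rightarrow> complex) \<Rightarrow> (int \<Rightarrow> real) \<Rightarrow> (real \<Rightarrow> real) \<Rightarrow> nat \<Rightarrow> 'a \<Rightarrow> real"
  where
  "var_kurtosis1_hat M w C \<phi> N \<omega> =
     72 / (sigma2_hat w \<phi> N \<omega>) ^ 2 * (2 * pi / real N ^ 2) * tuple_sum M w C \<phi> N 2 \<omega>"

definition var_kurtosis2_hat ::
  "'a measure \<Rightarrow> (int \<Rightarrow> 'a \<Rightarrow> complex) \<Rightarrow> (int \<Rightarrow> real) \<Rightarrow> (real \<Rightarrow> real) \<Rightarrow> nat \<Rightarrow> 'a \<Rightarrow> real"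
  where
  "var_kurtosis2_hat M w C \<phi> N \<omega> =
     24 / (sigma2_hat w \<phi> N \<omega>) ^ 4 * (2 * pi / real N ^ 4) * tuple_sum M w C \<phi> N 4 \<omega>"

definition var_kurtosis_hat ::
  "'a measure \<Rightarrow> (int \<Rightarrow> 'a \<Rightarrow> complex) \<Rightarrow> (int \<Rightarrow> real) \<Rightarrow> (real \<Rightarrow> real) \<Rightarrow> nat \<Rightarrow> 'a \<Rightarrow> real"
  where
  "var_kurtosis_hat M w C \<phi> N \<omega> =
     var_kurtosis1_hat M w C \<phi> N \<omega> + var_kurtosis2_hat M w C \<phi> N \<omega>"


section \<open>Convergence in distribution of random vectors\<close>

text \<open>
  \<^const>\<open>weak_conv_m\<close> is restricted to measures on the real line; for random vectors convergence
  in distribution is convergence of the expectations of bounded continuous functions.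
\<close>
definition converges_in_distribution ::
  "'a measure \<Rightarrow> (nat \<Rightarrow> 'a \<Rightarrow> 'b :: euclidean_space) \<Rightarrow> 'b measure \<Rightarrow> bool" where
  "converges_in_distribution M Y \<nu> \<longleftrightarrow>
     (\<forall>n. Y n \<in> borel_measurable M) \<and>
     (\<forall>f :: 'b \<Rightarrow> real. continuous_on UNIV f \<and> bounded (range f) \<longrightarrow>
        (\<lambda>n. LINT \<omega>|M. f (Y n \<omega>)) \<longlonglongrightarrow> (LINT y|\<nu>. f y))"

text \<open>The centred Gaussian law whose covariance matrix is the identity.\<close>
definition standard_gaussian :: "'b :: euclidean_space measure" where
  "standard_gaussian =
     density lborel (\<lambda>x. ennreal (exp (- (x \<bullet> x) / 2) / sqrt (2 * pi) ^ DIM('b)))"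

end

theory Submission
  imports Defs
begin

text \<open>
  After normalisation the real and imaginary parts of \<open>w\<^sub>l\<close>, \<open>1 \<le> l < N/2\<close>, are independent standard
  Gaussian variables \<open>\<xi>\<^sub>i\<close>, the wavelet coefficients are linear forms
  \<open>G\<^sub>k = \<Sum>\<^sub>i A\<^sub>k\<^sub>i \<xi>\<^sub>i\<close>, and orthogonality of the discrete Fourier basis bounds the operator norm of
  \<open>A\<close> uniformly in \<open>N\<close>, because no frequency carries more than a fraction \<open>O(1/N)\<close> of the variance.
  Since \<open>\<Sum>\<^sub>k G\<^sub>k = 0\<close>, a combination \<open>F = a S\<^sub>N + b U\<^sub>N\<close> is a sum of the Hermite terms \<open>H\<^sub>3(G\<^sub>k)\<close>,
  \<open>H\<^sub>4(G\<^sub>k)\<close> and \<open>H\<^sub>2(G\<^sub>k)\<close>. Gaussian integration by parts gives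
  \<open>E F f(F) = E \<Gamma> f'(F)\<close> with \<open>\<Gamma> = \<langle>D F, - D L\<^sup>-\<^sup>1 F\<rangle>\<close>, hence a differential equation for the
  characteristic function of \<open>F\<close> which is solved up to an error \<open>(Var \<Gamma>)\<^sup>1\<^sup>/\<^sup>2\<close> by that of a Gaussian
  variable. The Poincare inequality together with the bound on the operator norm of \<open>A\<close> gives
  \<open>Var \<Gamma> = O(N\<^sup>-\<^sup>1\<^sup>/\<^sup>2)\<close>. The same inequality and a count of resonant tuples \<open>l\<^sub>1 + \<dots> + l\<^sub>p \<in> N\<int>\<close>
  show that the variance estimators, whose means are the exact variances, are consistent.
\<close>

section \<open>Gaussian integration by parts\<close>

text \<open>The variances of \<open>S\<close> and \<open>U\<close> vary with N, and no limit of them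
  enters. Instead the bound for the characteristic function is explicit and uniform over bounded
  coefficients \<open>a\<close>, \<open>b\<close>, so that \<open>s / sqrt VS\<close> and
  \<open>t / sqrt VU\<close> can be inserted at each level. All that this asks of the variances is a
  positive lower bound. For the skewness that bound rests on the shape of the wavelet: many triples
  with l1 + l2 = l3 must carry weight, and they are found near a point where \<phi> equals 1/2.
  Means of cos (F + \<theta>) with an arbitrary phase stand in for complex exponentials and keep all
  integrals real; the phases 0 and - pi / 2 recover real and imaginary parts. The limit covariance
  is diagonal because odd and even Hermite terms are uncorrelated for every N already. The
  estimators occur only inside bounded test functions, so an event of small probability on which
  they are far from the variances, or even vanish, costs no more than a multiple of its
  probability.\<close>

lemma integrable_std_normal_power:
  "integrable std_normal_distribution (\<lambda>x. (1 + \<bar>x\<bar>) ^ m)"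
proof -
  have "integrable lborel (\<lambda>x. std_normal_density x * (1 + \<bar>x\<bar>) ^ m)"
  proof -
    have "(\<lambda>x::real. std_normal_density x * (1 + \<bar>x\<bar>) ^ m)
        = (\<lambda>x. \<Sum>k\<le>m. of_nat (m choose k) * (std_normal_density x * \<bar>x\<bar> ^ k))"
      by (subst add.commute, subst binomial_ring) (auto simp: sum_distrib_left algebra_simps)
    then show ?thesis
      by (auto intro!: Bochner_Integration.integrable_sum integrable_mult_right
          integrable_std_normal_moment_abs)
  qed
  then show ?thesis
    by (subst integrable_density) auto
qed

lemma integrable_abs_bound:
  fixes f g :: "'a \<Rightarrow> real"
  assumes "integrable M g" "f \<in> borel_measurable M" "\<And>x. \<bar>f x\<bar> \<le> g x"
  shows "integrable M f"
proof (rule Bochner_Integration.integrable_bound[OF assms(1,2)])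
  show "AE x in M. norm (f x) \<le> norm (g x)"
  proof (rule AE_I2)
    fix x show "norm (f x) \<le> norm (g x)"
      using assms(3)[of x] by simp
  qed
qed

text \<open>The derivative of the product of \<open>f\<close> with the density is integrated over
  [-n, n]. The growth bounds make these integrals converge to the integral over the line and make
  the boundary terms tend to 0.\<close>

lemma std_normal_integration_by_parts:
  fixes f f' :: "real \<Rightarrow> real"
  assumes D: "\<And>x. (f has_real_derivative f' x) (at x)"
    and f: "\<And>x. \<bar>f x\<bar> \<le> c * (1 + \<bar>x\<bar>) ^ m"
    and f': "\<And>x. \<bar>f' x\<bar> \<le> c' * (1 + \<bar>x\<bar>) ^ m'"
    and [measurable]: "f' \<in> borel_measurable borel"
  shows "(LINT x|std_normal_distribution. x * f x) = (LINT x|std_normal_distribution. f' x)"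
proof -
  let ?n = std_normal_density
  have "continuous_on UNIV f"
    by (rule DERIV_continuous_on[OF has_field_derivative_at_within[OF D]])
  then have [measurable]: "f \<in> borel_measurable borel"
    by (rule borel_measurable_continuous_onI)
  have intf': "integrable std_normal_distribution f'"
    by (rule integrable_abs_bound[OF integrable_mult_right[OF integrable_std_normal_power[of m'], of c']])
       (use f' in \<open>simp_all add: mult.commute\<close>)
  have intxf: "integrable std_normal_distribution (\<lambda>x. x * f x)"
  proof (rule integrable_abs_bound[OF integrable_mult_right[OF integrable_std_normal_power[of "Suc m"], of c]])
    fix x :: real
    have "\<bar>x\<bar> * \<bar>f x\<bar> \<le> (1 + \<bar>x\<bar>) * (c * (1 + \<bar>x\<bar>) ^ m)"
      by (intro mult_mono f) auto
    then show "\<bar>x * f x\<bar> \<le> c * (1 + \<bar>x\<bar>) ^ Suc m"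
      by (simp add: abs_mult algebra_simps)
  qed simp
  define g where "g x = ?n x * f' x - ?n x * (x * f x)" for x
  have i1: "integrable lborel (\<lambda>x. ?n x * f' x)" "integrable lborel (\<lambda>x. ?n x * (x * f x))"
    using intf' intxf by (simp_all add: integrable_density)
  then have g: "integrable lborel g"
    unfolding g_def by (rule Bochner_Integration.integrable_diff)
  have Dg: "((\<lambda>x. ?n x * f x) has_real_derivative g x) (at x)" for x
  proof -
    have "(?n has_real_derivative - x * ?n x) (at x)"
    proof -
      have "((\<lambda>x. exp (- x\<^sup>2 / 2)) has_real_derivative - x * exp (- x\<^sup>2 / 2)) (at x)"
        by (auto intro!: derivative_eq_intros)
      from DERIV_cmult[OF this, of "1 / sqrt (2 * pi)"] show ?thesis
        unfolding std_normal_density_def by (simp add: mult.commute)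
    qed
    from DERIV_mult[OF this D[of x]] show ?thesis
      by (simp add: g_def algebra_simps)
  qed
  have seg: "(LINT x:{-real n..real n}|lborel. g x) = ?n (real n) * f (real n) - ?n (- real n) * f (- real n)" for n
  proof -
    have "(g has_integral (?n (real n) * f (real n) - ?n (- real n) * f (- real n))) {-real n..real n}"
      by (rule fundamental_theorem_of_calculus)
         (use Dg in \<open>auto simp: has_real_derivative_iff_has_vector_derivative[symmetric]
            intro: has_field_derivative_at_within\<close>)
    moreover have "set_integrable lborel {-real n..real n} g"
      unfolding set_integrable_def by (rule integrable_mult_indicator[OF _ g]) simp
    ultimately show ?thesis
      by (metis set_borel_integral_eq_integral(2) integral_unique)
  qed
  have lim1: "(\<lambda>n. LINT x:{-real n..real n}|lborel. g x) \<longlonglongrightarrow> (LINT x|lborel. g x)"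
    unfolding set_lebesgue_integral_def
  proof (rule integral_dominated_convergence[where w="\<lambda>x. norm (g x)"])
    show "AE x in lborel. (\<lambda>n. indicator {-real n..real n} x *\<^sub>R g x) \<longlonglongrightarrow> g x"
    proof (rule AE_I2)
      fix x
      have "eventually (\<lambda>n. indicator {-real n..real n} x *\<^sub>R g x = g x) sequentially"
        using eventually_ge_at_top[of "nat \<lceil>\<bar>x\<bar>\<rceil>"]
        by eventually_elim (auto simp: indicator_def; linarith)
      then show "(\<lambda>n. indicator {-real n..real n} x *\<^sub>R g x) \<longlonglongrightarrow> g x"
        by (rule tendsto_eventually)
    qed
  qed (use g in \<open>auto simp: indicator_def\<close>)
  \<comment> \<open>From (|x| - 1)^2 >= 0 one gets - x^2 / 2 <= 3 / 2 - (1 + |x|). Trading the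
    Gaussian for an exponential in 1 + |x| reduces the boundary terms to the standard limit of t^m /
    exp t.\<close>
  have bnd: "\<bar>?n x * f x\<bar> \<le> c * exp (3/2) * ((1 + \<bar>x\<bar>) ^ m / exp (1 + \<bar>x\<bar>))" for x
  proof -
    have "0 \<le> c" using f[of 0] by simp
    have "0 \<le> (\<bar>x\<bar> - 1)\<^sup>2" by simp
    then have "- x\<^sup>2 / 2 \<le> 3/2 - (1 + \<bar>x\<bar>)"
      by (simp add: power2_eq_square algebra_simps)
    then have "exp (- x\<^sup>2 / 2) \<le> exp (3/2) / exp (1 + \<bar>x\<bar>)"
      by (simp flip: exp_diff)
    moreover have "1 / sqrt (2 * pi) \<le> 1"
      using pi_ge_two by (simp add: real_le_rsqrt)
    ultimately have "?n x \<le> 1 * (exp (3/2) / exp (1 + \<bar>x\<bar>))"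
      unfolding std_normal_density_def by (intro mult_mono) auto
    then have "?n x * \<bar>f x\<bar> \<le> (exp (3/2) / exp (1 + \<bar>x\<bar>)) * (c * (1 + \<bar>x\<bar>) ^ m)"
      using f[of x] by (intro mult_mono) auto
    then show ?thesis
      by (simp add: abs_mult field_simps)
  qed
  have lim0: "(\<lambda>n. c * exp (3/2) * ((1 + real n) ^ m / exp (1 + real n))) \<longlonglongrightarrow> c * exp (3/2) * 0"
  proof -
    have "filterlim (\<lambda>n. 1 + real n) at_top sequentially"
      by (intro filterlim_tendsto_add_at_top[OF tendsto_const] filterlim_real_sequentially)
    then show ?thesis
      by (intro tendsto_mult_left filterlim_compose[OF tendsto_power_div_exp_0])
  qed
  have l1: "(\<lambda>n. ?n (real n) * f (real n)) \<longlonglongrightarrow> 0"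
    by (rule Lim_null_comparison[OF _ lim0[unfolded mult_zero_right]])
       (use bnd[of "real _"] in \<open>auto intro!: always_eventually\<close>)
  have l2: "(\<lambda>n. ?n (- real n) * f (- real n)) \<longlonglongrightarrow> 0"
    by (rule Lim_null_comparison[OF _ lim0[unfolded mult_zero_right]])
       (use bnd[of "- real _"] in \<open>auto intro!: always_eventually\<close>)
  have "(LINT x|lborel. g x) = 0"
    using LIMSEQ_unique[OF lim1] tendsto_diff[OF l1 l2] unfolding seg by simp
  then have "(LINT x|lborel. ?n x * f' x) = (LINT x|lborel. ?n x * (x * f x))"
    unfolding g_def using i1 by simp
  then show ?thesis
    by (simp add: integral_density)
qed

section \<open>Product Gaussian measures and functions of polynomial growth\<close>

definition gauss :: "'i set \<Rightarrow> ('i \<Rightarrow> real) measure" where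
  "gauss I = PiM I (\<lambda>_. std_normal_distribution)"

interpretation gauss: product_sigma_finite "\<lambda>_. std_normal_distribution"
  by (simp add: product_sigma_finite_def prob_space_imp_sigma_finite prob_space_normal_density)

lemma prob_space_gauss: "prob_space (gauss I)"
  unfolding gauss_def by (intro prob_space_PiM prob_space_normal_density) simp

interpretation gaussp: prob_space "gauss I" for I
  by (rule prob_space_gauss)

lemma measurable_gauss_component:
  "i \<in> I \<Longrightarrow> (\<lambda>x. x i) \<in> borel_measurable (gauss I)"
  unfolding gauss_def by (drule measurable_component_singleton[where M="\<lambda>_. std_normal_distribution"]) simp

text \<open>The summand 1 keeps the weight at least 1, so two bounds can be brought to a common
  exponent. The bound is asked of all \<open>x\<close>, including points outside the carrier of
  \<open>gauss I\<close>; only coordinates in \<open>I\<close> enter it.\<close>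

definition poly_growth :: "'i set \<Rightarrow> (('i \<Rightarrow> real) \<Rightarrow> real) \<Rightarrow> bool" where
  "poly_growth I f \<longleftrightarrow> (\<exists>c m. \<forall>x. \<bar>f x\<bar> \<le> c * (1 + (\<Sum>i\<in>I. \<bar>x i\<bar>)) ^ m)"

lemma poly_growthI: "(\<And>x. \<bar>f x\<bar> \<le> c * (1 + (\<Sum>i\<in>I. \<bar>x i\<bar>)) ^ m) \<Longrightarrow> poly_growth I f"
  unfolding poly_growth_def by blast

lemma poly_growthE:
  assumes "poly_growth I f"
  obtains c m where "0 \<le> c" "\<And>x. \<bar>f x\<bar> \<le> c * (1 + (\<Sum>i\<in>I. \<bar>x i\<bar>)) ^ m"
proof -
  obtain c m where c: "\<And>x. \<bar>f x\<bar> \<le> c * (1 + (\<Sum>i\<in>I. \<bar>x i\<bar>)) ^ m"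
    using assms unfolding poly_growth_def by blast
  moreover have "0 \<le> c" using c[of "\<lambda>_. 0"] by simp
  ultimately show ?thesis using that by blast
qed

lemma poly_growth_bound: "poly_growth I g \<Longrightarrow> (\<And>x. \<bar>f x\<bar> \<le> \<bar>g x\<bar>) \<Longrightarrow> poly_growth I f"
  unfolding poly_growth_def by (meson order_trans)

lemma poly_growth_const: "poly_growth I (\<lambda>_. c)"
  by (rule poly_growthI[of _ "\<bar>c\<bar>" _ 0]) simp

lemma poly_growth_component: "finite I \<Longrightarrow> i \<in> I \<Longrightarrow> poly_growth I (\<lambda>x. x i)"
proof (rule poly_growthI)
  fix x :: "'a \<Rightarrow> real"
  assume "finite I" "i \<in> I"
  then have "\<bar>x i\<bar> \<le> (\<Sum>i\<in>I. \<bar>x i\<bar>)"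
    by (intro member_le_sum) auto
  then show "\<bar>x i\<bar> \<le> 1 * (1 + (\<Sum>i\<in>I. \<bar>x i\<bar>)) ^ 1"
    by simp
qed

lemma poly_growth_add:
  fixes I :: "'i set"
  assumes "poly_growth I f" "poly_growth I g"
  shows "poly_growth I (\<lambda>x. f x + g x)"
proof -
  obtain c m where f: "0 \<le> c" "\<And>x. \<bar>f x\<bar> \<le> c * (1 + (\<Sum>i\<in>I. \<bar>x i\<bar>)) ^ m"
    using poly_growthE[OF assms(1)] by metis
  obtain c' m' where g: "0 \<le> c'" "\<And>x. \<bar>g x\<bar> \<le> c' * (1 + (\<Sum>i\<in>I. \<bar>x i\<bar>)) ^ m'"
    using poly_growthE[OF assms(2)] by metis
  show ?thesis
  proof (rule poly_growthI)
    fix x :: "'i \<Rightarrow> real"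
    let ?s = "1 + (\<Sum>i\<in>I. \<bar>x i\<bar>)"
    have s: "1 \<le> ?s" by (simp add: sum_nonneg)
    have "\<bar>f x + g x\<bar> \<le> c * ?s ^ m + c' * ?s ^ m'"
      using f(2)[of x] g(2)[of x] by linarith
    also have "\<dots> \<le> c * ?s ^ (m + m') + c' * ?s ^ (m + m')"
      using s f(1) g(1) by (intro add_mono mult_left_mono power_increasing) auto
    finally show "\<bar>f x + g x\<bar> \<le> (c + c') * ?s ^ (m + m')"
      by (simp add: algebra_simps)
  qed
qed

lemma poly_growth_mult:
  fixes I :: "'i set"
  assumes "poly_growth I f" "poly_growth I g"
  shows "poly_growth I (\<lambda>x. f x * g x)"
proof -
  obtain c m where f: "0 \<le> c" "\<And>x. \<bar>f x\<bar> \<le> c * (1 + (\<Sum>i\<in>I. \<bar>x i\<bar>)) ^ m"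
    using poly_growthE[OF assms(1)] by metis
  obtain c' m' where g: "0 \<le> c'" "\<And>x. \<bar>g x\<bar> \<le> c' * (1 + (\<Sum>i\<in>I. \<bar>x i\<bar>)) ^ m'"
    using poly_growthE[OF assms(2)] by metis
  show ?thesis
  proof (rule poly_growthI)
    fix x :: "'i \<Rightarrow> real"
    let ?s = "1 + (\<Sum>i\<in>I. \<bar>x i\<bar>)"
    have s: "1 \<le> ?s" by (simp add: sum_nonneg)
    have "\<bar>f x * g x\<bar> \<le> (c * ?s ^ m) * (c' * ?s ^ m')"
      unfolding abs_mult using f g s by (intro mult_mono) auto
    then show "\<bar>f x * g x\<bar> \<le> (c * c') * ?s ^ (m + m')"
      by (simp add: power_add algebra_simps)
  qed
qed

lemma poly_growth_sum:
  "finite J \<Longrightarrow> (\<And>j. j \<in> J \<Longrightarrow> poly_growth I (f j)) \<Longrightarrow> poly_growth I (\<lambda>x. \<Sum>j\<in>J. f j x)"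
  by (induction J rule: finite_induct) (auto intro: poly_growth_const poly_growth_add)

lemma poly_growth_bounded: "(\<And>x. \<bar>f x\<bar> \<le> c) \<Longrightarrow> poly_growth I f"
  by (rule poly_growthI[of _ c _ 0]) simp

text \<open>It dominates the weight of \<open>poly_growth\<close> by a product of functions of one
  coordinate each, whose integral over a product measure factorises.\<close>

lemma one_plus_sum_le_prod:
  fixes a :: "'i \<Rightarrow> real"
  assumes "finite I" "\<And>i. i \<in> I \<Longrightarrow> 0 \<le> a i"
  shows "1 + (\<Sum>i\<in>I. a i) \<le> (\<Prod>i\<in>I. 1 + a i)"
  using assms
proof (induction I rule: finite_induct)
  case (insert i I)
  have "1 + (\<Sum>i\<in>insert i I. a i) \<le> (1 + a i) * (1 + (\<Sum>i\<in>I. a i))"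
    using insert by (simp add: algebra_simps sum_nonneg)
  also have "\<dots> \<le> (1 + a i) * (\<Prod>i\<in>I. 1 + a i)"
    using insert by (intro mult_left_mono) auto
  finally show ?case using insert by simp
qed simp

lemma integrable_gauss_power:
  assumes "finite I"
  shows "integrable (gauss I) (\<lambda>x. (1 + (\<Sum>i\<in>I. \<bar>x i\<bar>)) ^ m)"
proof (rule Bochner_Integration.integrable_bound)
  show "integrable (gauss I) (\<lambda>x. \<Prod>i\<in>I. (1 + \<bar>x i\<bar>) ^ m)"
    unfolding gauss_def using assms
    by (intro gauss.product_integrable_prod integrable_std_normal_power)
  show "AE x in gauss I. norm ((1 + (\<Sum>i\<in>I. \<bar>x i\<bar>)) ^ m) \<le> norm (\<Prod>i\<in>I. (1 + \<bar>x i\<bar>) ^ m)"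
  proof (rule AE_I2)
    fix x :: "'a \<Rightarrow> real"
    have "(1 + (\<Sum>i\<in>I. \<bar>x i\<bar>)) ^ m \<le> (\<Prod>i\<in>I. 1 + \<bar>x i\<bar>) ^ m"
      using assms by (intro power_mono one_plus_sum_le_prod) (auto simp: sum_nonneg)
    then show "norm ((1 + (\<Sum>i\<in>I. \<bar>x i\<bar>)) ^ m) \<le> norm (\<Prod>i\<in>I. (1 + \<bar>x i\<bar>) ^ m)"
      by (simp add: prod_power_distrib sum_nonneg abs_of_nonneg prod_nonneg)
  qed
qed (intro borel_measurable_power borel_measurable_add borel_measurable_sum borel_measurable_abs
      borel_measurable_const measurable_gauss_component)

lemma integrable_poly_growth:
  assumes "finite I" "poly_growth I f" "f \<in> borel_measurable (gauss I)"
  shows "integrable (gauss I) f"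
proof -
  obtain c m where f: "0 \<le> c" "\<And>x. \<bar>f x\<bar> \<le> c * (1 + (\<Sum>i\<in>I. \<bar>x i\<bar>)) ^ m"
    using poly_growthE[OF assms(2)] by metis
  show ?thesis
    by (rule integrable_abs_bound[OF integrable_mult_right[OF integrable_gauss_power[OF assms(1), of m], of c] assms(3) f(2)])
qed

text \<open>One-dimensional integration by parts will be used on lines parallel to an axis, and the
  constant may depend on the line. If s is 1 plus the sum of the other coordinates in absolute
  value, then s + |y| <= s (1 + |y|) because s >= 1.\<close>

lemma poly_growth_section:
  assumes I: "finite I" "i \<notin> I" and f: "poly_growth (insert i I) f"
  obtains c m where "\<And>y. \<bar>f (x(i := y))\<bar> \<le> c * (1 + \<bar>y\<bar>) ^ m"
proof -
  obtain c m where f: "0 \<le> c" "\<And>x. \<bar>f x\<bar> \<le> c * (1 + (\<Sum>i\<in>insert i I. \<bar>x i\<bar>)) ^ m"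
    using poly_growthE[OF f] by metis
  let ?s = "1 + (\<Sum>j\<in>I. \<bar>x j\<bar>)"
  have "\<bar>f (x(i := y))\<bar> \<le> (c * ?s ^ m) * (1 + \<bar>y\<bar>) ^ m" for y
  proof -
    have "(\<Sum>j\<in>I. \<bar>(x(i := y)) j\<bar>) = (\<Sum>j\<in>I. \<bar>x j\<bar>)"
      using I by (intro sum.cong) auto
    then have "\<bar>f (x(i := y))\<bar> \<le> c * (?s + \<bar>y\<bar>) ^ m"
      using f(2)[of "x(i := y)"] I by (simp add: algebra_simps)
    also have "?s + \<bar>y\<bar> \<le> ?s * (1 + \<bar>y\<bar>)"
      by (simp add: algebra_simps sum_nonneg)
    then have "c * (?s + \<bar>y\<bar>) ^ m \<le> c * (?s * (1 + \<bar>y\<bar>)) ^ m"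
      using f(1) by (intro mult_left_mono power_mono) (auto simp: sum_nonneg)
    finally show ?thesis by (simp add: power_mult_distrib)
  qed
  then show ?thesis using that by blast
qed

text \<open>Fubini isolates the coordinate \<open>i\<close>, and on each line parallel to its axis
  the one-dimensional formula applies.\<close>

lemma gauss_integration_by_parts:
  assumes I: "finite I" "i \<in> I"
    and D: "\<And>x. ((\<lambda>y. f (x(i := y))) has_real_derivative f' x) (at (x i))"
    and f: "poly_growth I f" "f \<in> borel_measurable (gauss I)"
    and f': "poly_growth I f'" "f' \<in> borel_measurable (gauss I)"
  shows "(LINT x|gauss I. x i * f x) = (LINT x|gauss I. f' x)"
proof -
  define J where "J = I - {i}"
  have J: "I = insert i J" "finite J" "i \<notin> J"
    using I by (auto simp: J_def)
  have i1: "integrable (gauss I) (\<lambda>x. x i * f x)"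
    using I f by (intro integrable_poly_growth poly_growth_mult poly_growth_component
        borel_measurable_times measurable_gauss_component) auto
  have i2: "integrable (gauss I) f'"
    using I f' by (intro integrable_poly_growth) auto
  have inner: "(LINT y|std_normal_distribution. (x(i := y)) i * f (x(i := y)))
      = (LINT y|std_normal_distribution. f' (x(i := y)))" if x: "x \<in> space (PiM J (\<lambda>_. std_normal_distribution))" for x
  proof -
    obtain c m where 1: "\<And>y. \<bar>f (x(i := y))\<bar> \<le> c * (1 + \<bar>y\<bar>) ^ m"
      using poly_growth_section[OF J(2,3) f(1)[unfolded J(1)], of x] by metis
    obtain c' m' where 2: "\<And>y. \<bar>f' (x(i := y))\<bar> \<le> c' * (1 + \<bar>y\<bar>) ^ m'"
      using poly_growth_section[OF J(2,3) f'(1)[unfolded J(1)], of x] by metis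
    have "(LINT y|std_normal_distribution. y * f (x(i := y)))
      = (LINT y|std_normal_distribution. f' (x(i := y)))"
    proof (rule std_normal_integration_by_parts[OF _ 1 2])
      show "((\<lambda>y. f (x(i := y))) has_real_derivative f' (x(i := y))) (at y)" for y
        \<comment> \<open>\<open>D\<close> differentiates at the value that the point already has in
          coordinate \<open>i\<close>. Taken at \<open>x(i := y)\<close>, it gives the derivative at
          every \<open>y\<close>.\<close>
        using D[of "x(i := y)"] by simp
      have "(\<lambda>y. x(i := y)) \<in> measurable std_normal_distribution (gauss I)"
        unfolding gauss_def J(1) by (intro measurable_fun_upd[where J=J]) (use x J in auto)
      then show "(\<lambda>y. f' (x(i := y))) \<in> borel_measurable borel"
        using measurable_compose[OF _ f'(2)] by simp
    qed
    then show ?thesis by simp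
  qed
  show ?thesis
    using gauss.product_integral_insert[OF J(2,3), of "\<lambda>x. x i * f x"]
      gauss.product_integral_insert[OF J(2,3), of f'] i1 i2 inner
    unfolding gauss_def J(1)[symmetric]
    by (simp cong: Bochner_Integration.integral_cong)
qed

section \<open>Polynomials in Gaussian variables and the Poincare inequality\<close>

text \<open>The mean value theorem bounds every difference quotient by \<open>g\<close>, so
  dominated convergence applies along any sequence of increments that tends to 0.\<close>

lemma has_real_derivative_integral_dominated:
  fixes f f' :: "real \<Rightarrow> 'a \<Rightarrow> real"
  assumes D: "\<And>t x. ((\<lambda>t. f t x) has_real_derivative f' t x) (at t)"
    and f: "\<And>t. integrable M (f t)" and f': "\<And>t. f' t \<in> borel_measurable M"
    and g: "integrable M g" "\<And>t x. \<bar>f' t x\<bar> \<le> g x"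
  shows "((\<lambda>t. LINT x|M. f t x) has_real_derivative (LINT x|M. f' t x)) (at t)"
proof -
  have "((\<lambda>h. ((LINT x|M. f (t + h) x) - (LINT x|M. f t x)) / h) \<longlongrightarrow> (LINT x|M. f' t x)) (at 0)"
    unfolding tendsto_at_iff_sequentially
  proof (intro allI impI)
    fix X :: "nat \<Rightarrow> real" assume X: "\<forall>i. X i \<in> UNIV - {0}" "X \<longlonglongrightarrow> 0"
    have "(\<lambda>n. LINT x|M. (f (t + X n) x - f t x) / X n) \<longlonglongrightarrow> (LINT x|M. f' t x)"
    proof (rule integral_dominated_convergence[OF f' _ g(1)])
      show "(\<lambda>x. (f (t + X n) x - f t x) / X n) \<in> borel_measurable M" for n
        using f by (auto intro!: borel_measurable_divide borel_measurable_diff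
            borel_measurable_integrable)
      show "AE x in M. (\<lambda>n. (f (t + X n) x - f t x) / X n) \<longlonglongrightarrow> f' t x"
      proof (rule AE_I2)
        fix x
        have "((\<lambda>h. (f (t + h) x - f t x) / h) \<longlongrightarrow> f' t x) (at 0)"
          using D[of x t] by (simp add: DERIV_def)
        then show "(\<lambda>n. (f (t + X n) x - f t x) / X n) \<longlonglongrightarrow> f' t x"
          unfolding tendsto_at_iff_sequentially using X by (simp add: o_def)
      qed
      show "AE x in M. norm ((f (t + X n) x - f t x) / X n) \<le> g x" for n
      proof (rule AE_I2)
        fix x
        have "norm (f (t + X n) x - f t x) \<le> g x * norm ((t + X n) - t)"
          by (rule field_differentiable_bound[where S=UNIV and f'="\<lambda>t. f' t x"])
             (use D g(2) in \<open>auto intro: has_field_derivative_at_within\<close>)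
        then show "norm ((f (t + X n) x - f t x) / X n) \<le> g x"
          using X by (simp add: divide_le_eq)
      qed
    qed
    moreover have "(LINT x|M. (f (t + X n) x - f t x) / X n)
        = ((LINT x|M. f (t + X n) x) - (LINT x|M. f t x)) / X n" for n
      by (simp only: Bochner_Integration.integral_diff[OF f f] integral_divide_zero)
    ultimately show "((\<lambda>h. ((LINT x|M. f (t + h) x) - (LINT x|M. f t x)) / h) \<circ> X) \<longlonglongrightarrow> (LINT x|M. f' t x)"
      by (simp only: o_def)
  qed
  then show ?thesis by (simp add: DERIV_def)
qed

text \<open>Polynomial functions of the coordinates in \<open>I\<close> are generated together with
  their gradients. Growth, measurability and the chain rule follow by induction on the generation,
  and partial derivatives stay in the class, so that differentiation can be repeated.\<close>

inductive polyd :: "'i set \<Rightarrow> (('i \<Rightarrow> real) \<Rightarrow> real) \<Rightarrow> ('i \<Rightarrow> ('i \<Rightarrow> real) \<Rightarrow> real) \<Rightarrow> bool"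
  for I where
  polyd_const: "polyd I (\<lambda>_. c) (\<lambda>_ _. 0)"
| polyd_component: "j \<in> I \<Longrightarrow> polyd I (\<lambda>x. x j) (\<lambda>i _. if i = j then 1 else 0)"
| polyd_add: "polyd I f f' \<Longrightarrow> polyd I g g' \<Longrightarrow>
    polyd I (\<lambda>x. f x + g x) (\<lambda>i x. f' i x + g' i x)"
| polyd_mult: "polyd I f f' \<Longrightarrow> polyd I g g' \<Longrightarrow>
    polyd I (\<lambda>x. f x * g x) (\<lambda>i x. f' i x * g x + f x * g' i x)"

lemma polyd_eq:
  "polyd I f f' \<Longrightarrow> (\<And>x. f x = g x) \<Longrightarrow> (\<And>i x. f' i x = g' i x) \<Longrightarrow> polyd I g g'"
  by (metis ext)

lemma polyd_cmult: "polyd I f f' \<Longrightarrow> polyd I (\<lambda>x. c * f x) (\<lambda>i x. c * f' i x)"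
  by (rule polyd_eq[OF polyd_mult[OF polyd_const]]) auto

lemma polyd_sum:
  "finite J \<Longrightarrow> (\<And>j. j \<in> J \<Longrightarrow> polyd I (f j) (f' j)) \<Longrightarrow>
    polyd I (\<lambda>x. \<Sum>j\<in>J. f j x) (\<lambda>i x. \<Sum>j\<in>J. f' j i x)"
proof (induction J rule: finite_induct)
  case empty
  show ?case by (rule polyd_eq[OF polyd_const[of _ 0]]) auto
next
  case (insert j J)
  have "polyd I (\<lambda>x. f j x + (\<Sum>j\<in>J. f j x)) (\<lambda>i x. f' j i x + (\<Sum>j\<in>J. f' j i x))"
    using insert by (intro polyd_add) auto
  then show ?case
    by (rule polyd_eq) (use insert in auto)
qed

lemma polyd_poly:
  "polyd I f f' \<Longrightarrow> polyd I (\<lambda>x. poly p (f x)) (\<lambda>i x. poly (pderiv p) (f x) * f' i x)"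
proof (induction p)
  case 0
  show ?case by (rule polyd_eq[OF polyd_const[of _ 0]]) auto
next
  case (pCons a p)
  show ?case
    by (rule polyd_eq[OF polyd_add[OF polyd_const polyd_mult[OF pCons.prems pCons.IH[OF pCons.prems]]]])
       (auto simp: pderiv_pCons algebra_simps)
qed

lemma polyd_linear:
  assumes "finite I"
  shows "polyd I (\<lambda>x. \<Sum>j\<in>I. a j * x j) (\<lambda>i _. if i \<in> I then a i else 0)"
proof -
  have "polyd I (\<lambda>x. \<Sum>j\<in>I. a j * x j) (\<lambda>i x. \<Sum>j\<in>I. a j * (if i = j then 1 else 0))"
    using assms by (intro polyd_sum polyd_cmult polyd_component) auto
  then show ?thesis
    by (rule polyd_eq) (use assms in \<open>auto simp: if_distrib[of "\<lambda>x. _ * x"] cong: if_cong\<close>)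
qed

lemma polyd_growth:
  assumes "finite I" "polyd I f f'"
  shows "poly_growth I f \<and> (\<forall>i. poly_growth I (f' i))"
  using assms(2)
proof induction
  case (polyd_component j)
  then show ?case using poly_growth_component[OF assms(1)] poly_growth_const by auto
next
  case (polyd_add f f' g g')
  then show ?case by (simp add: poly_growth_add)
next
  case (polyd_mult f f' g g')
  then show ?case by (simp add: poly_growth_add poly_growth_mult)
qed (simp add: poly_growth_const)

lemma polyd_measurable:
  assumes "polyd I f f'"
  shows "f \<in> borel_measurable (gauss I) \<and> (\<forall>i. f' i \<in> borel_measurable (gauss I))"
  using assms
proof induction
  case (polyd_component j)
  have "(\<lambda>x. x j) \<in> borel_measurable (gauss I)"
    using polyd_component by (rule measurable_gauss_component)
  then show ?case by simp
next
  case (polyd_add f f' g g')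
  then show ?case by (intro conjI allI borel_measurable_add) blast+
next
  case (polyd_mult f f' g g')
  then show ?case by (intro conjI allI borel_measurable_add borel_measurable_times) blast+
qed simp

lemma polyd_integrable: "finite I \<Longrightarrow> polyd I f f' \<Longrightarrow> integrable (gauss I) f"
  using polyd_growth polyd_measurable by (metis integrable_poly_growth)

lemma polyd_derivative_ex: "polyd I f f' \<Longrightarrow> \<exists>f''. polyd I (f' i) f''"
proof (induction rule: polyd.induct)
  case (polyd_mult f f' g g')
  then obtain a b where "polyd I (f' i) a" "polyd I (g' i) b" by blast
  from polyd.polyd_add[OF polyd.polyd_mult[OF this(1) polyd_mult.hyps(2)]
      polyd.polyd_mult[OF polyd_mult.hyps(1) this(2)]]
  show ?case by blast
next
  case (polyd_add f f' g g')
  then obtain a b where "polyd I (f' i) a" "polyd I (g' i) b" by blast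
  from polyd.polyd_add[OF this] show ?case by blast
qed (auto intro: polyd.polyd_const)

text \<open>This permits passing to restricted points and to merged points of product spaces without
  changing the value of a polynomial.\<close>

lemma polyd_local: "polyd I f f' \<Longrightarrow> (\<And>i. i \<in> I \<Longrightarrow> x i = y i) \<Longrightarrow> f x = f y"
  by (induction rule: polyd.induct) auto

text \<open>The chain rule serves twice: with all coordinates but one constant it gives partial
  derivatives, and with rotating coordinates it gives the derivative along the Gaussian
  interpolation.\<close>

lemma polyd_curve:
  assumes "finite I" "polyd I f f'" "\<And>i. i \<in> I \<Longrightarrow> (\<gamma> i has_real_derivative \<gamma>' i) (at t)"
  shows "((\<lambda>t. f (\<lambda>i. \<gamma> i t)) has_real_derivative (\<Sum>i\<in>I. f' i (\<lambda>i. \<gamma> i t) * \<gamma>' i)) (at t)"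
  using assms(2)
proof induction
  case (polyd_component j)
  then have "(\<Sum>i\<in>I. (if i = j then 1 else 0) * \<gamma>' i) = \<gamma>' j"
    using assms(1) by (simp add: if_distrib[of "\<lambda>x. x * _"] cong: if_cong)
  then show ?case using assms(3)[OF polyd_component] by (simp add: if_distrib cong: if_cong)
next
  case (polyd_add f f' g g')
  from DERIV_add[OF polyd_add.IH] show ?case
    by (simp add: sum.distrib algebra_simps)
next
  case (polyd_mult f f' g g')
  from DERIV_mult[OF polyd_mult.IH] show ?case
    by (simp add: sum.distrib algebra_simps sum_distrib_left)
qed simp

lemma polyd_partial:
  assumes "finite I" "polyd I f f'" "i \<in> I"
  shows "((\<lambda>y. f (x(i := y))) has_real_derivative f' i (x(i := y))) (at y)"
proof -
  have "((\<lambda>t. f (\<lambda>j. (x(i := t)) j)) has_real_derivative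
     (\<Sum>j\<in>I. f' j (\<lambda>j. (x(i := y)) j) * (if j = i then 1 else 0))) (at y)"
    by (rule polyd_curve[OF assms(1,2)]) (auto intro!: derivative_eq_intros)
  moreover have "(\<Sum>j\<in>I. f' j (\<lambda>j. (x(i := y)) j) * (if j = i then 1 else 0)) = f' i (x(i := y))"
    using assms by (simp add: if_distrib cong: if_cong del: fun_upd_apply)
  ultimately show ?thesis by (simp del: fun_upd_apply)
qed

lemma polyd_integration_by_parts:
  assumes "finite I" "polyd I f f'" "i \<in> I"
  shows "(LINT x|gauss I. x i * f x) = (LINT x|gauss I. f' i x)"
proof (rule gauss_integration_by_parts[OF assms(1,3)])
  show "((\<lambda>y. f (x(i := y))) has_real_derivative f' i x) (at (x i))" for x
    using polyd_partial[OF assms, of x "x i"] by simp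
qed (use polyd_growth[OF assms(1,2)] polyd_measurable[OF assms(2)] in auto)

text \<open>The coordinates in \<open>I <+> I\<close> form two independent copies of the Gaussian
  vector. With (1, 0) and (cos \<theta>, sin \<theta>) for the pair of \<open>c\<close> and
  \<open>s\<close>, a function of one copy and its rotation live on the same space.\<close>

lemma polyd_rotate:
  assumes "polyd I f f'"
  shows "polyd (I <+> I) (\<lambda>z. f (\<lambda>i. c * z (Inl i) + s * z (Inr i)))
    (\<lambda>j z. (case j of Inl i \<Rightarrow> c | Inr i \<Rightarrow> s) * f' (case j of Inl i \<Rightarrow> i | Inr i \<Rightarrow> i) (\<lambda>i. c * z (Inl i) + s * z (Inr i)))"
  using assms
proof induction
  case (polyd_const d)
  show ?case by (rule polyd_eq[OF polyd.polyd_const]) auto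
next
  case (polyd_component j)
  have "polyd (I <+> I) (\<lambda>z. c * z (Inl j) + s * z (Inr j))
     (\<lambda>k z. c * (if k = Inl j then 1 else 0) + s * (if k = Inr j then 1 else 0))"
    using polyd_component by (intro polyd_add polyd_cmult polyd.polyd_component) auto
  then show ?case by (rule polyd_eq) (auto split: sum.split)
next
  case (polyd_add f f' g g')
  show ?case by (rule polyd_eq[OF polyd.polyd_add[OF polyd_add.IH]]) (auto simp: algebra_simps)
next
  case (polyd_mult f f' g g')
  show ?case by (rule polyd_eq[OF polyd.polyd_mult[OF polyd_mult.IH]]) (auto simp: algebra_simps)
qed

section \<open>Marginals and rotations of the Gaussian product measure\<close>

lemma integral_gauss_reindex:
  fixes f :: "('i \<Rightarrow> real) \<Rightarrow> real" and h :: "'i \<Rightarrow> 'j"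
  assumes f: "polyd I f f'" and "inj_on h I" "h ` I \<subseteq> K"
  shows "(LINT z|gauss K. f (\<lambda>i. z (h i))) = (LINT x|gauss I. f x)"
proof -
  let ?r = "\<lambda>z. \<lambda>i\<in>I. z (h i)"
  have eq: "distr (gauss K) (gauss I) ?r = gauss I"
    unfolding gauss_def
    using distr_PiM_reindex[of K "\<lambda>_. std_normal_distribution" h I] assms(2,3)
    by (auto simp: prob_space_normal_density)
  have r: "?r \<in> measurable (gauss K) (gauss I)"
    unfolding gauss_def
    by (intro measurable_restrict measurable_component_singleton) (use assms(3) in auto)
  have "(LINT x|gauss I. f x) = (LINT x|distr (gauss K) (gauss I) ?r. f x)"
    by (simp add: eq)
  also have "\<dots> = (LINT z|gauss K. f (?r z))"
    by (rule integral_distr) (use r polyd_measurable[OF f] in auto)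
  also have "\<dots> = (LINT z|gauss K. f (\<lambda>i. z (h i)))"
    by (intro Bochner_Integration.integral_cong refl polyd_local[OF f]) auto
  finally show ?thesis ..
qed

lemma integral_gauss_independent:
  fixes I :: "'i set"
  assumes I: "finite I" and f: "polyd I f f'" and g: "polyd I g g'"
  shows "(LINT z|gauss (I <+> I). f (\<lambda>i. z (Inl i)) * g (\<lambda>i. z (Inr i)))
    = (LINT x|gauss I. f x) * (LINT x|gauss I. g x)"
proof -
  let ?l = "Inl ` I :: ('i + 'i) set" and ?r = "Inr ` I :: ('i + 'i) set"
  have J: "?l \<union> ?r = I <+> I" by (auto simp: Plus_def)
  have "integrable (gauss (I <+> I)) (\<lambda>z. f (\<lambda>i. 1 * z (Inl i) + 0 * z (Inr i)) * g (\<lambda>i. 0 * z (Inl i) + 1 * z (Inr i)))"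
    by (rule polyd_integrable[OF _ polyd_mult[OF polyd_rotate[OF f] polyd_rotate[OF g]]]) (use I in simp)
  then have int: "integrable (gauss (I <+> I)) (\<lambda>z. f (\<lambda>i. z (Inl i)) * g (\<lambda>i. z (Inr i)))"
    by simp
  have "(LINT z|gauss (I <+> I). f (\<lambda>i. z (Inl i)) * g (\<lambda>i. z (Inr i)))
    = (LINT x|gauss ?l. (LINT y|gauss ?r.
       f (\<lambda>i. (merge ?l ?r (x, y)) (Inl i)) * g (\<lambda>i. (merge ?l ?r (x, y)) (Inr i))))"
    unfolding gauss_def J[symmetric]
    by (rule gauss.product_integral_fold) (use I int in \<open>auto simp: gauss_def J\<close>)
  also have "\<dots> = (LINT x|gauss ?l. (LINT y|gauss ?r. f (\<lambda>i. x (Inl i)) * g (\<lambda>i. y (Inr i))))"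
  proof -
    have "f (\<lambda>i. (merge ?l ?r (x, y)) (Inl i)) = f (\<lambda>i. x (Inl i))" for x y
      by (rule polyd_local[OF f]) (simp add: merge_def)
    moreover have "g (\<lambda>i. (merge ?l ?r (x, y)) (Inr i)) = g (\<lambda>i. y (Inr i))" for x y
      by (rule polyd_local[OF g]) (auto simp: merge_def)
    ultimately show ?thesis by simp
  qed
  also have "\<dots> = (LINT x|gauss ?l. f (\<lambda>i. x (Inl i))) * (LINT y|gauss ?r. g (\<lambda>i. y (Inr i)))"
    by simp
  also have "(LINT x|gauss ?l. f (\<lambda>i. x (Inl i))) = (LINT x|gauss I. f x)"
    by (rule integral_gauss_reindex[OF f]) auto
  also have "(LINT y|gauss ?r. g (\<lambda>i. y (Inr i))) = (LINT x|gauss I. g x)"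
    by (rule integral_gauss_reindex[OF g]) auto
  finally show ?thesis .
qed

text \<open>The rotated argument has derivative - sin \<theta> times the first copy plus cos
  \<theta> times the second. Integrating both factors by parts creates second derivatives of
  \<open>g\<close> with coefficients - sin \<theta> cos \<theta> and cos \<theta> sin \<theta>,
  which cancel. Since \<open>f\<close> depends on the first copy alone, only the term with - sin
  \<theta> keeps a derivative of \<open>f\<close>.\<close>

lemma gauss_interpolation_derivative:
  fixes I :: "'i set"
  assumes I: "finite I" and f: "polyd I f f'" and g: "polyd I g g'"
  defines "rot \<equiv> \<lambda>\<theta> z i. cos \<theta> * z (Inl i) + sin \<theta> * z (Inr i :: 'i + 'i)"
  shows "((\<lambda>\<theta>. LINT z|gauss (I <+> I). f (\<lambda>i. z (Inl i)) * g (rot \<theta> z)) has_real_derivative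
    - sin \<theta> * (\<Sum>i\<in>I. LINT z|gauss (I <+> I). f' i (\<lambda>i. z (Inl i)) * g' i (rot \<theta> z))) (at \<theta>)"
proof -
  let ?J = "I <+> I"
  let ?L = "\<lambda>z i. z (Inl i :: 'i + 'i)"
  have J: "finite ?J" using I by simp
  have fL: "polyd ?J (\<lambda>z. f (?L z)) (\<lambda>j z. (case j of Inl i \<Rightarrow> 1 | Inr i \<Rightarrow> 0) * f' (case j of Inl i \<Rightarrow> i | Inr i \<Rightarrow> i) (?L z))"
    using polyd_rotate[OF f, of 1 0] by simp
  have gR: "polyd ?J (\<lambda>z. g (rot \<theta> z)) (\<lambda>j z. (case j of Inl i \<Rightarrow> cos \<theta> | Inr i \<Rightarrow> sin \<theta>) * g' (case j of Inl i \<Rightarrow> i | Inr i \<Rightarrow> i) (rot \<theta> z))" for \<theta>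
    using polyd_rotate[OF g, of "cos \<theta>" "sin \<theta>"] by (simp add: rot_def)
  obtain g'' where g'': "polyd I (g' i) (g'' i)" for i
    using polyd_derivative_ex[OF g] by metis
  obtain f'' where f'': "polyd I (f' i) (f'' i)" for i
    using polyd_derivative_ex[OF f] by metis
  have g'R: "polyd ?J (\<lambda>z. g' i (rot \<theta> z)) (\<lambda>j z. (case j of Inl i \<Rightarrow> cos \<theta> | Inr i \<Rightarrow> sin \<theta>) * g'' i (case j of Inl i \<Rightarrow> i | Inr i \<Rightarrow> i) (rot \<theta> z))" for \<theta> i
    using polyd_rotate[OF g''[of i], of "cos \<theta>" "sin \<theta>"] by (simp add: rot_def)
  have f'L: "polyd ?J (\<lambda>z. f' i (?L z)) (\<lambda>j z. (case j of Inl i \<Rightarrow> 1 | Inr i \<Rightarrow> 0) * f'' i (case j of Inl i \<Rightarrow> i | Inr i \<Rightarrow> i) (?L z))" for i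
    using polyd_rotate[OF f''[of i], of 1 0] by simp
  define d where "d \<theta> i z = - sin \<theta> * z (Inl i) + cos \<theta> * z (Inr i)" for \<theta> i and z :: "'i + 'i \<Rightarrow> real"
  have \<Phi>: "polyd ?J (\<lambda>z. f (?L z) * g' i (rot \<theta> z))
     (\<lambda>j z. (case j of Inl i \<Rightarrow> 1 | Inr i \<Rightarrow> 0) * f' (case j of Inl i \<Rightarrow> i | Inr i \<Rightarrow> i) (?L z) * g' i (rot \<theta> z) +
       f (?L z) * ((case j of Inl i \<Rightarrow> cos \<theta> | Inr i \<Rightarrow> sin \<theta>) * g'' i (case j of Inl i \<Rightarrow> i | Inr i \<Rightarrow> i) (rot \<theta> z)))" for i \<theta>
    by (rule polyd_mult[OF fL g'R])
  have intz: "integrable (gauss ?J) (\<lambda>z. z j * (f (?L z) * g' i (rot \<theta> z)))" if "j \<in> ?J" for i j \<theta>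
    by (rule polyd_integrable[OF J polyd_mult[OF polyd_component[OF that] \<Phi>]])
  have inta: "integrable (gauss ?J) (\<lambda>z. f' i (?L z) * g' i (rot \<theta> z))" for i \<theta>
    by (rule polyd_integrable[OF J polyd_mult[OF f'L g'R]])
  have intb: "integrable (gauss ?J) (\<lambda>z. f (?L z) * g'' i i (rot \<theta> z))" for i \<theta>
  proof -
    obtain h where "polyd I (g'' i i) h" using polyd_derivative_ex[OF g''] by metis
    from polyd_rotate[OF this, of "cos \<theta>" "sin \<theta>"] show ?thesis
      by (intro polyd_integrable[OF J polyd_mult[OF fL]]) (auto simp: rot_def)
  qed
  have key: "(LINT z|gauss ?J. f (?L z) * g' i (rot \<theta> z) * d \<theta> i z)
      = - sin \<theta> * (LINT z|gauss ?J. f' i (?L z) * g' i (rot \<theta> z))" if i: "i \<in> I" for i \<theta>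
  proof -
    have iJ: "Inl i \<in> ?J" "Inr i \<in> ?J" using i by auto
    have "(LINT z|gauss ?J. f (?L z) * g' i (rot \<theta> z) * d \<theta> i z)
        = - sin \<theta> * (LINT z|gauss ?J. z (Inl i) * (f (?L z) * g' i (rot \<theta> z)))
          + cos \<theta> * (LINT z|gauss ?J. z (Inr i) * (f (?L z) * g' i (rot \<theta> z)))"
    proof -
      have "(LINT z|gauss ?J. f (?L z) * g' i (rot \<theta> z) * d \<theta> i z)
        = (LINT z|gauss ?J. - sin \<theta> * (z (Inl i) * (f (?L z) * g' i (rot \<theta> z)))
            + cos \<theta> * (z (Inr i) * (f (?L z) * g' i (rot \<theta> z))))"
        by (simp add: d_def algebra_simps)
      then show ?thesis
        using intz[OF iJ(1), of i \<theta>] intz[OF iJ(2), of i \<theta>]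
        by (simp only: Bochner_Integration.integral_add integrable_mult_right integral_mult_right_zero)
    qed
    also have "(LINT z|gauss ?J. z (Inl i) * (f (?L z) * g' i (rot \<theta> z)))
       = (LINT z|gauss ?J. f' i (?L z) * g' i (rot \<theta> z) + cos \<theta> * (f (?L z) * g'' i i (rot \<theta> z)))"
      using polyd_integration_by_parts[OF J \<Phi> iJ(1)] by (simp add: algebra_simps)
    also have "\<dots> = (LINT z|gauss ?J. f' i (?L z) * g' i (rot \<theta> z)) + cos \<theta> * (LINT z|gauss ?J. f (?L z) * g'' i i (rot \<theta> z))"
      using inta intb by simp
    also have "(LINT z|gauss ?J. z (Inr i) * (f (?L z) * g' i (rot \<theta> z)))
       = sin \<theta> * (LINT z|gauss ?J. f (?L z) * g'' i i (rot \<theta> z))"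
      using polyd_integration_by_parts[OF J \<Phi> iJ(2)] by (simp add: algebra_simps)
    finally show ?thesis by (simp add: algebra_simps)
  qed
  have abs_rot: "\<bar>rot \<theta> z i\<bar> \<le> \<bar>z (Inl i)\<bar> + \<bar>z (Inr i)\<bar>" for \<theta> z i
  proof -
    have "\<bar>rot \<theta> z i\<bar> \<le> \<bar>cos \<theta>\<bar> * \<bar>z (Inl i)\<bar> + \<bar>sin \<theta>\<bar> * \<bar>z (Inr i)\<bar>"
      unfolding rot_def by (metis abs_mult abs_triangle_ineq)
    also have "\<dots> \<le> 1 * \<bar>z (Inl i)\<bar> + 1 * \<bar>z (Inr i)\<bar>"
      by (intro add_mono mult_right_mono abs_cos_le_one abs_sin_le_one) auto
    finally show ?thesis by simp
  qed
  have "\<exists>c m. 0 \<le> c \<and> (\<forall>x. \<bar>g' i x\<bar> \<le> c * (1 + (\<Sum>j\<in>I. \<bar>x j\<bar>)) ^ m)" for i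
  proof -
    have "poly_growth I (g' i)" using polyd_growth[OF I g] by auto
    then show ?thesis by (rule poly_growthE) blast
  qed
  then obtain c m where c: "0 \<le> c i" "\<And>x. \<bar>g' i x\<bar> \<le> c i * (1 + (\<Sum>j\<in>I. \<bar>x j\<bar>)) ^ m i" for i
    by metis
  \<comment> \<open>A majorant free of \<theta>: sine and cosine are bounded by 1, so a rotated
    coordinate is at most the sum of the absolute values of the two coordinates that it
    mixes.\<close>
  define B where "B z = \<bar>f (?L z)\<bar> * (\<Sum>i\<in>I. (c i * (1 + (\<Sum>j\<in>?J. \<bar>z j\<bar>)) ^ m i) * (\<bar>z (Inl i)\<bar> + \<bar>z (Inr i)\<bar>))" for z
  have sumJ: "(\<Sum>j\<in>?J. \<bar>z j\<bar>) = (\<Sum>i\<in>I. \<bar>z (Inl i)\<bar> + \<bar>z (Inr i)\<bar>)" for z :: "'i + 'i \<Rightarrow> real"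
    using I by (simp add: sum.Plus sum.distrib)
  have g'bound: "\<bar>g' i (rot \<theta> z)\<bar> \<le> c i * (1 + (\<Sum>j\<in>?J. \<bar>z j\<bar>)) ^ m i" for i \<theta> z
  proof -
    have "\<bar>g' i (rot \<theta> z)\<bar> \<le> c i * (1 + (\<Sum>j\<in>I. \<bar>rot \<theta> z j\<bar>)) ^ m i" by (rule c)
    also have "\<dots> \<le> c i * (1 + (\<Sum>j\<in>?J. \<bar>z j\<bar>)) ^ m i"
      unfolding sumJ using c(1) abs_rot
      by (intro mult_left_mono power_mono add_mono sum_mono) (auto simp: sum_nonneg)
    finally show ?thesis .
  qed
  have pgf: "poly_growth ?J (\<lambda>z. f (?L z))" using polyd_growth[OF J fL] by auto
  have intB: "integrable (gauss ?J) B"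
  proof (rule integrable_poly_growth[OF J])
    show "poly_growth ?J B"
      unfolding B_def
    proof (intro poly_growth_mult poly_growth_sum I poly_growth_add)
      show "poly_growth ?J (\<lambda>x. \<bar>f (\<lambda>i. x (Inl i))\<bar>)"
        by (rule poly_growth_bound[OF pgf]) simp
      show "poly_growth ?J (\<lambda>x. (1 + (\<Sum>j\<in>?J. \<bar>x j\<bar>)) ^ m j)" for j
        by (rule poly_growthI[of _ 1 _ "m j"]) (auto simp: sum_nonneg)
      show "poly_growth ?J (\<lambda>x. \<bar>x (Inl j)\<bar>)" if "j \<in> I" for j
        by (rule poly_growth_bound[OF poly_growth_component[OF J, of "Inl j"]]) (use that in auto)
      show "poly_growth ?J (\<lambda>x. \<bar>x (Inr j)\<bar>)" if "j \<in> I" for j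
        by (rule poly_growth_bound[OF poly_growth_component[OF J, of "Inr j"]]) (use that in auto)
    qed (rule poly_growth_const)
    have [measurable]: "(\<lambda>z. f (?L z)) \<in> borel_measurable (gauss ?J)"
      using polyd_measurable[OF fL] by auto
    show "B \<in> borel_measurable (gauss ?J)"
      unfolding B_def
      by (intro borel_measurable_times borel_measurable_abs borel_measurable_sum borel_measurable_add
          borel_measurable_power borel_measurable_const measurable_gauss_component) auto
  qed
  have "((\<lambda>\<theta>. LINT z|gauss ?J. f (?L z) * g (rot \<theta> z)) has_real_derivative
     (LINT z|gauss ?J. f (?L z) * (\<Sum>i\<in>I. g' i (rot \<theta> z) * d \<theta> i z))) (at \<theta>)"
  proof (rule has_real_derivative_integral_dominated[OF _ _ _ intB])
    show "((\<lambda>t. f (?L z) * g (rot t z)) has_real_derivative f (?L z) * (\<Sum>i\<in>I. g' i (rot t z) * d t i z)) (at t)" for t z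
      unfolding rot_def
      by (intro DERIV_cmult polyd_curve[OF I g]) (auto intro!: derivative_eq_intros simp: d_def)
    show "integrable (gauss ?J) (\<lambda>z. f (?L z) * g (rot t z))" for t
      by (rule polyd_integrable[OF J polyd_mult[OF fL gR]])
    show "(\<lambda>z. f (?L z) * (\<Sum>i\<in>I. g' i (rot t z) * d t i z)) \<in> borel_measurable (gauss ?J)" for t
    proof -
      have [measurable]: "(\<lambda>z. f (?L z)) \<in> borel_measurable (gauss ?J)"
        using polyd_measurable[OF fL] by auto
      have [measurable]: "(\<lambda>z. g' i (rot t z)) \<in> borel_measurable (gauss ?J)" for i
        using polyd_measurable[OF g'R] by auto
      have [measurable]: "i \<in> I \<Longrightarrow> d t i \<in> borel_measurable (gauss ?J)" for i
        unfolding d_def by (intro borel_measurable_add borel_measurable_times borel_measurable_const measurable_gauss_component) auto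
      show ?thesis by measurable
    qed
    show "\<bar>f (?L z) * (\<Sum>i\<in>I. g' i (rot t z) * d t i z)\<bar> \<le> B z" for t z
    proof -
      have "\<bar>d t i z\<bar> \<le> \<bar>z (Inl i)\<bar> + \<bar>z (Inr i)\<bar>" for i
      proof -
        have "\<bar>d t i z\<bar> \<le> \<bar>sin t\<bar> * \<bar>z (Inl i)\<bar> + \<bar>cos t\<bar> * \<bar>z (Inr i)\<bar>"
          unfolding d_def abs_mult[symmetric] using abs_triangle_ineq[of "- sin t * z (Inl i)" "cos t * z (Inr i)"]
          by simp
        also have "\<dots> \<le> 1 * \<bar>z (Inl i)\<bar> + 1 * \<bar>z (Inr i)\<bar>"
          by (intro add_mono mult_right_mono abs_cos_le_one abs_sin_le_one) auto
        finally show ?thesis by simp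
      qed
      then have "\<bar>\<Sum>i\<in>I. g' i (rot t z) * d t i z\<bar> \<le> (\<Sum>i\<in>I. (c i * (1 + (\<Sum>j\<in>?J. \<bar>z j\<bar>)) ^ m i) * (\<bar>z (Inl i)\<bar> + \<bar>z (Inr i)\<bar>))"
        using g'bound c(1)
        by (intro order_trans[OF sum_abs] sum_mono)
           (auto simp: abs_mult sum_nonneg intro!: mult_mono)
      then show ?thesis unfolding B_def abs_mult by (intro mult_left_mono) auto
    qed
  qed
  moreover have "(LINT z|gauss ?J. f (?L z) * (\<Sum>i\<in>I. g' i (rot \<theta> z) * d \<theta> i z))
     = - sin \<theta> * (\<Sum>i\<in>I. LINT z|gauss ?J. f' i (?L z) * g' i (rot \<theta> z))"
  proof -
    have "integrable (gauss ?J) (\<lambda>z. f (?L z) * g' i (rot \<theta> z) * d \<theta> i z)" if "i \<in> I" for i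
    proof -
      have "integrable (gauss ?J) (\<lambda>z. - sin \<theta> * (z (Inl i) * (f (?L z) * g' i (rot \<theta> z))) + cos \<theta> * (z (Inr i) * (f (?L z) * g' i (rot \<theta> z))))"
        using that by (intro Bochner_Integration.integrable_add integrable_mult_right intz) auto
      then show ?thesis by (rule Bochner_Integration.integrable_cong[THEN iffD1, rotated -1]) (auto simp: d_def algebra_simps)
    qed
    then show ?thesis
      using key by (simp add: sum_distrib_left mult.assoc[symmetric])
  qed
  ultimately show ?thesis by simp
qed

text \<open>Interpolating between \<open>x\<close> and an independent copy, the covariance of \<open>f\<close> along the path is
  differentiated by the preceding lemma.\<close>
theorem gauss_poincare:
  fixes I :: "'i set"
  assumes I: "finite I" and f: "polyd I f f'"
  shows "(LINT x|gauss I. (f x)\<^sup>2) - (LINT x|gauss I. f x)\<^sup>2 \<le> (\<Sum>i\<in>I. LINT x|gauss I. (f' i x)\<^sup>2)"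
proof -
  let ?J = "I <+> I"
  let ?L = "\<lambda>z i. z (Inl i :: 'i + 'i)"
  define rot :: "real \<Rightarrow> ('i + 'i \<Rightarrow> real) \<Rightarrow> 'i \<Rightarrow> real"
    where "rot = (\<lambda>\<theta> z i. cos \<theta> * z (Inl i) + sin \<theta> * z (Inr i))"
  have J: "finite ?J" using I by simp
  \<comment> \<open>With the constant 1 in place of \<open>f\<close> the derivative along the path
    vanishes. So the mean does not depend on the angle, and at angle 0 it is a mean over the first
    copy.\<close>
  have inv: "(LINT z|gauss ?J. g (rot \<theta> z)) = (LINT x|gauss I. g x)" if g: "polyd I g g'" for g g' \<theta>
  proof -
    have "\<forall>t. ((\<lambda>\<theta>. LINT z|gauss ?J. g (rot \<theta> z)) has_real_derivative 0) (at t)"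
      using gauss_interpolation_derivative[OF I polyd_const[of I 1] g] by (simp add: rot_def)
    then have "(LINT z|gauss ?J. g (rot \<theta> z)) = (LINT z|gauss ?J. g (rot 0 z))"
      by (rule DERIV_isconst_all)
    also have "\<dots> = (LINT x|gauss I. g x)"
      unfolding rot_def using integral_gauss_reindex[OF g, of Inl ?J]
      by (simp add: image_subset_iff InlI)
    finally show ?thesis .
  qed
  obtain f'' where f'': "polyd I (f' i) (f'' i)" for i
    using polyd_derivative_ex[OF f] by metis
  define A where "A = (\<Sum>i\<in>I. LINT x|gauss I. (f' i x)\<^sup>2)"
  define D where "D \<theta> = (LINT z|gauss ?J. f (?L z) * f (rot \<theta> z))" for \<theta>
  define D' where "D' \<theta> = (\<Sum>i\<in>I. LINT z|gauss ?J. f' i (?L z) * f' i (rot \<theta> z))" for \<theta>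
  have DD: "(D has_real_derivative - sin \<theta> * D' \<theta>) (at \<theta>)" for \<theta>
    unfolding D_def D'_def rot_def by (rule gauss_interpolation_derivative[OF I f f])
  \<comment> \<open>By x y <= (x^2 + y^2) / 2, where by invariance both squares have the same
    mean.\<close>
  have D'A: "D' \<theta> \<le> A" for \<theta>
    unfolding D'_def A_def
  proof (rule sum_mono)
    fix i assume "i \<in> I"
    have sq: "polyd I (\<lambda>x. f' i x * f' i x) (\<lambda>j x. f'' i j x * f' i x + f' i x * f'' i j x)"
      by (rule polyd_mult[OF f'' f''])
    have pL: "polyd ?J (\<lambda>z. f' i (?L z)) (\<lambda>j z. (case j of Inl i \<Rightarrow> 1 | Inr i \<Rightarrow> 0) * f'' i (case j of Inl i \<Rightarrow> i | Inr i \<Rightarrow> i) (?L z))"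
      using polyd_rotate[OF f''[of i], of 1 0] by simp
    have pR: "polyd ?J (\<lambda>z. f' i (rot \<theta> z)) (\<lambda>j z. (case j of Inl i \<Rightarrow> cos \<theta> | Inr i \<Rightarrow> sin \<theta>) * f'' i (case j of Inl i \<Rightarrow> i | Inr i \<Rightarrow> i) (rot \<theta> z))"
      using polyd_rotate[OF f''[of i], of "cos \<theta>" "sin \<theta>"] by (simp add: rot_def)
    have iLL: "integrable (gauss ?J) (\<lambda>z. f' i (?L z) * f' i (?L z))"
      by (rule polyd_integrable[OF J polyd_mult[OF pL pL]])
    have iRR: "integrable (gauss ?J) (\<lambda>z. f' i (rot \<theta> z) * f' i (rot \<theta> z))"
      by (rule polyd_integrable[OF J polyd_mult[OF pR pR]])
    have iLR: "integrable (gauss ?J) (\<lambda>z. f' i (?L z) * f' i (rot \<theta> z))"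
      by (rule polyd_integrable[OF J polyd_mult[OF pL pR]])
    have "(LINT z|gauss ?J. f' i (?L z) * f' i (rot \<theta> z))
      \<le> (LINT z|gauss ?J. (f' i (?L z) * f' i (?L z)) / 2 + (f' i (rot \<theta> z) * f' i (rot \<theta> z)) / 2)"
    proof (rule integral_mono[OF iLR])
      show "integrable (gauss ?J) (\<lambda>z. (f' i (?L z) * f' i (?L z)) / 2 + (f' i (rot \<theta> z) * f' i (rot \<theta> z)) / 2)"
        using iLL iRR by (intro Bochner_Integration.integrable_add integrable_divide) auto
      fix z
      show "f' i (?L z) * f' i (rot \<theta> z) \<le> (f' i (?L z) * f' i (?L z)) / 2 + (f' i (rot \<theta> z) * f' i (rot \<theta> z)) / 2"
        using sum_squares_bound[of "f' i (?L z)" "f' i (rot \<theta> z)"] by (simp add: power2_eq_square field_simps)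
    qed
    also have "\<dots> = (LINT z|gauss ?J. f' i (rot 0 z) * f' i (rot 0 z)) / 2 + (LINT z|gauss ?J. f' i (rot \<theta> z) * f' i (rot \<theta> z)) / 2"
      using iLL iRR by (simp add: rot_def)
    also have "\<dots> = (LINT x|gauss I. (f' i x)\<^sup>2)"
      using inv[OF sq] by (simp add: power2_eq_square)
    finally show "(LINT z|gauss ?J. f' i (?L z) * f' i (rot \<theta> z)) \<le> (LINT x|gauss I. (f' i x)\<^sup>2)" .
  qed
  \<comment> \<open>Comparison with A cos \<theta>, whose derivative is - A sin \<theta>. The path
    leads from \<open>D 0\<close>, the second moment, to \<open>D (pi / 2)\<close>, where the copies
    are independent and the squared mean appears.\<close>
  have "D 0 - A * cos 0 \<le> D (pi / 2) - A * cos (pi / 2)"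
  proof (rule DERIV_nonneg_imp_nondecreasing[where f="\<lambda>\<theta>. D \<theta> - A * cos \<theta>" and a=0 and b="pi / 2"])
    fix x :: real assume x: "0 \<le> x" "x \<le> pi / 2"
    have "((\<lambda>\<theta>. D \<theta> - A * cos \<theta>) has_real_derivative sin x * (A - D' x)) (at x)"
      by (auto intro!: derivative_eq_intros DD simp: algebra_simps)
    moreover have "0 \<le> sin x * (A - D' x)"
      using x D'A[of x] by (intro mult_nonneg_nonneg sin_ge_zero) auto
    ultimately show "\<exists>y. ((\<lambda>\<theta>. D \<theta> - A * cos \<theta>) has_real_derivative y) (at x) \<and> 0 \<le> y"
      by blast
  qed simp
  moreover have "D 0 = (LINT x|gauss I. (f x)\<^sup>2)"
  proof -
    have "D 0 = (LINT z|gauss ?J. (\<lambda>x. f x * f x) (rot 0 z))"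
      unfolding D_def rot_def by simp
    also have "\<dots> = (LINT x|gauss I. f x * f x)"
      by (rule inv[OF polyd_mult[OF f f]])
    finally show ?thesis by (simp add: power2_eq_square)
  qed
  moreover have "D (pi / 2) = (LINT x|gauss I. f x)\<^sup>2"
    unfolding D_def rot_def using integral_gauss_independent[OF I f f] by (simp add: power2_eq_square)
  ultimately show ?thesis by (simp add: A_def)
qed

section \<open>A Stein bound for cubic and quartic functionals\<close>

text \<open>The class contains the polynomials and also sin (s F + \<theta>), the test functions
  behind the characteristic function, which are not polynomial.\<close>

definition growth_smooth ::
  "'i set \<Rightarrow> (('i \<Rightarrow> real) \<Rightarrow> real) \<Rightarrow> ('i \<Rightarrow> ('i \<Rightarrow> real) \<Rightarrow> real) \<Rightarrow> bool" where
  "growth_smooth I f f' \<longleftrightarrow> f \<in> borel_measurable (gauss I) \<and> poly_growth I f \<and>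
    (\<forall>i\<in>I. f' i \<in> borel_measurable (gauss I) \<and> poly_growth I (f' i) \<and>
      (\<forall>x. ((\<lambda>y. f (x(i := y))) has_real_derivative f' i x) (at (x i))))"

lemma growth_smooth_polyd:
  assumes "finite I" "polyd I f f'"
  shows "growth_smooth I f f'"
proof -
  have "((\<lambda>y. f (x(i := y))) has_real_derivative f' i x) (at (x i))" if "i \<in> I" for i x
    using polyd_partial[OF assms that, of x "x i"] by simp
  then show ?thesis
    using polyd_growth[OF assms] polyd_measurable[OF assms(2)] by (auto simp: growth_smooth_def)
qed

lemma growth_smooth_mult:
  assumes f: "growth_smooth I f f'" and g: "growth_smooth I g g'"
  shows "growth_smooth I (\<lambda>x. f x * g x) (\<lambda>i x. f' i x * g x + f x * g' i x)"
proof -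
  have "((\<lambda>y. f (x(i := y)) * g (x(i := y))) has_real_derivative f' i x * g x + f x * g' i x) (at (x i))"
    if "i \<in> I" for i x
  proof -
    have "((\<lambda>y. f (x(i := y))) has_real_derivative f' i x) (at (x i))"
      "((\<lambda>y. g (x(i := y))) has_real_derivative g' i x) (at (x i))"
      using f g that by (auto simp: growth_smooth_def)
    from DERIV_mult[OF this] show ?thesis by (simp add: algebra_simps)
  qed
  then show ?thesis
    using f g unfolding growth_smooth_def
    by (intro conjI ballI allI borel_measurable_times poly_growth_mult borel_measurable_add poly_growth_add) blast+
qed

lemma growth_smooth_sin:
  assumes "growth_smooth I f f'"
  shows "growth_smooth I (\<lambda>x. sin (s * f x + \<theta>)) (\<lambda>i x. s * cos (s * f x + \<theta>) * f' i x)"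
proof -
  have m: "f \<in> borel_measurable (gauss I)" using assms by (simp add: growth_smooth_def)
  have "((\<lambda>y. sin (s * f (x(i := y)) + \<theta>)) has_real_derivative s * cos (s * f x + \<theta>) * f' i x) (at (x i))"
    if "i \<in> I" for i x
  proof -
    have "((\<lambda>y. f (x(i := y))) has_real_derivative f' i x) (at (x i))"
      using assms that by (auto simp: growth_smooth_def)
    then show ?thesis by (auto intro!: derivative_eq_intros)
  qed
  moreover have "poly_growth I (\<lambda>x. s * cos (s * f x + \<theta>))"
    by (intro poly_growth_mult poly_growth_const poly_growth_bounded[of _ 1]) simp
  moreover have "(\<lambda>x. s * cos (s * f x + \<theta>)) \<in> borel_measurable (gauss I)"
    "(\<lambda>x. sin (s * f x + \<theta>)) \<in> borel_measurable (gauss I)"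
    using m by measurable
  moreover have "poly_growth I (\<lambda>x. sin (s * f x + \<theta>))"
    by (intro poly_growth_bounded[of _ 1]) simp
  ultimately show ?thesis
    using assms unfolding growth_smooth_def
    by (intro conjI ballI allI borel_measurable_times[of "\<lambda>x. s * cos (s * f x + \<theta>)"]
        poly_growth_mult[of _ "\<lambda>x. s * cos (s * f x + \<theta>)"]) blast+
qed

lemma growth_smooth_integrable: "finite I \<Longrightarrow> growth_smooth I f f' \<Longrightarrow> integrable (gauss I) f"
  by (auto simp: growth_smooth_def intro: integrable_poly_growth)

lemma growth_smooth_integration_by_parts:
  assumes "finite I" "growth_smooth I f f'" "i \<in> I"
  shows "(LINT x|gauss I. x i * f x) = (LINT x|gauss I. f' i x)"
  using assms by (intro gauss_integration_by_parts) (auto simp: growth_smooth_def)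

fun normal_moment :: "nat \<Rightarrow> real" where
  "normal_moment 0 = 1"
| "normal_moment (Suc 0) = 0"
| "normal_moment (Suc (Suc m)) = real (Suc m) * normal_moment m"

text \<open>The mean of \<open>p\<close> under the standard normal law, given as a finite sum so
  that bounds which use it refer to no particular array.\<close>

definition normal_mean :: "real poly \<Rightarrow> real" where
  "normal_mean p = (\<Sum>i\<le>degree p. coeff p i * normal_moment i)"

text \<open>Rows of unit length make each linear form \<open>G k\<close> standard normal, and
  \<open>bessel\<close> bounds the squared operator norm of the matrix by \<open>lam\<close>. The
  correlation of \<open>G k\<close> and \<open>G k'\<close> is the inner product
  \<open>rho k k'\<close> of two rows.\<close>

locale gaussian_array =
  fixes I :: "'i set" and K :: "'k set" and A :: "'k \<Rightarrow> 'i \<Rightarrow> real" and lam :: real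
  assumes finI: "finite I" and finK: "finite K" and K: "K \<noteq> {}"
    and unit: "\<And>k. k \<in> K \<Longrightarrow> (\<Sum>i\<in>I. (A k i)\<^sup>2) = 1"
    and bessel: "\<And>v. (\<Sum>i\<in>I. (\<Sum>k\<in>K. A k i * v k)\<^sup>2) \<le> lam * (\<Sum>k\<in>K. (v k)\<^sup>2)"
begin

definition G :: "'k \<Rightarrow> ('i \<Rightarrow> real) \<Rightarrow> real" where "G k x = (\<Sum>i\<in>I. A k i * x i)"
definition rho :: "'k \<Rightarrow> 'k \<Rightarrow> real" where "rho k k' = (\<Sum>i\<in>I. A k i * A k' i)"
definition n :: real where "n = real (card K)"

lemma n_pos: "0 < n"
  using finK K by (simp add: n_def card_gt_0_iff)

lemma polyd_G: "polyd I (\<lambda>x. poly p (G k x)) (\<lambda>i x. poly (pderiv p) (G k x) * (if i \<in> I then A k i else 0))"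
  unfolding G_def by (rule polyd_poly[OF polyd_linear[OF finI]])

lemma integrable_G: "integrable (gauss I) (\<lambda>x. poly p (G k x))"
  by (rule polyd_integrable[OF finI polyd_G])

lemma integrable_GG: "integrable (gauss I) (\<lambda>x. poly p (G k x) * poly q (G k' x))"
  by (rule polyd_integrable[OF finI polyd_mult[OF polyd_G polyd_G]])

text \<open>The operator that takes p to x p - p' is the adjoint of differentiation under the normal
  law and raises Hermite indices by one. Integration by parts in the coordinates of
  \<open>G k\<close> yields the mean of p' f with weight equal to the squared length of the row,
  which is 1, and the subtracted p' removes it.\<close>

lemma stein:
  assumes k: "k \<in> K" and f: "growth_smooth I f f'"
  shows "(LINT x|gauss I. poly ([:0, 1:] * p - pderiv p) (G k x) * f x)
    = (\<Sum>i\<in>I. A k i * (LINT x|gauss I. poly p (G k x) * f' i x))"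
proof -
  let ?p = "\<lambda>x. poly p (G k x)" and ?q = "\<lambda>x. poly (pderiv p) (G k x)"
  have gp: "growth_smooth I ?p (\<lambda>i x. ?q x * (if i \<in> I then A k i else 0))"
    by (rule growth_smooth_polyd[OF finI polyd_G])
  have gpf: "growth_smooth I (\<lambda>x. ?p x * f x) (\<lambda>i x. ?q x * (if i \<in> I then A k i else 0) * f x + ?p x * f' i x)"
    by (rule growth_smooth_mult[OF gp f])
  have i1: "integrable (gauss I) (\<lambda>x. x i * (?p x * f x))" if "i \<in> I" for i
    by (rule growth_smooth_integrable[OF finI growth_smooth_mult[OF
          growth_smooth_polyd[OF finI polyd_component[OF that]] gpf]])
  have gq: "growth_smooth I (\<lambda>x. ?q x * f x) (\<lambda>i x. poly (pderiv (pderiv p)) (G k x) * (if i \<in> I then A k i else 0) * f x + ?q x * f' i x)"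
    by (rule growth_smooth_mult[OF growth_smooth_polyd[OF finI polyd_G] f])
  have i2: "integrable (gauss I) (\<lambda>x. ?q x * f x)"
    by (rule growth_smooth_integrable[OF finI gq])
  have i3: "integrable (gauss I) (\<lambda>x. ?p x * f' i x)" if "i \<in> I" for i
  proof (rule integrable_poly_growth[OF finI])
    show "poly_growth I (\<lambda>x. ?p x * f' i x)"
      using gp f that by (intro poly_growth_mult) (auto simp: growth_smooth_def)
    show "(\<lambda>x. ?p x * f' i x) \<in> borel_measurable (gauss I)"
      using gp f that by (intro borel_measurable_times) (auto simp: growth_smooth_def)
  qed
  have "(LINT x|gauss I. G k x * (?p x * f x)) = (LINT x|gauss I. (\<Sum>i\<in>I. A k i * (x i * (?p x * f x))))"
    by (simp add: G_def sum_distrib_right mult.assoc)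
  also have "\<dots> = (\<Sum>i\<in>I. A k i * (LINT x|gauss I. x i * (?p x * f x)))"
    using i1 by (simp add: Bochner_Integration.integral_sum)
  also have "\<dots> = (\<Sum>i\<in>I. (A k i)\<^sup>2 * (LINT x|gauss I. ?q x * f x) + A k i * (LINT x|gauss I. ?p x * f' i x))"
  proof (rule sum.cong[OF refl])
    fix i assume i: "i \<in> I"
    have "(LINT x|gauss I. x i * (?p x * f x)) = (LINT x|gauss I. A k i * (?q x * f x) + ?p x * f' i x)"
      using growth_smooth_integration_by_parts[OF finI gpf i] i by (simp add: mult_ac)
    also have "\<dots> = A k i * (LINT x|gauss I. ?q x * f x) + (LINT x|gauss I. ?p x * f' i x)"
      using i2 i3[OF i] by simp
    finally show "A k i * (LINT x|gauss I. x i * (?p x * f x))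
      = (A k i)\<^sup>2 * (LINT x|gauss I. ?q x * f x) + A k i * (LINT x|gauss I. ?p x * f' i x)"
      by (simp add: power2_eq_square algebra_simps)
  qed
  also have "\<dots> = (LINT x|gauss I. ?q x * f x) + (\<Sum>i\<in>I. A k i * (LINT x|gauss I. ?p x * f' i x))"
    using unit[OF k] by (simp add: sum.distrib flip: sum_distrib_right)
  finally have *: "(LINT x|gauss I. G k x * (?p x * f x))
     = (LINT x|gauss I. ?q x * f x) + (\<Sum>i\<in>I. A k i * (LINT x|gauss I. ?p x * f' i x))" .
  have i4: "integrable (gauss I) (\<lambda>x. G k x * (?p x * f x))"
    unfolding G_def sum_distrib_right mult.assoc using i1 unfolding G_def
    by (intro Bochner_Integration.integrable_sum integrable_mult_right) auto
  have "(LINT x|gauss I. poly ([:0, 1:] * p - pderiv p) (G k x) * f x)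
     = (LINT x|gauss I. G k x * (?p x * f x) - ?q x * f x)"
    by (simp add: algebra_simps)
  also have "\<dots> = (LINT x|gauss I. G k x * (?p x * f x)) - (LINT x|gauss I. ?q x * f x)"
    using i4 i2 by simp
  finally show ?thesis using * by simp
qed

lemma moment_G:
  assumes "k \<in> K"
  shows "(LINT x|gauss I. (G k x) ^ m) = normal_moment m"
proof (induction m rule: normal_moment.induct)
  case 1
  show ?case by (simp add: gaussp.prob_space)
next
  case 2
  show ?case
    using stein[OF assms growth_smooth_polyd[OF finI polyd_const[of I 1]], of 1] by simp
next
  case (3 m)
  have "poly ([:0, 1:] * monom 1 (Suc m) - pderiv (monom 1 (Suc m))) y = y ^ Suc (Suc m) - real (Suc m) * y ^ m" for y :: real
    by (simp add: poly_monom pderiv_monom)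
  then have "(LINT x|gauss I. (G k x) ^ Suc (Suc m) - real (Suc m) * (G k x) ^ m) = 0"
    using stein[OF assms growth_smooth_polyd[OF finI polyd_const[of I 1]], of "monom 1 (Suc m)"] by simp
  moreover have i: "integrable (gauss I) (\<lambda>x. (G k x) ^ j)" for j
    using integrable_G[of "monom 1 j" k] by (simp add: poly_monom)
  ultimately have "(LINT x|gauss I. (G k x) ^ Suc (Suc m)) = real (Suc m) * (LINT x|gauss I. (G k x) ^ m)"
    unfolding Bochner_Integration.integral_diff[OF i integrable_mult_right[OF i]]
    by (simp del: power_Suc)
  then show ?case using 3 by (simp del: power_Suc)
qed

lemma mean_G:
  assumes "k \<in> K"
  shows "(LINT x|gauss I. poly p (G k x)) = normal_mean p"
proof -
  have "integrable (gauss I) (\<lambda>x. (G k x) ^ j)" for j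
    using integrable_G[of "monom 1 j" k] by (simp add: poly_monom)
  then show ?thesis
    unfolding poly_altdef normal_mean_def
    by (subst Bochner_Integration.integral_sum) (auto simp: moment_G[OF assms])
qed

text \<open>One derivative moves to the other form at the price of a factor \<open>rho\<close>.
  Iterated, this gives the orthogonality of Hermite polynomials in correlated variables.\<close>

lemma stein_pair:
  assumes "k \<in> K"
  shows "(LINT x|gauss I. poly ([:0, 1:] * p - pderiv p) (G k x) * poly q (G k' x))
    = rho k k' * (LINT x|gauss I. poly p (G k x) * poly (pderiv q) (G k' x))"
proof -
  have "(\<Sum>i\<in>I. A k i * (LINT x|gauss I. poly p (G k x) * (poly (pderiv q) (G k' x) * (if i \<in> I then A k' i else 0))))
     = (\<Sum>i\<in>I. A k i * A k' i * (LINT x|gauss I. poly p (G k x) * poly (pderiv q) (G k' x)))"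
    by (intro sum.cong refl) (simp flip: mult.assoc)
  then show ?thesis
    unfolding stein[OF assms growth_smooth_polyd[OF finI polyd_G]] rho_def
    by (simp add: sum_distrib_right)
qed

text \<open>A matrix and its transpose have the same norm. If w is the image of y and W its squared
  length, then W is the inner product of y with the transposed image of w, so W^2 <= lam W |y|^2 by
  Cauchy-Schwarz.\<close>

lemma bessel_dual: "(\<Sum>k\<in>K. (\<Sum>i\<in>I. A k i * y i)\<^sup>2) \<le> lam * (\<Sum>i\<in>I. (y i)\<^sup>2)"
proof -
  define w where "w k = (\<Sum>i\<in>I. A k i * y i)" for k
  define W where "W = (\<Sum>k\<in>K. (w k)\<^sup>2)"
  have W0: "0 \<le> W" unfolding W_def by (simp add: sum_nonneg)
  have "W = (\<Sum>i\<in>I. y i * (\<Sum>k\<in>K. A k i * w k))"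
  proof -
    have "W = (\<Sum>k\<in>K. w k * (\<Sum>i\<in>I. A k i * y i))"
      by (simp add: W_def w_def power2_eq_square)
    also have "\<dots> = (\<Sum>k\<in>K. \<Sum>i\<in>I. y i * (A k i * w k))"
      by (simp add: sum_distrib_left mult_ac)
    also have "\<dots> = (\<Sum>i\<in>I. \<Sum>k\<in>K. y i * (A k i * w k))"
      by (rule sum.swap)
    finally show ?thesis by (simp add: sum_distrib_left)
  qed
  then have "W\<^sup>2 \<le> (\<Sum>i\<in>I. (y i)\<^sup>2) * (\<Sum>i\<in>I. (\<Sum>k\<in>K. A k i * w k)\<^sup>2)"
    by (simp add: Cauchy_Schwarz_ineq_sum)
  also have "\<dots> \<le> (\<Sum>i\<in>I. (y i)\<^sup>2) * (lam * W)"
    unfolding W_def by (intro mult_left_mono bessel) (simp add: sum_nonneg)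
  finally have le: "W * W \<le> (lam * (\<Sum>i\<in>I. (y i)\<^sup>2)) * W"
    by (simp add: power2_eq_square mult_ac)
  show ?thesis
  proof (cases "W = 0")
    case True
    \<comment> \<open>W = 0 forbids the division by W; here only the sign of \<open>lam\<close>
      matters, which a unit vector in \<open>bessel\<close> reveals.\<close>
    obtain k0 where "k0 \<in> K" using K by auto
    have "0 \<le> lam * (\<Sum>i\<in>I. (y i)\<^sup>2)"
    proof -
      have "0 \<le> (\<Sum>i\<in>I. (\<Sum>k\<in>K. A k i * (if k = k0 then 1 else 0))\<^sup>2)" by (simp add: sum_nonneg)
      also have "\<dots> \<le> lam * (\<Sum>k\<in>K. (if k = k0 then 1 else 0)\<^sup>2)" by (rule bessel)
      also have "(\<Sum>k\<in>K. (if k = k0 then 1 else 0 :: real)\<^sup>2) = 1"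
        using \<open>k0 \<in> K\<close> finK by (simp add: if_distrib[of "\<lambda>x. x\<^sup>2"] cong: if_cong)
      finally show ?thesis by (intro mult_nonneg_nonneg) (auto simp: sum_nonneg)
    qed
    then show ?thesis using True by (simp add: W_def w_def)
  next
    case False
    then have "W \<le> lam * (\<Sum>i\<in>I. (y i)\<^sup>2)"
      using le W0 by simp
    then show ?thesis by (simp add: W_def w_def)
  qed
qed

lemma lam_nonneg: "0 \<le> lam"
proof -
  obtain k0 where k0: "k0 \<in> K" using K by auto
  have "0 \<le> (\<Sum>i\<in>I. (\<Sum>k\<in>K. A k i * (if k = k0 then 1 else 0))\<^sup>2)" by (simp add: sum_nonneg)
  also have "\<dots> \<le> lam * (\<Sum>k\<in>K. (if k = k0 then 1 else 0)\<^sup>2)" by (rule bessel)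
  also have "(\<Sum>k\<in>K. (if k = k0 then 1 else 0 :: real)\<^sup>2) = 1"
    using k0 finK by (simp add: if_distrib[of "\<lambda>x. x\<^sup>2"] cong: if_cong)
  finally show ?thesis by simp
qed

text \<open>The maximum of the \<open>\<alpha>\<^sub>k\<^sup>2\<close> is bounded by the square root of \<open>\<Sum> \<alpha>\<^sub>k\<^sup>4\<close>; the loss of a factor
  \<open>sqrt n\<close> is harmless against the gain of a factor \<open>n\<close> from the operator norm.\<close>
lemma gradient_bound:
  fixes \<alpha> \<beta> :: "'k \<Rightarrow> real"
  shows "(\<Sum>j\<in>I. ((\<Sum>k\<in>K. A k j * (\<alpha> k * (\<Sum>i\<in>I. A k i * ((\<Sum>k\<in>K. A k i * \<beta> k) / sqrt n)))) / sqrt n)\<^sup>2)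
    \<le> lam ^ 3 / (n * sqrt n) * ((\<Sum>k\<in>K. \<alpha> k ^ 4) + (\<Sum>k\<in>K. \<beta> k ^ 4)) / 2"
proof -
  define v where "v i = (\<Sum>k\<in>K. A k i * \<beta> k) / sqrt n" for i
  define w where "w k = (\<Sum>i\<in>I. A k i * v i)" for k
  define a where "a = (\<Sum>k\<in>K. \<alpha> k ^ 4)"
  define b where "b = (\<Sum>k\<in>K. \<beta> k ^ 4)"
  have nn: "0 < n" "0 \<le> lam" using n_pos lam_nonneg by auto
  have "(\<Sum>j\<in>I. ((\<Sum>k\<in>K. A k j * (\<alpha> k * w k)) / sqrt n)\<^sup>2) = (\<Sum>j\<in>I. (\<Sum>k\<in>K. A k j * (\<alpha> k * w k))\<^sup>2) / n"
    using nn by (simp add: power_divide flip: sum_divide_distrib)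
  also have "\<dots> \<le> lam * (\<Sum>k\<in>K. (\<alpha> k * w k)\<^sup>2) / n"
    using nn by (intro divide_right_mono bessel) auto
  also have "(\<Sum>k\<in>K. (\<alpha> k * w k)\<^sup>2) \<le> (\<Sum>k\<in>K. sqrt a * (w k)\<^sup>2)"
  proof (rule sum_mono)
    fix k assume k: "k \<in> K"
    have "(\<alpha> k)^4 \<le> a"
      unfolding a_def using finK k by (intro member_le_sum) auto
    then have "(\<alpha> k)\<^sup>2 \<le> sqrt a"
      by (intro real_le_rsqrt) simp
    then show "(\<alpha> k * w k)\<^sup>2 \<le> sqrt a * (w k)\<^sup>2"
      by (simp add: power_mult_distrib mult_right_mono)
  qed
  also have "\<dots> = sqrt a * (\<Sum>k\<in>K. (w k)\<^sup>2)" by (simp add: sum_distrib_left)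
  also have "(\<Sum>k\<in>K. (w k)\<^sup>2) \<le> lam * (\<Sum>i\<in>I. (v i)\<^sup>2)"
    unfolding w_def by (rule bessel_dual)
  also have "(\<Sum>i\<in>I. (v i)\<^sup>2) = (\<Sum>i\<in>I. (\<Sum>k\<in>K. A k i * \<beta> k)\<^sup>2) / n"
    using nn by (simp add: v_def power_divide flip: sum_divide_distrib)
  also have "\<dots> \<le> lam * (\<Sum>k\<in>K. (\<beta> k)\<^sup>2) / n"
    using nn by (intro divide_right_mono bessel) auto
  \<comment> \<open>Cauchy-Schwarz passes to fourth powers, which for polynomials in the
    \<open>G k\<close> add up to a mean of order n.\<close>
  also have "(\<Sum>k\<in>K. (\<beta> k)\<^sup>2) \<le> sqrt n * sqrt b"
  proof -
    have "(\<Sum>k\<in>K. 1 * (\<beta> k)\<^sup>2)\<^sup>2 \<le> (\<Sum>k\<in>K. 1\<^sup>2) * (\<Sum>k\<in>K. ((\<beta> k)\<^sup>2)\<^sup>2)"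
      by (rule Cauchy_Schwarz_ineq_sum)
    then have "(\<Sum>k\<in>K. (\<beta> k)\<^sup>2)\<^sup>2 \<le> n * b"
      by (simp add: n_def b_def)
    then show ?thesis
      by (simp add: real_le_rsqrt flip: real_sqrt_mult)
  qed
  finally have *: "(\<Sum>j\<in>I. ((\<Sum>k\<in>K. A k j * (\<alpha> k * w k)) / sqrt n)\<^sup>2)
     \<le> lam * (sqrt a * (lam * (lam * (sqrt n * sqrt b) / n))) / n"
    using nn by (simp add: mult_left_mono divide_right_mono a_def sum_nonneg)
  also have "\<dots> = lam ^ 3 / (n * sqrt n) * (sqrt a * sqrt b)"
    using nn by (simp add: field_simps power3_eq_cube)
  also have "\<dots> \<le> lam ^ 3 / (n * sqrt n) * ((a + b) / 2)"
  proof (intro mult_left_mono)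
    have "sqrt (a * b) \<le> (a + b) / 2"
      by (rule arith_geo_mean_sqrt) (auto simp: a_def b_def sum_nonneg)
    then show "sqrt a * sqrt b \<le> (a + b) / 2" by (simp add: real_sqrt_mult)
  qed (use nn in simp)
  finally show ?thesis by (simp add: v_def w_def a_def b_def)
qed

section \<open>The functional \<open>F\<close> and its Stein kernel\<close>

context
  fixes a b :: real
begin

text \<open>The polynomial \<open>hp\<close> is \<open>a (x\<^sup>3 - 3 x) + b (x\<^sup>4 - 3) = a H\<^sub>3 + b (H\<^sub>4 + 6 H\<^sub>2)\<close>, and \<open>Qp\<close> is obtained
  from it by lowering the index of every Hermite polynomial.\<close>
definition hp :: "real poly" where "hp = [:- 3 * b, - 3 * a, 0, a, b:]"
definition Qp :: "real poly" where "Qp = [:- a, 3 * b, a, b:]"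
definition F :: "('i \<Rightarrow> real) \<Rightarrow> real" where "F x = (\<Sum>k\<in>K. poly hp (G k x)) / sqrt n"
text \<open>The negative inverse generator divides a Hermite term of index q by q, and
  differentiation multiplies it by q while lowering the index. So the gradient of this transform of
  \<open>F\<close> is \<open>u\<close>, with \<open>Qp\<close> at the place of \<open>hp\<close>,
  whereas \<open>v\<close> is the gradient of \<open>F\<close> itself.\<close>

definition u :: "'i \<Rightarrow> ('i \<Rightarrow> real) \<Rightarrow> real" where "u i x = (\<Sum>k\<in>K. A k i * poly Qp (G k x)) / sqrt n"
definition v :: "'i \<Rightarrow> ('i \<Rightarrow> real) \<Rightarrow> real" where "v i x = (\<Sum>k\<in>K. A k i * poly (pderiv hp) (G k x)) / sqrt n"
definition Gam :: "('i \<Rightarrow> real) \<Rightarrow> real" where "Gam x = (\<Sum>i\<in>I. u i x * v i x)"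

lemma hp_eq: "hp = [:0, 1:] * Qp - pderiv Qp"
  by (simp add: hp_def Qp_def pderiv_pCons)

lemma polyd_F: "polyd I F (\<lambda>i x. if i \<in> I then v i x else 0)"
proof -
  have "polyd I (\<lambda>x. (1 / sqrt n) * (\<Sum>k\<in>K. poly hp (G k x)))
     (\<lambda>i x. (1 / sqrt n) * (\<Sum>k\<in>K. poly (pderiv hp) (G k x) * (if i \<in> I then A k i else 0)))"
    by (intro polyd_cmult polyd_sum finK polyd_G)
  then show ?thesis
    by (rule polyd_eq) (auto simp: F_def v_def mult.commute)
qed

lemma growth_smooth_F: "growth_smooth I F v"
  using growth_smooth_polyd[OF finI polyd_F] by (auto simp: growth_smooth_def)

lemma polyd_uv:
  "polyd I (\<lambda>x. (\<Sum>k\<in>K. A k i * poly p (G k x)) / sqrt n)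
    (\<lambda>j x. if j \<in> I then (\<Sum>k\<in>K. A k i * (A k j * poly (pderiv p) (G k x))) / sqrt n else 0)"
proof -
  have "polyd I (\<lambda>x. (1 / sqrt n) * (\<Sum>k\<in>K. A k i * poly p (G k x)))
     (\<lambda>j x. (1 / sqrt n) * (\<Sum>k\<in>K. A k i * (poly (pderiv p) (G k x) * (if j \<in> I then A k j else 0))))"
    by (intro polyd_cmult polyd_sum finK polyd_G)
  then show ?thesis
    by (rule polyd_eq) (auto simp: mult.commute)
qed

lemma polyd_Gam:
  "polyd I Gam (\<lambda>j x. \<Sum>i\<in>I.
    (if j \<in> I then (\<Sum>k\<in>K. A k i * (A k j * poly (pderiv Qp) (G k x))) / sqrt n else 0) * v i x +
    u i x * (if j \<in> I then (\<Sum>k\<in>K. A k i * (A k j * poly (pderiv (pderiv hp)) (G k x))) / sqrt n else 0))"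
  unfolding Gam_def[abs_def] u_def v_def by (intro polyd_sum finI polyd_mult polyd_uv)

text \<open>A function of \<open>F\<close> has a gradient parallel to that of \<open>F\<close>, and
  \<open>c\<close> is the factor of proportionality. Applying \<open>stein\<close> to each summand
  of \<open>F\<close> collects the inner product of \<open>u\<close> with that gradient.\<close>

lemma stein_F:
  assumes f: "growth_smooth I f (\<lambda>i x. c x * v i x)" and c: "c \<in> borel_measurable (gauss I)" "\<And>i. i \<in> I \<Longrightarrow> poly_growth I c"
  shows "(LINT x|gauss I. F x * f x) = (LINT x|gauss I. c x * Gam x)"
proof -
  have ih: "integrable (gauss I) (\<lambda>x. poly hp (G k x) * f x)" for k
    by (rule growth_smooth_integrable[OF finI growth_smooth_mult[OF growth_smooth_polyd[OF finI polyd_G] f]])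
  have gv: "poly_growth I (v i)" "v i \<in> borel_measurable (gauss I)" if "i \<in> I" for i
    using growth_smooth_F that by (auto simp: growth_smooth_def)
  have gQ: "poly_growth I (\<lambda>x. poly Qp (G k x))" "(\<lambda>x. poly Qp (G k x)) \<in> borel_measurable (gauss I)" for k
    using growth_smooth_polyd[OF finI polyd_G] by (auto simp: growth_smooth_def)
  have iQ: "integrable (gauss I) (\<lambda>x. poly Qp (G k x) * (c x * v i x))" if "i \<in> I" for i k
    using that c gv gQ by (intro integrable_poly_growth finI poly_growth_mult borel_measurable_times) auto
  have "(LINT x|gauss I. F x * f x) = (LINT x|gauss I. (\<Sum>k\<in>K. poly hp (G k x) * f x) / sqrt n)"
    by (simp add: F_def sum_distrib_right)
  also have "\<dots> = (\<Sum>k\<in>K. LINT x|gauss I. poly hp (G k x) * f x) / sqrt n"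
    using ih by (simp add: Bochner_Integration.integral_sum)
  also have "\<dots> = (\<Sum>k\<in>K. \<Sum>i\<in>I. A k i * (LINT x|gauss I. poly Qp (G k x) * (c x * v i x))) / sqrt n"
    unfolding hp_eq by (intro arg_cong2[where f="(/)"] refl sum.cong) (rule stein[OF _ f])
  also have "\<dots> = (LINT x|gauss I. (\<Sum>k\<in>K. \<Sum>i\<in>I. A k i * (poly Qp (G k x) * (c x * v i x))) / sqrt n)"
    using iQ by (simp add: Bochner_Integration.integral_sum)
  also have "\<dots> = (LINT x|gauss I. c x * Gam x)"
  proof (intro Bochner_Integration.integral_cong refl)
    fix x
    have "(\<Sum>k\<in>K. \<Sum>i\<in>I. A k i * (poly Qp (G k x) * (c x * v i x)))
       = (\<Sum>i\<in>I. \<Sum>k\<in>K. c x * v i x * (A k i * poly Qp (G k x)))"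
      by (subst sum.swap) (simp add: mult_ac)
    then show "(\<Sum>k\<in>K. \<Sum>i\<in>I. A k i * (poly Qp (G k x) * (c x * v i x))) / sqrt n = c x * Gam x"
      by (simp add: Gam_def u_def sum_distrib_left sum_divide_distrib mult_ac)
  qed
  finally show ?thesis .
qed

text \<open>The case of \<open>stein_F\<close> in which \<open>f\<close> is \<open>F\<close> and
  \<open>c\<close> is 1. The number around which \<open>Gam\<close> must concentrate is thus the
  exact variance of \<open>F\<close>.\<close>

lemma second_moment_F_Gam: "(LINT x|gauss I. (F x)\<^sup>2) = (LINT x|gauss I. Gam x)"
proof -
  have "growth_smooth I F (\<lambda>i x. 1 * v i x)" using growth_smooth_F by simp
  from stein_F[OF this] show ?thesis
    by (simp add: power2_eq_square poly_growth_const)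
qed

text \<open>At correlation r the Hermite polynomials of indices p and q have covariance p! r^p if p
  = q, and 0 otherwise. This gives 3! for H3, 4! for H4, and 6^2 2! = 72 for the part 6 H2. Odd and
  even parts do not mix, hence there is no term in a b.\<close>

lemma covariance_hp:
  assumes "k \<in> K" "k' \<in> K"
  shows "(LINT x|gauss I. poly hp (G k x) * poly hp (G k' x))
    = 6 * a\<^sup>2 * rho k k' ^ 3 + b\<^sup>2 * (24 * rho k k' ^ 4 + 72 * rho k k' ^ 2)"
proof -
  let ?E = "\<lambda>p q. LINT x|gauss I. poly p (G k x) * poly q (G k' x)"
  let ?D = "\<lambda>p. [:0, 1:] * p - pderiv p"
  have st: "?E (?D p) q = rho k k' * ?E p (pderiv q)" for p q
    by (rule stein_pair[OF assms(1)])
  \<comment> \<open>\<open>?R\<close> and \<open>?T\<close> continue the lowering of indices that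
    leads from \<open>hp\<close> to \<open>Qp\<close>. A term of index 0 cannot be lowered further;
    the constants 6 b and a split off for this reason and contribute only means.\<close>
  let ?R = "[:5 * b, a, b:]" let ?T = "[:a, b:]"
  have Q: "Qp = ?D ?R" by (simp add: Qp_def pderiv_pCons)
  have R: "?R = ?D ?T + [:6 * b:]" by (simp add: pderiv_pCons)
  have add: "?E (p + r) q = ?E p q + ?E r q" for p q r
    using integrable_GG by (simp add: algebra_simps)
  have cst: "?E [:c:] q = c * normal_mean q" for c q
    using mean_G[OF assms(2), of q] by simp
  have h: "pderiv hp = [:-3 * a, 0, 3 * a, 4 * b:]" "pderiv (pderiv hp) = [:0, 6 * a, 12 * b:]"
    "pderiv (pderiv (pderiv hp)) = [:6 * a, 24 * b:]"
    by (simp_all add: hp_def pderiv_pCons)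
  have T: "?T = ?D [:b:] + [:a:]" by (simp add: pderiv_pCons)
  \<comment> \<open>\<open>normal_mean\<close> sums up to the degree, which drops if the leading
    coefficient vanishes; hence the case distinctions.\<close>
  have m1: "normal_mean [:0, 6 * a, 12 * b:] = 12 * b"
  proof (cases "b = 0")
    case True
    then show ?thesis by (cases "a = 0") (auto simp: normal_mean_def)
  qed (simp add: normal_mean_def numeral_2_eq_2)
  have m2: "normal_mean [:24 * b:] = 24 * b" by (simp add: normal_mean_def)
  have m3: "normal_mean [:6 * a, 24 * b:] = 6 * a"
    by (cases "b = 0") (auto simp: normal_mean_def)
  have "?E hp hp = rho k k' * ?E Qp (pderiv hp)"
    unfolding hp_eq[symmetric] st[symmetric] ..
  also have "?E Qp (pderiv hp) = rho k k' * ?E ?R (pderiv (pderiv hp))"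
    unfolding Q st ..
  also have "?E ?R (pderiv (pderiv hp)) = rho k k' * ?E ?T (pderiv (pderiv (pderiv hp))) + 6 * b * normal_mean (pderiv (pderiv hp))"
    unfolding R add st cst ..
  finally have *: "?E hp hp = rho k k' * (rho k k' * (rho k k' * ?E ?T (pderiv (pderiv (pderiv hp))) + 6 * b * normal_mean (pderiv (pderiv hp))))" .
  have "?E ?T (pderiv (pderiv (pderiv hp))) = rho k k' * (b * (24 * b)) + a * (6 * a)"
    unfolding T add st cst h using m2 m3 by (simp add: pderiv_pCons cst)
  moreover have "normal_mean (pderiv (pderiv hp)) = 12 * b"
    by (simp only: h(2) m1)
  ultimately show ?thesis
    unfolding * by (simp add: algebra_simps power2_eq_square power3_eq_cube power4_eq_xxxx)
qed

lemma second_moment_F: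
  "(LINT x|gauss I. (F x)\<^sup>2) =
    a\<^sup>2 * (6 / n * (\<Sum>k\<in>K. \<Sum>k'\<in>K. rho k k' ^ 3)) +
    b\<^sup>2 * (1 / n * (\<Sum>k\<in>K. \<Sum>k'\<in>K. 24 * rho k k' ^ 4 + 72 * rho k k' ^ 2))"
proof -
  have nn: "0 < n" using n_pos .
  have "(LINT x|gauss I. (F x)\<^sup>2) = (LINT x|gauss I. (\<Sum>k\<in>K. \<Sum>k'\<in>K. poly hp (G k x) * poly hp (G k' x)) / n)"
    using nn by (simp add: F_def power_divide power2_eq_square sum_product)
  also have "\<dots> = (\<Sum>k\<in>K. \<Sum>k'\<in>K. LINT x|gauss I. poly hp (G k x) * poly hp (G k' x)) / n"
    using integrable_GG by (simp add: Bochner_Integration.integral_sum)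
  also have "\<dots> = (\<Sum>k\<in>K. \<Sum>k'\<in>K. 6 * a\<^sup>2 * rho k k' ^ 3 + b\<^sup>2 * (24 * rho k k' ^ 4 + 72 * rho k k' ^ 2)) / n"
    by (simp add: covariance_hp)
  also have "\<dots> = a\<^sup>2 * (6 / n * (\<Sum>k\<in>K. \<Sum>k'\<in>K. rho k k' ^ 3)) +
    b\<^sup>2 * (1 / n * (\<Sum>k\<in>K. \<Sum>k'\<in>K. 24 * rho k k' ^ 4 + 72 * rho k k' ^ 2))"
    by (simp add: sum.distrib sum_distrib_left sum_divide_distrib add_divide_distrib algebra_simps)
  finally show ?thesis .
qed

definition fourth_bound :: real where
  "fourth_bound = normal_mean (pderiv Qp ^ 4) + normal_mean (pderiv hp ^ 4) +
    normal_mean (pderiv (pderiv hp) ^ 4) + normal_mean (Qp ^ 4)"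

text \<open>Each derivative of \<open>Gam\<close> has one part that differentiates \<open>u\<close>
  and one that differentiates \<open>v\<close>. Both fall under \<open>gradient_bound\<close>, and
  taking means of its n fourth powers turns the factor n^(-3/2) into n^(-1/2).\<close>

lemma variance_Gam:
  "(LINT x|gauss I. (Gam x - (LINT x|gauss I. Gam x))\<^sup>2) \<le> lam ^ 3 / sqrt n * fourth_bound"
proof -
  let ?E = "LINT x|gauss I. Gam x"
  define D where "D j x = (\<Sum>i\<in>I.
    (if j \<in> I then (\<Sum>k\<in>K. A k i * (A k j * poly (pderiv Qp) (G k x))) / sqrt n else 0) * v i x +
    u i x * (if j \<in> I then (\<Sum>k\<in>K. A k i * (A k j * poly (pderiv (pderiv hp)) (G k x))) / sqrt n else 0))" for j x
  have pG: "polyd I Gam D" unfolding D_def[abs_def] by (rule polyd_Gam)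
  have nn: "0 < n" "0 \<le> lam" using n_pos lam_nonneg by auto
  have iG: "integrable (gauss I) Gam" by (rule polyd_integrable[OF finI pG])
  have iG2: "integrable (gauss I) (\<lambda>x. (Gam x)\<^sup>2)"
    using polyd_integrable[OF finI polyd_mult[OF pG pG]] by (simp add: power2_eq_square)
  have iD: "integrable (gauss I) (\<lambda>x. (D j x)\<^sup>2)" for j
  proof -
    obtain D' where "polyd I (D j) D'" using polyd_derivative_ex[OF pG] by blast
    from polyd_integrable[OF finI polyd_mult[OF this this]] show ?thesis by (simp add: power2_eq_square)
  qed
  have "(LINT x|gauss I. (Gam x - ?E)\<^sup>2) = (LINT x|gauss I. (Gam x)\<^sup>2) - ?E\<^sup>2"
    using iG iG2 by (rule gaussp.variance_eq)
  also have "\<dots> \<le> (\<Sum>j\<in>I. LINT x|gauss I. (D j x)\<^sup>2)"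
    by (rule gauss_poincare[OF finI pG])
  also have "\<dots> = (LINT x|gauss I. (\<Sum>j\<in>I. (D j x)\<^sup>2))"
    using iD by (simp add: Bochner_Integration.integral_sum)
  also have "\<dots> \<le> (LINT x|gauss I. lam ^ 3 / (n * sqrt n) *
     (\<Sum>k\<in>K. poly (pderiv Qp ^ 4 + pderiv hp ^ 4 + pderiv (pderiv hp) ^ 4 + Qp ^ 4) (G k x)))"
  proof (rule integral_mono)
    show "integrable (gauss I) (\<lambda>x. \<Sum>j\<in>I. (D j x)\<^sup>2)"
      using iD by (intro Bochner_Integration.integrable_sum)
    show "integrable (gauss I) (\<lambda>x. lam ^ 3 / (n * sqrt n) *
       (\<Sum>k\<in>K. poly (pderiv Qp ^ 4 + pderiv hp ^ 4 + pderiv (pderiv hp) ^ 4 + Qp ^ 4) (G k x)))"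
      by (intro integrable_mult_right Bochner_Integration.integrable_sum integrable_G)
    fix x
    \<comment> \<open>The double sums are regrouped into a transposed image, an image, a pointwise
      multiplication and a second transposed image, which is the shape of
      \<open>gradient_bound\<close>.\<close>
    define X where "X j = (\<Sum>k\<in>K. A k j * (poly (pderiv Qp) (G k x) * (\<Sum>i\<in>I. A k i * ((\<Sum>k\<in>K. A k i * poly (pderiv hp) (G k x)) / sqrt n)))) / sqrt n" for j
    define Y where "Y j = (\<Sum>k\<in>K. A k j * (poly (pderiv (pderiv hp)) (G k x) * (\<Sum>i\<in>I. A k i * ((\<Sum>k\<in>K. A k i * poly Qp (G k x)) / sqrt n)))) / sqrt n" for j
    have DXY: "D j x = X j + Y j" if j: "j \<in> I" for j
    proof -
      have gen: "(\<Sum>i\<in>I. (\<Sum>k\<in>K. A k i * (A k j * p k)) / sqrt n * z i)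
         = (\<Sum>k\<in>K. A k j * (p k * (\<Sum>i\<in>I. A k i * z i))) / sqrt n" for p z
      proof -
        have "(\<Sum>i\<in>I. (\<Sum>k\<in>K. A k i * (A k j * p k)) / sqrt n * z i)
          = (\<Sum>i\<in>I. \<Sum>k\<in>K. A k j * (p k * (A k i * z i)) / sqrt n)"
          unfolding sum_distrib_right sum_divide_distrib by (simp add: mult_ac)
        also have "\<dots> = (\<Sum>k\<in>K. \<Sum>i\<in>I. A k j * (p k * (A k i * z i)) / sqrt n)"
          by (rule sum.swap)
        finally show ?thesis by (simp add: sum_distrib_left sum_divide_distrib)
      qed
      have "(\<Sum>i\<in>I. (\<Sum>k\<in>K. A k i * (A k j * poly (pderiv Qp) (G k x))) / sqrt n * v i x) = X j"
        unfolding X_def v_def by (rule gen)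
      moreover have "(\<Sum>i\<in>I. u i x * ((\<Sum>k\<in>K. A k i * (A k j * poly (pderiv (pderiv hp)) (G k x))) / sqrt n)) = Y j"
        unfolding Y_def u_def by (subst mult.commute) (rule gen)
      ultimately show ?thesis
        using j by (simp only: D_def if_True sum.distrib)
    qed
    have "(\<Sum>j\<in>I. (D j x)\<^sup>2) \<le> (\<Sum>j\<in>I. 2 * (X j)\<^sup>2 + 2 * (Y j)\<^sup>2)"
    proof (rule sum_mono)
      fix j assume "j \<in> I"
      then show "(D j x)\<^sup>2 \<le> 2 * (X j)\<^sup>2 + 2 * (Y j)\<^sup>2"
        using sum_squares_bound[of "X j" "Y j"] by (simp add: DXY power2_sum)
    qed
    also have "\<dots> = 2 * (\<Sum>j\<in>I. (X j)\<^sup>2) + 2 * (\<Sum>j\<in>I. (Y j)\<^sup>2)"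
      by (simp add: sum.distrib sum_distrib_left)
    also have "\<dots> \<le> 2 * (lam ^ 3 / (n * sqrt n) * ((\<Sum>k\<in>K. poly (pderiv Qp) (G k x) ^ 4) + (\<Sum>k\<in>K. poly (pderiv hp) (G k x) ^ 4)) / 2) +
       2 * (lam ^ 3 / (n * sqrt n) * ((\<Sum>k\<in>K. poly (pderiv (pderiv hp)) (G k x) ^ 4) + (\<Sum>k\<in>K. poly Qp (G k x) ^ 4)) / 2)"
      unfolding X_def Y_def by (intro add_mono mult_left_mono gradient_bound) auto
    also have "\<dots> = lam ^ 3 / (n * sqrt n) *
       (\<Sum>k\<in>K. poly (pderiv Qp ^ 4 + pderiv hp ^ 4 + pderiv (pderiv hp) ^ 4 + Qp ^ 4) (G k x))"
      by (simp add: sum.distrib algebra_simps poly_power add_divide_distrib)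
    finally show "(\<Sum>j\<in>I. (D j x)\<^sup>2) \<le> lam ^ 3 / (n * sqrt n) *
       (\<Sum>k\<in>K. poly (pderiv Qp ^ 4 + pderiv hp ^ 4 + pderiv (pderiv hp) ^ 4 + Qp ^ 4) (G k x))" .
  qed
  also have "\<dots> = lam ^ 3 / (n * sqrt n) * (\<Sum>k\<in>K. fourth_bound)"
  proof -
    have "(LINT x|gauss I. poly (pderiv Qp ^ 4 + pderiv hp ^ 4 + pderiv (pderiv hp) ^ 4 + Qp ^ 4) (G k x)) = fourth_bound" if "k \<in> K" for k
      unfolding poly_add using integrable_G by (simp add: mean_G[OF that] fourth_bound_def del: poly_power)
    then show ?thesis
      using integrable_G by (simp add: Bochner_Integration.integral_sum del: poly_power poly_add)
  qed
  also have "\<dots> = lam ^ 3 / sqrt n * fourth_bound"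
    using nn by (simp add: n_def)
  finally show ?thesis .
qed

text \<open>Let c(s) be the mean of cos (s F + \<theta>). By \<open>stein_F\<close>, c'(s) is - s
  times the mean of cos (s F + \<theta>) \<open>Gam\<close>. With \<open>Gam\<close> replaced by its
  mean s2 this is the equation solved by cos \<theta> exp (- s2 s^2 / 2), and the replacement costs
  at most the mean absolute deviation of \<open>Gam\<close>.\<close>

lemma cos_F_bound:
  "\<bar>(LINT x|gauss I. cos (F x + \<theta>)) - cos \<theta> * exp (- (LINT x|gauss I. (F x)\<^sup>2) / 2)\<bar>
    \<le> sqrt (lam ^ 3 / sqrt n * fourth_bound)"
proof -
  define s2 where "s2 = (LINT x|gauss I. Gam x)"
  define \<epsilon> where "\<epsilon> = (LINT x|gauss I. \<bar>Gam x - s2\<bar>)"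
  define c where "c s = (LINT x|gauss I. cos (s * F x + \<theta>))" for s
  have iG: "integrable (gauss I) Gam" by (rule polyd_integrable[OF finI polyd_Gam])
  have iG2: "integrable (gauss I) (\<lambda>x. (Gam x)\<^sup>2)"
    using polyd_integrable[OF finI polyd_mult[OF polyd_Gam polyd_Gam]] by (simp add: power2_eq_square)
  have mF[measurable]: "F \<in> borel_measurable (gauss I)" and mG[measurable]: "Gam \<in> borel_measurable (gauss I)"
    using polyd_measurable[OF polyd_F] polyd_measurable[OF polyd_Gam] by auto
  have iF: "integrable (gauss I) F" by (rule polyd_integrable[OF finI polyd_F])
  \<comment> \<open>Cauchy-Schwarz, in the form that the variance of
    \<open>\<bar>Gam x - s2\<bar>\<close> is nonnegative.\<close>
  have eps: "\<epsilon> \<le> sqrt (lam ^ 3 / sqrt n * fourth_bound)"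
  proof (rule real_le_rsqrt)
    have i2: "integrable (gauss I) (\<lambda>x. (Gam x - s2)\<^sup>2)"
      using iG iG2 by (simp add: power2_diff)
    have "0 \<le> (LINT x|gauss I. (\<bar>Gam x - s2\<bar> - \<epsilon>)\<^sup>2)" by simp
    also have "\<dots> = (LINT x|gauss I. \<bar>Gam x - s2\<bar>\<^sup>2) - (LINT x|gauss I. \<bar>Gam x - s2\<bar>)\<^sup>2"
      unfolding \<epsilon>_def using iG i2 by (intro gaussp.variance_eq) auto
    finally have "\<epsilon>\<^sup>2 \<le> (LINT x|gauss I. (Gam x - s2)\<^sup>2)" by (simp add: \<epsilon>_def)
    then show "\<epsilon>\<^sup>2 \<le> lam ^ 3 / sqrt n * fourth_bound"
      using variance_Gam unfolding s2_def by linarith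
  qed
  have int_cos: "integrable (gauss I) (\<lambda>x. cos (s * F x + \<theta>))" for s
    by (rule gaussp.integrable_const_bound[of _ 1]) auto
  have dc: "(c has_real_derivative - s * (LINT x|gauss I. cos (s * F x + \<theta>) * Gam x)) (at s)" for s
  proof -
    have "(c has_real_derivative (LINT x|gauss I. - (F x * sin (s * F x + \<theta>)))) (at s)"
      unfolding c_def
    proof (rule has_real_derivative_integral_dominated[where g="\<lambda>x. \<bar>F x\<bar>"])
      show "((\<lambda>t. cos (t * F x + \<theta>)) has_real_derivative - (F x * sin (t * F x + \<theta>))) (at t)" for t x
        by (auto intro!: derivative_eq_intros)
      show "\<bar>- (F x * sin (t * F x + \<theta>))\<bar> \<le> \<bar>F x\<bar>" for t x
        by (simp add: abs_mult mult_left_le)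
    qed (use iF int_cos in auto)
    moreover have "(LINT x|gauss I. F x * sin (s * F x + \<theta>)) = (LINT x|gauss I. (s * cos (s * F x + \<theta>)) * Gam x)"
    proof (rule stein_F)
      show "growth_smooth I (\<lambda>x. sin (s * F x + \<theta>)) (\<lambda>i x. s * cos (s * F x + \<theta>) * v i x)"
        by (rule growth_smooth_sin[OF growth_smooth_F])
      show "poly_growth I (\<lambda>x. s * cos (s * F x + \<theta>))"
        by (intro poly_growth_mult poly_growth_const poly_growth_bounded[of _ 1]) simp
    qed simp
    ultimately show ?thesis by (simp add: mult.assoc)
  qed
  have icG: "integrable (gauss I) (\<lambda>x. cos (s * F x + \<theta>) * Gam x)" for s
    by (rule integrable_abs_bound[OF integrable_abs[OF iG]])
       (auto simp: abs_mult mult_left_le_one_le)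
  have icGs: "\<bar>(LINT x|gauss I. cos (s * F x + \<theta>) * Gam x) - s2 * c s\<bar> \<le> \<epsilon>" for s
  proof -
    define f where "f x = cos (s * F x + \<theta>) * (Gam x - s2)" for x
    have f_eq: "f = (\<lambda>x. cos (s * F x + \<theta>) * Gam x - s2 * cos (s * F x + \<theta>))"
      by (auto simp: f_def algebra_simps)
    have intf: "integrable (gauss I) f"
      unfolding f_eq by (intro Bochner_Integration.integrable_diff icG integrable_mult_right int_cos)
    have "(LINT x|gauss I. cos (s * F x + \<theta>) * Gam x) - s2 * c s = (LINT x|gauss I. f x)"
      unfolding c_def f_eq
      by (subst Bochner_Integration.integral_diff[OF icG integrable_mult_right[OF int_cos]]) simp
    moreover have "\<bar>LINT x|gauss I. f x\<bar> \<le> (LINT x|gauss I. \<bar>f x\<bar>)"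
      by (rule integral_abs_bound)
    moreover have "(LINT x|gauss I. \<bar>f x\<bar>) \<le> \<epsilon>"
      unfolding \<epsilon>_def
    proof (rule integral_mono[OF integrable_abs[OF intf]])
      show "integrable (gauss I) (\<lambda>x. \<bar>Gam x - s2\<bar>)" using iG by simp
      show "\<bar>f x\<bar> \<le> \<bar>Gam x - s2\<bar>" for x
        unfolding f_def abs_mult by (intro mult_left_le_one_le) auto
    qed
    ultimately show ?thesis by linarith
  qed
  \<comment> \<open>The integrating factor is at most exp (s2 / 2) on [0, 1] and equals it at s = 1,
    where it is divided out again. So the integration of the equation adds no factor that grows with
    the variance.\<close>
  define D where "D s = c s * exp (s2 * s\<^sup>2 / 2)" for s
  have "0 \<le> s2" unfolding s2_def second_moment_F_Gam[symmetric] by simp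
  have dD: "(D has_real_derivative exp (s2 * s\<^sup>2 / 2) * (- s * ((LINT x|gauss I. cos (s * F x + \<theta>) * Gam x) - s2 * c s))) (at s)" for s
    unfolding D_def by (auto intro!: derivative_eq_intros dc simp: algebra_simps)
  have "norm (D 1 - D 0) \<le> (exp (s2 / 2) * \<epsilon>) * norm (1 - 0 :: real)"
  proof (rule field_differentiable_bound[where S="{0..1}"])
    show "(D has_field_derivative exp (s2 * s\<^sup>2 / 2) * (- s * ((LINT x|gauss I. cos (s * F x + \<theta>) * Gam x) - s2 * c s))) (at s within {0..1})" if "s \<in> {0..1}" for s
      by (rule has_field_derivative_at_within[OF dD])
    show "norm (exp (s2 * s\<^sup>2 / 2) * (- s * ((LINT x|gauss I. cos (s * F x + \<theta>) * Gam x) - s2 * c s))) \<le> exp (s2 / 2) * \<epsilon>" if s: "s \<in> {0..1}" for s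
    proof -
      have "s2 * s\<^sup>2 \<le> s2 * 1"
        using s \<open>0 \<le> s2\<close> by (intro mult_left_mono) (auto simp: power_le_one)
      then have "exp (s2 * s\<^sup>2 / 2) \<le> exp (s2 / 2)" by simp
      moreover have "\<bar>s\<bar> * \<bar>(LINT x|gauss I. cos (s * F x + \<theta>) * Gam x) - s2 * c s\<bar> \<le> 1 * \<epsilon>"
        using s icGs by (intro mult_mono) auto
      ultimately show ?thesis
        by (simp add: abs_mult mult_mono)
    qed
  qed auto
  moreover have "D 0 = cos \<theta>" by (simp add: D_def c_def gaussp.prob_space)
  moreover have "D 1 = c 1 * exp (s2 / 2)" by (simp add: D_def)
  ultimately have "\<bar>c 1 * exp (s2 / 2) - cos \<theta>\<bar> \<le> exp (s2 / 2) * \<epsilon>" by simp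
  moreover have "c 1 * exp (s2 / 2) - cos \<theta> = exp (s2 / 2) * (c 1 - cos \<theta> * exp (- s2 / 2))"
    by (simp add: algebra_simps flip: exp_add)
  ultimately have "\<bar>c 1 - cos \<theta> * exp (- s2 / 2)\<bar> \<le> \<epsilon>"
    by (simp add: abs_mult)
  then show ?thesis
    using eps unfolding c_def second_moment_F_Gam s2_def by simp
qed

text \<open>The coefficients will be divided by standard deviations that vary with N, so the bound
  may depend on their size only. The number 18 is the largest sum of absolute coefficients among the
  four polynomials, 6 + 12 for the second derivative of \<open>hp\<close>, and every power up to the
  third is at most 1 + y^4.\<close>

lemma fourth_bound_le:
  assumes "\<bar>a\<bar> \<le> B" "\<bar>b\<bar> \<le> B"
  shows "fourth_bound \<le> 4 * (18 * B) ^ 4 * normal_mean ([:1, 0, 0, 0, 1:] ^ 4)"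
proof -
  obtain k where k: "k \<in> K" using K by auto
  have B: "0 \<le> B" using assms by auto
  have main: "normal_mean (p ^ 4) \<le> (18 * B) ^ 4 * normal_mean ([:1, 0, 0, 0, 1:] ^ 4)"
    if p: "\<And>y. \<bar>poly p y\<bar> \<le> (18 * B) * (1 + y ^ 4)" for p
  proof -
    have "(LINT x|gauss I. poly (p ^ 4) (G k x)) \<le> (LINT x|gauss I. (18 * B) ^ 4 * poly ([:1, 0, 0, 0, 1:] ^ 4) (G k x))"
    proof (intro integral_mono integrable_G integrable_mult_right)
      fix x
      have "\<bar>poly p (G k x)\<bar> ^ 4 \<le> ((18 * B) * (1 + G k x ^ 4)) ^ 4"
        by (intro power_mono p) simp
      moreover have "poly [:1, 0, 0, 0, 1:] (G k x) = 1 + G k x ^ 4"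
        by (simp add: power4_eq_xxxx)
      moreover have "\<bar>poly p (G k x)\<bar> ^ 4 = poly p (G k x) ^ 4" by simp
      ultimately show "poly (p ^ 4) (G k x) \<le> (18 * B) ^ 4 * poly ([:1, 0, 0, 0, 1:] ^ 4) (G k x)"
        by (simp only: poly_power power_mult_distrib)
    qed
    then show ?thesis by (simp add: mean_G[OF k] del: poly_power)
  qed
  have y: "\<bar>y\<bar> \<le> 1 + y ^ 4" "\<bar>y\<bar> ^ 2 \<le> 1 + y ^ 4" "\<bar>y\<bar> ^ 3 \<le> 1 + y ^ 4" "1 \<le> 1 + y ^ 4" for y :: real
  proof -
    have "\<bar>y\<bar> ^ j \<le> 1 + y ^ 4" if "j \<le> 4" for j
    proof (cases "\<bar>y\<bar> \<le> 1")
      case True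
      then have "\<bar>y\<bar> ^ j \<le> 1" by (simp add: power_le_one)
      then show ?thesis by (smt (verit) zero_le_even_power even_numeral)
    next
      case False
      then have "\<bar>y\<bar> ^ j \<le> \<bar>y\<bar> ^ 4" using that by (intro power_increasing) auto
      then show ?thesis by simp
    qed
    from this[of 1] this[of 2] this[of 3] show "\<bar>y\<bar> \<le> 1 + y ^ 4" "\<bar>y\<bar> ^ 2 \<le> 1 + y ^ 4" "\<bar>y\<bar> ^ 3 \<le> 1 + y ^ 4" "1 \<le> 1 + y ^ 4"
      by auto
  qed
  have q: "\<bar>poly [:c0, c1, c2, c3:] y\<bar> \<le> (18 * B) * (1 + y ^ 4)"
    if "\<bar>c0\<bar> + \<bar>c1\<bar> + \<bar>c2\<bar> + \<bar>c3\<bar> \<le> 18 * B" for c0 c1 c2 c3 y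
  proof -
    have "\<bar>poly [:c0, c1, c2, c3:] y\<bar> = \<bar>c0 + c1 * y + c2 * y ^ 2 + c3 * y ^ 3\<bar>"
      by (simp add: algebra_simps power2_eq_square power3_eq_cube)
    also have "\<dots> \<le> \<bar>c0\<bar> + \<bar>c1 * y\<bar> + \<bar>c2 * y ^ 2\<bar> + \<bar>c3 * y ^ 3\<bar>" by linarith
    also have "\<dots> \<le> \<bar>c0\<bar> * (1 + y ^ 4) + \<bar>c1\<bar> * (1 + y ^ 4) + \<bar>c2\<bar> * (1 + y ^ 4) + \<bar>c3\<bar> * (1 + y ^ 4)"
      using y(1)[of y] y(2)[of y] y(3)[of y] y(4)[of y] mult_left_mono[OF y(4)[of y], of "\<bar>c0\<bar>"]
      unfolding abs_mult power_abs by (intro add_mono mult_left_mono) auto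
    also have "\<dots> = (\<bar>c0\<bar> + \<bar>c1\<bar> + \<bar>c2\<bar> + \<bar>c3\<bar>) * (1 + y ^ 4)"
      by (simp add: algebra_simps)
    also have "\<dots> \<le> (18 * B) * (1 + y ^ 4)"
      using that by (intro mult_right_mono) auto
    finally show ?thesis .
  qed
  \<comment> \<open>All four polynomials are written with four coefficients, the last possibly 0, so
    that \<open>q\<close> covers them.\<close>
  have e1: "pderiv Qp = [:3 * b, 2 * a, 3 * b, 0:]" and e2: "pderiv hp = [:- 3 * a, 0, 3 * a, 4 * b:]"
    and e3: "pderiv (pderiv hp) = [:0, 6 * a, 12 * b, 0:]" and e4: "Qp = [:- a, 3 * b, a, b:]"
    by (simp_all add: Qp_def hp_def pderiv_pCons)
  have f1: "\<bar>poly (pderiv Qp) y\<bar> \<le> (18 * B) * (1 + y ^ 4)" for y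
    unfolding e1 by (rule q) (use assms in auto)
  have f2: "\<bar>poly (pderiv hp) y\<bar> \<le> (18 * B) * (1 + y ^ 4)" for y
    unfolding e2 by (rule q) (use assms in auto)
  have f3: "\<bar>poly (pderiv (pderiv hp)) y\<bar> \<le> (18 * B) * (1 + y ^ 4)" for y
    unfolding e3 by (rule q) (use assms in auto)
  have f4: "\<bar>poly Qp y\<bar> \<le> (18 * B) * (1 + y ^ 4)" for y
    unfolding e4 by (rule q) (use assms in auto)
  from main[OF f1] main[OF f2] main[OF f3] main[OF f4]
  show ?thesis unfolding fourth_bound_def by linarith
qed

end

end

section \<open>Gaussian families with a product characteristic function\<close>

lemma std_normal_cos: "(LINT x|std_normal_distribution. cos (t * x + \<theta>)) = cos \<theta> * exp (- t\<^sup>2 / 2)"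
proof -
  interpret real_distribution std_normal_distribution by (rule real_dist_normal_dist)
  have i: "integrable std_normal_distribution (\<lambda>x. iexp (t * x))"
    by (rule integrable_iexp) auto
  have c: "(CLINT x|std_normal_distribution. iexp (t * x)) = complex_of_real (exp (- t\<^sup>2 / 2))"
    using char_std_normal_distribution by (simp add: char_def fun_eq_iff)
  have "(LINT x|std_normal_distribution. cos (t * x)) = exp (- t\<^sup>2 / 2)"
    using arg_cong[OF c, of Re] integral_Re[OF i] by (simp add: Re_exp)
  moreover have "(LINT x|std_normal_distribution. sin (t * x)) = 0"
    using arg_cong[OF c, of Im] integral_Im[OF i] by (simp add: Im_exp)
  moreover have "integrable std_normal_distribution (\<lambda>x. cos (t * x))" "integrable std_normal_distribution (\<lambda>x. sin (t * x))"
    by (auto intro!: integrable_const_bound[of _ 1])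
  ultimately show ?thesis by (simp add: cos_add mult.commute)
qed

text \<open>Divided by its mean, \<open>W\<close> is a probability density. The hypothesis gives
  \<open>Y\<close> the standard normal characteristic function under the new measure, and hence the
  standard normal law. In terms of the old measure, \<open>W\<close> is uncorrelated with the events
  of \<open>Y\<close>.\<close>

lemma (in prob_space) weighted_std_normal:
  fixes W Y :: "'a \<Rightarrow> real"
  assumes [measurable]: "W \<in> borel_measurable M" "Y \<in> borel_measurable M"
    and W: "\<And>\<omega>. 0 \<le> W \<omega>" "\<And>\<omega>. W \<omega> \<le> c"
    and H: "\<And>t \<theta>. expectation (\<lambda>\<omega>. W \<omega> * cos (t * Y \<omega> + \<theta>)) = expectation W * (cos \<theta> * exp (- t\<^sup>2 / 2))"
    and B[measurable]: "B \<in> sets borel"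
  shows "expectation (\<lambda>\<omega>. W \<omega> * indicator B (Y \<omega>)) = expectation W * measure std_normal_distribution B"
proof -
  have iW: "integrable M W"
    by (rule integrable_const_bound[of _ c]) (use W in auto)
  define e where "e = expectation W"
  have e0: "0 \<le> e" unfolding e_def using W by simp
  show ?thesis
  proof (cases "e = 0")
    case True
    then have "AE \<omega> in M. W \<omega> = 0"
      using iW W by (simp add: e_def integral_nonneg_eq_0_iff_AE)
    then have "expectation (\<lambda>\<omega>. W \<omega> * indicator B (Y \<omega>)) = 0"
      by (intro integral_eq_zero_AE) auto
    then show ?thesis using True by (simp add: e_def)
  next
    case False
    with e0 have e: "0 < e" by simp
    define N where "N = density M (\<lambda>\<omega>. ennreal (W \<omega> / e))"
    have iWe: "integrable M (\<lambda>\<omega>. W \<omega> / e)" using iW by simp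
    have "emeasure N (space N) = 1"
    proof -
      have "emeasure N (space N) = (\<integral>\<^sup>+ \<omega>. ennreal (W \<omega> / e) \<partial>M)"
        unfolding N_def by (subst emeasure_density) (auto intro!: nn_integral_cong)
      also have "\<dots> = ennreal (expectation (\<lambda>\<omega>. W \<omega> / e))"
        using iWe W e by (intro nn_integral_eq_integral) auto
      also have "\<dots> = 1" using e by (simp add: e_def[symmetric])
      finally show ?thesis .
    qed
    then interpret N: prob_space N by (rule prob_spaceI)
    have mY: "Y \<in> borel_measurable N" by (simp add: N_def)
    interpret D: real_distribution "distr N borel Y"
      using mY by (simp add: N.real_distribution_distr)
    have Nint: "(LINT \<omega>|N. f \<omega>) = expectation (\<lambda>\<omega>. W \<omega> * f \<omega>) / e" if [measurable]: "f \<in> borel_measurable M" for f :: "'a \<Rightarrow> real"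
      unfolding N_def using W e by (subst integral_density) auto
    have "char (distr N borel Y) = char std_normal_distribution"
    proof
      fix t
      have i: "integrable N (\<lambda>\<omega>. iexp (t * Y \<omega>))"
        using mY by (intro N.integrable_iexp) auto
      have ch: "char (distr N borel Y) t = (CLINT \<omega>|N. iexp (t * Y \<omega>))"
        unfolding char_def using mY by (subst integral_distr) auto
      have "Re (char (distr N borel Y) t) = exp (- t\<^sup>2 / 2)"
      proof -
        have "Re (char (distr N borel Y) t) = (LINT \<omega>|N. cos (t * Y \<omega>))"
          unfolding ch integral_Re[OF i, symmetric] by (simp add: Re_exp)
        also have "\<dots> = expectation (\<lambda>\<omega>. W \<omega> * cos (t * Y \<omega>)) / e" by (rule Nint) simp
        also have "\<dots> = exp (- t\<^sup>2 / 2)" using H[of t 0] e by (simp add: e_def)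
        finally show ?thesis .
      qed
      moreover have "Im (char (distr N borel Y) t) = 0"
      proof -
        have "Im (char (distr N borel Y) t) = (LINT \<omega>|N. sin (t * Y \<omega>))"
          unfolding ch integral_Im[OF i, symmetric] by (simp add: Im_exp)
        also have "\<dots> = expectation (\<lambda>\<omega>. W \<omega> * sin (t * Y \<omega>)) / e" by (rule Nint) simp
        \<comment> \<open>The phase - pi / 2 turns the hypothesis on cosines into a statement on
          sines.\<close>
        also have "(\<lambda>\<omega>. W \<omega> * sin (t * Y \<omega>)) = (\<lambda>\<omega>. W \<omega> * cos (t * Y \<omega> + - (pi / 2)))"
          by (simp add: cos_diff)
        also have "expectation (\<lambda>\<omega>. W \<omega> * cos (t * Y \<omega> + - (pi / 2))) = 0"
          unfolding H by simp
        finally show ?thesis by simp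
      qed
      ultimately show "char (distr N borel Y) t = char std_normal_distribution t"
        by (simp add: char_std_normal_distribution complex_eq_iff)
    qed
    then have eq: "distr N borel Y = std_normal_distribution"
      by (intro Levy_uniqueness D.real_distribution_axioms real_dist_normal_dist)
    have "measure std_normal_distribution B = measure (distr N borel Y) B" by (simp add: eq)
    also have "\<dots> = measure N (Y -` B \<inter> space N)"
      using mY by (intro measure_distr) auto
    also have "\<dots> = (LINT \<omega>|N. indicator (Y -` B \<inter> space N) \<omega>)" by simp
    also have "\<dots> = (LINT \<omega>|N. indicator B (Y \<omega>))"
      by (intro Bochner_Integration.integral_cong) (auto simp: indicator_def)
    also have "\<dots> = expectation (\<lambda>\<omega>. W \<omega> * indicator B (Y \<omega>)) / e"
      by (rule Nint) simp
    finally show ?thesis using e by (simp add: e_def)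
  qed
qed

text \<open>The coordinates are replaced one at a time: cosines of the remaining linear form are turned
  into the nonnegative weights \<open>1 + cos\<close>, to which uniqueness of one-dimensional
  characteristic functions applies.\<close>
lemma (in prob_space) gaussian_family_rectangles:
  fixes Y :: "'i \<Rightarrow> 'a \<Rightarrow> real"
  assumes I: "finite I" and Y: "\<And>i. i \<in> I \<Longrightarrow> Y i \<in> borel_measurable M"
    and H: "\<And>t \<theta>. expectation (\<lambda>\<omega>. cos ((\<Sum>i\<in>I. t i * Y i \<omega>) + \<theta>)) = cos \<theta> * exp (- (\<Sum>i\<in>I. (t i)\<^sup>2) / 2)"
    and "J \<subseteq> I" and B: "\<And>i. B i \<in> sets borel"
  shows "expectation (\<lambda>\<omega>. (\<Prod>i\<in>J. indicator (B i) (Y i \<omega>)) * cos ((\<Sum>i\<in>I - J. t i * Y i \<omega>) + \<theta>))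
    = (\<Prod>i\<in>J. measure std_normal_distribution (B i)) * (cos \<theta> * exp (- (\<Sum>i\<in>I - J. (t i)\<^sup>2) / 2))"
proof -
  have "finite J" using I \<open>J \<subseteq> I\<close> finite_subset by auto
  then show ?thesis
    using \<open>J \<subseteq> I\<close>
  proof (induction J arbitrary: t \<theta> rule: finite_induct)
    case empty
    then show ?case using H by simp
  next
    case (insert k J)
    have k: "k \<in> I" "k \<notin> J" "J \<subseteq> I" using insert by auto
    define R where "R = I - insert k J"
    have R: "I - J = insert k R" "k \<notin> R" "finite R" using k I by (auto simp: R_def)
    define p where "p = (\<Prod>i\<in>J. measure std_normal_distribution (B i))"
    define V where "V \<omega> = (\<Prod>i\<in>J. indicator (B i) (Y i \<omega>) :: real)" for \<omega>
    have V01: "0 \<le> V \<omega>" "V \<omega> \<le> 1" for \<omega>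
      unfolding V_def by (auto intro!: prod_nonneg prod_le_1)
    have mY: "Y i \<in> borel_measurable M" if "i \<in> insert k (J \<union> R)" for i
      using that k Y by (auto simp: R_def)
    have mind: "(\<lambda>\<omega>. indicator (B i) (Y i \<omega>) :: real) \<in> borel_measurable M" if "i \<in> insert k J" for i
      using measurable_compose[OF mY, of i "\<lambda>y. indicator (B i) y :: real"] that B by auto
    have mV[measurable]: "V \<in> borel_measurable M"
      unfolding V_def by (intro borel_measurable_prod mind) auto
    have mS[measurable]: "(\<lambda>\<omega>. \<Sum>i\<in>R. t i * Y i \<omega>) \<in> borel_measurable M" for t
      by (intro borel_measurable_sum borel_measurable_times borel_measurable_const mY) auto
    have mk[measurable]: "Y k \<in> borel_measurable M" using mY by auto
    have IH: "expectation (\<lambda>\<omega>. V \<omega> * cos (s * Y k \<omega> + (\<Sum>i\<in>R. t i * Y i \<omega>) + \<theta>))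
      = p * (cos \<theta> * exp (- (s\<^sup>2 + (\<Sum>i\<in>R. (t i)\<^sup>2)) / 2))" for s t \<theta>
    proof -
      have "(\<Sum>i\<in>R. (if i = k then s else t i) * Y i \<omega>) = (\<Sum>i\<in>R. t i * Y i \<omega>)"
        "(\<Sum>i\<in>R. (if i = k then s else t i)\<^sup>2) = (\<Sum>i\<in>R. (t i)\<^sup>2)" for \<omega>
        using R by (auto intro!: sum.cong)
      then show ?thesis
        using insert.IH[OF k(3), of "\<lambda>i. if i = k then s else t i" \<theta>] R
        unfolding R(1) by (simp add: V_def p_def)
    qed
    have bnd: "integrable M (\<lambda>\<omega>. V \<omega> * cos (g \<omega>))" if [measurable]: "g \<in> borel_measurable M" for g
    proof (rule integrable_const_bound[of _ 1])
      have "\<bar>V \<omega> * cos (g \<omega>)\<bar> \<le> 1 * 1" for \<omega>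
        unfolding abs_mult using V01 by (intro mult_mono) auto
      then show "AE \<omega> in M. norm (V \<omega> * cos (g \<omega>)) \<le> 1" by simp
    qed simp
    have iV: "integrable M V"
      by (rule integrable_const_bound[of _ 1]) (use V01 in auto)
    have EV: "expectation V = p"
      using IH[of 0 "\<lambda>_. 0" 0] by simp
    \<comment> \<open>The weight is nonnegative because of the summand 1. Its product with a cosine
      of \<open>Y k\<close> splits into cosines of linear forms, to which the induction hypothesis
      applies.\<close>
    have key: "expectation (\<lambda>\<omega>. V \<omega> * (1 + cos ((\<Sum>i\<in>R. t i * Y i \<omega>) + \<theta>)) * indicator (B k) (Y k \<omega>))
       = p * (1 + cos \<theta> * exp (- (\<Sum>i\<in>R. (t i)\<^sup>2) / 2)) * measure std_normal_distribution (B k)" for t \<theta>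
    proof -
      define W where "W \<omega> = V \<omega> * (1 + cos ((\<Sum>i\<in>R. t i * Y i \<omega>) + \<theta>))" for \<omega>
      let ?S = "\<lambda>\<omega>. (\<Sum>i\<in>R. t i * Y i \<omega>)"
      let ?e = "exp (- (\<Sum>i\<in>R. (t i)\<^sup>2) / 2)"
      have EW: "expectation W = p * (1 + cos \<theta> * ?e)"
      proof -
        have "expectation (\<lambda>\<omega>. V \<omega> * cos (?S \<omega> + \<theta>)) = p * (cos \<theta> * ?e)"
          using IH[of 0 t \<theta>] by simp
        moreover have "expectation W = expectation (\<lambda>\<omega>. V \<omega> + V \<omega> * cos (?S \<omega> + \<theta>))"
          unfolding W_def[abs_def] by (simp only: distrib_left mult_1_right)
        moreover have "\<dots> = expectation V + expectation (\<lambda>\<omega>. V \<omega> * cos (?S \<omega> + \<theta>))"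
          by (rule Bochner_Integration.integral_add[OF iV bnd]) simp
        ultimately have "expectation W = p + p * (cos \<theta> * ?e)"
          by (simp only: EV)
        then show ?thesis by (simp add: algebra_simps)
      qed
      have "expectation (\<lambda>\<omega>. W \<omega> * indicator (B k) (Y k \<omega>)) = expectation W * measure std_normal_distribution (B k)"
      proof (rule weighted_std_normal)
        show "W \<in> borel_measurable M" unfolding W_def by measurable
        show "0 \<le> W \<omega>" "W \<omega> \<le> 2" for \<omega>
        proof -
          have c: "0 \<le> 1 + cos (?S \<omega> + \<theta>)" "1 + cos (?S \<omega> + \<theta>) \<le> 2"
            using cos_ge_minus_one[of "?S \<omega> + \<theta>"] cos_le_one[of "?S \<omega> + \<theta>"] by linarith+
          then show "0 \<le> W \<omega>" unfolding W_def using V01 by simp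
          have "W \<omega> \<le> 1 * 2" unfolding W_def using V01 c by (intro mult_mono) auto
          then show "W \<omega> \<le> 2" by simp
        qed
        fix s \<eta>
        have "W \<omega> * cos (s * Y k \<omega> + \<eta>) = V \<omega> * cos (s * Y k \<omega> + (\<Sum>i\<in>R. 0 * Y i \<omega>) + \<eta>)
            + (1/2) * (V \<omega> * cos (s * Y k \<omega> + ?S \<omega> + (\<theta> + \<eta>)))
            + (1/2) * (V \<omega> * cos (- s * Y k \<omega> + ?S \<omega> + (\<theta> - \<eta>)))" for \<omega>
        proof -
          have "cos (?S \<omega> + \<theta>) * cos (s * Y k \<omega> + \<eta>) =
            (1/2) * cos (s * Y k \<omega> + ?S \<omega> + (\<theta> + \<eta>)) + (1/2) * cos (- s * Y k \<omega> + ?S \<omega> + (\<theta> - \<eta>))"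
            using cos_times_cos[of "?S \<omega> + \<theta>" "s * Y k \<omega> + \<eta>"]
            by (simp add: algebra_simps)
          then show ?thesis by (simp add: W_def algebra_simps)
        qed
        then have "expectation (\<lambda>\<omega>. W \<omega> * cos (s * Y k \<omega> + \<eta>))
          = expectation (\<lambda>\<omega>. V \<omega> * cos (s * Y k \<omega> + (\<Sum>i\<in>R. 0 * Y i \<omega>) + \<eta>))
            + (1/2) * expectation (\<lambda>\<omega>. V \<omega> * cos (s * Y k \<omega> + ?S \<omega> + (\<theta> + \<eta>)))
            + (1/2) * expectation (\<lambda>\<omega>. V \<omega> * cos (- s * Y k \<omega> + ?S \<omega> + (\<theta> - \<eta>)))"
          by (simp add: Bochner_Integration.integral_add bnd)
        also have "\<dots> = p * (cos \<eta> * exp (- s\<^sup>2 / 2)) + (1/2) * (p * (cos (\<theta> + \<eta>) * exp (- (s\<^sup>2 + (\<Sum>i\<in>R. (t i)\<^sup>2)) / 2)))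
           + (1/2) * (p * (cos (\<theta> - \<eta>) * exp (- (s\<^sup>2 + (\<Sum>i\<in>R. (t i)\<^sup>2)) / 2)))"
          unfolding IH by simp
        also have "exp (- (s\<^sup>2 + (\<Sum>i\<in>R. (t i)\<^sup>2)) / 2) = exp (- s\<^sup>2 / 2) * ?e"
          by (simp add: add_divide_distrib flip: exp_add)
        also have "p * (cos \<eta> * exp (- s\<^sup>2 / 2)) + (1/2) * (p * (cos (\<theta> + \<eta>) * (exp (- s\<^sup>2 / 2) * ?e)))
           + (1/2) * (p * (cos (\<theta> - \<eta>) * (exp (- s\<^sup>2 / 2) * ?e))) = expectation W * (cos \<eta> * exp (- s\<^sup>2 / 2))"
          unfolding EW by (simp add: cos_add cos_diff algebra_simps)
        finally show "expectation (\<lambda>\<omega>. W \<omega> * cos (s * Y k \<omega> + \<eta>)) = expectation W * (cos \<eta> * exp (- s\<^sup>2 / 2))" .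
      qed (use B in auto)
      then show ?thesis by (simp add: W_def EW)
    qed
    define m where "m = measure std_normal_distribution (B k)"
    have i1: "integrable M (\<lambda>\<omega>. V \<omega> * cos (g \<omega>) * indicator (B k) (Y k \<omega>))" if g[measurable]: "g \<in> borel_measurable M" for g
    proof (rule integrable_const_bound[of _ 1])
      have "\<bar>V \<omega> * cos (g \<omega>) * indicator (B k) (Y k \<omega>)\<bar> \<le> 1 * 1 * 1" for \<omega>
        unfolding abs_mult using V01 by (intro mult_mono) (auto simp: indicator_def)
      then show "AE \<omega> in M. norm (V \<omega> * cos (g \<omega>) * indicator (B k) (Y k \<omega>)) \<le> 1" by simp
      show "(\<lambda>\<omega>. V \<omega> * cos (g \<omega>) * indicator (B k) (Y k \<omega>)) \<in> borel_measurable M"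
        by (intro borel_measurable_times mind) auto
    qed
    have i0: "integrable M (\<lambda>\<omega>. V \<omega> * indicator (B k) (Y k \<omega>))"
      using i1[of "\<lambda>_. 0"] by simp
    \<comment> \<open>The zero form with phase 0 makes the weight twice \<open>V\<close>. This
      isolates the contribution of the summand 1, and subtracting it leaves the cosine.\<close>
    have E0: "expectation (\<lambda>\<omega>. V \<omega> * indicator (B k) (Y k \<omega>)) = p * m"
    proof -
      have "(\<lambda>\<omega>. V \<omega> * (1 + cos ((\<Sum>i\<in>R. 0 * Y i \<omega>) + 0)) * indicator (B k) (Y k \<omega>))
         = (\<lambda>\<omega>. 2 * (V \<omega> * indicator (B k) (Y k \<omega>)))"
        by auto
      with key[of "\<lambda>_. 0" 0] have "expectation (\<lambda>\<omega>. 2 * (V \<omega> * indicator (B k) (Y k \<omega>))) = p * 2 * m"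
        by (simp add: m_def)
      then show ?thesis by simp
    qed
    have "expectation (\<lambda>\<omega>. V \<omega> * indicator (B k) (Y k \<omega>) + V \<omega> * cos ((\<Sum>i\<in>R. t i * Y i \<omega>) + \<theta>) * indicator (B k) (Y k \<omega>))
      = p * (1 + cos \<theta> * exp (- (\<Sum>i\<in>R. (t i)\<^sup>2) / 2)) * m"
      using key[of t \<theta>] by (simp add: m_def algebra_simps)
    then have "expectation (\<lambda>\<omega>. V \<omega> * cos ((\<Sum>i\<in>R. t i * Y i \<omega>) + \<theta>) * indicator (B k) (Y k \<omega>))
      = p * m * (cos \<theta> * exp (- (\<Sum>i\<in>R. (t i)\<^sup>2) / 2))"
      by (subst (asm) Bochner_Integration.integral_add[OF i0 i1]) (auto simp: E0 algebra_simps)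
    then show ?case
      using insert.hyps unfolding R_def[symmetric]
      by (simp add: V_def p_def m_def mult_ac)
  qed
qed

text \<open>Once all coordinates have been replaced no cosine is left: the law agrees with the
  product measure on rectangles, which determine it.\<close>

lemma (in prob_space) gaussian_family_distr:
  fixes Y :: "'i \<Rightarrow> 'a \<Rightarrow> real"
  assumes I: "finite I" and Y: "\<And>i. i \<in> I \<Longrightarrow> Y i \<in> borel_measurable M"
    and H: "\<And>t \<theta>. expectation (\<lambda>\<omega>. cos ((\<Sum>i\<in>I. t i * Y i \<omega>) + \<theta>)) = cos \<theta> * exp (- (\<Sum>i\<in>I. (t i)\<^sup>2) / 2)"
  shows "(\<lambda>\<omega>. \<lambda>i\<in>I. Y i \<omega>) \<in> measurable M (gauss I)"
    and "distr M (gauss I) (\<lambda>\<omega>. \<lambda>i\<in>I. Y i \<omega>) = gauss I"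
proof -
  show m: "(\<lambda>\<omega>. \<lambda>i\<in>I. Y i \<omega>) \<in> measurable M (gauss I)"
    unfolding gauss_def by (intro measurable_restrict) (use Y in simp)
  show "distr M (gauss I) (\<lambda>\<omega>. \<lambda>i\<in>I. Y i \<omega>) = gauss I"
    unfolding gauss_def
  proof (rule gauss.PiM_eqI[OF I])
    show "sets (distr M (PiM I (\<lambda>_. std_normal_distribution)) (\<lambda>\<omega>. \<lambda>i\<in>I. Y i \<omega>)) = sets (PiM I (\<lambda>_. std_normal_distribution))"
      by simp
    fix A :: "'i \<Rightarrow> real set" assume A: "\<And>i. i \<in> I \<Longrightarrow> A i \<in> sets std_normal_distribution"
    \<comment> \<open>\<open>gaussian_family_rectangles\<close> wants Borel sets at all indices, and
      \<open>A\<close> is known to be Borel only on \<open>I\<close>.\<close>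
    define B where "B i = (if i \<in> I then A i else {})" for i
    have B: "B i \<in> sets borel" for i using A by (auto simp: B_def)
    have "expectation (\<lambda>\<omega>. (\<Prod>i\<in>I. indicator (B i) (Y i \<omega>))) = (\<Prod>i\<in>I. measure std_normal_distribution (B i))"
      using gaussian_family_rectangles[OF I Y H subset_refl B, where t="\<lambda>_. 0" and \<theta>=0] by simp
    moreover have "(\<Prod>i\<in>I. indicator (B i) (Y i \<omega>) :: real) = indicator ((\<lambda>\<omega>. \<lambda>i\<in>I. Y i \<omega>) -` Pi\<^sub>E I A \<inter> space M) \<omega>"
      if "\<omega> \<in> space M" for \<omega>
    proof (cases "\<forall>i\<in>I. Y i \<omega> \<in> A i")
      case True
      then show ?thesis using that I by (auto simp: B_def indicator_def)
    next
      case False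
      then obtain i where "i \<in> I" "Y i \<omega> \<notin> A i" by auto
      then have "(\<Prod>i\<in>I. indicator (B i) (Y i \<omega>) :: real) = 0"
        using I by (intro prod_zero) (auto simp: B_def indicator_def)
      moreover have "(\<lambda>i\<in>I. Y i \<omega>) \<notin> Pi\<^sub>E I A"
        using \<open>i \<in> I\<close> \<open>Y i \<omega> \<notin> A i\<close> by (auto simp: PiE_def Pi_def)
      ultimately show ?thesis by (simp add: indicator_def)
    qed
    ultimately have "expectation (indicator ((\<lambda>\<omega>. \<lambda>i\<in>I. Y i \<omega>) -` Pi\<^sub>E I A \<inter> space M)) = (\<Prod>i\<in>I. measure std_normal_distribution (A i))"
      by (simp add: B_def cong: Bochner_Integration.integral_cong prod.cong)
    then have pr: "prob ((\<lambda>\<omega>. \<lambda>i\<in>I. Y i \<omega>) -` Pi\<^sub>E I A \<inter> space M) = (\<Prod>i\<in>I. measure std_normal_distribution (A i))"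
      by (simp add: Int_absorb2)
    have PA: "Pi\<^sub>E I A \<in> sets (PiM I (\<lambda>_. std_normal_distribution))"
      using A I by (intro sets_PiM_I_finite) auto
    interpret S: prob_space std_normal_distribution by (rule prob_space_normal_density) simp
    have "emeasure (distr M (PiM I (\<lambda>_. std_normal_distribution)) (\<lambda>\<omega>. \<lambda>i\<in>I. Y i \<omega>)) (Pi\<^sub>E I A)
      = emeasure M ((\<lambda>\<omega>. \<lambda>i\<in>I. Y i \<omega>) -` Pi\<^sub>E I A \<inter> space M)"
      using m PA unfolding gauss_def by (rule emeasure_distr)
    also have "\<dots> = ennreal (\<Prod>i\<in>I. measure std_normal_distribution (A i))"
      by (simp add: emeasure_eq_measure pr)
    also have "\<dots> = (\<Prod>i\<in>I. emeasure std_normal_distribution (A i))"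
      by (simp add: S.emeasure_eq_measure prod_ennreal)
    finally show "emeasure (distr M (PiM I (\<lambda>_. std_normal_distribution)) (\<lambda>\<omega>. \<lambda>i\<in>I. Y i \<omega>)) (Pi\<^sub>E I A)
      = (\<Prod>i\<in>I. emeasure std_normal_distribution (A i))" .
  qed
qed

section \<open>Weak convergence in the plane\<close>

definition gauss2 :: "(real \<times> real) measure" where
  "gauss2 = std_normal_distribution \<Otimes>\<^sub>M std_normal_distribution"

interpretation std_normal: prob_space std_normal_distribution
  by (rule prob_space_normal_density) simp

interpretation std_normal_pair: pair_prob_space std_normal_distribution std_normal_distribution ..

interpretation gauss2: prob_space gauss2
  unfolding gauss2_def by (rule std_normal_pair.prob_space_axioms)

lemma sets_gauss2 [measurable_cong, simp]: "sets gauss2 = sets borel"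
proof -
  have "sets gauss2 = sets (borel \<Otimes>\<^sub>M borel :: (real \<times> real) measure)"
    unfolding gauss2_def by (intro sets_pair_measure_cong) auto
  then show ?thesis by (simp only: borel_prod)
qed

lemma space_gauss2 [simp]: "space gauss2 = UNIV"
  using sets_eq_imp_space_eq[OF sets_gauss2] by simp

lemma gauss2_density:
  "gauss2 = density lborel (\<lambda>x. ennreal (exp (- (x \<bullet> x) / 2) / (2 * pi)))"
proof -
  have "gauss2 = density (lborel \<Otimes>\<^sub>M lborel) (\<lambda>(x, y). ennreal (std_normal_density x) * ennreal (std_normal_density y))"
    unfolding gauss2_def
    by (intro pair_measure_density) (auto simp: prob_space_imp_sigma_finite prob_space_normal_density lborel.sigma_finite_measure_axioms)
  also have "\<dots> = density lborel (\<lambda>x. ennreal (exp (- (x \<bullet> x) / 2) / (2 * pi)))"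
    unfolding lborel_prod
  proof (intro arg_cong2[where f=density] refl ext)
    fix x :: "real \<times> real"
    have "std_normal_density (fst x) * std_normal_density (snd x)
      = (1 / sqrt (2 * pi) * (1 / sqrt (2 * pi))) * (exp (- (fst x)\<^sup>2 / 2) * exp (- (snd x)\<^sup>2 / 2))"
      by (simp add: std_normal_density_def)
    also have "exp (- (fst x)\<^sup>2 / 2) * exp (- (snd x)\<^sup>2 / 2) = exp (- (x \<bullet> x) / 2)"
      by (simp add: inner_prod_def power2_eq_square add_divide_distrib flip: exp_add)
    also have "1 / sqrt (2 * pi) * (1 / sqrt (2 * pi)) = 1 / (2 * pi)"
      by simp
    finally show "(case x of (x, y) \<Rightarrow> ennreal (std_normal_density x) * ennreal (std_normal_density y))
      = ennreal (exp (- (x \<bullet> x) / 2) / (2 * pi))"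
      by (simp add: case_prod_beta flip: ennreal_mult)
  qed
  finally show ?thesis .
qed

lemma standard_gaussian_eq_gauss2: "standard_gaussian = gauss2"
  by (simp add: standard_gaussian_def gauss2_density)

lemma gauss2_cos:
  "(LINT u|gauss2. cos (a * fst u + b * snd u + \<theta>)) = cos \<theta> * exp (- (a\<^sup>2 + b\<^sup>2) / 2)"
proof -
  have i: "integrable (std_normal_distribution \<Otimes>\<^sub>M std_normal_distribution) (\<lambda>(x, y). cos (a * x + b * y + \<theta>))"
    by (rule std_normal_pair.integrable_const_bound[of _ 1]) auto
  have "(LINT u|gauss2. cos (a * fst u + b * snd u + \<theta>))
     = (LINT x|std_normal_distribution. LINT y|std_normal_distribution. cos (b * y + (a * x + \<theta>)))"
    using std_normal_pair.integral_fst[OF i] by (simp add: gauss2_def case_prod_beta' add_ac)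
  also have "\<dots> = (LINT x|std_normal_distribution. cos (a * x + \<theta>) * exp (- b\<^sup>2 / 2))"
    by (simp only: std_normal_cos)
  also have "\<dots> = cos \<theta> * exp (- a\<^sup>2 / 2) * exp (- b\<^sup>2 / 2)"
    by (simp only: integral_mult_left_zero std_normal_cos)
  also have "\<dots> = cos \<theta> * exp (- (a\<^sup>2 + b\<^sup>2) / 2)"
    by (simp add: add_divide_distrib flip: exp_add)
  finally show ?thesis .
qed

lemma gauss2_second_moment: "integrable gauss2 (\<lambda>u. (norm u)\<^sup>2)"
proof -
  have m: "integrable std_normal_distribution (\<lambda>x. x\<^sup>2)"
    by (rule integrable_std_normal_distribution_moment)
  have "integrable gauss2 (\<lambda>u. (fst u)\<^sup>2)"
    unfolding gauss2_def by (rule std_normal_pair.Fubini_integrable) (use m in \<open>auto simp: std_normal.prob_space\<close>)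
  moreover have "integrable gauss2 (\<lambda>u. (snd u)\<^sup>2)"
    unfolding gauss2_def by (rule std_normal_pair.Fubini_integrable) (use m in auto)
  ultimately have "integrable gauss2 (\<lambda>u. (fst u)\<^sup>2 + (snd u)\<^sup>2)" by simp
  then show ?thesis by (simp add: norm_prod_def)
qed

section \<open>Gaussian smoothing in the plane\<close>

definition heat :: "real \<Rightarrow> real \<times> real \<Rightarrow> real \<times> real \<Rightarrow> real" where
  "heat \<epsilon> x z = exp (- ((fst x - fst z)\<^sup>2 + (snd x - snd z)\<^sup>2) / (2 * \<epsilon>\<^sup>2))"

lemma heat_bounds: "0 \<le> heat \<epsilon> x z" "heat \<epsilon> x z \<le> 1"
  by (auto simp: heat_def divide_nonpos_nonneg)

lemma continuous_pair_measurable: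
  fixes g :: "(real \<times> real) \<times> (real \<times> real) \<Rightarrow> real"
  assumes "continuous_on UNIV g" and "sets A = sets borel" "sets B = sets borel"
  shows "g \<in> borel_measurable (A \<Otimes>\<^sub>M B)"
proof -
  have "sets (A \<Otimes>\<^sub>M B) = sets (borel \<Otimes>\<^sub>M borel)"
    by (intro sets_pair_measure_cong assms)
  then have "sets (A \<Otimes>\<^sub>M B) = sets borel" by (simp only: borel_prod)
  then show ?thesis
    using borel_measurable_continuous_onI[OF assms(1)] by (simp cong: measurable_cong_sets)
qed

lemma continuous_measurable_borel:
  assumes "continuous_on UNIV g" and "sets A = sets borel"
  shows "g \<in> borel_measurable A"
  using borel_measurable_continuous_onI[OF assms(1)] assms(2) by (simp cong: measurable_cong_sets)

lemma continuous_heat: "continuous_on UNIV (\<lambda>y. heat \<epsilon> (fst y) (snd y))"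
  by (cases "\<epsilon> = 0") (auto simp: heat_def intro!: continuous_intros)

lemma heat_measurable:
  assumes "sets Q = sets borel"
  shows "heat \<epsilon> x \<in> borel_measurable Q" "(\<lambda>x. heat \<epsilon> x z) \<in> borel_measurable Q"
    "sets A = sets borel \<Longrightarrow> (\<lambda>(x, z). heat \<epsilon> x z) \<in> borel_measurable (A \<Otimes>\<^sub>M Q)"
proof -
  have "continuous_on UNIV (\<lambda>z. heat \<epsilon> x z)" "continuous_on UNIV (\<lambda>x. heat \<epsilon> x z)"
    by (cases "\<epsilon> = 0"; auto simp: heat_def intro!: continuous_intros)+
  then show "heat \<epsilon> x \<in> borel_measurable Q" "(\<lambda>x. heat \<epsilon> x z) \<in> borel_measurable Q"
    using continuous_measurable_borel assms by blast+
  show "(\<lambda>(x, z). heat \<epsilon> x z) \<in> borel_measurable (A \<Otimes>\<^sub>M Q)" if "sets A = sets borel"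
    using continuous_pair_measurable[OF continuous_heat that assms] by (simp add: case_prod_beta')
qed

text \<open>The cosine of the inner product of \<open>u\<close> with (x - z) / \<epsilon>. It is
  spelled out as an affine form in \<open>z\<close> so that the assumed convergence of means of
  cosines applies to it literally.\<close>

definition phase :: "real \<Rightarrow> real \<times> real \<Rightarrow> real \<times> real \<Rightarrow> real \<times> real \<Rightarrow> real" where
  "phase \<epsilon> x u z = cos (- (fst u / \<epsilon>) * fst z + - (snd u / \<epsilon>) * snd z + (fst u * fst x + snd u * snd x) / \<epsilon>)"

lemma phase_measurable:
  assumes "\<epsilon> \<noteq> 0" "sets Q = sets borel"
  shows "phase \<epsilon> x u \<in> borel_measurable Q"
    "sets A = sets borel \<Longrightarrow> (\<lambda>(u, z). phase \<epsilon> x u z) \<in> borel_measurable (A \<Otimes>\<^sub>M Q)"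
proof -
  have "continuous_on UNIV (\<lambda>z. phase \<epsilon> x u z)"
    using assms(1) by (auto simp: phase_def intro!: continuous_intros)
  then show "phase \<epsilon> x u \<in> borel_measurable Q"
    using continuous_measurable_borel assms by blast
  have "continuous_on UNIV (\<lambda>y. phase \<epsilon> x (fst y) (snd y))"
    using assms(1) by (auto simp: phase_def intro!: continuous_intros)
  then show "(\<lambda>(u, z). phase \<epsilon> x u z) \<in> borel_measurable (A \<Otimes>\<^sub>M Q)" if "sets A = sets borel"
    using continuous_pair_measurable[OF _ that assms(2)] by (simp add: case_prod_beta')
qed

lemma phase_bound: "\<bar>phase \<epsilon> x u z\<bar> \<le> 1"
  by (simp add: phase_def)

text \<open>The kernel is the characteristic function of a Gaussian vector \<open>u\<close>. So its
  mean under \<open>Q\<close> is a Gaussian average of means of cosines.\<close>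

lemma integral_heat:
  fixes Q :: "(real \<times> real) measure"
  assumes "prob_space Q" and [measurable_cong, simp]: "sets Q = sets borel" and \<epsilon>: "\<epsilon> \<noteq> 0"
  shows "(LINT z|Q. heat \<epsilon> x z) = (LINT u|gauss2. LINT z|Q. phase \<epsilon> x u z)"
proof -
  interpret Q: prob_space Q by fact
  interpret pair_prob_space gauss2 Q ..
  have i: "integrable (gauss2 \<Otimes>\<^sub>M Q) (\<lambda>(u, z). phase \<epsilon> x u z)"
    by (rule integrable_const_bound[of _ 1])
       (use phase_bound phase_measurable(2)[OF \<epsilon> assms(2) sets_gauss2] in \<open>auto simp: case_prod_beta\<close>)
  have "heat \<epsilon> x z = (LINT u|gauss2. phase \<epsilon> x u z)" for z
  proof -
    have "(LINT u|gauss2. phase \<epsilon> x u z) = (LINT u|gauss2. cos ((fst x - fst z) / \<epsilon> * fst u + (snd x - snd z) / \<epsilon> * snd u + 0))"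
      unfolding phase_def
      using \<epsilon> by (intro Bochner_Integration.integral_cong refl arg_cong[where f=cos]) (simp add: field_simps)
    also have "\<dots> = exp (- (((fst x - fst z) / \<epsilon>)\<^sup>2 + ((snd x - snd z) / \<epsilon>)\<^sup>2) / 2)"
      unfolding gauss2_cos by simp
    also have "\<dots> = heat \<epsilon> x z"
      unfolding heat_def using \<epsilon> by (simp add: power_divide field_simps)
    finally show ?thesis ..
  qed
  then have "(LINT z|Q. heat \<epsilon> x z) = (LINT z|Q. LINT u|gauss2. phase \<epsilon> x u z)" by simp
  also have "\<dots> = (LINT u|gauss2. LINT z|Q. phase \<epsilon> x u z)"
    by (rule Fubini_integral[OF i])
  finally show ?thesis .
qed

text \<open>In the representation by \<open>phase\<close> the inner means converge for each
  \<open>u\<close> and are bounded by 1, so dominated convergence applies.\<close>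

lemma integral_heat_convergence:
  fixes P :: "nat \<Rightarrow> (real \<times> real) measure"
  assumes P: "\<And>n. prob_space (P n)" and S: "\<And>n. sets (P n) = sets borel"
    and H: "\<And>a b \<theta>. (\<lambda>n. LINT z|P n. cos (a * fst z + b * snd z + \<theta>)) \<longlonglongrightarrow> cos \<theta> * exp (- (a\<^sup>2 + b\<^sup>2) / 2)"
    and \<epsilon>: "\<epsilon> \<noteq> 0"
  shows "(\<lambda>n. LINT z|P n. heat \<epsilon> x z) \<longlonglongrightarrow> (LINT z|gauss2. heat \<epsilon> x z)"
  unfolding integral_heat[OF P S \<epsilon>] integral_heat[OF gauss2.prob_space_axioms sets_gauss2 \<epsilon>]
proof (rule integral_dominated_convergence[where w="\<lambda>_. 1"])
  have meas: "(\<lambda>u. LINT z|Q. phase \<epsilon> x u z) \<in> borel_measurable gauss2" if "prob_space Q" and [measurable_cong]: "sets Q = sets borel" for Q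
  proof -
    interpret Q: prob_space Q by fact
    show ?thesis by (rule Q.borel_measurable_lebesgue_integral) (rule phase_measurable(2)[OF \<epsilon> that(2) sets_gauss2])
  qed
  show "(\<lambda>u. LINT z|P n. phase \<epsilon> x u z) \<in> borel_measurable gauss2" for n by (rule meas[OF P S])
  show "(\<lambda>u. LINT z|gauss2. phase \<epsilon> x u z) \<in> borel_measurable gauss2" by (rule meas[OF gauss2.prob_space_axioms sets_gauss2])
  show "AE u in gauss2. (\<lambda>n. LINT z|P n. phase \<epsilon> x u z) \<longlonglongrightarrow> (LINT z|gauss2. phase \<epsilon> x u z)"
    unfolding phase_def gauss2_cos by (intro AE_I2 H)
  show "AE u in gauss2. norm (LINT z|P n. phase \<epsilon> x u z) \<le> 1" for n
  proof (rule AE_I2)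
    fix u
    interpret Pn: prob_space "P n" by (rule P)
    have [measurable_cong]: "sets (P n) = sets borel" by (rule S)
    have "norm (LINT z|P n. phase \<epsilon> x u z) \<le> (LINT z|P n. norm (phase \<epsilon> x u z))" by (rule integral_norm_bound)
    also have "\<dots> \<le> (LINT z|P n. 1)"
      using phase_bound phase_measurable(1)[OF \<epsilon> S]
      by (intro integral_mono Pn.integrable_const_bound[of _ 1]) auto
    finally show "norm (LINT z|P n. phase \<epsilon> x u z) \<le> 1" by (simp add: Pn.prob_space)
  qed
qed simp

text \<open>The substitution replaces x by z + \<epsilon> x, and the factor 2 pi \<epsilon>^2 is the
  total mass of the unnormalised kernel.\<close>

lemma smoothing_eq:
  fixes f :: "real \<times> real \<Rightarrow> real"
  assumes [measurable]: "f \<in> borel_measurable borel" and \<epsilon>: "0 < \<epsilon>"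
  shows "(LINT x|lborel. f x * heat \<epsilon> x z) = (2 * pi * \<epsilon>\<^sup>2) * (LINT x|gauss2. f (z + \<epsilon> *\<^sub>R x))"
proof -
  have "(LINT x|lborel. f x * heat \<epsilon> x z)
     = (LINT x|density (distr lborel borel (\<lambda>x. z + \<epsilon> *\<^sub>R x)) (\<lambda>_. ennreal (\<bar>\<epsilon>\<bar> ^ DIM(real \<times> real))). f x * heat \<epsilon> x z)"
    using lborel_affine[of \<epsilon> z] \<epsilon> by simp
  also have "\<dots> = (LINT x|distr lborel borel (\<lambda>x. z + \<epsilon> *\<^sub>R x). \<epsilon>\<^sup>2 * (f x * heat \<epsilon> x z))"
    using heat_measurable(2)[of borel \<epsilon> z] by (subst integral_density) (auto simp: power2_eq_square)
  also have "\<dots> = (LINT x|lborel. \<epsilon>\<^sup>2 * (f (z + \<epsilon> *\<^sub>R x) * heat \<epsilon> (z + \<epsilon> *\<^sub>R x) z))"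
    using heat_measurable(2)[of borel \<epsilon> z] by (subst integral_distr) auto
  also have "(\<lambda>x. heat \<epsilon> (z + \<epsilon> *\<^sub>R x) z) = (\<lambda>x. exp (- (x \<bullet> x) / 2))"
    using \<epsilon> by (auto simp: heat_def inner_prod_def power_mult_distrib power2_eq_square field_simps)
  also have "(LINT x|lborel. \<epsilon>\<^sup>2 * (f (z + \<epsilon> *\<^sub>R x) * exp (- (x \<bullet> x) / 2)))
     = (2 * pi * \<epsilon>\<^sup>2) * (LINT x|lborel. exp (- (x \<bullet> x) / 2) / (2 * pi) * f (z + \<epsilon> *\<^sub>R x))"
    by (simp flip: integral_mult_right_zero) (simp add: mult_ac)
  also have "(LINT x|lborel. exp (- (x \<bullet> x) / 2) / (2 * pi) * f (z + \<epsilon> *\<^sub>R x)) = (LINT x|gauss2. f (z + \<epsilon> *\<^sub>R x))"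
    unfolding gauss2_density by (subst integral_density) auto
  finally show ?thesis .
qed

text \<open>\<open>f\<close> is replaced by its Gaussian mollification \<open>h \<epsilon>\<close>,
  which is uniformly close to it. By Fubini the means of \<open>h \<epsilon>\<close> are integrals
  of \<open>f\<close> against means of \<open>heat\<close>, whose convergence is known. Compact
  support makes \<open>f\<close> integrable over the plane and uniformly continuous.\<close>

lemma weak_convergence_compact_support:
  fixes P :: "nat \<Rightarrow> (real \<times> real) measure" and f :: "real \<times> real \<Rightarrow> real"
  assumes P: "\<And>n. prob_space (P n)" and S: "\<And>n. sets (P n) = sets borel"
    and H: "\<And>a b \<theta>. (\<lambda>n. LINT z|P n. cos (a * fst z + b * snd z + \<theta>)) \<longlonglongrightarrow> cos \<theta> * exp (- (a\<^sup>2 + b\<^sup>2) / 2)"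
    and f: "continuous_on UNIV f" "\<And>x. \<bar>f x\<bar> \<le> B" "\<And>x. R < norm x \<Longrightarrow> f x = 0"
  shows "(\<lambda>n. LINT z|P n. f z) \<longlonglongrightarrow> (LINT z|gauss2. f z)"
proof -
  have [measurable]: "f \<in> borel_measurable borel" using f(1) by (rule borel_measurable_continuous_onI)
  have B: "0 \<le> B" using f(2)[of 0] by simp
  have fb: "\<bar>f x\<bar> \<le> B * indicator (cball 0 R) x" for x
    using f(2)[of x] f(3)[of x] by (auto simp: indicator_def not_le)
  have cbf: "emeasure lborel (cball (0 :: real \<times> real) R) < \<infinity>" by (rule emeasure_lborel_cball_finite)
  have cb: "integrable lborel (\<lambda>x::real \<times> real. B * indicator (cball 0 R) x)"
    by (intro integrable_mult_right integrable_real_indicator cbf) simp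
  have if_: "integrable lborel f"
    by (rule integrable_abs_bound[OF cb _ fb]) simp
  \<comment> \<open>Two points at distance less than 1 lie together in the ball of radius |R| + 2 or
    both lie outside the support.\<close>
  have uc: "\<exists>\<delta>>0. \<forall>x y. dist x y < \<delta> \<longrightarrow> \<bar>f x - f y\<bar> < \<eta>" if "0 < \<eta>" for \<eta>
  proof -
    have "uniformly_continuous_on (cball 0 (\<bar>R\<bar> + 2)) f"
      by (intro compact_uniformly_continuous continuous_on_subset[OF f(1)]) auto
    from this[unfolded uniformly_continuous_on_def, rule_format, OF that]
    obtain d where "0 < d" "\<forall>x\<in>cball 0 (\<bar>R\<bar> + 2). \<forall>y\<in>cball 0 (\<bar>R\<bar> + 2). dist y x < d \<longrightarrow> dist (f y) (f x) < \<eta>"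
      by auto
    then have d: "0 < d" "\<And>x y. x \<in> cball 0 (\<bar>R\<bar> + 2) \<Longrightarrow> y \<in> cball 0 (\<bar>R\<bar> + 2) \<Longrightarrow> dist y x < d \<Longrightarrow> dist (f y) (f x) < \<eta>"
      by auto
    show ?thesis
    proof (intro exI[of _ "min d 1"] conjI allI impI)
      fix x y :: "real \<times> real" assume xy: "dist x y < min d 1"
      show "\<bar>f x - f y\<bar> < \<eta>"
      proof (cases "norm x \<le> \<bar>R\<bar> + 1")
        case True
        then have "norm y \<le> \<bar>R\<bar> + 2" using xy norm_triangle_sub[of y x] by (simp add: dist_norm norm_minus_commute)
        then show ?thesis using d(2)[of y x] xy True by (simp add: dist_real_def)
      next
        case False
        then have "\<bar>R\<bar> < norm y" using xy norm_triangle_sub[of x y] by (simp add: dist_norm)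
        then show ?thesis using False f(3)[of x] f(3)[of y] that by simp
      qed
    qed (use d in auto)
  qed
  define h where "h \<epsilon> z = (LINT x|gauss2. f (z + \<epsilon> *\<^sub>R x))" for \<epsilon> z
  have happrox: "\<exists>\<epsilon>>0. \<forall>z. \<bar>h \<epsilon> z - f z\<bar> \<le> e" if e: "0 < e" for e
  proof -
    obtain \<delta> where \<delta>: "0 < \<delta>" "\<And>x y. dist x y < \<delta> \<Longrightarrow> \<bar>f x - f y\<bar> < e / 2"
      using uc[of "e / 2"] e by auto
    define m where "m = (LINT x|gauss2. (norm x)\<^sup>2)"
    have m: "0 \<le> m" unfolding m_def by simp
    \<comment> \<open>Where the shift exceeds \<delta>, the oscillation 2 B is dominated by a
      multiple of |x|^2, as in Chebyshev's inequality. The choice of \<epsilon> makes the mean of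
      this multiple at most e / 2, and the 1 in the denominator covers the case K m = 0.\<close>
    define K where "K = 2 * B / \<delta>\<^sup>2"
    have K: "0 \<le> K" using B by (simp add: K_def)
    define \<epsilon> where "\<epsilon> = sqrt (e / (2 * (K * m + 1)))"
    have Km: "0 < K * m + 1" using K m by (simp add: add_nonneg_pos)
    have \<epsilon>: "0 < \<epsilon>" using e Km by (simp add: \<epsilon>_def)
    have \<epsilon>2: "\<epsilon>\<^sup>2 = e / (2 * (K * m + 1))" using e Km by (simp add: \<epsilon>_def)
    have pt: "\<bar>f (z + \<epsilon> *\<^sub>R x) - f z\<bar> \<le> e / 2 + K * \<epsilon>\<^sup>2 * (norm x)\<^sup>2" for x z
    proof (cases "norm (\<epsilon> *\<^sub>R x) < \<delta>")
      case True
      then have "\<bar>f (z + \<epsilon> *\<^sub>R x) - f z\<bar> < e / 2" by (intro \<delta>(2)) (simp add: dist_norm)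
      moreover have "0 \<le> K * \<epsilon>\<^sup>2 * (norm x)\<^sup>2" using K by simp
      ultimately show ?thesis by linarith
    next
      case False
      then have "\<delta>\<^sup>2 \<le> (norm (\<epsilon> *\<^sub>R x))\<^sup>2" using \<delta>(1) by (intro power_mono) auto
      then have "2 * B * \<delta>\<^sup>2 \<le> 2 * B * (\<epsilon>\<^sup>2 * (norm x)\<^sup>2)"
        using B by (intro mult_left_mono) (auto simp: power_mult_distrib)
      then have "2 * B \<le> K * \<epsilon>\<^sup>2 * (norm x)\<^sup>2"
        using \<delta>(1) by (simp add: K_def field_simps)
      moreover have "\<bar>f (z + \<epsilon> *\<^sub>R x) - f z\<bar> \<le> 2 * B"
        using f(2)[of "z + \<epsilon> *\<^sub>R x"] f(2)[of z] by linarith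
      ultimately show ?thesis using e by linarith
    qed
    have "\<bar>h \<epsilon> z - f z\<bar> \<le> e" for z
    proof -
      have i1: "integrable gauss2 (\<lambda>x. f (z + \<epsilon> *\<^sub>R x))"
        by (rule gauss2.integrable_const_bound[of _ B]) (use f(2) in auto)
      then have i2: "integrable gauss2 (\<lambda>x. f (z + \<epsilon> *\<^sub>R x) - f z)" by simp
      have "h \<epsilon> z - f z = (LINT x|gauss2. f (z + \<epsilon> *\<^sub>R x) - f z)"
        using i1 gauss2.prob_space by (simp add: h_def)
      then have "\<bar>h \<epsilon> z - f z\<bar> \<le> (LINT x|gauss2. \<bar>f (z + \<epsilon> *\<^sub>R x) - f z\<bar>)"
        using integral_abs_bound[of gauss2 "\<lambda>x. f (z + \<epsilon> *\<^sub>R x) - f z"] by simp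
      also have "\<dots> \<le> (LINT x|gauss2. e / 2 + K * \<epsilon>\<^sup>2 * (norm x)\<^sup>2)"
        by (intro integral_mono integrable_abs[OF i2] pt)
           (auto intro!: Bochner_Integration.integrable_add integrable_mult_right gauss2_second_moment)
      also have "\<dots> = e / 2 + K * \<epsilon>\<^sup>2 * m"
        using gauss2_second_moment gauss2.prob_space by (simp add: m_def)
      also have "K * \<epsilon>\<^sup>2 * m \<le> e / 2"
        using e K m Km by (simp add: \<epsilon>2 field_simps)
      finally show ?thesis by simp
    qed
    then show ?thesis using \<epsilon> by blast
  qed
  have fub: "(LINT x|lborel. f x * (LINT z|Q. heat \<epsilon> x z)) = (2 * pi * \<epsilon>\<^sup>2) * (LINT z|Q. h \<epsilon> z)"
    if Q: "prob_space Q" "sets Q = sets borel" and \<epsilon>: "0 < \<epsilon>" for Q \<epsilon>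
  proof -
    interpret Q: prob_space Q by fact
    have [measurable_cong]: "sets Q = sets borel" by fact
    interpret pair_sigma_finite lborel Q ..
    have i: "integrable (lborel \<Otimes>\<^sub>M Q) (\<lambda>(x, z). f x * heat \<epsilon> x z)"
    proof (rule integrable_abs_bound)
      have "integrable (lborel \<Otimes>\<^sub>M Q) (\<lambda>x::(real \<times> real) \<times> (real \<times> real). B * indicator (cball 0 R \<times> space Q) x)"
      proof (intro integrable_mult_right integrable_real_indicator)
        show "emeasure (lborel \<Otimes>\<^sub>M Q) (cball (0 :: real \<times> real) R \<times> space Q) < \<infinity>"
          using cbf by (subst Q.emeasure_pair_measure_Times) (auto simp: Q.emeasure_space_1)
      qed auto
      moreover have "integrable (lborel \<Otimes>\<^sub>M Q) (\<lambda>x::(real \<times> real) \<times> (real \<times> real). B * indicator (cball 0 R \<times> space Q) x)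
          \<longleftrightarrow> integrable (lborel \<Otimes>\<^sub>M Q) (\<lambda>x::(real \<times> real) \<times> (real \<times> real). B * indicator (cball 0 R) (fst x))"
        by (intro Bochner_Integration.integrable_cong refl)
           (auto simp: indicator_def space_pair_measure mem_Times_iff)
      ultimately show "integrable (lborel \<Otimes>\<^sub>M Q) (\<lambda>x::(real \<times> real) \<times> (real \<times> real). B * indicator (cball 0 R) (fst x))"
        by (simp only:)
      show "(\<lambda>(x, z). f x * heat \<epsilon> x z) \<in> borel_measurable (lborel \<Otimes>\<^sub>M Q)"
        using heat_measurable(3)[OF Q(2), of lborel \<epsilon>] by (simp add: case_prod_beta')
      fix y :: "(real \<times> real) \<times> (real \<times> real)"
      have "\<bar>f (fst y) * heat \<epsilon> (fst y) (snd y)\<bar> \<le> \<bar>f (fst y)\<bar> * 1"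
        unfolding abs_mult using heat_bounds[of \<epsilon>] by (intro mult_left_mono) auto
      then show "\<bar>case y of (x, z) \<Rightarrow> f x * heat \<epsilon> x z\<bar> \<le> B * indicator (cball 0 R) (fst y)"
        using fb[of "fst y"] by (simp add: case_prod_beta)
    qed
    have "(LINT x|lborel. f x * (LINT z|Q. heat \<epsilon> x z)) = (LINT x|lborel. LINT z|Q. f x * heat \<epsilon> x z)"
      by simp
    also have "\<dots> = (LINT z|Q. LINT x|lborel. f x * heat \<epsilon> x z)"
      by (rule Fubini_integral[OF i, symmetric])
    also have "\<dots> = (LINT z|Q. (2 * pi * \<epsilon>\<^sup>2) * h \<epsilon> z)"
      by (simp add: smoothing_eq[OF _ \<epsilon>] h_def)
    finally show ?thesis by simp
  qed
  have hconv: "(\<lambda>n. LINT z|P n. h \<epsilon> z) \<longlonglongrightarrow> (LINT z|gauss2. h \<epsilon> z)" if \<epsilon>: "0 < \<epsilon>" for \<epsilon>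
  proof -
    have meas: "(\<lambda>x. f x * (LINT z|Q. heat \<epsilon> x z)) \<in> borel_measurable lborel" if "prob_space Q" and [measurable_cong]: "sets Q = sets borel" for Q
    proof -
      interpret Q: prob_space Q by fact
      have "(\<lambda>x. LINT z|Q. heat \<epsilon> x z) \<in> borel_measurable lborel"
        by (rule Q.borel_measurable_lebesgue_integral) (rule heat_measurable(3)[OF that(2)], simp)
      then show ?thesis by simp
    qed
    have "(\<lambda>n. LINT x|lborel. f x * (LINT z|P n. heat \<epsilon> x z)) \<longlonglongrightarrow> (LINT x|lborel. f x * (LINT z|gauss2. heat \<epsilon> x z))"
    proof (rule integral_dominated_convergence[where w="\<lambda>x. \<bar>f x\<bar>"])
      show "AE x in lborel. (\<lambda>n. f x * (LINT z|P n. heat \<epsilon> x z)) \<longlonglongrightarrow> f x * (LINT z|gauss2. heat \<epsilon> x z)"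
        using integral_heat_convergence[OF P S H] \<epsilon> by (intro AE_I2 tendsto_mult_left) auto
      show "AE x in lborel. norm (f x * (LINT z|P n. heat \<epsilon> x z)) \<le> \<bar>f x\<bar>" for n
      proof (rule AE_I2)
        fix x
        interpret Pn: prob_space "P n" by (rule P)
        have [measurable_cong]: "sets (P n) = sets borel" by (rule S)
        have "(LINT z|P n. heat \<epsilon> x z) \<le> (LINT z|P n. 1)"
          by (intro integral_mono Pn.integrable_const_bound[of _ 1]) (use heat_bounds heat_measurable(1)[OF S] in auto)
        moreover have "0 \<le> (LINT z|P n. heat \<epsilon> x z)" using heat_bounds by (intro integral_nonneg_AE) auto
        ultimately have "\<bar>LINT z|P n. heat \<epsilon> x z\<bar> \<le> 1" by (simp add: Pn.prob_space)
        then show "norm (f x * (LINT z|P n. heat \<epsilon> x z)) \<le> \<bar>f x\<bar>"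
          by (simp add: abs_mult mult_left_le)
      qed
    qed (use if_ meas[OF P S] meas[OF gauss2.prob_space_axioms sets_gauss2] in auto)
    then have "(\<lambda>n. (2 * pi * \<epsilon>\<^sup>2) * (LINT z|P n. h \<epsilon> z)) \<longlonglongrightarrow> (2 * pi * \<epsilon>\<^sup>2) * (LINT z|gauss2. h \<epsilon> z)"
      unfolding fub[OF P S \<epsilon>] fub[OF gauss2.prob_space_axioms sets_gauss2 \<epsilon>] .
    then show ?thesis
      using \<epsilon> by (subst (asm) tendsto_mult_left_iff) auto
  qed
  have diff: "\<bar>(LINT z|Q. h \<epsilon> z) - (LINT z|Q. f z)\<bar> \<le> e"
    if Q: "prob_space Q" and sQ[measurable_cong]: "sets Q = sets borel" and he: "\<And>z. \<bar>h \<epsilon> z - f z\<bar> \<le> e" for Q \<epsilon> e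
  proof -
    interpret Q: prob_space Q by fact
    have hm: "h \<epsilon> \<in> borel_measurable Q"
      unfolding h_def by (rule gauss2.borel_measurable_lebesgue_integral) (simp add: case_prod_beta)
    have i1: "integrable Q f"
      by (rule Q.integrable_const_bound[of _ B]) (use f(2) in auto)
    have "\<bar>h \<epsilon> z\<bar> \<le> e + B" for z using he[of z] f(2)[of z] by linarith
    then have i2: "integrable Q (h \<epsilon>)"
      by (intro Q.integrable_const_bound[of _ "e + B"] hm) auto
    have "(LINT z|Q. h \<epsilon> z) - (LINT z|Q. f z) = (LINT z|Q. h \<epsilon> z - f z)" using i1 i2 by simp
    also have "\<bar>\<dots>\<bar> \<le> (LINT z|Q. \<bar>h \<epsilon> z - f z\<bar>)" by (rule integral_abs_bound)
    also have "\<dots> \<le> (LINT z|Q. e)" using i1 i2 he by (intro integral_mono) auto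
    finally show ?thesis by (simp add: Q.prob_space)
  qed
  show ?thesis
  proof (rule LIMSEQ_I)
    fix e :: real assume e: "0 < e"
    obtain \<epsilon> where \<epsilon>: "0 < \<epsilon>" "\<And>z. \<bar>h \<epsilon> z - f z\<bar> \<le> e / 4" using happrox[of "e / 4"] e by auto
    obtain N where N: "\<And>n. N \<le> n \<Longrightarrow> \<bar>(LINT z|P n. h \<epsilon> z) - (LINT z|gauss2. h \<epsilon> z)\<bar> < e / 4"
      using LIMSEQ_D[OF hconv[OF \<epsilon>(1)], of "e / 4"] e by auto
    show "\<exists>N. \<forall>n\<ge>N. norm ((LINT z|P n. f z) - (LINT z|gauss2. f z)) < e"
    proof (intro exI[of _ N] allI impI)
      fix n assume "N \<le> n"
      from N[OF this] diff[OF P S \<epsilon>(2), of n] diff[OF gauss2.prob_space_axioms sets_gauss2 \<epsilon>(2)] e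
      show "norm ((LINT z|P n. f z) - (LINT z|gauss2. f z)) < e"
        unfolding real_norm_def by linarith
    qed
  qed
qed

text \<open>Tightness follows from the compactly supported case: the cutoffs are continuous of
  compact support, so their means converge, and the mass that they miss is asymptotically the mass
  that they miss under the limit law.\<close>

theorem weak_convergence_gauss2:
  fixes P :: "nat \<Rightarrow> (real \<times> real) measure" and f :: "real \<times> real \<Rightarrow> real"
  assumes P: "\<And>n. prob_space (P n)" and S: "\<And>n. sets (P n) = sets borel"
    and H: "\<And>a b \<theta>. (\<lambda>n. LINT z|P n. cos (a * fst z + b * snd z + \<theta>)) \<longlonglongrightarrow> cos \<theta> * exp (- (a\<^sup>2 + b\<^sup>2) / 2)"
    and f: "continuous_on UNIV f" "\<And>x. \<bar>f x\<bar> \<le> B"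
  shows "(\<lambda>n. LINT z|P n. f z) \<longlonglongrightarrow> (LINT z|gauss2. f z)"
proof -
  have fm[measurable]: "f \<in> borel_measurable borel" using f(1) by (rule borel_measurable_continuous_onI)
  have B: "0 \<le> B" using f(2)[of 0] by simp
  define cut where "cut R x = max 0 (min 1 (R + 1 - norm x))" for R :: real and x :: "real \<times> real"
  have cut01: "0 \<le> cut R x" "cut R x \<le> 1" "\<bar>cut R x\<bar> \<le> 1" for R x by (auto simp: cut_def)
  have cutc: "continuous_on UNIV (cut R)" for R
    unfolding cut_def by (intro continuous_intros)
  have cutm[measurable]: "cut R \<in> borel_measurable borel" for R
    by (rule borel_measurable_continuous_onI[OF cutc])
  have cuts: "cut R x = 0" if "R + 1 < norm x" for R x using that by (simp add: cut_def)
  have c1: "(\<lambda>n. LINT z|P n. cut R z) \<longlonglongrightarrow> (LINT z|gauss2. cut R z)" for R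
    by (rule weak_convergence_compact_support[OF P S H cutc cut01(3) cuts])
  have c2: "(\<lambda>n. LINT z|P n. f z * cut R z) \<longlonglongrightarrow> (LINT z|gauss2. f z * cut R z)" for R
  proof (rule weak_convergence_compact_support[OF P S H])
    show "continuous_on UNIV (\<lambda>z. f z * cut R z)" by (intro continuous_intros f(1) cutc)
    show "\<bar>f z * cut R z\<bar> \<le> B" for z
    proof -
      have "\<bar>f z\<bar> * \<bar>cut R z\<bar> \<le> B * 1" by (intro mult_mono f(2) cut01 B) auto
      then show ?thesis by (simp add: abs_mult)
    qed
    show "f z * cut R z = 0" if "R + 1 < norm z" for z using cuts[OF that] by simp
  qed
  have tail: "\<bar>(LINT z|Q. f z) - (LINT z|Q. f z * cut R z)\<bar> \<le> B * (1 - (LINT z|Q. cut R z))"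
    if Q: "prob_space Q" and sQ[measurable_cong]: "sets Q = sets borel" for Q R
  proof -
    interpret Q: prob_space Q by fact
    have i1: "integrable Q f" by (rule Q.integrable_const_bound[of _ B]) (use f(2) in auto)
    have i2: "integrable Q (cut R)" by (rule Q.integrable_const_bound[of _ 1]) (use cut01 in auto)
    have i3: "integrable Q (\<lambda>z. f z * cut R z)"
    proof (rule Q.integrable_const_bound[of _ B])
      have "\<bar>f z\<bar> * \<bar>cut R z\<bar> \<le> B * 1" for z by (intro mult_mono f(2) cut01 B) auto
      then show "AE z in Q. norm (f z * cut R z) \<le> B" by (simp add: abs_mult)
    qed simp
    have "(LINT z|Q. f z) - (LINT z|Q. f z * cut R z) = (LINT z|Q. f z - f z * cut R z)" using i1 i3 by simp
    also have "\<bar>\<dots>\<bar> \<le> (LINT z|Q. \<bar>f z - f z * cut R z\<bar>)" by (rule integral_abs_bound)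
    also have "\<dots> \<le> (LINT z|Q. B * (1 - cut R z))"
    proof (rule integral_mono)
      fix z
      have "\<bar>f z - f z * cut R z\<bar> = \<bar>f z\<bar> * (1 - cut R z)"
      proof -
        have "f z - f z * cut R z = f z * (1 - cut R z)" by (simp add: algebra_simps)
        then show ?thesis using cut01(2)[of R z] by (simp add: abs_mult)
      qed
      also have "\<dots> \<le> B * (1 - cut R z)" using cut01(2)[of R z] by (intro mult_right_mono f(2)) auto
      finally show "\<bar>f z - f z * cut R z\<bar> \<le> B * (1 - cut R z)" .
    qed (use i1 i2 i3 in auto)
    also have "\<dots> = B * (1 - (LINT z|Q. cut R z))" using i2 by (simp add: Q.prob_space)
    finally show ?thesis .
  qed
  have "(\<lambda>k. LINT z|gauss2. cut (real k) z) \<longlonglongrightarrow> (LINT z|gauss2. 1)"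
  proof (rule integral_dominated_convergence[where w="\<lambda>_. 1"])
    show "AE z in gauss2. (\<lambda>k. cut (real k) z) \<longlonglongrightarrow> 1"
    proof (rule AE_I2)
      fix z :: "real \<times> real"
      have "eventually (\<lambda>k. cut (real k) z = 1) sequentially"
        using eventually_ge_at_top[of "nat \<lceil>norm z\<rceil>"]
        by eventually_elim (simp add: cut_def min_def max_def; linarith)
      then show "(\<lambda>k. cut (real k) z) \<longlonglongrightarrow> 1" by (rule tendsto_eventually)
    qed
  qed (use cut01 in auto)
  then have lim1: "(\<lambda>k. LINT z|gauss2. cut (real k) z) \<longlonglongrightarrow> 1" using gauss2.prob_space by simp
  show ?thesis
  proof (rule LIMSEQ_I)
    fix e :: real assume e: "0 < e"
    \<comment> \<open>The missed mass is at most 2 \<eta> for late terms and \<eta> for the limit.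
      The tails therefore cost 3 B \<eta> <= 3 e / 8, and the truncated function costs e /
      4.\<close>
    define \<eta> where "\<eta> = e / (8 * (B + 1))"
    have \<eta>: "0 < \<eta>" using e B by (simp add: \<eta>_def)
    have B\<eta>: "B * \<eta> \<le> e / 8" using e B by (simp add: \<eta>_def field_simps)
    obtain k where "\<bar>(LINT z|gauss2. cut (real k) z) - 1\<bar> < \<eta>"
      using LIMSEQ_D[OF lim1 \<eta>] by auto
    then have k: "1 - (LINT z|gauss2. cut (real k) z) \<le> \<eta>" by linarith
    obtain N1 where N1: "\<And>n. N1 \<le> n \<Longrightarrow> \<bar>(LINT z|P n. cut (real k) z) - (LINT z|gauss2. cut (real k) z)\<bar> < \<eta>"
      using LIMSEQ_D[OF c1 \<eta>, of "real k"] by auto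
    obtain N2 where N2: "\<And>n. N2 \<le> n \<Longrightarrow> \<bar>(LINT z|P n. f z * cut (real k) z) - (LINT z|gauss2. f z * cut (real k) z)\<bar> < e / 4"
      using LIMSEQ_D[OF c2, of "e / 4" "real k"] e by auto
    show "\<exists>N. \<forall>n\<ge>N. norm ((LINT z|P n. f z) - (LINT z|gauss2. f z)) < e"
    proof (intro exI[of _ "max N1 N2"] allI impI)
      fix n assume n: "max N1 N2 \<le> n"
      then have n2: "N2 \<le> n" by simp
      have "1 - (LINT z|P n. cut (real k) z) \<le> 2 * \<eta>" using N1[of n] n k by linarith
      then have "B * (1 - (LINT z|P n. cut (real k) z)) \<le> B * (2 * \<eta>)" using B by (rule mult_left_mono)
      moreover have "B * (1 - (LINT z|gauss2. cut (real k) z)) \<le> B * \<eta>" using k B by (rule mult_left_mono)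
      ultimately show "norm ((LINT z|P n. f z) - (LINT z|gauss2. f z)) < e"
        using tail[OF P S, of n "real k"] tail[OF gauss2.prob_space_axioms sets_gauss2, of "real k"]
          N2[OF n2] B\<eta> e
        unfolding real_norm_def by linarith
    qed
  qed
qed

section \<open>The discrete Fourier model of the wavelet coefficients\<close>

lemma cis_sum:
  assumes N: "0 < N"
  shows "(\<Sum>k\<in>{1..int N}. cis (2 * pi / real N * of_int d * of_int k)) = (if int N dvd d then of_nat N else 0)"
proof -
  define z where "z = cis (2 * pi / real N * of_int d)"
  have "(\<Sum>k\<in>{1..int N}. cis (2 * pi / real N * of_int d * of_int k)) = (\<Sum>i<N. z * z ^ i)"
  proof (rule sum.reindex_bij_witness[of _ "\<lambda>i. int i + 1" "\<lambda>k. nat (k - 1)"])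
    fix k assume k: "k \<in> {1..int N}"
    have "z * z ^ nat (k - 1) = z ^ Suc (nat (k - 1))" by simp
    also have "\<dots> = cis (real (Suc (nat (k - 1))) * (2 * pi / real N * of_int d))"
      unfolding z_def by (rule Complex.DeMoivre)
    also have "real (Suc (nat (k - 1))) = of_int k" using k by simp
    finally show "z * z ^ nat (k - 1) = cis (2 * pi / real N * of_int d * of_int k)" by (simp add: mult_ac)
  qed auto
  also have "\<dots> = z * (\<Sum>i<N. z ^ i)" by (simp add: sum_distrib_left)
  also have "\<dots> = (if int N dvd d then of_nat N else 0)"
  proof (cases "int N dvd d")
    case True
    then obtain m where "d = int N * m" by auto
    then have "z = cis (2 * pi * of_int m)"
      unfolding z_def using N by (intro arg_cong[where f=cis]) simp
    moreover have "cis (2 * pi * of_int m) = 1" by (rule cis_multiple_2pi) simp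
    ultimately have "z = 1" by (simp only:)
    then show ?thesis using True by simp
  next
    case False
    have "z \<noteq> 1"
    proof
      assume "z = 1"
      then have "cos (2 * pi / real N * of_int d) = 1" by (simp add: z_def complex_eq_iff)
      then obtain m :: int where "2 * pi / real N * of_int d = of_int m * 2 * pi"
        by (auto simp: cos_one_2pi_int)
      then have "real_of_int d = of_int (m * int N)" using N by (simp add: field_simps)
      then have "d = m * int N" by (simp only: of_int_eq_iff)
      then show False using False by simp
    qed
    moreover have "z ^ N = 1"
    proof -
      have "z ^ N = cis (real N * (2 * pi / real N * of_int d))" unfolding z_def by (rule Complex.DeMoivre)
      also have "\<dots> = cis (2 * pi * of_int d)" using N by simp
      finally show ?thesis by simp
    qed
    ultimately show ?thesis using False by (simp add: geometric_sum)
  qed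
  finally show ?thesis .
qed

text \<open>On the grid of multiples of 2 pi / N the Fejer kernel vanishes except at multiples of 2
  pi. In the estimators it only selects the tuples whose sum is divisible by N.\<close>

lemma fejer_eq:
  assumes "0 < N"
  shows "fejer N (2 * pi / real N * of_int d) = (if int N dvd d then real N / (2 * pi) else 0)"
  using assms unfolding fejer_def cis_sum[OF assms] by (simp add: power2_eq_square field_simps)

lemma power_sum_lists:
  fixes f :: "'b \<Rightarrow> 'c :: comm_semiring_1"
  assumes "finite B"
  shows "(\<Sum>l\<in>B. f l) ^ q = (\<Sum>ls\<in>{ls. length ls = q \<and> set ls \<subseteq> B}. \<Prod>l\<leftarrow>ls. f l)"
proof (induction q)
  case 0
  have "{ls. length ls = 0 \<and> set ls \<subseteq> B} = {[]}" by auto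
  then show ?case by simp
next
  case (Suc q)
  have eq: "{ls. length ls = Suc q \<and> set ls \<subseteq> B} = (\<lambda>(l, ls). l # ls) ` (B \<times> {ls. length ls = q \<and> set ls \<subseteq> B})"
    by (auto simp: length_Suc_conv image_iff)
  have "(\<Sum>l\<in>B. f l) ^ Suc q = (\<Sum>(l, ls)\<in>B \<times> {ls. length ls = q \<and> set ls \<subseteq> B}. f l * (\<Prod>l\<leftarrow>ls. f l))"
    by (simp add: Suc.IH sum_product sum.cartesian_product)
  also have "\<dots> = (\<Sum>ls\<in>{ls. length ls = Suc q \<and> set ls \<subseteq> B}. \<Prod>l\<leftarrow>ls. f l)"
    unfolding eq by (subst sum.reindex) (auto simp: inj_on_def case_prod_beta)
  finally show ?case .
qed

lemma cis_sum_list: "(\<Prod>l\<leftarrow>ls. complex_of_real (p l) * cis (t * of_int l)) = complex_of_real (\<Prod>l\<leftarrow>ls. p l) * cis (t * of_int (sum_list ls))"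
  by (induction ls) (auto simp: cis_mult distrib_left mult_ac)

lemma square_sum_bound:
  fixes y :: "'b \<Rightarrow> real"
  assumes "finite A"
  shows "(\<Sum>a\<in>A. y a)\<^sup>2 \<le> real (card A) * (\<Sum>a\<in>A. (y a)\<^sup>2)"
  using Cauchy_Schwarz_ineq_sum[of "\<lambda>_. 1" y A] by simp

text \<open>The number \<open>p l\<close> stands for \<open>C\<^sub>l a\<^sup>2(4l/N) / (N \<sigma>\<^sub>N\<^sup>2)\<close>. The coordinates \<open>(l, True)\<close> and \<open>(l, False)\<close> are
  the normalised real and imaginary parts of \<open>w\<^sub>l\<close>.\<close>
locale band_model =
  fixes N :: nat and p :: "nat \<Rightarrow> real" and lam :: real
  assumes N: "4 \<le> N"
    and p_nonneg: "\<And>l. 0 \<le> p l"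
    and p_sum: "(\<Sum>l\<in>{l. 1 \<le> l \<and> 2 * l < N}. 2 * p l) = 1"
    and p_le: "\<And>l. 1 \<le> l \<Longrightarrow> 2 * l < N \<Longrightarrow> real N * p l \<le> lam"
begin

definition L :: "nat set" where "L = {l. 1 \<le> l \<and> 2 * l < N}"
definition I :: "(nat \<times> bool) set" where "I = L \<times> UNIV"
definition K :: "int set" where "K = {1..int N}"
definition freq :: "nat \<Rightarrow> int \<Rightarrow> real" where "freq l k = 2 * pi / real N * of_int (int l) * of_int k"
text \<open>The entries reflect Re (w e^(i t)) = Re w cos t - Im w sin t. The amplitude contains 2
  \<open>p l\<close> because the frequencies l and - l are merged.\<close>

definition A :: "int \<Rightarrow> nat \<times> bool \<Rightarrow> real" where
  "A k i = sqrt (2 * p (fst i)) * (if snd i then cos (freq (fst i) k) else - sin (freq (fst i) k))"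

lemma N_pos: "0 < N" using N by simp

lemma finite_L: "finite L"
  by (rule finite_subset[of _ "{..N}"]) (auto simp: L_def)

lemma finite_I: "finite I" by (simp add: I_def finite_L)

lemma sum_I: "(\<Sum>i\<in>I. f i) = (\<Sum>l\<in>L. f (l, True) + f (l, False))" for f :: "nat \<times> bool \<Rightarrow> real"
  unfolding I_def by (subst sum.cartesian_product') (simp add: UNIV_bool add.commute)

lemma p_sum_L: "(\<Sum>l\<in>L. 2 * p l) = 1"
  using p_sum by (simp add: L_def)

lemma lam_nonneg': "0 \<le> lam"
proof -
  have "0 \<le> real N * p 1" using p_nonneg by simp
  also have "\<dots> \<le> lam" using N by (intro p_le) auto
  finally show ?thesis .
qed

lemma not_dvd_small:
  assumes "d \<noteq> 0" "\<bar>d\<bar> < int N"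
  shows "\<not> int N dvd d"
proof
  assume "int N dvd d"
  from dvd_imp_le_int[OF assms(1) this] show False using assms(2) by simp
qed

text \<open>Expanding the squares leaves sums of roots of unity, which vanish for k different from
  k'. The frequencies run over all N residues, of which the band uses a part.\<close>

lemma parseval:
  fixes v :: "int \<Rightarrow> real"
  shows "(\<Sum>l\<in>{1..int N}. (cmod (\<Sum>k\<in>K. complex_of_real (v k) * cis (2 * pi / real N * of_int k * of_int l)))\<^sup>2) = real N * (\<Sum>k\<in>K. (v k)\<^sup>2)"
proof -
  have "complex_of_real (\<Sum>l\<in>{1..int N}. (cmod (\<Sum>k\<in>K. complex_of_real (v k) * cis (2 * pi / real N * of_int k * of_int l)))\<^sup>2)
    = (\<Sum>l\<in>{1..int N}. \<Sum>k\<in>K. \<Sum>k'\<in>K. complex_of_real (v k * v k') * cis (2 * pi / real N * of_int (k - k') * of_int l))"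
  proof (unfold of_real_sum, rule sum.cong[OF refl])
    fix l
    let ?z = "\<lambda>k. complex_of_real (v k) * cis (2 * pi / real N * of_int k * of_int l)"
    have "complex_of_real ((cmod (\<Sum>k\<in>K. ?z k))\<^sup>2) = (\<Sum>k\<in>K. ?z k) * cnj (\<Sum>k\<in>K. ?z k)"
      by (rule complex_norm_square)
    also have "\<dots> = (\<Sum>k\<in>K. \<Sum>k'\<in>K. ?z k * cnj (?z k'))"
      by (simp add: sum_product)
    also have "\<dots> = (\<Sum>k\<in>K. \<Sum>k'\<in>K. complex_of_real (v k * v k') * cis (2 * pi / real N * of_int (k - k') * of_int l))"
    proof (intro sum.cong refl)
      fix k k'
      have "cis (2 * pi / real N * of_int k * of_int l) * cis (- (2 * pi / real N * of_int k' * of_int l)) = cis (2 * pi / real N * of_int (k - k') * of_int l)"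
        unfolding cis_mult by (rule arg_cong[where f=cis]) (simp add: algebra_simps diff_divide_distrib)
      then show "?z k * cnj (?z k') = complex_of_real (v k * v k') * cis (2 * pi / real N * of_int (k - k') * of_int l)"
        by (simp add: cis_cnj mult_ac)
    qed
    finally show "complex_of_real ((cmod (\<Sum>k\<in>K. ?z k))\<^sup>2) = \<dots>" .
  qed
  also have "\<dots> = (\<Sum>k\<in>K. \<Sum>k'\<in>K. complex_of_real (v k * v k') * (\<Sum>l\<in>{1..int N}. cis (2 * pi / real N * of_int (k - k') * of_int l)))"
  proof -
    have "(\<Sum>l\<in>{1..int N}. \<Sum>k\<in>K. \<Sum>k'\<in>K. complex_of_real (v k * v k') * cis (2 * pi / real N * of_int (k - k') * of_int l))
      = (\<Sum>k\<in>K. \<Sum>l\<in>{1..int N}. \<Sum>k'\<in>K. complex_of_real (v k * v k') * cis (2 * pi / real N * of_int (k - k') * of_int l))"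
      by (rule sum.swap)
    also have "\<dots> = (\<Sum>k\<in>K. \<Sum>k'\<in>K. \<Sum>l\<in>{1..int N}. complex_of_real (v k * v k') * cis (2 * pi / real N * of_int (k - k') * of_int l))"
      by (intro sum.cong refl sum.swap)
    finally show ?thesis by (simp only: sum_distrib_left)
  qed
  also have "\<dots> = (\<Sum>k\<in>K. \<Sum>k'\<in>K. if k' = k then complex_of_real (v k * v k') * of_nat N else 0)"
  proof (intro sum.cong refl)
    fix k k' assume k: "k \<in> K" "k' \<in> K"
    show "complex_of_real (v k * v k') * (\<Sum>l\<in>{1..int N}. cis (2 * pi / real N * of_int (k - k') * of_int l))
      = (if k' = k then complex_of_real (v k * v k') * of_nat N else 0)"
    proof (cases "k' = k")
      case True
      then show ?thesis unfolding cis_sum[OF N_pos] by simp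
    next
      case False
      then have "\<not> int N dvd (k - k')" using k by (intro not_dvd_small) (auto simp: K_def)
      then show ?thesis using False unfolding cis_sum[OF N_pos] by simp
    qed
  qed
  also have "\<dots> = complex_of_real (real N * (\<Sum>k\<in>K. (v k)\<^sup>2))"
    by (simp add: K_def sum_distrib_left power2_eq_square mult_ac)
  finally show ?thesis by (simp only: of_real_eq_iff)
qed

text \<open>For \<open>bessel\<close>, \<open>p l\<close> is replaced by its bound lam / N and the
  sum over the band is enlarged to all N residues; the factor N of Parseval's identity then cancels
  the 1 / N. The 2 stems from merging l and - l.\<close>

sublocale gaussian_array I K A "2 * lam"
proof
  show "finite I" by (rule finite_I)
  show "finite K" "K \<noteq> {}" using N by (auto simp: K_def)
  show "(\<Sum>i\<in>I. (A k i)\<^sup>2) = 1" if "k \<in> K" for k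
  proof -
    have "(\<Sum>i\<in>I. (A k i)\<^sup>2) = (\<Sum>l\<in>L. 2 * p l * ((cos (freq l k))\<^sup>2 + (sin (freq l k))\<^sup>2))"
      unfolding sum_I using p_nonneg by (simp only: distrib_left) (simp add: A_def power_mult_distrib)
    then show ?thesis using p_sum_L by simp
  qed
  show "(\<Sum>i\<in>I. (\<Sum>k\<in>K. A k i * v k)\<^sup>2) \<le> 2 * lam * (\<Sum>k\<in>K. (v k)\<^sup>2)" for v
  proof -
    let ?z = "\<lambda>l::int. \<Sum>k\<in>K. complex_of_real (v k) * cis (2 * pi / real N * of_int k * of_int l)"
    have pt: "(\<Sum>k\<in>K. A k (l, True) * v k)\<^sup>2 + (\<Sum>k\<in>K. A k (l, False) * v k)\<^sup>2 = 2 * p l * (cmod (?z (int l)))\<^sup>2" for l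
    proof -
      have "(\<Sum>k\<in>K. A k (l, True) * v k) = sqrt (2 * p l) * Re (?z (int l))"
        by (simp add: A_def freq_def sum_distrib_left mult_ac)
      moreover have "(\<Sum>k\<in>K. A k (l, False) * v k) = - sqrt (2 * p l) * Im (?z (int l))"
        by (simp add: A_def freq_def sum_distrib_left mult_ac sum_negf)
      ultimately show ?thesis
        using p_nonneg[of l] by (simp add: power_mult_distrib cmod_power2 algebra_simps)
    qed
    have "(\<Sum>i\<in>I. (\<Sum>k\<in>K. A k i * v k)\<^sup>2) = (\<Sum>l\<in>L. 2 * p l * (cmod (?z (int l)))\<^sup>2)"
      unfolding sum_I pt ..
    also have "\<dots> \<le> (\<Sum>l\<in>L. 2 * (lam / N) * (cmod (?z (int l)))\<^sup>2)"
    proof (intro sum_mono mult_right_mono mult_left_mono)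
      fix l assume "l \<in> L"
      then show "p l \<le> lam / real N" using p_le[of l] N_pos by (simp add: L_def field_simps)
    qed auto
    also have "\<dots> = 2 * (lam / N) * (\<Sum>l\<in>L. (cmod (?z (int l)))\<^sup>2)"
      by (simp add: sum_distrib_left)
    also have "(\<Sum>l\<in>L. (cmod (?z (int l)))\<^sup>2) = (\<Sum>l\<in>int ` L. (cmod (?z l))\<^sup>2)"
      by (subst sum.reindex) auto
    also have "2 * (lam / N) * (\<Sum>l\<in>int ` L. (cmod (?z l))\<^sup>2) \<le> 2 * (lam / N) * (\<Sum>l\<in>{1..int N}. (cmod (?z l))\<^sup>2)"
      using lam_nonneg' by (intro mult_left_mono sum_mono2) (auto simp: L_def)
    also have "\<dots> = 2 * lam * (\<Sum>k\<in>K. (v k)\<^sup>2)"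
      unfolding parseval using N_pos by simp
    finally show ?thesis .
  qed
qed

lemma n_eq: "n = real N"
  unfolding n_def by (simp add: K_def)

text \<open>No frequency of the band is a multiple of N, so every cosine and sine has sum 0 over the
  grid. This removes the linear term by which x^3 differs from H3, and makes \<open>F_eq\<close> an
  exact identity.\<close>

lemma sum_G: "(\<Sum>k\<in>K. G k x) = 0"
proof -
  have z: "(\<Sum>k\<in>K. A k i) = 0" if "i \<in> I" for i
  proof -
    obtain l b where i: "i = (l, b)" "l \<in> L" using \<open>i \<in> I\<close> by (cases i) (auto simp: I_def)
    have "\<not> int N dvd int l" using i by (intro not_dvd_small) (auto simp: L_def)
    then have c: "(\<Sum>k\<in>K. cis (freq l k)) = 0"
      unfolding freq_def K_def cis_sum[OF N_pos] by simp
    have "(\<Sum>k\<in>K. cos (freq l k)) = 0" "(\<Sum>k\<in>K. sin (freq l k)) = 0"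
      using arg_cong[OF c, of Re] arg_cong[OF c, of Im] by simp_all
    then show ?thesis by (cases b) (simp_all add: i A_def sum_negf flip: sum_distrib_left)
  qed
  have "(\<Sum>k\<in>K. G k x) = (\<Sum>i\<in>I. (\<Sum>k\<in>K. A k i) * x i)"
    unfolding G_def sum_distrib_right by (rule sum.swap)
  then show ?thesis using z by simp
qed

section \<open>The skewness and kurtosis functionals and their exact variances\<close>

definition S :: "(nat \<times> bool \<Rightarrow> real) \<Rightarrow> real" where "S x = 1 / sqrt (real N) * (\<Sum>k\<in>K. G k x ^ 3)"
definition U :: "(nat \<times> bool \<Rightarrow> real) \<Rightarrow> real" where "U x = 1 / sqrt (real N) * (\<Sum>k\<in>K. G k x ^ 4 - 3)"

lemma F_eq: "F a b x = a * S x + b * U x"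
proof -
  have "(\<Sum>k\<in>K. poly (hp a b) (G k x)) = a * (\<Sum>k\<in>K. G k x ^ 3) + b * (\<Sum>k\<in>K. G k x ^ 4 - 3) - 3 * a * (\<Sum>k\<in>K. G k x)"
    unfolding sum_distrib_left sum.distrib[symmetric] sum_subtractf[symmetric]
    by (intro sum.cong refl) (simp add: hp_def algebra_simps power3_eq_cube power4_eq_xxxx)
  then show ?thesis
    unfolding F_def S_def U_def n_eq sum_G by (simp add: add_divide_distrib)
qed

definition Band :: "int set" where "Band = {l. l \<noteq> 0 \<and> 2 * \<bar>l\<bar> < int N}"
definition pp :: "int \<Rightarrow> real" where "pp l = p (nat \<bar>l\<bar>)"
definition T :: "nat \<Rightarrow> int list set" where "T q = {ls. length ls = q \<and> set ls \<subseteq> Band}"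
definition kap :: "int list \<Rightarrow> real" where "kap ls = 2 * pi * fejer N (2 * pi / real N * of_int (sum_list ls))"
text \<open>N times the weight of the resonant tuples, those with sum divisible by N. It is the
  average row sum of the matrix of q-th powers of correlations, as \<open>sum_rho_power\<close>
  shows.\<close>

definition mom :: "nat \<Rightarrow> real" where "mom q = (\<Sum>ls\<in>T q. (\<Prod>l\<leftarrow>ls. pp l) * kap ls)"

lemma finite_Band: "finite Band"
  by (rule finite_subset[of _ "{- int N..int N}"]) (auto simp: Band_def)

lemma finite_T: "finite (T q)"
  unfolding T_def using finite_lists_length_eq[OF finite_Band, of q] by (simp add: conj_commute)

lemma kap_eq: "kap ls = (if int N dvd sum_list ls then real N else 0)"
  unfolding kap_def fejer_eq[OF N_pos] by simp

lemma sum_Band: "(\<Sum>l\<in>Band. f l) = (\<Sum>l\<in>L. f (int l) + f (- int l))" for f :: "int \<Rightarrow> 'c::comm_monoid_add"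
proof -
  have Band: "Band = int ` L \<union> (\<lambda>l. - int l) ` L"
  proof (intro set_eqI iffI)
    fix l assume l: "l \<in> Band"
    show "l \<in> int ` L \<union> (\<lambda>l. - int l) ` L"
    proof (cases "l \<ge> 0")
      case True
      then have "l = int (nat l)" "nat l \<in> L" using l by (auto simp: Band_def L_def)
      then show ?thesis by blast
    next
      case False
      then have "l = - int (nat (- l))" "nat (- l) \<in> L" using l by (auto simp: Band_def L_def)
      then show ?thesis by blast
    qed
  qed (auto simp: Band_def L_def)
  have "1 \<le> l" if "l \<in> L" for l using that by (simp add: L_def)
  then have "int ` L \<inter> (\<lambda>l. - int l) ` L = {}" by fastforce
  then show ?thesis
    unfolding Band
    by (subst sum.union_disjoint) (auto simp: finite_L sum.reindex inj_on_def sum.distrib)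
qed

lemma rho_eq: "complex_of_real (rho k k') = (\<Sum>l\<in>Band. complex_of_real (pp l) * cis (2 * pi / real N * of_int (k - k') * of_int l))"
proof -
  have "rho k k' = (\<Sum>l\<in>L. 2 * p l * cos (freq l k - freq l k'))"
  proof -
    have "rho k k' = (\<Sum>l\<in>L. (sqrt (2 * p l) * sqrt (2 * p l)) * (cos (freq l k) * cos (freq l k') + sin (freq l k) * sin (freq l k')))"
      unfolding rho_def sum_I by (simp add: A_def algebra_simps)
    then show ?thesis using p_nonneg by (simp add: cos_diff)
  qed
  also have "\<dots> = (\<Sum>l\<in>L. 2 * p l * cos (2 * pi / real N * of_int (k - k') * of_int (int l)))"
    by (intro sum.cong refl arg_cong2[where f="(*)"] arg_cong[where f=cos])
       (simp add: freq_def algebra_simps diff_divide_distrib)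
  finally have *: "rho k k' = \<dots>" .
  show ?thesis
    unfolding * sum_Band of_real_sum
    by (intro sum.cong refl) (simp add: pp_def complex_eq_iff)
qed

text \<open>Expanding the power gives a sum over tuples. For each tuple the double sum over the grid
  factorises into two geometric sums, each of which is N or 0.\<close>

lemma sum_rho_power: "(\<Sum>k\<in>K. \<Sum>k'\<in>K. rho k k' ^ q) = real N * mom q"
proof -
  have "complex_of_real (\<Sum>k\<in>K. \<Sum>k'\<in>K. rho k k' ^ q) = (\<Sum>k\<in>K. \<Sum>k'\<in>K. complex_of_real (rho k k') ^ q)"
    by simp
  also have "\<dots> = (\<Sum>k\<in>K. \<Sum>k'\<in>K. \<Sum>ls\<in>T q. complex_of_real (\<Prod>l\<leftarrow>ls. pp l) * cis (2 * pi / real N * of_int (k - k') * of_int (sum_list ls)))"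
    unfolding rho_eq power_sum_lists[OF finite_Band] T_def cis_sum_list ..
  also have "\<dots> = (\<Sum>ls\<in>T q. complex_of_real (\<Prod>l\<leftarrow>ls. pp l) * (\<Sum>k\<in>K. \<Sum>k'\<in>K. cis (2 * pi / real N * of_int (k - k') * of_int (sum_list ls))))"
  proof -
    have "(\<Sum>k\<in>K. \<Sum>k'\<in>K. \<Sum>ls\<in>T q. complex_of_real (\<Prod>l\<leftarrow>ls. pp l) * cis (2 * pi / real N * of_int (k - k') * of_int (sum_list ls)))
      = (\<Sum>k\<in>K. \<Sum>ls\<in>T q. \<Sum>k'\<in>K. complex_of_real (\<Prod>l\<leftarrow>ls. pp l) * cis (2 * pi / real N * of_int (k - k') * of_int (sum_list ls)))"
      by (intro sum.cong refl sum.swap)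
    also have "\<dots> = (\<Sum>ls\<in>T q. \<Sum>k\<in>K. \<Sum>k'\<in>K. complex_of_real (\<Prod>l\<leftarrow>ls. pp l) * cis (2 * pi / real N * of_int (k - k') * of_int (sum_list ls)))"
      by (rule sum.swap)
    finally show ?thesis by (simp add: sum_distrib_left)
  qed
  also have "\<dots> = (\<Sum>ls\<in>T q. complex_of_real ((\<Prod>l\<leftarrow>ls. pp l) * (real N * kap ls)))"
  proof (intro sum.cong refl)
    fix ls :: "int list"
    let ?s = "sum_list ls"
    have "(\<Sum>k\<in>K. \<Sum>k'\<in>K. cis (2 * pi / real N * of_int (k - k') * of_int ?s))
      = (\<Sum>k\<in>K. cis (2 * pi / real N * of_int ?s * of_int k)) * (\<Sum>k'\<in>K. cis (2 * pi / real N * of_int (- ?s) * of_int k'))"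
      unfolding sum_product cis_mult
      by (intro sum.cong refl arg_cong[where f=cis]) (simp add: algebra_simps diff_divide_distrib)
    also have "\<dots> = complex_of_real (real N * kap ls)"
      unfolding K_def cis_sum[OF N_pos] by (simp add: kap_eq)
    finally show "complex_of_real (\<Prod>l\<leftarrow>ls. pp l) * (\<Sum>k\<in>K. \<Sum>k'\<in>K. cis (2 * pi / real N * of_int (k - k') * of_int ?s))
      = complex_of_real ((\<Prod>l\<leftarrow>ls. pp l) * (real N * kap ls))" by simp
  qed
  also have "\<dots> = complex_of_real (real N * mom q)"
    unfolding mom_def of_real_sum[symmetric] sum_distrib_left by (simp add: mult_ac)
  finally show ?thesis by (simp only: of_real_eq_iff)
qed

definition VS :: real where "VS = 6 * mom 3"
definition VU :: real where "VU = 72 * mom 2 + 24 * mom 4"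

lemma second_moment_SU: "(LINT x|gauss I. (a * S x + b * U x)\<^sup>2) = a\<^sup>2 * VS + b\<^sup>2 * VU"
proof -
  have s: "(\<Sum>k\<in>K. \<Sum>k'\<in>K. 24 * rho k k' ^ 4 + 72 * rho k k' ^ 2) = 24 * (real N * mom 4) + 72 * (real N * mom 2)"
    unfolding sum.distrib sum_distrib_left[symmetric] sum_rho_power ..
  show ?thesis
    using second_moment_F[of a b] N_pos unfolding F_eq[abs_def] n_eq s sum_rho_power
    by (simp add: VS_def VU_def distrib_left)
qed

subsection \<open>The variance estimators\<close>

text \<open>The counterpart of |w_l|^2 / C_l; under \<open>gauss I\<close> it is a standard
  exponential variable for \<open>l\<close> in \<open>L\<close>.\<close>

definition V :: "nat \<Rightarrow> (nat \<times> bool \<Rightarrow> real) \<Rightarrow> real" where "V l x = ((x (l, True))\<^sup>2 + (x (l, False))\<^sup>2) / 2"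
definition prodV :: "nat list \<Rightarrow> (nat \<times> bool \<Rightarrow> real) \<Rightarrow> real" where "prodV ls x = (\<Prod>l\<leftarrow>ls. V l x)"

lemma V_nonneg: "0 \<le> V l x" by (simp add: V_def)

lemma prodV_nonneg: "0 \<le> prodV ls x"
  unfolding prodV_def using V_nonneg by (induction ls) auto

lemma polyd_V:
  assumes "l \<in> L"
  shows "polyd I (V l) (\<lambda>i x. if fst i = l then x i else 0)"
proof -
  have l: "(l, True) \<in> I" "(l, False) \<in> I" using assms by (auto simp: I_def)
  show ?thesis
    by (rule polyd_eq[OF polyd_cmult[of _ _ _ "1/2", OF polyd_add[OF polyd_mult[OF polyd_component[OF l(1)] polyd_component[OF l(1)]]
          polyd_mult[OF polyd_component[OF l(2)] polyd_component[OF l(2)]]]]])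
       (auto simp: V_def power2_eq_square prod_eq_iff)
qed

lemma prodV_remove1: "l \<in> set ls \<Longrightarrow> V l x * prodV (remove1 l ls) x = prodV ls x"
  unfolding prodV_def by (induction ls) (auto simp: mult_ac)

text \<open>The coordinate \<open>i\<close> enters only through \<open>V (fst i)\<close>, whose
  derivative is \<open>x i\<close>. Each of its occurrences in turn loses the factor that is
  differentiated.\<close>

lemma polyd_prodV:
  assumes "set ls \<subseteq> L"
  shows "polyd I (prodV ls) (\<lambda>i x. real (count_list ls (fst i)) * (x i * prodV (remove1 (fst i) ls) x))"
  using assms
proof (induction ls)
  case Nil
  show ?case by (rule polyd_eq[OF polyd_const[of _ 1]]) (auto simp: prodV_def)
next
  case (Cons l ls)
  then have IH: "polyd I (prodV ls) (\<lambda>i x. real (count_list ls (fst i)) * (x i * prodV (remove1 (fst i) ls) x))"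
    and l: "l \<in> L" by auto
  show ?case
  proof (rule polyd_eq[OF polyd_mult[OF polyd_V[OF l] IH]])
    show "V l x * prodV ls x = prodV (l # ls) x" for x by (simp add: prodV_def)
    show "(if fst i = l then x i else 0) * prodV ls x + V l x * (real (count_list ls (fst i)) * (x i * prodV (remove1 (fst i) ls) x))
       = real (count_list (l # ls) (fst i)) * (x i * prodV (remove1 (fst i) (l # ls)) x)" for i x
    proof (cases "fst i = l")
      case True
      have "real (count_list ls l) * (V l x * prodV (remove1 l ls) x) = real (count_list ls l) * prodV ls x"
        using prodV_remove1[of l ls x] by (cases "l \<in> set ls") (auto simp: count_list_0_iff)
      then show ?thesis using True by (simp add: algebra_simps)
    next
      case False
      then show ?thesis by (simp add: prodV_def)
    qed
  qed
qed

lemma integrable_prodV: "set ls \<subseteq> L \<Longrightarrow> integrable (gauss I) (prodV ls)"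
  by (rule polyd_integrable[OF finite_I polyd_prodV])

text \<open>This is the moment recursion E V^(c + 1) = (c + 1) E V^c of the exponential law.
  Integration by parts in both coordinates of \<open>l\<close> produces the mean itself, and the
  derivative of the remaining product, summed over the two coordinates, regains the factor
  \<open>V l\<close> that it lost.\<close>

lemma mean_prodV_Cons:
  assumes l: "l \<in> L" and ls: "set ls \<subseteq> L"
  shows "(LINT x|gauss I. prodV (l # ls) x) = (1 + real (count_list ls l)) * (LINT x|gauss I. prodV ls x)"
proof -
  let ?c = "real (count_list ls l)"
  have iP: "integrable (gauss I) (prodV ls)" by (rule integrable_prodV[OF ls])
  have one: "(LINT x|gauss I. x (l, b) * (x (l, b) * prodV ls x))
      = (LINT x|gauss I. prodV ls x) + ?c * (LINT x|gauss I. (x (l, b))\<^sup>2 * prodV (remove1 l ls) x)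
      \<and> integrable (gauss I) (\<lambda>x. x (l, b) * (x (l, b) * prodV ls x))
      \<and> integrable (gauss I) (\<lambda>x. (x (l, b))\<^sup>2 * prodV (remove1 l ls) x)" for b
  proof -
    have i: "(l, b) \<in> I" using l by (simp add: I_def)
    have pd: "polyd I (\<lambda>x. x (l, b) * prodV ls x)
      (\<lambda>i x. (if i = (l, b) then 1 else 0) * prodV ls x + x (l, b) * (real (count_list ls (fst i)) * (x i * prodV (remove1 (fst i) ls) x)))"
      by (rule polyd_mult[OF polyd_component[OF i] polyd_prodV[OF ls]])
    have r: "set (remove1 l ls) \<subseteq> L" using ls set_remove1_subset[of l ls] by auto
    have i2: "integrable (gauss I) (\<lambda>x. (x (l, b))\<^sup>2 * prodV (remove1 l ls) x)"
      using polyd_integrable[OF finite_I polyd_mult[OF polyd_mult[OF polyd_component[OF i] polyd_component[OF i]] polyd_prodV[OF r]]]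
      by (simp add: power2_eq_square)
    have i3: "integrable (gauss I) (\<lambda>x. x (l, b) * (x (l, b) * prodV ls x))"
      by (rule polyd_integrable[OF finite_I polyd_mult[OF polyd_component[OF i] pd]])
    have "(LINT x|gauss I. x (l, b) * (x (l, b) * prodV ls x))
      = (LINT x|gauss I. prodV ls x + ?c * ((x (l, b))\<^sup>2 * prodV (remove1 l ls) x))"
      unfolding polyd_integration_by_parts[OF finite_I pd i] by (simp add: power2_eq_square mult_ac)
    then show ?thesis using i2 i3 iP by simp
  qed
  have "(LINT x|gauss I. prodV (l # ls) x)
     = (LINT x|gauss I. (x (l, True) * (x (l, True) * prodV ls x) + x (l, False) * (x (l, False) * prodV ls x)) / 2)"
    by (intro Bochner_Integration.integral_cong refl) (simp add: prodV_def V_def power2_eq_square algebra_simps)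
  also have "\<dots> = ((LINT x|gauss I. x (l, True) * (x (l, True) * prodV ls x)) + (LINT x|gauss I. x (l, False) * (x (l, False) * prodV ls x))) / 2"
    using one by simp
  also have "\<dots> = (LINT x|gauss I. prodV ls x) + ?c * ((LINT x|gauss I. (x (l, True))\<^sup>2 * prodV (remove1 l ls) x) + (LINT x|gauss I. (x (l, False))\<^sup>2 * prodV (remove1 l ls) x)) / 2"
    using one[of True] one[of False] by (simp add: algebra_simps add_divide_distrib)
  also have "(LINT x|gauss I. (x (l, True))\<^sup>2 * prodV (remove1 l ls) x) + (LINT x|gauss I. (x (l, False))\<^sup>2 * prodV (remove1 l ls) x)
     = (LINT x|gauss I. (x (l, True))\<^sup>2 * prodV (remove1 l ls) x + (x (l, False))\<^sup>2 * prodV (remove1 l ls) x)"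
    using one by simp
  also have "\<dots> = 2 * (LINT x|gauss I. V l x * prodV (remove1 l ls) x)"
    by (simp add: V_def algebra_simps flip: integral_mult_right_zero)
  also have "?c * (2 * (LINT x|gauss I. V l x * prodV (remove1 l ls) x)) / 2 = ?c * (LINT x|gauss I. prodV ls x)"
    by (cases "l \<in> set ls") (auto simp: prodV_remove1 count_list_0_iff)
  finally show ?thesis by (simp add: algebra_simps)
qed

text \<open>By the recursion the mean is the product of the factorials of the multiplicities. The
  lower bound permits division by \<open>dl\<close>, and the upper one controls the moments in
  \<open>variance_What\<close>.\<close>

lemma mean_prodV_bounds:
  assumes "set ls \<subseteq> L"
  shows "1 \<le> (LINT x|gauss I. prodV ls x) \<and> (LINT x|gauss I. prodV ls x) \<le> fact (length ls)"
  using assms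
proof (induction ls)
  case Nil
  show ?case by (simp add: prodV_def gaussp.prob_space)
next
  case (Cons l ls)
  let ?E = "LINT x|gauss I. prodV ls x"
  have IH: "1 \<le> ?E" "?E \<le> fact (length ls)" using Cons by auto
  have eq: "(LINT x|gauss I. prodV (l # ls) x) = (1 + real (count_list ls l)) * ?E"
    using Cons by (intro mean_prodV_Cons) auto
  have "1 * 1 \<le> (1 + real (count_list ls l)) * ?E" using IH by (intro mult_mono) auto
  moreover have "(1 + real (count_list ls l)) * ?E \<le> (1 + real (length ls)) * fact (length ls)"
    using IH count_le_length[of ls l] by (intro mult_mono) auto
  ultimately show ?case unfolding eq by (simp add: algebra_simps)
qed

end

context band_model
begin

text \<open>In these variables \<open>dl\<close> is \<open>\<delta>\<close>, while \<open>What\<close> and \<open>R\<close> are the tuple sums of the estimators and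
  \<open>\<sigma>\<close>-hat squared, divided by their orders of magnitude.\<close>
definition ab :: "int list \<Rightarrow> nat list" where "ab ls = map (\<lambda>l. nat \<bar>l\<bar>) ls"
definition dl :: "int list \<Rightarrow> real" where "dl ls = (LINT x|gauss I. prodV (ab ls) x)"
definition What :: "nat \<Rightarrow> (nat \<times> bool \<Rightarrow> real) \<Rightarrow> real" where
  "What q x = (\<Sum>ls\<in>T q. (\<Prod>l\<leftarrow>ls. pp l) * kap ls / dl ls * prodV (ab ls) x)"
definition R :: "(nat \<times> bool \<Rightarrow> real) \<Rightarrow> real" where "R x = (\<Sum>l\<in>L. 2 * p l * V l x)"

lemma ab_L: "ls \<in> T q \<Longrightarrow> set (ab ls) \<subseteq> L"
  by (fastforce simp: T_def ab_def L_def Band_def)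

lemma length_ab: "ls \<in> T q \<Longrightarrow> length (ab ls) = q"
  by (simp add: T_def ab_def)

lemma dl_ge_1: "ls \<in> T q \<Longrightarrow> 1 \<le> dl ls"
  using mean_prodV_bounds[OF ab_L] by (simp add: dl_def)

lemma pp_nonneg: "0 \<le> pp l" by (simp add: pp_def p_nonneg)

lemma pp_le: "l \<in> Band \<Longrightarrow> pp l \<le> lam / real N"
  using p_le[of "nat \<bar>l\<bar>"] N_pos by (auto simp: pp_def Band_def field_simps)

lemma prod_pp_bounds:
  assumes "set ls \<subseteq> Band"
  shows "0 \<le> (\<Prod>l\<leftarrow>ls. pp l) \<and> (\<Prod>l\<leftarrow>ls. pp l) \<le> (lam / real N) ^ length ls"
  using assms
proof (induction ls)
  case (Cons l ls)
  then have IH: "0 \<le> (\<Prod>l\<leftarrow>ls. pp l)" "(\<Prod>l\<leftarrow>ls. pp l) \<le> (lam / real N) ^ length ls"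
    and l: "l \<in> Band" by auto
  have "pp l * (\<Prod>l\<leftarrow>ls. pp l) \<le> (lam / real N) * (lam / real N) ^ length ls"
    using IH pp_le[OF l] lam_nonneg' by (intro mult_mono) auto
  then show ?case using IH pp_nonneg[of l] by simp
qed simp

text \<open>Division by \<open>dl\<close> compensates for repeated frequencies. This is what makes
  the tuple sums unbiased at every finite N.\<close>

lemma mean_What: "(LINT x|gauss I. What q x) = mom q"
proof -
  have "(LINT x|gauss I. What q x) = (\<Sum>ls\<in>T q. (\<Prod>l\<leftarrow>ls. pp l) * kap ls / dl ls * dl ls)"
    unfolding What_def dl_def using ab_L integrable_prodV
    by (subst Bochner_Integration.integral_sum) auto
  also have "\<dots> = mom q"
    unfolding mom_def using dl_ge_1 by (intro sum.cong refl) fastforce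
  finally show ?thesis .
qed

section \<open>Counting resonant tuples\<close>

lemma card_Band: "card Band \<le> N"
proof -
  have "card Band = (\<Sum>l\<in>Band. 1)" by simp
  also have "\<dots> = 2 * card L" unfolding sum_Band by simp
  finally have "card Band = 2 * card L" .
  moreover have "card L \<le> card {1..(N - 1) div 2}"
    by (rule card_mono) (auto simp: L_def)
  ultimately show ?thesis by simp
qed

lemma card_T: "card (T q) \<le> N ^ q"
proof -
  have "card (T q) = card Band ^ q"
    unfolding T_def using card_lists_length_eq[OF finite_Band, of q] by (simp add: conj_commute)
  then show ?thesis using card_Band by (simp add: power_mono)
qed

definition D :: "int \<Rightarrow> nat \<Rightarrow> int list set" where "D s m = {ls \<in> T m. int N dvd sum_list ls + s}"

text \<open>Two entries of the band differ by less than N, so the resonance determines the head of a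
  list from its tail. One degree of freedom is lost.\<close>

lemma card_D: "card (D s (Suc m)) \<le> N ^ m"
proof -
  have inj: "inj_on tl (D s (Suc m))"
  proof (rule inj_onI)
    fix xs ys assume xy: "xs \<in> D s (Suc m)" "ys \<in> D s (Suc m)" "tl xs = tl ys"
    obtain a u where xs: "xs = a # u" using xy by (cases xs) (auto simp: D_def T_def)
    obtain b v where ys: "ys = b # v" using xy by (cases ys) (auto simp: D_def T_def)
    have "u = v" using xy xs ys by simp
    have "int N dvd (sum_list xs + s) - (sum_list ys + s)"
      using xy by (intro dvd_diff) (auto simp: D_def)
    then have "int N dvd a - b" using xs ys \<open>u = v\<close> by simp
    moreover have "\<bar>a - b\<bar> < int N" using xy xs ys by (auto simp: D_def T_def Band_def)
    ultimately have "a = b" using not_dvd_small[of "a - b"] by auto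
    then show "xs = ys" using xs ys \<open>u = v\<close> by simp
  qed
  have "tl ` D s (Suc m) \<subseteq> T m"
  proof
    fix r assume "r \<in> tl ` D s (Suc m)"
    then obtain xs where "r = tl xs" "xs \<in> D s (Suc m)" by blast
    then show "r \<in> T m" by (cases xs) (auto simp: D_def T_def)
  qed
  then have "card (D s (Suc m)) \<le> card (T m)"
    using card_inj_on_le[OF inj _ finite_T] by blast
  then show ?thesis using card_T[of m] by simp
qed

definition Al :: "nat \<Rightarrow> nat \<Rightarrow> int list set" where
  "Al q l = {ls \<in> T q. l \<in> set (ab ls) \<and> int N dvd sum_list ls}"

lemma finite_Al: "finite (Al q l)"
  by (rule finite_subset[OF _ finite_T[of q]]) (auto simp: Al_def)

text \<open>One entry is \<open>l\<close> or \<open>- l\<close>, at one of m + 2 places. The other m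
  + 1 entries satisfy a resonance condition with this entry as offset, which leaves at most N^m
  choices.\<close>

lemma card_Al: "card (Al (Suc (Suc m)) l) \<le> 2 * Suc (Suc m) * N ^ m"
proof -
  let ?q = "Suc (Suc m)"
  let ?f = "\<lambda>j s r. take j r @ s # drop j (r :: int list)"
  have fin: "finite (D s m)" for s m by (rule finite_subset[OF _ finite_T[of m]]) (auto simp: D_def)
  have sub: "Al ?q l \<subseteq> (\<Union>j\<in>{..<?q}. \<Union>s\<in>{int l, - int l}. ?f j s ` D s (Suc m))"
  proof
    fix ls assume ls: "ls \<in> Al ?q l"
    then obtain j where j: "j < length ls" "l = nat \<bar>ls ! j\<bar>"
      by (auto simp: Al_def ab_def in_set_conv_nth)
    define s where "s = ls ! j"
    define r where "r = take j ls @ drop (Suc j) ls"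
    have len: "length ls = ?q" using ls by (simp add: Al_def T_def)
    have lsr: "ls = ?f j s r" using j id_take_nth_drop[OF j(1)] by (simp add: r_def s_def)
    have "sum_list ls = sum_list (take j ls @ s # drop (Suc j) ls)"
      using id_take_nth_drop[OF j(1)] by (simp add: s_def)
    then have "sum_list ls = sum_list r + s" by (simp add: r_def)
    moreover have "set r \<subseteq> set ls" unfolding r_def using set_take_subset[of j ls] set_drop_subset[of "Suc j" ls] by auto
    ultimately have r: "r \<in> D s (Suc m)"
      using ls len j by (auto simp: D_def T_def Al_def r_def)
    have s: "s \<in> {int l, - int l}" using j by (auto simp: s_def)
    show "ls \<in> (\<Union>j\<in>{..<?q}. \<Union>s\<in>{int l, - int l}. ?f j s ` D s (Suc m))"
    proof (intro UN_I[of j] UN_I[of s])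
      show "ls \<in> ?f j s ` D s (Suc m)" using lsr r by (rule image_eqI)
    qed (use j len s in auto)
  qed
  have "card (Al ?q l) \<le> card (\<Union>j\<in>{..<?q}. \<Union>s\<in>{int l, - int l}. ?f j s ` D s (Suc m))"
    by (rule card_mono[OF _ sub]) (use fin in auto)
  also have "\<dots> \<le> (\<Sum>j\<in>{..<?q}. card (\<Union>s\<in>{int l, - int l}. ?f j s ` D s (Suc m)))"
    by (rule card_UN_le) simp
  also have "\<dots> \<le> (\<Sum>j\<in>{..<?q}. 2 * N ^ m)"
  proof (rule sum_mono)
    fix j
    have "card (\<Union>s\<in>{int l, - int l}. ?f j s ` D s (Suc m)) \<le> card (?f j (int l) ` D (int l) (Suc m)) + card (?f j (- int l) ` D (- int l) (Suc m))"
      by (simp add: card_Un_le)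
    also have "\<dots> \<le> card (D (int l) (Suc m)) + card (D (- int l) (Suc m))"
      by (intro add_mono card_image_le fin)
    also have "\<dots> \<le> N ^ m + N ^ m" by (intro add_mono card_D)
    finally show "card (\<Union>s\<in>{int l, - int l}. ?f j s ` D s (Suc m)) \<le> 2 * N ^ m" by simp
  qed
  finally show ?thesis by simp
qed

lemma polyd_What:
  "polyd I (What q) (\<lambda>i x. \<Sum>ls\<in>T q. (\<Prod>l\<leftarrow>ls. pp l) * kap ls / dl ls *
     (real (count_list (ab ls) (fst i)) * (x i * prodV (remove1 (fst i) (ab ls)) x)))"
  unfolding What_def[abs_def] using ab_L by (intro polyd_sum finite_T polyd_cmult polyd_prodV) auto

lemma gauss_variance_bound:
  assumes f: "polyd I f f'"
  shows "(LINT x|gauss I. (f x - (LINT x|gauss I. f x))\<^sup>2) \<le> (\<Sum>i\<in>I. LINT x|gauss I. (f' i x)\<^sup>2)"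
proof -
  have i1: "integrable (gauss I) f" by (rule polyd_integrable[OF finite_I f])
  have i2: "integrable (gauss I) (\<lambda>x. (f x)\<^sup>2)"
    using polyd_integrable[OF finite_I polyd_mult[OF f f]] by (simp add: power2_eq_square)
  show ?thesis
    using gauss_poincare[OF finite_I f] gaussp.variance_eq[OF i1 i2] by simp
qed

text \<open>Put q = m + 2. A coefficient is at most lam^q N^(1 - q), and a partial derivative
  involves at most 2 q N^m resonant tuples that contain its frequency. So the squared derivative is
  of order N^(-2), and the Poincare inequality sums it over fewer than N frequencies.\<close>

lemma variance_What:
  "(LINT x|gauss I. (What (Suc (Suc m)) x - mom (Suc (Suc m)))\<^sup>2)
    \<le> 8 * real (Suc (Suc m)) ^ 4 * fact (2 * m + 3) * lam ^ (2 * m + 4) / real N"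
proof -
  let ?q = "Suc (Suc m)"
  define c where "c ls = (\<Prod>l\<leftarrow>ls. pp l) * kap ls / dl ls" for ls
  define c0 where "c0 = (lam / real N) ^ ?q * real N"
  have c: "0 \<le> c ls" "c ls \<le> c0" if "ls \<in> T ?q" for ls
  proof -
    have b: "0 \<le> (\<Prod>l\<leftarrow>ls. pp l)" "(\<Prod>l\<leftarrow>ls. pp l) \<le> (lam / real N) ^ ?q"
      using prod_pp_bounds[of ls] that by (auto simp: T_def)
    have d: "1 \<le> dl ls" by (rule dl_ge_1[OF that])
    have k: "0 \<le> kap ls" "kap ls \<le> real N" by (auto simp: kap_eq)
    show "0 \<le> c ls" unfolding c_def using b d k by simp
    have "c ls \<le> (\<Prod>l\<leftarrow>ls. pp l) * kap ls / 1"
      unfolding c_def using b d k by (intro divide_left_mono) auto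
    also have "\<dots> \<le> c0"
      unfolding c0_def div_by_1 using lam_nonneg' by (intro mult_mono b k) auto
    finally show "c ls \<le> c0" .
  qed
  have c00: "0 \<le> c0" using lam_nonneg' by (simp add: c0_def)
  have c_zero: "c ls = 0" if "\<not> int N dvd sum_list ls" for ls using that by (simp add: c_def kap_eq)
  define W' where "W' i x = (\<Sum>ls\<in>T ?q. c ls * (real (count_list (ab ls) (fst i)) * (x i * prodV (remove1 (fst i) (ab ls)) x)))" for i and x :: "nat \<times> bool \<Rightarrow> real"
  have pW: "polyd I (What ?q) W'" unfolding W'_def[abs_def] c_def by (rule polyd_What)
  have rem: "set (remove1 l (ab ls)) \<subseteq> L" if "ls \<in> T ?q" for l ls
    using ab_L[OF that] set_remove1_subset[of l "ab ls"] by auto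
  have intVr: "integrable (gauss I) (\<lambda>x. V l x * (prodV (remove1 l (ab ls)) x)\<^sup>2)"
    "(LINT x|gauss I. V l x * (prodV (remove1 l (ab ls)) x)\<^sup>2) \<le> fact (2 * m + 3)"
    if "ls \<in> Al ?q l" for l ls
  proof -
    let ?r = "remove1 l (ab ls)"
    have ls: "ls \<in> T ?q" "l \<in> set (ab ls)" using that by (auto simp: Al_def)
    have l: "l \<in> L" using ab_L[OF ls(1)] ls(2) by auto
    have sub: "set (l # ?r @ ?r) \<subseteq> L" using l rem[OF ls(1), of l] by auto
    have eq: "prodV (l # ?r @ ?r) = (\<lambda>x. V l x * (prodV ?r x)\<^sup>2)"
      by (auto simp: prodV_def power2_eq_square)
    \<comment> \<open>One occurrence of \<open>l\<close> is removed from m + 2 entries, the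
      remaining m + 1 are squared, and \<open>V l\<close> is one factor more.\<close>
    have len: "length (l # ?r @ ?r) = 2 * m + 3"
      using length_ab[OF ls(1)] ls(2) by (simp add: length_remove1)
    show "integrable (gauss I) (\<lambda>x. V l x * (prodV ?r x)\<^sup>2)"
      using integrable_prodV[OF sub] unfolding eq .
    show "(LINT x|gauss I. V l x * (prodV ?r x)\<^sup>2) \<le> fact (2 * m + 3)"
      using mean_prodV_bounds[OF sub] unfolding eq len by simp
  qed
  \<comment> \<open>The two coordinates of a frequency are taken together because the sum of their
    squares is 2 \<open>V l\<close>, which brings the bound back to products of
    \<open>V\<close>.\<close>
  have pt: "(W' (l, True) x)\<^sup>2 + (W' (l, False) x)\<^sup>2
      \<le> real (card (Al ?q l)) * (c0 * real ?q)\<^sup>2 * 2 * (\<Sum>ls\<in>Al ?q l. V l x * (prodV (remove1 l (ab ls)) x)\<^sup>2)" for l x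
  proof -
    have one: "(W' (l, b) x)\<^sup>2 \<le> real (card (Al ?q l)) * (c0 * real ?q)\<^sup>2 * (\<Sum>ls\<in>Al ?q l. (x (l, b))\<^sup>2 * (prodV (remove1 l (ab ls)) x)\<^sup>2)" for b
    proof -
      have "W' (l, b) x = (\<Sum>ls\<in>Al ?q l. c ls * (real (count_list (ab ls) l) * (x (l, b) * prodV (remove1 l (ab ls)) x)))"
        unfolding W'_def
        by (rule sum.mono_neutral_cong_right[OF finite_T])
           (use c_zero in \<open>auto simp: Al_def count_list_0_iff\<close>)
      then have "(W' (l, b) x)\<^sup>2 \<le> real (card (Al ?q l)) * (\<Sum>ls\<in>Al ?q l. (c ls * (real (count_list (ab ls) l) * (x (l, b) * prodV (remove1 l (ab ls)) x)))\<^sup>2)"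
        by (simp only: square_sum_bound[OF finite_Al])
      also have "\<dots> \<le> real (card (Al ?q l)) * (\<Sum>ls\<in>Al ?q l. (c0 * real ?q)\<^sup>2 * ((x (l, b))\<^sup>2 * (prodV (remove1 l (ab ls)) x)\<^sup>2))"
      proof (intro mult_left_mono sum_mono)
        fix ls assume "ls \<in> Al ?q l"
        then have ls: "ls \<in> T ?q" by (auto simp: Al_def)
        have "c ls * real (count_list (ab ls) l) \<le> c0 * real ?q"
          using c[OF ls] c00 count_le_length[of "ab ls" l] length_ab[OF ls] by (intro mult_mono) auto
        then have "(c ls * real (count_list (ab ls) l))\<^sup>2 \<le> (c0 * real ?q)\<^sup>2"
          using c[OF ls] by (intro power_mono) auto
        then have "(c ls * real (count_list (ab ls) l))\<^sup>2 * ((x (l, b))\<^sup>2 * (prodV (remove1 l (ab ls)) x)\<^sup>2)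
          \<le> (c0 * real ?q)\<^sup>2 * ((x (l, b))\<^sup>2 * (prodV (remove1 l (ab ls)) x)\<^sup>2)"
          by (intro mult_right_mono) auto
        then show "(c ls * (real (count_list (ab ls) l) * (x (l, b) * prodV (remove1 l (ab ls)) x)))\<^sup>2
          \<le> (c0 * real ?q)\<^sup>2 * ((x (l, b))\<^sup>2 * (prodV (remove1 l (ab ls)) x)\<^sup>2)"
          by (simp only: power_mult_distrib mult_ac)
      qed simp
      finally show ?thesis by (simp only: sum_distrib_left mult_ac)
    qed
    have "(W' (l, True) x)\<^sup>2 + (W' (l, False) x)\<^sup>2
      \<le> real (card (Al ?q l)) * (c0 * real ?q)\<^sup>2 * ((\<Sum>ls\<in>Al ?q l. (x (l, True))\<^sup>2 * (prodV (remove1 l (ab ls)) x)\<^sup>2) +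
        (\<Sum>ls\<in>Al ?q l. (x (l, False))\<^sup>2 * (prodV (remove1 l (ab ls)) x)\<^sup>2))"
      using one[of True] one[of False] by (simp only: distrib_left)
    also have "(\<Sum>ls\<in>Al ?q l. (x (l, True))\<^sup>2 * (prodV (remove1 l (ab ls)) x)\<^sup>2) +
        (\<Sum>ls\<in>Al ?q l. (x (l, False))\<^sup>2 * (prodV (remove1 l (ab ls)) x)\<^sup>2)
        = 2 * (\<Sum>ls\<in>Al ?q l. V l x * (prodV (remove1 l (ab ls)) x)\<^sup>2)"
      unfolding sum.distrib[symmetric] sum_distrib_left by (intro sum.cong refl) (simp add: V_def algebra_simps)
    finally show ?thesis by (simp only: mult_ac)
  qed
  have intW: "integrable (gauss I) (\<lambda>x. (W' i x)\<^sup>2)" for i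
  proof -
    obtain g where "polyd I (W' i) g" using polyd_derivative_ex[OF pW] by blast
    from polyd_integrable[OF finite_I polyd_mult[OF this this]] show ?thesis by (simp add: power2_eq_square)
  qed
  have cardL: "real (card L) \<le> real N"
  proof -
    have "card L \<le> card {..<N}" by (rule card_mono) (auto simp: L_def)
    then show ?thesis by simp
  qed
  have "(LINT x|gauss I. (What ?q x - mom ?q)\<^sup>2) \<le> (\<Sum>i\<in>I. LINT x|gauss I. (W' i x)\<^sup>2)"
    using gauss_variance_bound[OF pW] by (simp only: mean_What)
  also have "\<dots> = (\<Sum>l\<in>L. LINT x|gauss I. (W' (l, True) x)\<^sup>2 + (W' (l, False) x)\<^sup>2)"
    unfolding sum_I using intW by (intro sum.cong refl) simp
  also have "\<dots> \<le> (\<Sum>l\<in>L. (2 * real ?q * real N ^ m)\<^sup>2 * (c0 * real ?q)\<^sup>2 * 2 * fact (2 * m + 3))"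
  proof (rule sum_mono)
    fix l assume "l \<in> L"
    let ?a = "real (card (Al ?q l))"
    have "(LINT x|gauss I. (W' (l, True) x)\<^sup>2 + (W' (l, False) x)\<^sup>2)
      \<le> (LINT x|gauss I. ?a * (c0 * real ?q)\<^sup>2 * 2 * (\<Sum>ls\<in>Al ?q l. V l x * (prodV (remove1 l (ab ls)) x)\<^sup>2))"
      by (intro integral_mono pt Bochner_Integration.integrable_add intW integrable_mult_right
          Bochner_Integration.integrable_sum intVr)
    also have "\<dots> = ?a * (c0 * real ?q)\<^sup>2 * 2 * (\<Sum>ls\<in>Al ?q l. LINT x|gauss I. V l x * (prodV (remove1 l (ab ls)) x)\<^sup>2)"
      using intVr by (simp add: Bochner_Integration.integral_sum)
    also have "\<dots> \<le> ?a * (c0 * real ?q)\<^sup>2 * 2 * (\<Sum>ls\<in>Al ?q l. fact (2 * m + 3))"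
      by (intro mult_left_mono sum_mono intVr) auto
    also have "\<dots> = ?a\<^sup>2 * (c0 * real ?q)\<^sup>2 * 2 * fact (2 * m + 3)"
      by (simp add: power2_eq_square)
    also have "\<dots> \<le> (2 * real ?q * real N ^ m)\<^sup>2 * (c0 * real ?q)\<^sup>2 * 2 * fact (2 * m + 3)"
    proof (intro mult_right_mono power_mono)
      have "real (card (Al ?q l)) \<le> real (2 * ?q * N ^ m)"
        using card_Al[of m l] by (simp only: of_nat_le_iff)
      then show "?a \<le> 2 * real ?q * real N ^ m" by (simp only: of_nat_mult of_nat_power of_nat_numeral)
    qed auto
    finally show "(LINT x|gauss I. (W' (l, True) x)\<^sup>2 + (W' (l, False) x)\<^sup>2) \<le> \<dots>" .
  qed
  also have "\<dots> = real (card L) * ((2 * real ?q * real N ^ m)\<^sup>2 * (c0 * real ?q)\<^sup>2 * 2 * fact (2 * m + 3))" by simp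
  also have "\<dots> \<le> real N * ((2 * real ?q * real N ^ m)\<^sup>2 * (c0 * real ?q)\<^sup>2 * 2 * fact (2 * m + 3))"
    by (intro mult_right_mono cardL) auto
  also have "\<dots> = 8 * real ?q ^ 4 * fact (2 * m + 3) * lam ^ (2 * m + 4) / real N"
  proof -
    have c0_eq: "c0 * real N ^ m = lam ^ ?q / real N"
      using N_pos by (simp add: c0_def power_divide field_simps)
    have "real N * ((2 * real ?q * real N ^ m)\<^sup>2 * (c0 * real ?q)\<^sup>2 * 2 * fact (2 * m + 3))
      = real N * (8 * real ?q ^ 4 * fact (2 * m + 3) * (c0 * real N ^ m)\<^sup>2)"
      by (simp only: power_mult_distrib) (simp add: power2_eq_square power4_eq_xxxx)
    also have "\<dots> = 8 * real ?q ^ 4 * fact (2 * m + 3) * (lam ^ ?q)\<^sup>2 / real N"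
      unfolding c0_eq using N_pos by (simp add: power2_eq_square)
    also have "(lam ^ ?q)\<^sup>2 = lam ^ (2 * m + 4)"
      by (simp only: power_mult[symmetric]) (rule arg_cong[where f="\<lambda>k. lam ^ k"], simp)
    finally show ?thesis .
  qed
  finally show ?thesis .
qed

lemma mean_V: "l \<in> L \<Longrightarrow> (LINT x|gauss I. V l x) = 1"
  using mean_prodV_Cons[of l "[]"] by (simp add: prodV_def gaussp.prob_space)

lemma integrable_V: "l \<in> L \<Longrightarrow> integrable (gauss I) (V l)"
  by (rule polyd_integrable[OF finite_I polyd_V])

section \<open>The normalised variance estimator and lower bounds for the moments\<close>

lemma mean_R: "(LINT x|gauss I. R x) = 1"
  unfolding R_def using integrable_V mean_V p_sum_L by (simp add: Bochner_Integration.integral_sum)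

text \<open>The weights 2 \<open>p l\<close> add up to 1 and none exceeds 2 lam / N, so the sum of
  their squares is O(1 / N).\<close>

lemma variance_R: "(LINT x|gauss I. (R x - 1)\<^sup>2) \<le> 4 * lam / real N"
proof -
  have pR: "polyd I R (\<lambda>i x. \<Sum>l\<in>L. 2 * p l * (if fst i = l then x i else 0))"
    unfolding R_def[abs_def] by (intro polyd_sum finite_L polyd_cmult polyd_V)
  have "(LINT x|gauss I. (R x - 1)\<^sup>2) \<le> (\<Sum>i\<in>I. LINT x|gauss I. (\<Sum>l\<in>L. 2 * p l * (if fst i = l then x i else 0))\<^sup>2)"
    using gauss_variance_bound[OF pR] unfolding mean_R .
  also have "\<dots> = (\<Sum>l\<in>L. (2 * p l)\<^sup>2 * 2)"
    unfolding sum_I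
  proof (rule sum.cong[OF refl])
    fix l assume l: "l \<in> L"
    have e: "(\<Sum>l'\<in>L. 2 * p l' * (if fst (l, b) = l' then x (l, b) else 0)) = 2 * p l * x (l, b)" for b and x :: "nat \<times> bool \<Rightarrow> real"
      using l finite_L by (simp add: if_distrib[of "\<lambda>z. _ * z"] cong: if_cong)
    have i: "integrable (gauss I) (\<lambda>x. (x (l, b))\<^sup>2)" for b
    proof -
      have "(l, b) \<in> I" using l by (simp add: I_def)
      from polyd_integrable[OF finite_I polyd_mult[OF polyd_component[OF this] polyd_component[OF this]]]
      show ?thesis by (simp add: power2_eq_square)
    qed
    have "(LINT x|gauss I. (x (l, True))\<^sup>2) + (LINT x|gauss I. (x (l, False))\<^sup>2) = (LINT x|gauss I. 2 * V l x)"
      using i by (simp add: V_def)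
    also have "\<dots> = 2" using integrable_V[OF l] mean_V[OF l] by simp
    finally show "(LINT x|gauss I. (\<Sum>l'\<in>L. 2 * p l' * (if fst (l, True) = l' then x (l, True) else 0))\<^sup>2) +
      (LINT x|gauss I. (\<Sum>l'\<in>L. 2 * p l' * (if fst (l, False) = l' then x (l, False) else 0))\<^sup>2) = (2 * p l)\<^sup>2 * 2"
      unfolding e power_mult_distrib[of "2 * p l"] by (simp flip: distrib_left)
  qed
  also have "\<dots> \<le> (\<Sum>l\<in>L. 4 * (lam / real N) * (2 * p l))"
  proof (rule sum_mono)
    fix l assume "l \<in> L"
    then have "p l \<le> lam / real N" using p_le[of l] N_pos by (simp add: L_def field_simps)
    then have "p l * (8 * p l) \<le> (lam / real N) * (8 * p l)" using p_nonneg by (intro mult_right_mono) auto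
    moreover have "(2 * p l)\<^sup>2 * 2 = p l * (8 * p l)" "4 * (lam / real N) * (2 * p l) = (lam / real N) * (8 * p l)"
      by (simp_all add: power2_eq_square)
    ultimately show "(2 * p l)\<^sup>2 * 2 \<le> 4 * (lam / real N) * (2 * p l)" by (simp only:)
  qed
  also have "\<dots> = 4 * lam / real N"
    using p_sum_L sum_distrib_left[of "4 * (lam / real N)" "\<lambda>l. 2 * p l" L] by (simp only: mult_1_right times_divide_eq_right)
  finally show ?thesis .
qed

lemma mom_nonneg: "0 \<le> mom q"
  unfolding mom_def using prod_pp_bounds by (intro sum_nonneg mult_nonneg_nonneg) (auto simp: T_def kap_eq)

text \<open>The tuples (l, - l) and (l, l', - (l + l')) have sum 0 and are therefore resonant. At
  least d N and (d N)^2 of them are available, and each contributes N times a product of two or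
  three weights of size at least cc / N.\<close>

lemma mom_lower:
  assumes L0: "L0 \<subseteq> L" "\<And>l. l \<in> L0 \<Longrightarrow> cc / real N \<le> p l"
    and sums: "\<And>l l'. l \<in> L0 \<Longrightarrow> l' \<in> L0 \<Longrightarrow> l + l' \<in> L \<and> cc / real N \<le> p (l + l')"
    and card: "d * real N \<le> real (card L0)" and pos: "0 \<le> cc" "0 \<le> d"
  shows "d * cc\<^sup>2 \<le> mom 2" "d\<^sup>2 * cc ^ 3 \<le> mom 3"
proof -
  have nn: "0 < real N" using N_pos by simp
  have LB: "int l \<in> Band" "- int l \<in> Band" if "l \<in> L" for l using that by (auto simp: L_def Band_def)
  have term0: "0 \<le> (\<Prod>l\<leftarrow>ls. pp l) * kap ls" if "ls \<in> T q" for ls q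
    using prod_pp_bounds[of ls] that by (auto simp: T_def kap_eq)
  have "d * cc\<^sup>2 \<le> (real (card L0) / real N) * cc\<^sup>2"
    using card nn by (intro mult_right_mono) (auto simp: field_simps)
  also have "\<dots> = (\<Sum>l\<in>L0. (cc / real N)\<^sup>2 * real N)"
    using nn by (simp add: power2_eq_square field_simps)
  also have "\<dots> \<le> (\<Sum>l\<in>L0. (\<Prod>l\<leftarrow>[int l, - int l]. pp l) * kap [int l, - int l])"
  proof (rule sum_mono)
    fix l assume l: "l \<in> L0"
    have "(cc / real N)\<^sup>2 \<le> p l * p l"
      unfolding power2_eq_square using L0(2)[OF l] pos nn p_nonneg by (intro mult_mono) auto
    then show "(cc / real N)\<^sup>2 * real N \<le> (\<Prod>l\<leftarrow>[int l, - int l]. pp l) * kap [int l, - int l]"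
      using nn by (simp add: kap_eq pp_def mult_right_mono)
  qed
  also have "\<dots> = (\<Sum>ls\<in>(\<lambda>l. [int l, - int l]) ` L0. (\<Prod>l\<leftarrow>ls. pp l) * kap ls)"
    by (subst sum.reindex) (auto simp: inj_on_def)
  also have "\<dots> \<le> mom 2"
    unfolding mom_def
  proof (intro sum_mono2 finite_T term0[of _ 2])
    show "(\<lambda>l. [int l, - int l]) ` L0 \<subseteq> T 2"
    proof clarify
      fix l assume "l \<in> L0"
      then have "int l \<in> Band" "- int l \<in> Band" using L0(1) LB by blast+
      then show "[int l, - int l] \<in> T 2" by (simp add: T_def)
    qed
  qed auto
  finally show "d * cc\<^sup>2 \<le> mom 2" .
  have "d\<^sup>2 * cc ^ 3 \<le> (real (card L0) / real N)\<^sup>2 * cc ^ 3"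
    using card nn pos by (intro mult_right_mono power_mono) (auto simp: field_simps)
  also have "\<dots> = (\<Sum>(l, l')\<in>L0 \<times> L0. (cc / real N) ^ 3 * real N)"
    using nn by (simp add: card_cartesian_product power2_eq_square power3_eq_cube field_simps)
  also have "\<dots> \<le> (\<Sum>(l, l')\<in>L0 \<times> L0. (\<Prod>l\<leftarrow>[int l, int l', - int (l + l')]. pp l) * kap [int l, int l', - int (l + l')])"
  proof (rule sum_mono, clarify)
    fix l l' assume l: "l \<in> L0" "l' \<in> L0"
    have "(cc / real N) ^ 3 \<le> p l * (p l' * p (l + l'))"
      unfolding power3_eq_cube mult.assoc using L0(2)[OF l(1)] L0(2)[OF l(2)] sums[OF l] pos nn p_nonneg
      by (intro mult_mono) auto
    moreover have "pp (- int (l + l')) = p (l + l')" by (simp add: pp_def nat_add_distrib flip: of_nat_add)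
    ultimately show "(cc / real N) ^ 3 * real N \<le> (\<Prod>l\<leftarrow>[int l, int l', - int (l + l')]. pp l) * kap [int l, int l', - int (l + l')]"
      using nn by (simp add: kap_eq pp_def mult_right_mono)
  qed
  also have "\<dots> = (\<Sum>ls\<in>(\<lambda>(l, l'). [int l, int l', - int (l + l')]) ` (L0 \<times> L0). (\<Prod>l\<leftarrow>ls. pp l) * kap ls)"
    by (subst sum.reindex) (auto simp: inj_on_def case_prod_beta)
  also have "\<dots> \<le> mom 3"
    unfolding mom_def
  proof (intro sum_mono2 finite_T term0[of _ 3])
    show "(\<lambda>(l, l'). [int l, int l', - int (l + l')]) ` (L0 \<times> L0) \<subseteq> T 3"
    proof clarify
      fix l l' assume l: "l \<in> L0" "l' \<in> L0"
      then have "int l \<in> Band" "int l' \<in> Band" "- int (l + l') \<in> Band"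
        using L0(1) sums[OF l] LB by blast+
      then show "[int l, int l', - int (l + l')] \<in> T 3" by (simp add: T_def)
    qed
  qed auto
  finally show "d\<^sup>2 * cc ^ 3 \<le> mom 3" .
qed

theorem characteristic_bound:
  assumes "\<bar>a\<bar> \<le> B" "\<bar>b\<bar> \<le> B"
  shows "\<bar>(LINT x|gauss I. cos (a * S x + b * U x + \<theta>)) - cos \<theta> * exp (- (a\<^sup>2 * VS + b\<^sup>2 * VU) / 2)\<bar>
    \<le> sqrt ((2 * lam) ^ 3 / sqrt (real N) * (4 * (18 * B) ^ 4 * normal_mean ([:1, 0, 0, 0, 1:] ^ 4)))"
proof -
  have "\<bar>(LINT x|gauss I. cos (F a b x + \<theta>)) - cos \<theta> * exp (- (LINT x|gauss I. (F a b x)\<^sup>2) / 2)\<bar>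
    \<le> sqrt ((2 * lam) ^ 3 / sqrt (real N) * fourth_bound a b)"
    using cos_F_bound[of a b \<theta>] by (simp only: n_eq)
  also have "\<dots> \<le> sqrt ((2 * lam) ^ 3 / sqrt (real N) * (4 * (18 * B) ^ 4 * normal_mean ([:1, 0, 0, 0, 1:] ^ 4)))"
    using lam_nonneg' by (intro real_sqrt_le_mono mult_left_mono fourth_bound_le assms) auto
  finally show ?thesis by (simp only: F_eq second_moment_SU)
qed

lemma polyd_S_ex: "\<exists>f'. polyd I S f'" and polyd_U_ex: "\<exists>f'. polyd I U f'"
proof -
  have F: "F 1 0 = S" "F 0 1 = U" by (simp_all add: F_eq fun_eq_iff)
  show "\<exists>f'. polyd I S f'" using polyd_F[of 1 0] unfolding F by blast
  show "\<exists>f'. polyd I U f'" using polyd_F[of 0 1] unfolding F by blast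
qed

end

section \<open>Wavelet coefficients of the field\<close>

definition band :: "nat \<Rightarrow> int set" where "band N = {l. l \<noteq> 0 \<and> 2 * \<bar>l\<bar> < int N}"

lemma finite_band: "finite (band N)"
  by (rule finite_subset[of _ "{- int N..int N}"]) (auto simp: band_def)

locale wavelet =
  fixes \<phi> :: "real \<Rightarrow> real"
  assumes cutoff: "wavelet_cutoff \<phi>"
begin

abbreviation aa :: "nat \<Rightarrow> int \<Rightarrow> real" where "aa N l \<equiv> wavelet_a \<phi> (4 * of_int l / real N)"

lemma phi_continuous: "continuous_on UNIV \<phi>"
proof -
  have "(deriv ^^ 0) \<phi> differentiable_on UNIV"
    using cutoff unfolding wavelet_cutoff_def smooth_def by blast
  then show ?thesis by (simp add: differentiable_imp_continuous_on)
qed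

lemma phi_one: "\<bar>x\<bar> \<le> 1 / 2 \<Longrightarrow> \<phi> x = 1"
  using cutoff by (auto simp: wavelet_cutoff_def)

lemma phi_even: "\<phi> (- x) = \<phi> x"
  using cutoff by (auto simp: wavelet_cutoff_def)

lemma phi_bounds: "0 \<le> \<phi> x" "\<phi> x \<le> 1"
  using cutoff by (auto simp: wavelet_cutoff_def)

text \<open>At the points 1 and - 1 themselves continuity is used. As a consequence
  \<open>wavelet_a \<phi>\<close> vanishes at the ends of its range, so the frequency N / 2 carries
  no weight and all others lie strictly inside \<open>band N\<close>.\<close>

lemma phi_zero: "1 \<le> \<bar>x\<bar> \<Longrightarrow> \<phi> x = 0"
proof -
  have gt: "\<phi> y = 0" if "1 < \<bar>y\<bar>" for y using that cutoff by (auto simp: wavelet_cutoff_def)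
  have "\<phi> 1 = 0"
  proof -
    have "(\<lambda>n. 1 + 1 / real (Suc n)) \<longlonglongrightarrow> 1 + 0"
      by (intro tendsto_add tendsto_const) (rule LIMSEQ_Suc[OF lim_1_over_n])
    then have "(\<lambda>n. \<phi> (1 + 1 / real (Suc n))) \<longlonglongrightarrow> \<phi> (1 + 0)"
      by (rule continuous_on_tendsto_compose[OF phi_continuous]) auto
    moreover have "\<phi> (1 + 1 / real (Suc n)) = 0" for n by (intro gt) simp
    ultimately show ?thesis by (simp add: LIMSEQ_const_iff)
  qed
  moreover have "\<phi> (- 1) = 0" using phi_even[of 1] \<open>\<phi> 1 = 0\<close> by simp
  ultimately show "1 \<le> \<bar>x\<bar> \<Longrightarrow> \<phi> x = 0"
    using gt[of x] by (cases "\<bar>x\<bar> = 1") (auto simp: abs_if split: if_splits)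
qed

lemma a_sq: "(wavelet_a \<phi> x)\<^sup>2 = \<phi> (x / 2) - \<phi> x"
  using cutoff by (auto simp: wavelet_a_def wavelet_cutoff_def)

lemma a_nonneg: "0 \<le> wavelet_a \<phi> x"
  using cutoff by (auto simp: wavelet_a_def wavelet_cutoff_def)

lemma a_even: "wavelet_a \<phi> (- x) = wavelet_a \<phi> x"
  using phi_even[of x] phi_even[of "x / 2"] by (simp add: wavelet_a_def)

lemma aa_even: "aa N (- l) = aa N l"
  using a_even[of "4 * of_int l / real N"] by simp

lemma a_sq_le: "(wavelet_a \<phi> x)\<^sup>2 \<le> 1"
  using phi_bounds[of "x / 2"] phi_bounds[of x] unfolding a_sq by linarith

lemma a_zero: "\<bar>x\<bar> \<le> 1 / 2 \<or> 2 \<le> \<bar>x\<bar> \<Longrightarrow> wavelet_a \<phi> x = 0"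
  using phi_one[of x] phi_one[of "x / 2"] phi_zero[of x] phi_zero[of "x / 2"]
  by (auto simp: wavelet_a_def)

lemma aa_nonzero:
  assumes "aa N l \<noteq> 0"
  shows "l \<in> band N" "real N / 8 < \<bar>of_int l\<bar>" "\<bar>of_int l\<bar> < real N / 2"
proof -
  have N: "0 < N"
  proof (rule ccontr)
    assume "\<not> 0 < N"
    then show False using assms a_zero[of 0] by simp
  qed
  have "\<not> (\<bar>4 * of_int l / real N\<bar> \<le> 1 / 2 \<or> 2 \<le> \<bar>4 * of_int l / real N\<bar>)"
    using a_zero assms by blast
  then have "1 / 2 < \<bar>4 * of_int l / real N\<bar>" "\<bar>4 * of_int l / real N\<bar> < 2" by linarith+
  then show b: "real N / 8 < \<bar>of_int l\<bar>" "\<bar>of_int l\<bar> < real N / 2"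
    using N by (auto simp: abs_mult field_simps)
  then have "l \<noteq> 0" using N by auto
  moreover have "real_of_int (2 * \<bar>l\<bar>) < real_of_int (int N)" using b by simp
  then have "2 * \<bar>l\<bar> < int N" by (simp only: of_int_less_iff)
  ultimately show "l \<in> band N" by (simp add: band_def)
qed

lemma psi_complex:
  "complex_of_real (psi \<phi> N t) = complex_of_real (1 / sqrt (real N)) * (\<Sum>l\<in>band N. complex_of_real (aa N l) * cis (of_int l * t))"
proof -
  let ?f = "\<lambda>l::int. complex_of_real (aa N l) * cis (of_int l * t)"
  have "infsum ?f UNIV = infsum ?f (band N)"
    using aa_nonzero(1) by (intro infsum_cong_neutral) auto
  also have "\<dots> = sum ?f (band N)" by (rule infsum_finite[OF finite_band])
  finally have eq: "infsum ?f UNIV = sum ?f (band N)" .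
  then have "Im (sum ?f (band N)) = 0" using psi_series_real[OF cutoff, of N t] by simp
  then have "sum ?f (band N) = complex_of_real (Re (infsum ?f UNIV))"
    unfolding eq by (simp add: complex_eq_iff)
  then show ?thesis by (simp add: psi_def)
qed

lemma psi_bound: "\<bar>psi \<phi> N t\<bar> \<le> 1 / sqrt (real N) * real (card (band N))"
proof -
  have "\<bar>psi \<phi> N t\<bar> = cmod (complex_of_real (psi \<phi> N t))" by simp
  also have "\<dots> \<le> 1 / sqrt (real N) * (\<Sum>l\<in>band N. 1)"
    unfolding psi_complex norm_mult norm_of_real
  proof (intro mult_mono)
    show "cmod (\<Sum>l\<in>band N. complex_of_real (aa N l) * cis (of_int l * t)) \<le> (\<Sum>l\<in>band N. 1)"
    proof (rule sum_norm_le)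
      fix l
      have "aa N l \<le> 1" using a_sq_le a_nonneg by (simp add: power2_le_imp_le[of _ 1])
      then show "cmod (complex_of_real (aa N l) * cis (of_int l * t)) \<le> 1"
        using a_nonneg by (simp add: norm_mult)
    qed
  qed auto
  finally show ?thesis by simp
qed

lemma psi_continuous: "continuous_on UNIV (psi \<phi> N)"
proof -
  have eq: "psi \<phi> N = (\<lambda>t. Re (complex_of_real (1 / sqrt (real N)) * (\<Sum>l\<in>band N. complex_of_real (aa N l) * cis (of_int l * t))))"
    unfolding psi_complex[symmetric] by simp
  have c: "continuous_on UNIV (\<lambda>t. Re (s * (\<Sum>l\<in>band N. complex_of_real (aa N l) * cis (of_int l * t))))" for s
    by (auto intro!: continuous_intros simp: cis_conv_exp)
  show ?thesis unfolding eq by (rule c)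
qed

end

lemma set_integral_sum:
  fixes f :: "'i \<Rightarrow> 'a \<Rightarrow> 'b :: {banach, second_countable_topology}"
  assumes "\<And>i. i \<in> A \<Longrightarrow> set_integrable M S (f i)"
  shows "set_integrable M S (\<lambda>x. \<Sum>i\<in>A. f i x)"
    and "(LINT x:S|M. (\<Sum>i\<in>A. f i x)) = (\<Sum>i\<in>A. LINT x:S|M. f i x)"
  using assms unfolding set_integrable_def set_lebesgue_integral_def scaleR_sum_right
  by (auto intro!: Bochner_Integration.integrable_sum Bochner_Integration.integral_sum)

lemma borel_measurable_norm_compose:
  "f \<in> borel_measurable M \<Longrightarrow> (\<lambda>x. norm (f x)) \<in> borel_measurable M"
  by (rule measurable_compose[OF _ borel_measurable_norm])

lemma borel_measurable_cnj_compose: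
  assumes "f \<in> borel_measurable M"
  shows "(\<lambda>x. cnj (f x)) \<in> borel_measurable M"
proof -
  have "cnj \<in> borel_measurable borel"
    by (intro borel_measurable_continuous_onI continuous_on_cnj continuous_on_id)
  from measurable_compose[OF assms this] show ?thesis .
qed

lemma integral_cis:
  "set_integrable lborel {-pi..pi} (\<lambda>\<theta>. cis (of_int d * \<theta>))"
  "(LINT \<theta>:{-pi..pi}|lborel. cis (of_int d * \<theta>)) = (if d = 0 then complex_of_real (2 * pi) else 0)"
proof -
  have c: "continuous_on {-pi..pi} (\<lambda>\<theta>. cis (of_int d * \<theta>))"
    by (auto intro!: continuous_intros simp: cis_conv_exp)
  show i: "set_integrable lborel {-pi..pi} (\<lambda>\<theta>. cis (of_int d * \<theta>))"
    by (rule borel_integrable_atLeastAtMost'[OF c])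
  show "(LINT \<theta>:{-pi..pi}|lborel. cis (of_int d * \<theta>)) = (if d = 0 then complex_of_real (2 * pi) else 0)"
  proof (cases "d = 0")
    case True
    have "((\<lambda>\<theta>. cis (of_int d * \<theta>)) has_integral (pi - (- pi)) *\<^sub>R 1) {-pi..pi}"
      using True has_integral_const_real[of "1::complex" "-pi" pi] by simp
    then show ?thesis
      using True set_borel_integral_eq_integral(2)[OF i] by (simp add: integral_unique scaleR_conv_of_real)
  next
    case False
    have "((\<lambda>\<theta>. cis (of_int d * \<theta>)) has_integral
        (cis (of_int d * pi) / (\<i> * of_int d) - cis (of_int d * - pi) / (\<i> * of_int d))) {-pi..pi}"
    proof (rule fundamental_theorem_of_calculus)
      fix x
      show "((\<lambda>\<theta>. cis (of_int d * \<theta>) / (\<i> * of_int d)) has_vector_derivative cis (of_int d * x)) (at x within {-pi..pi})"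
      proof -
        have "((\<lambda>z. exp (\<i> * of_int d * z) / (\<i> * of_int d)) has_field_derivative exp (\<i> * of_int d * of_real x)) (at (of_real x))"
          using False by (auto intro!: derivative_eq_intros)
        from has_vector_derivative_real_field[OF this] show ?thesis
          by (simp add: cis_conv_exp mult.assoc)
      qed
    qed simp
    moreover have "cis (of_int d * pi) = cis (of_int d * - pi)"
      using sin_npi_int[of d] by (simp add: complex_eq_iff mult.commute)
    ultimately show ?thesis
      using False set_borel_integral_eq_integral(2)[OF i] by (simp add: integral_unique)
  qed
qed

section \<open>Second order structure of the field and its wavelet coefficients\<close>

locale wavelet_field = prob_space M + wavelet \<phi>
  for M :: "'a measure" and \<phi> +
  fixes X :: "real \<Rightarrow> 'a \<Rightarrow> real" and w :: "int \<Rightarrow> 'a \<Rightarrow> complex" and C :: "int \<Rightarrow> real"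
  assumes field: "torus_field M X w C"
    and gaussian: "jointly_gaussian M w"
    and C_pos: "\<And>l. 1 \<le> l \<Longrightarrow> 0 < C l"
begin

lemma
  shows X_meas: "(\<lambda>(\<theta>, \<omega>). X \<theta> \<omega>) \<in> borel_measurable (borel \<Otimes>\<^sub>M M)"
    and X_sq: "integrable M (\<lambda>\<omega>. (X \<theta> \<omega>)\<^sup>2)"
    and X_stat: "expectation (\<lambda>\<omega>. X (\<theta> + h) \<omega> * X (\<theta>' + h) \<omega>) = expectation (\<lambda>\<omega>. X \<theta> \<omega> * X \<theta>' \<omega>)"
    and X_series: "(\<lambda>n::nat. LINT \<omega>|M. (cmod (complex_of_real (X \<theta> \<omega>) - (\<Sum>l\<in>{- int n..int n}. w l \<omega> * cis (of_int l * \<theta>))))\<^sup>2) \<longlonglongrightarrow> 0"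
    and w_meas: "w l \<in> borel_measurable M"
    and w_sq: "integrable M (\<lambda>\<omega>. (cmod (w l \<omega>))\<^sup>2)"
    and w_neg: "AE \<omega> in M. w (- l) \<omega> = cnj (w l \<omega>)"
    and w_mean: "(LINT \<omega>|M. w l \<omega>) = 0"
    and w_orth: "l \<noteq> l' \<Longrightarrow> (LINT \<omega>|M. w l \<omega> * cnj (w l' \<omega>)) = 0"
    and w_var: "(LINT \<omega>|M. (cmod (w l \<omega>))\<^sup>2) = C l"
    and C_summable: "C summable_on UNIV"
proof -
  note f = field[unfolded torus_field_def]
  show "(\<lambda>(\<theta>, \<omega>). X \<theta> \<omega>) \<in> borel_measurable (borel \<Otimes>\<^sub>M M)" by (rule f[THEN conjunct1])
  note f = f[THEN conjunct2, THEN conjunct2]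
  show "integrable M (\<lambda>\<omega>. (X \<theta> \<omega>)\<^sup>2)" by (rule f[THEN conjunct1, rule_format])
  note f = f[THEN conjunct2, THEN conjunct2]
  show "expectation (\<lambda>\<omega>. X (\<theta> + h) \<omega> * X (\<theta>' + h) \<omega>) = expectation (\<lambda>\<omega>. X \<theta> \<omega> * X \<theta>' \<omega>)"
    by (rule f[THEN conjunct1, rule_format])
  note f = f[THEN conjunct2]
  show "(\<lambda>n::nat. LINT \<omega>|M. (cmod (complex_of_real (X \<theta> \<omega>) - (\<Sum>l\<in>{- int n..int n}. w l \<omega> * cis (of_int l * \<theta>))))\<^sup>2) \<longlonglongrightarrow> 0"
    by (rule f[THEN conjunct1, rule_format])
  note f = f[THEN conjunct2]
  show "w l \<in> borel_measurable M" by (rule f[THEN conjunct1, rule_format])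
  note f = f[THEN conjunct2]
  show "integrable M (\<lambda>\<omega>. (cmod (w l \<omega>))\<^sup>2)" by (rule f[THEN conjunct1, rule_format])
  note f = f[THEN conjunct2, THEN conjunct2]
  show "AE \<omega> in M. w (- l) \<omega> = cnj (w l \<omega>)" by (rule f[THEN conjunct1, rule_format])
  note f = f[THEN conjunct2]
  show "(LINT \<omega>|M. w l \<omega>) = 0" by (rule f[THEN conjunct1, rule_format])
  note f = f[THEN conjunct2]
  show "l \<noteq> l' \<Longrightarrow> (LINT \<omega>|M. w l \<omega> * cnj (w l' \<omega>)) = 0" by (rule f[THEN conjunct1, rule_format])
  note f = f[THEN conjunct2]
  show "(LINT \<omega>|M. (cmod (w l \<omega>))\<^sup>2) = C l" by (rule f[THEN conjunct1, rule_format])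
  show "C summable_on UNIV" by (rule f[THEN conjunct2])
qed

lemma C_nonneg: "0 \<le> C l"
  by (simp add: w_var[symmetric])

lemma C_neg: "C (- l) = C l"
proof -
  have "(LINT \<omega>|M. (cmod (w (- l) \<omega>))\<^sup>2) = (LINT \<omega>|M. (cmod (w l \<omega>))\<^sup>2)"
    using w_neg[of l] by (intro integral_cong_AE borel_measurable_power borel_measurable_norm_compose w_meas) auto
  then show ?thesis by (simp add: w_var)
qed

lemma cmod_product_bound: "cmod (a * b) \<le> (cmod a)\<^sup>2 + (cmod b)\<^sup>2"
proof -
  have "2 * (cmod a * cmod b) \<le> (cmod a)\<^sup>2 + (cmod b)\<^sup>2"
    using sum_squares_bound[of "cmod a" "cmod b"] by (simp add: mult.assoc)
  moreover have "0 \<le> cmod a * cmod b" by simp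
  ultimately show ?thesis unfolding norm_mult by linarith
qed

lemma integrable_ww: "integrable M (\<lambda>\<omega>. w l \<omega> * w l' \<omega>)" "integrable M (\<lambda>\<omega>. w l \<omega> * cnj (w l' \<omega>))"
proof -
  have i: "integrable M (\<lambda>\<omega>. (cmod (w l \<omega>))\<^sup>2 + (cmod (w l' \<omega>))\<^sup>2)" using w_sq by simp
  have b: "AE \<omega> in M. norm (w l \<omega> * w l' \<omega>) \<le> norm ((cmod (w l \<omega>))\<^sup>2 + (cmod (w l' \<omega>))\<^sup>2)"
    "AE \<omega> in M. norm (w l \<omega> * cnj (w l' \<omega>)) \<le> norm ((cmod (w l \<omega>))\<^sup>2 + (cmod (w l' \<omega>))\<^sup>2)"
    using cmod_product_bound[of "w l _" "w l' _"] by (auto simp: norm_mult)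
  show "integrable M (\<lambda>\<omega>. w l \<omega> * w l' \<omega>)"
    by (rule Bochner_Integration.integrable_bound[OF i _ b(1)]) (intro borel_measurable_times w_meas)
  show "integrable M (\<lambda>\<omega>. w l \<omega> * cnj (w l' \<omega>))"
    by (rule Bochner_Integration.integrable_bound[OF i _ b(2)])
       (intro borel_measurable_times borel_measurable_cnj_compose w_meas)
qed

lemma integrable_w: "integrable M (w l)"
proof (rule Bochner_Integration.integrable_bound)
  show "integrable M (\<lambda>\<omega>. 1 + (cmod (w l \<omega>))\<^sup>2)" using w_sq by simp
  have "cmod z \<le> 1 + (cmod z)\<^sup>2" for z
    using cmod_product_bound[of 1 z] by simp
  then show "AE \<omega> in M. cmod (w l \<omega>) \<le> norm (1 + (cmod (w l \<omega>))\<^sup>2)" by (intro AE_I2) simp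
qed (rule w_meas)

lemma linear_second_moment:
  assumes A: "finite A"
  shows "integrable M (\<lambda>\<omega>. (cmod (\<Sum>l\<in>A. c l * w l \<omega>))\<^sup>2)"
    and "(LINT \<omega>|M. (cmod (\<Sum>l\<in>A. c l * w l \<omega>))\<^sup>2) = (\<Sum>l\<in>A. (cmod (c l))\<^sup>2 * C l)"
proof -
  have eq: "complex_of_real ((cmod (\<Sum>l\<in>A. c l * w l \<omega>))\<^sup>2) = (\<Sum>l\<in>A. \<Sum>l'\<in>A. (c l * cnj (c l')) * (w l \<omega> * cnj (w l' \<omega>)))" for \<omega>
    unfolding complex_norm_square by (simp add: sum_product mult_ac)
  have "integrable M (\<lambda>\<omega>. complex_of_real ((cmod (\<Sum>l\<in>A. c l * w l \<omega>))\<^sup>2))"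
    unfolding eq using integrable_ww by (intro Bochner_Integration.integrable_sum integrable_mult_right)
  then show int: "integrable M (\<lambda>\<omega>. (cmod (\<Sum>l\<in>A. c l * w l \<omega>))\<^sup>2)"
    by (simp only: complex_of_real_integrable_eq)
  have "complex_of_real (LINT \<omega>|M. (cmod (\<Sum>l\<in>A. c l * w l \<omega>))\<^sup>2)
    = (LINT \<omega>|M. (\<Sum>l\<in>A. \<Sum>l'\<in>A. (c l * cnj (c l')) * (w l \<omega> * cnj (w l' \<omega>))))"
    unfolding eq[symmetric] by (rule integral_complex_of_real[symmetric])
  also have "\<dots> = (\<Sum>l\<in>A. \<Sum>l'\<in>A. (c l * cnj (c l')) * (LINT \<omega>|M. w l \<omega> * cnj (w l' \<omega>)))"
    using integrable_ww by (simp add: Bochner_Integration.integral_sum)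
  also have "\<dots> = (\<Sum>l\<in>A. \<Sum>l'\<in>A. if l' = l then complex_of_real ((cmod (c l))\<^sup>2 * C l) else 0)"
  proof (intro sum.cong refl)
    fix l l'
    have "(LINT \<omega>|M. w l \<omega> * cnj (w l \<omega>)) = complex_of_real (C l)"
      unfolding w_var[symmetric] integral_complex_of_real[symmetric] complex_norm_square ..
    then show "(c l * cnj (c l')) * (LINT \<omega>|M. w l \<omega> * cnj (w l' \<omega>)) = (if l' = l then complex_of_real ((cmod (c l))\<^sup>2 * C l) else 0)"
      using w_orth[of l l'] complex_norm_square[of "c l"] by (cases "l' = l") simp_all
  qed
  also have "\<dots> = complex_of_real (\<Sum>l\<in>A. (cmod (c l))\<^sup>2 * C l)"
    using A by simp
  finally show "(LINT \<omega>|M. (cmod (\<Sum>l\<in>A. c l * w l \<omega>))\<^sup>2) = (\<Sum>l\<in>A. (cmod (c l))\<^sup>2 * C l)"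
    by (simp only: of_real_eq_iff)
qed

text \<open>The wavelet coefficient that results from integrating the Fourier series term by term;
  \<open>beta_AE\<close> identifies it with the integral over the path.\<close>

definition bt :: "nat \<Rightarrow> int \<Rightarrow> 'a \<Rightarrow> complex" where
  "bt N k \<omega> = complex_of_real (1 / sqrt (real N)) *
     (\<Sum>l\<in>band N. complex_of_real (aa N l) * (w l \<omega> * cis (of_int l * (of_int k * (2 * pi / real N)))))"

text \<open>Orthogonality of the exponentials pairs l with - l, and evenness of
  \<open>wavelet_a \<phi>\<close> undoes the sign. Every truncation that contains the band gives the
  same value.\<close>

lemma trig_psi_integral:
  fixes c :: "int \<Rightarrow> complex" and t :: real
  assumes A: "finite A" "band N \<subseteq> A"
  shows "set_integrable lborel {-pi..pi} (\<lambda>\<theta>. (\<Sum>l\<in>A. c l * cis (of_int l * \<theta>)) * complex_of_real (psi \<phi> N (\<theta> - t)))"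
    and "(LINT \<theta>:{-pi..pi}|lborel. (\<Sum>l\<in>A. c l * cis (of_int l * \<theta>)) * complex_of_real (psi \<phi> N (\<theta> - t)))
      = complex_of_real (2 * pi) * (complex_of_real (1 / sqrt (real N)) * (\<Sum>l\<in>band N. complex_of_real (aa N l) * (c l * cis (of_int l * t))))"
proof -
  let ?s = "complex_of_real (1 / sqrt (real N))"
  have eq: "(\<Sum>l\<in>A. c l * cis (of_int l * \<theta>)) * complex_of_real (psi \<phi> N (\<theta> - t))
    = (\<Sum>l\<in>A. \<Sum>m\<in>band N. (?s * c l * complex_of_real (aa N m) * cis (- (of_int m * t))) * cis (of_int (l + m) * \<theta>))" for \<theta>
  proof -
    have e: "cis (of_int l * \<theta>) * cis (of_int m * (\<theta> - t)) = cis (- (of_int m * t)) * cis (of_int (l + m) * \<theta>)" for l m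
      unfolding cis_mult by (rule arg_cong[where f=cis]) (simp add: algebra_simps)
    have "(\<Sum>l\<in>A. c l * cis (of_int l * \<theta>)) * complex_of_real (psi \<phi> N (\<theta> - t))
      = (\<Sum>l\<in>A. \<Sum>m\<in>band N. (?s * c l * complex_of_real (aa N m)) * (cis (of_int l * \<theta>) * cis (of_int m * (\<theta> - t))))"
      unfolding psi_complex sum_distrib_left sum_distrib_right
      by (rule trans[OF sum.swap]) (simp only: mult_ac)
    then show ?thesis unfolding e by (simp only: mult.assoc)
  qed
  have i1: "set_integrable lborel {-pi..pi} (\<lambda>\<theta>. a * cis (of_int d * \<theta>))" for a d
    using integral_cis(1)[of d] by (rule set_integrable_mult_right)
  show "set_integrable lborel {-pi..pi} (\<lambda>\<theta>. (\<Sum>l\<in>A. c l * cis (of_int l * \<theta>)) * complex_of_real (psi \<phi> N (\<theta> - t)))"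
    unfolding eq by (intro set_integral_sum(1) i1)
  have "(LINT \<theta>:{-pi..pi}|lborel. (\<Sum>l\<in>A. c l * cis (of_int l * \<theta>)) * complex_of_real (psi \<phi> N (\<theta> - t)))
    = (\<Sum>l\<in>A. \<Sum>m\<in>band N. (?s * c l * complex_of_real (aa N m) * cis (- (of_int m * t))) * (if l + m = 0 then complex_of_real (2 * pi) else 0))"
  proof -
    have I: "set_integrable lborel {-pi..pi} (\<lambda>\<theta>. \<Sum>m\<in>band N. f m * cis (of_int (l + m) * \<theta>))" for f l
      by (intro set_integral_sum(1) i1)
    have V: "(LINT \<theta>:{-pi..pi}|lborel. (\<Sum>m\<in>band N. f m * cis (of_int (l + m) * \<theta>))) = (\<Sum>m\<in>band N. f m * (if l + m = 0 then complex_of_real (2 * pi) else 0))" for f l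
      unfolding set_integral_sum(2)[OF i1] by (simp only: set_integral_mult_right integral_cis(2))
    show ?thesis unfolding eq set_integral_sum(2)[OF I] V ..
  qed
  also have "\<dots> = (\<Sum>m\<in>band N. \<Sum>l\<in>A. if l = - m then ?s * c (- m) * complex_of_real (aa N m) * cis (- (of_int m * t)) * complex_of_real (2 * pi) else 0)"
    by (rule trans[OF sum.swap]) (intro sum.cong refl, auto simp: add_eq_0_iff2)
  also have "\<dots> = (\<Sum>m\<in>band N. ?s * c (- m) * complex_of_real (aa N m) * cis (- (of_int m * t)) * complex_of_real (2 * pi))"
  proof (intro sum.cong refl)
    fix m assume "m \<in> band N"
    then have "- m \<in> A" using A(2) by (auto simp: band_def)
    then show "(\<Sum>l\<in>A. if l = - m then ?s * c (- m) * complex_of_real (aa N m) * cis (- (of_int m * t)) * complex_of_real (2 * pi) else 0)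
      = ?s * c (- m) * complex_of_real (aa N m) * cis (- (of_int m * t)) * complex_of_real (2 * pi)"
      using A(1) by simp
  qed
  also have "\<dots> = (\<Sum>l\<in>band N. ?s * c l * complex_of_real (aa N l) * cis (of_int l * t) * complex_of_real (2 * pi))"
    by (rule sum.reindex_bij_witness[of _ uminus uminus]) (auto simp: band_def a_even)
  finally show "(LINT \<theta>:{-pi..pi}|lborel. (\<Sum>l\<in>A. c l * cis (of_int l * \<theta>)) * complex_of_real (psi \<phi> N (\<theta> - t)))
      = complex_of_real (2 * pi) * (?s * (\<Sum>l\<in>band N. complex_of_real (aa N l) * (c l * cis (of_int l * t))))"
    by (simp add: sum_distrib_left mult_ac)
qed

text \<open>The partial sums of the Fourier series converge in \<open>L\<^sup>2(M)\<close> boundedly in \<open>\<theta>\<close>, so Fubini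
  turns the error of the wavelet coefficient, which does not depend on the truncation, into zero.\<close>
lemma beta_AE: "AE \<omega> in M. complex_of_real (beta X \<phi> N k \<omega>) = bt N k \<omega>"
proof -
  define t where "t = of_int k * (2 * pi / real N)"
  \<comment> \<open>The torus as a finite measure space, so that constants are integrable and Fubini
    applies together with \<open>M\<close>.\<close>
  define \<Theta> where "\<Theta> = restrict_space lborel {-pi..pi::real}"
  have sp: "space \<Theta> = {-pi..pi}" by (simp add: \<Theta>_def space_restrict_space)
  have emT: "emeasure \<Theta> (space \<Theta>) = ennreal (2 * pi)"
    unfolding \<Theta>_def sp[unfolded \<Theta>_def] by (subst emeasure_restrict_space) auto
  interpret T: finite_measure \<Theta> by (rule finite_measureI) (simp add: emT)
  interpret MT: pair_sigma_finite M \<Theta> ..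
  have id[measurable]: "(\<lambda>x. x) \<in> measurable \<Theta> borel"
    unfolding \<Theta>_def by (rule measurable_restrict_space1) simp
  have int\<Theta>: "(LINT \<theta>|\<Theta>. f \<theta>) = (LINT \<theta>:{-pi..pi}|lborel. f \<theta>)" for f :: "real \<Rightarrow> complex"
    unfolding \<Theta>_def set_lebesgue_integral_def by (rule integral_restrict_space) simp
  have int\<Theta>r: "(LINT \<theta>|\<Theta>. f \<theta>) = (LINT \<theta>:{-pi..pi}|lborel. f \<theta>)" for f :: "real \<Rightarrow> real"
    unfolding \<Theta>_def set_lebesgue_integral_def by (rule integral_restrict_space) simp
  have integ\<Theta>: "integrable \<Theta> f = set_integrable lborel {-pi..pi} f" for f :: "real \<Rightarrow> complex"
    unfolding \<Theta>_def set_integrable_def by (rule integrable_restrict_space) simp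
  note [measurable] = w_meas
  have Xm[measurable]: "(\<lambda>(\<omega>, \<theta>). X \<theta> \<omega>) \<in> borel_measurable (M \<Otimes>\<^sub>M \<Theta>)"
  proof -
    have "(\<lambda>p. (snd p, fst p)) \<in> measurable (M \<Otimes>\<^sub>M \<Theta>) (borel \<Otimes>\<^sub>M M)" by measurable
    from measurable_compose[OF this X_meas] show ?thesis by (simp add: case_prod_beta')
  qed
  have X\<theta>: "X \<theta> \<in> borel_measurable M" for \<theta>
    using measurable_compose[OF measurable_Pair1' X_meas, of \<theta>] by simp
  define \<psi> where "\<psi> \<theta> = psi \<phi> N (\<theta> - t)" for \<theta>
  define c where "c = 1 / sqrt (real N) * real (card (band N))"
  have \<psi>c: "\<bar>\<psi> \<theta>\<bar> \<le> c" for \<theta> unfolding \<psi>_def c_def by (rule psi_bound)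
  have c0: "0 \<le> c" unfolding c_def by simp
  have [measurable]: "\<psi> \<in> borel_measurable borel"
    unfolding \<psi>_def by (intro borel_measurable_continuous_onI continuous_on_compose2[OF psi_continuous] continuous_intros) auto
  have \<psi>m[measurable]: "\<psi> \<in> borel_measurable \<Theta>"
    using measurable_compose[OF id, of \<psi>] by simp
  define Sn where "Sn n \<theta> \<omega> = (\<Sum>l\<in>{- int n..int n}. w l \<omega> * cis (of_int l * \<theta>))" for n :: nat and \<theta> \<omega>
  define D where "D n \<theta> \<omega> = complex_of_real (X \<theta> \<omega>) - Sn n \<theta> \<omega>" for n \<theta> \<omega>
  have cism[measurable]: "(\<lambda>\<theta>. cis (of_int l * \<theta>)) \<in> borel_measurable \<Theta>" for l
  proof -
    have "(\<lambda>\<theta>. cis (of_int l * \<theta>)) \<in> borel_measurable borel"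
      by (intro borel_measurable_continuous_onI) (auto intro!: continuous_intros simp: cis_conv_exp)
    from measurable_compose[OF id this] show ?thesis .
  qed
  have Dm[measurable]: "(\<lambda>(\<omega>, \<theta>). D n \<theta> \<omega>) \<in> borel_measurable (M \<Otimes>\<^sub>M \<Theta>)" for n
    unfolding D_def Sn_def case_prod_beta'
    by (intro borel_measurable_diff measurable_compose[OF _ borel_measurable_of_real] borel_measurable_sum borel_measurable_times
        measurable_compose[OF measurable_fst w_meas] measurable_compose[OF measurable_snd cism] Xm[unfolded case_prod_beta'])
  have D\<theta>m: "D n \<theta> \<in> borel_measurable M" for n \<theta>
    unfolding D_def[abs_def] Sn_def using X\<theta> by measurable
  \<comment> \<open>By stationarity the second moment is the same at all points. This yields a
    majorant for the mean error that does not depend on the point.\<close>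
  define v0 where "v0 = expectation (\<lambda>\<omega>. (X 0 \<omega>)\<^sup>2)"
  have v0: "expectation (\<lambda>\<omega>. (X \<theta> \<omega>)\<^sup>2) = v0" for \<theta>
    using X_stat[of 0 \<theta> 0] by (simp add: v0_def power2_eq_square)
  have Sn_eq: "Sn n \<theta> \<omega> = (\<Sum>l\<in>{- int n..int n}. cis (of_int l * \<theta>) * w l \<omega>)" for n \<theta> \<omega>
    by (simp add: Sn_def mult.commute)
  have Sint: "integrable M (\<lambda>\<omega>. (cmod (Sn n \<theta> \<omega>))\<^sup>2)" and Sval: "expectation (\<lambda>\<omega>. (cmod (Sn n \<theta> \<omega>))\<^sup>2) \<le> infsum C UNIV" for n \<theta>
  proof -
    show "integrable M (\<lambda>\<omega>. (cmod (Sn n \<theta> \<omega>))\<^sup>2)"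
      unfolding Sn_eq by (rule linear_second_moment(1)) simp
    have "expectation (\<lambda>\<omega>. (cmod (Sn n \<theta> \<omega>))\<^sup>2) = (\<Sum>l\<in>{- int n..int n}. C l)"
      unfolding Sn_eq by (subst linear_second_moment(2)) auto
    also have "\<dots> \<le> infsum C UNIV"
      by (rule finite_sum_le_infsum[OF C_summable]) (auto simp: C_nonneg)
    finally show "expectation (\<lambda>\<omega>. (cmod (Sn n \<theta> \<omega>))\<^sup>2) \<le> infsum C UNIV" .
  qed
  have Dsq: "(cmod (D n \<theta> \<omega>))\<^sup>2 \<le> 2 * (X \<theta> \<omega>)\<^sup>2 + 2 * (cmod (Sn n \<theta> \<omega>))\<^sup>2" for n \<theta> \<omega>
  proof -
    have "cmod (D n \<theta> \<omega>) \<le> \<bar>X \<theta> \<omega>\<bar> + cmod (Sn n \<theta> \<omega>)"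
      unfolding D_def using norm_triangle_ineq4[of "complex_of_real (X \<theta> \<omega>)" "Sn n \<theta> \<omega>"] by simp
    then have "(cmod (D n \<theta> \<omega>))\<^sup>2 \<le> (\<bar>X \<theta> \<omega>\<bar> + cmod (Sn n \<theta> \<omega>))\<^sup>2" by (intro power_mono) auto
    also have "\<dots> \<le> 2 * (X \<theta> \<omega>)\<^sup>2 + 2 * (cmod (Sn n \<theta> \<omega>))\<^sup>2"
      using sum_squares_bound[of "\<bar>X \<theta> \<omega>\<bar>" "cmod (Sn n \<theta> \<omega>)"] by (simp add: power2_sum)
    finally show ?thesis .
  qed
  have Dint2: "integrable M (\<lambda>\<omega>. (cmod (D n \<theta> \<omega>))\<^sup>2)" for n \<theta>
  proof (rule integrable_abs_bound)
    show "integrable M (\<lambda>\<omega>. 2 * (X \<theta> \<omega>)\<^sup>2 + 2 * (cmod (Sn n \<theta> \<omega>))\<^sup>2)" using X_sq Sint by simp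
    show "(\<lambda>\<omega>. (cmod (D n \<theta> \<omega>))\<^sup>2) \<in> borel_measurable M"
      by (intro borel_measurable_power borel_measurable_norm_compose D\<theta>m)
  qed (use Dsq in simp)
  have Dint1: "integrable M (\<lambda>\<omega>. cmod (D n \<theta> \<omega>))" for n \<theta>
  proof (rule integrable_abs_bound)
    show "integrable M (\<lambda>\<omega>. 1 + (cmod (D n \<theta> \<omega>))\<^sup>2)" using Dint2 by simp
    show "\<bar>cmod (D n \<theta> \<omega>)\<bar> \<le> 1 + (cmod (D n \<theta> \<omega>))\<^sup>2" for \<omega>
      using cmod_product_bound[of 1 "D n \<theta> \<omega>"] by simp
  qed (intro borel_measurable_norm_compose D\<theta>m)
  define g where "g n \<theta> = expectation (\<lambda>\<omega>. cmod (D n \<theta> \<omega>))" for n \<theta>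
  have g0: "0 \<le> g n \<theta>" for n \<theta> unfolding g_def by simp
  have gsq: "(g n \<theta>)\<^sup>2 \<le> expectation (\<lambda>\<omega>. (cmod (D n \<theta> \<omega>))\<^sup>2)" for n \<theta>
  proof -
    have "0 \<le> expectation (\<lambda>\<omega>. (cmod (D n \<theta> \<omega>) - g n \<theta>)\<^sup>2)" by simp
    also have "\<dots> = expectation (\<lambda>\<omega>. (cmod (D n \<theta> \<omega>))\<^sup>2) - (g n \<theta>)\<^sup>2"
      unfolding g_def using Dint1 Dint2 by (rule variance_eq)
    finally show ?thesis by simp
  qed
  have gbound: "g n \<theta> \<le> 1 + (2 * v0 + 2 * infsum C UNIV)" for n \<theta>
  proof -
    have "g n \<theta> \<le> 1 + (g n \<theta>)\<^sup>2" using cmod_product_bound[of 1 "complex_of_real (g n \<theta>)"] g0[of n \<theta>] by simp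
    also have "\<dots> \<le> 1 + expectation (\<lambda>\<omega>. 2 * (X \<theta> \<omega>)\<^sup>2 + 2 * (cmod (Sn n \<theta> \<omega>))\<^sup>2)"
    proof -
      have "expectation (\<lambda>\<omega>. (cmod (D n \<theta> \<omega>))\<^sup>2) \<le> expectation (\<lambda>\<omega>. 2 * (X \<theta> \<omega>)\<^sup>2 + 2 * (cmod (Sn n \<theta> \<omega>))\<^sup>2)"
        by (rule integral_mono[OF Dint2 _ Dsq]) (use X_sq Sint in simp)
      then show ?thesis using gsq[of n \<theta>] by linarith
    qed
    also have "\<dots> \<le> 1 + (2 * v0 + 2 * infsum C UNIV)"
      using X_sq Sint Sval[of n \<theta>] by (simp add: v0)
    finally show ?thesis .
  qed
  have glim: "(\<lambda>n. g n \<theta>) \<longlonglongrightarrow> 0" for \<theta>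
  proof -
    have "(\<lambda>n. expectation (\<lambda>\<omega>. (cmod (D n \<theta> \<omega>))\<^sup>2)) \<longlonglongrightarrow> 0"
      unfolding D_def Sn_def by (rule X_series)
    then have "(\<lambda>n. sqrt (expectation (\<lambda>\<omega>. (cmod (D n \<theta> \<omega>))\<^sup>2))) \<longlonglongrightarrow> sqrt 0"
      by (rule tendsto_real_sqrt)
    then have lim: "(\<lambda>n. sqrt (expectation (\<lambda>\<omega>. (cmod (D n \<theta> \<omega>))\<^sup>2))) \<longlonglongrightarrow> 0"
      by (simp only: real_sqrt_zero)
    have nb: "norm (g n \<theta>) \<le> sqrt (expectation (\<lambda>\<omega>. (cmod (D n \<theta> \<omega>))\<^sup>2))" for n
      using gsq[of n \<theta>] g0[of n \<theta>] by (simp add: real_le_rsqrt)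
    show ?thesis
      by (rule Lim_null_comparison[OF always_eventually[OF allI[OF nb]] lim])
  qed
  have gm: "g n \<in> borel_measurable \<Theta>" for n
    unfolding g_def[abs_def]
  proof (rule borel_measurable_lebesgue_integral)
    have "(\<lambda>(\<theta>, \<omega>). D n \<theta> \<omega>) \<in> borel_measurable (\<Theta> \<Otimes>\<^sub>M M)"
      using measurable_compose[OF measurable_pair_swap' Dm[of n]] by (simp add: case_prod_beta')
    then show "(\<lambda>(\<theta>, \<omega>). cmod (D n \<theta> \<omega>)) \<in> borel_measurable (\<Theta> \<Otimes>\<^sub>M M)"
      unfolding case_prod_beta' by (rule borel_measurable_norm_compose)
  qed
  have gT: "(\<lambda>n. LINT \<theta>|\<Theta>. g n \<theta>) \<longlonglongrightarrow> (LINT \<theta>|\<Theta>. 0)"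
    by (rule integral_dominated_convergence[where w="\<lambda>_. 1 + (2 * v0 + 2 * infsum C UNIV)"])
       (use gm glim g0 gbound in auto)
  have psf: "pair_sigma_finite \<Theta> M" ..
  have Xprod: "integrable (M \<Otimes>\<^sub>M \<Theta>) (\<lambda>(\<omega>, \<theta>). (X \<theta> \<omega>)\<^sup>2)"
  proof -
    have "integrable (\<Theta> \<Otimes>\<^sub>M M) (\<lambda>(\<theta>, \<omega>). (X \<theta> \<omega>)\<^sup>2)"
    proof (rule pair_sigma_finite.Fubini_integrable)
      show "pair_sigma_finite \<Theta> M" by (rule psf)
      have "(\<lambda>p. (snd p, fst p)) \<in> measurable (\<Theta> \<Otimes>\<^sub>M M) (M \<Otimes>\<^sub>M \<Theta>)" by measurable
      from measurable_compose[OF this Xm] show "(\<lambda>(\<theta>, \<omega>). (X \<theta> \<omega>)\<^sup>2) \<in> borel_measurable (\<Theta> \<Otimes>\<^sub>M M)"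
        by (simp add: case_prod_beta')
    qed (use X_sq in \<open>auto simp: v0\<close>)
    from pair_sigma_finite.integrable_product_swap[OF psf this] show ?thesis by (simp add: case_prod_beta')
  qed
  have Xprod1: "integrable (M \<Otimes>\<^sub>M \<Theta>) (\<lambda>(\<omega>, \<theta>). complex_of_real (X \<theta> \<omega>))"
  proof (rule Bochner_Integration.integrable_bound)
    have fin: "emeasure (M \<Otimes>\<^sub>M \<Theta>) (space (M \<Otimes>\<^sub>M \<Theta>)) < \<infinity>"
      unfolding space_pair_measure by (subst T.emeasure_pair_measure_Times) (auto simp: emT emeasure_space_1)
    then have "integrable (M \<Otimes>\<^sub>M \<Theta>) (\<lambda>_. 1::real)"
      by (intro finite_measure.integrable_const finite_measureI) auto
    then show "integrable (M \<Otimes>\<^sub>M \<Theta>) (\<lambda>p. 1 + (X (snd p) (fst p))\<^sup>2)"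
      using Xprod by (intro Bochner_Integration.integrable_add) (auto simp: case_prod_beta')
    show "(\<lambda>(\<omega>, \<theta>). complex_of_real (X \<theta> \<omega>)) \<in> borel_measurable (M \<Otimes>\<^sub>M \<Theta>)"
      unfolding case_prod_beta' by (rule measurable_compose[OF Xm[unfolded case_prod_beta'] borel_measurable_of_real])
    have "\<bar>y\<bar> \<le> 1 + y\<^sup>2" for y :: real using cmod_product_bound[of 1 "complex_of_real y"] by simp
    then show "AE p in M \<Otimes>\<^sub>M \<Theta>. norm (case p of (\<omega>, \<theta>) \<Rightarrow> complex_of_real (X \<theta> \<omega>)) \<le> norm (1 + (X (snd p) (fst p))\<^sup>2)"
      by (intro AE_I2) (simp add: case_prod_beta')
  qed
  have wprod: "integrable (M \<Otimes>\<^sub>M \<Theta>) (\<lambda>(\<omega>, \<theta>). w l \<omega> * cis (of_int l * \<theta>))" for l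
  proof (rule MT.Fubini_integrable)
    show "(\<lambda>(\<omega>, \<theta>). w l \<omega> * cis (of_int l * \<theta>)) \<in> borel_measurable (M \<Otimes>\<^sub>M \<Theta>)"
      unfolding case_prod_beta'
      by (intro borel_measurable_times measurable_compose[OF measurable_fst w_meas] measurable_compose[OF measurable_snd cism])
    show "integrable M (\<lambda>\<omega>. LINT \<theta>|\<Theta>. norm (case (\<omega>, \<theta>) of (\<omega>, \<theta>) \<Rightarrow> w l \<omega> * cis (of_int l * \<theta>)))"
      using integrable_w[of l] by (simp add: norm_mult)
    show "AE \<omega> in M. integrable \<Theta> (\<lambda>\<theta>. case (\<omega>, \<theta>) of (\<omega>, \<theta>) \<Rightarrow> w l \<omega> * cis (of_int l * \<theta>))"
      using integral_cis(1)[of l] by (intro AE_I2) (simp add: integ\<Theta>)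
  qed
  have Dprod: "integrable (M \<Otimes>\<^sub>M \<Theta>) (\<lambda>(\<omega>, \<theta>). D n \<theta> \<omega>)" for n
  proof -
    have "integrable (M \<Otimes>\<^sub>M \<Theta>) (\<lambda>p. (case p of (\<omega>, \<theta>) \<Rightarrow> complex_of_real (X \<theta> \<omega>)) - (\<Sum>l\<in>{- int n..int n}. case p of (\<omega>, \<theta>) \<Rightarrow> w l \<omega> * cis (of_int l * \<theta>)))"
      by (intro Bochner_Integration.integrable_diff Xprod1 Bochner_Integration.integrable_sum wprod)
    then show ?thesis by (simp add: D_def Sn_def case_prod_beta')
  qed
  have D\<psi>: "integrable (M \<Otimes>\<^sub>M \<Theta>) (\<lambda>(\<omega>, \<theta>). D n \<theta> \<omega> * complex_of_real (\<psi> \<theta>))" for n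
  proof (rule Bochner_Integration.integrable_bound[OF integrable_mult_right[OF integrable_norm[OF Dprod], of c]])
    show "(\<lambda>(\<omega>, \<theta>). D n \<theta> \<omega> * complex_of_real (\<psi> \<theta>)) \<in> borel_measurable (M \<Otimes>\<^sub>M \<Theta>)"
      using Dm[of n] measurable_compose[OF measurable_snd \<psi>m, of M] by (simp add: case_prod_beta')
    show "AE p in M \<Otimes>\<^sub>M \<Theta>. norm (case p of (\<omega>, \<theta>) \<Rightarrow> D n \<theta> \<omega> * complex_of_real (\<psi> \<theta>)) \<le> norm (c * norm (case p of (\<omega>, \<theta>) \<Rightarrow> D n \<theta> \<omega>))"
    proof (rule AE_I2)
      fix p
      show "norm (case p of (\<omega>, \<theta>) \<Rightarrow> D n \<theta> \<omega> * complex_of_real (\<psi> \<theta>)) \<le> norm (c * norm (case p of (\<omega>, \<theta>) \<Rightarrow> D n \<theta> \<omega>))"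
        using mult_left_mono[OF \<psi>c[of "snd p"], of "cmod (D n (snd p) (fst p))"] c0
        by (simp add: case_prod_beta' norm_mult mult.commute)
    qed
  qed
  \<comment> \<open>\<open>Z\<close> does not involve the truncation: for each \<open>n\<close>
    beyond \<open>N\<close> it equals almost surely the integral of the remainder \<open>D n\<close>
    against the wavelet. Its version \<open>Z0\<close> inherits integrability from Fubini, and its
    mean modulus is below a sequence tending to 0.\<close>
  define Z where "Z \<omega> = (LINT \<theta>|\<Theta>. complex_of_real (X \<theta> \<omega> * \<psi> \<theta>)) - complex_of_real (2 * pi) * bt N k \<omega>" for \<omega>
  have ZD: "AE \<omega> in M. Z \<omega> = (LINT \<theta>|\<Theta>. D n \<theta> \<omega> * complex_of_real (\<psi> \<theta>))" if n: "N \<le> n" for n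
  proof -
    have sub: "band N \<subseteq> {- int n..int n}" using n by (auto simp: band_def)
    have "AE \<omega> in M. integrable \<Theta> (\<lambda>\<theta>. D n \<theta> \<omega> * complex_of_real (\<psi> \<theta>))"
      using MT.AE_integrable_fst'[OF D\<psi>] by simp
    then show ?thesis
    proof eventually_elim
      fix \<omega> assume iD: "integrable \<Theta> (\<lambda>\<theta>. D n \<theta> \<omega> * complex_of_real (\<psi> \<theta>))"
      have iS: "integrable \<Theta> (\<lambda>\<theta>. Sn n \<theta> \<omega> * complex_of_real (\<psi> \<theta>))"
        unfolding integ\<Theta> Sn_def \<psi>_def by (rule trig_psi_integral(1)[OF _ sub]) simp
      have vS: "(LINT \<theta>|\<Theta>. Sn n \<theta> \<omega> * complex_of_real (\<psi> \<theta>)) = complex_of_real (2 * pi) * bt N k \<omega>"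
        unfolding int\<Theta> Sn_def \<psi>_def bt_def t_def[symmetric] by (rule trig_psi_integral(2)[OF _ sub]) simp
      have "(\<lambda>\<theta>. complex_of_real (X \<theta> \<omega> * \<psi> \<theta>)) = (\<lambda>\<theta>. D n \<theta> \<omega> * complex_of_real (\<psi> \<theta>) + Sn n \<theta> \<omega> * complex_of_real (\<psi> \<theta>))"
        by (auto simp: D_def algebra_simps)
      then show "Z \<omega> = (LINT \<theta>|\<Theta>. D n \<theta> \<omega> * complex_of_real (\<psi> \<theta>))"
        unfolding Z_def using iD iS vS by simp
    qed
  qed
  have Zint: "integrable M (\<lambda>\<omega>. LINT \<theta>|\<Theta>. D n \<theta> \<omega> * complex_of_real (\<psi> \<theta>))" for n
    using MT.integrable_fst'[OF D\<psi>] by simp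
  define Z0 where "Z0 \<omega> = (LINT \<theta>|\<Theta>. D N \<theta> \<omega> * complex_of_real (\<psi> \<theta>))" for \<omega>
  have bound: "expectation (\<lambda>\<omega>. cmod (Z0 \<omega>)) \<le> c * (LINT \<theta>|\<Theta>. g n \<theta>)" if n: "N \<le> n" for n
  proof -
    have "expectation (\<lambda>\<omega>. cmod (Z0 \<omega>)) = expectation (\<lambda>\<omega>. cmod (LINT \<theta>|\<Theta>. D n \<theta> \<omega> * complex_of_real (\<psi> \<theta>)))"
    proof (rule integral_cong_AE)
      show "AE \<omega> in M. cmod (Z0 \<omega>) = cmod (LINT \<theta>|\<Theta>. D n \<theta> \<omega> * complex_of_real (\<psi> \<theta>))"
        using ZD[OF n] ZD[OF order_refl] by eventually_elim (simp add: Z0_def)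
    qed (use Zint in \<open>auto simp: Z0_def intro!: borel_measurable_norm_compose borel_measurable_integrable\<close>)
    also have "\<dots> \<le> expectation (\<lambda>\<omega>. LINT \<theta>|\<Theta>. cmod (D n \<theta> \<omega> * complex_of_real (\<psi> \<theta>)))"
    proof (rule integral_mono)
      show "integrable M (\<lambda>\<omega>. LINT \<theta>|\<Theta>. cmod (D n \<theta> \<omega> * complex_of_real (\<psi> \<theta>)))"
        using MT.integrable_fst'[OF integrable_norm[OF D\<psi>[of n]]] by (simp add: case_prod_beta')
    qed (use Zint in auto)
    also have "\<dots> = (LINT \<theta>|\<Theta>. expectation (\<lambda>\<omega>. cmod (D n \<theta> \<omega> * complex_of_real (\<psi> \<theta>))))"
      using MT.Fubini_integral[of "\<lambda>\<omega> \<theta>. cmod (D n \<theta> \<omega> * complex_of_real (\<psi> \<theta>))"] integrable_norm[OF D\<psi>[of n]]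
      by (simp add: case_prod_beta')
    also have "\<dots> = (LINT \<theta>|\<Theta>. g n \<theta> * \<bar>\<psi> \<theta>\<bar>)"
      by (simp add: norm_mult g_def)
    also have "\<dots> \<le> (LINT \<theta>|\<Theta>. g n \<theta> * c)"
    proof (rule integral_mono)
      have gi: "integrable \<Theta> (g n)"
        by (rule T.integrable_const_bound[of _ "1 + (2 * v0 + 2 * infsum C UNIV)"]) (use gm g0 gbound in auto)
      then show "integrable \<Theta> (\<lambda>\<theta>. g n \<theta> * c)" by simp
      show "g n \<theta> * \<bar>\<psi> \<theta>\<bar> \<le> g n \<theta> * c" for \<theta> using g0 \<psi>c by (intro mult_left_mono) auto
      show "integrable \<Theta> (\<lambda>\<theta>. g n \<theta> * \<bar>\<psi> \<theta>\<bar>)"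
      proof (rule integrable_abs_bound)
        show "integrable \<Theta> (\<lambda>\<theta>. g n \<theta> * c)" using gi by simp
        show "\<bar>g n \<theta> * \<bar>\<psi> \<theta>\<bar>\<bar> \<le> g n \<theta> * c" for \<theta> using g0[of n \<theta>] \<psi>c by (simp add: abs_mult mult_left_mono)
      qed (use gm in measurable)
    qed
    finally show ?thesis by (simp add: mult.commute)
  qed
  have "expectation (\<lambda>\<omega>. cmod (Z0 \<omega>)) \<le> 0"
  proof (rule LIMSEQ_le_const)
    show "(\<lambda>n. c * (LINT \<theta>|\<Theta>. g n \<theta>)) \<longlonglongrightarrow> 0"
      using tendsto_mult_left[OF gT, of c] by simp
    show "\<exists>M. \<forall>n\<ge>M. expectation (\<lambda>\<omega>. cmod (Z0 \<omega>)) \<le> c * (LINT \<theta>|\<Theta>. g n \<theta>)"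
      using bound by blast
  qed
  moreover have "0 \<le> expectation (\<lambda>\<omega>. cmod (Z0 \<omega>))" by simp
  ultimately have "expectation (\<lambda>\<omega>. cmod (Z0 \<omega>)) = 0" by linarith
  then have "AE \<omega> in M. cmod (Z0 \<omega>) = 0"
    using Zint[of N] by (subst (asm) integral_nonneg_eq_0_iff_AE) (auto simp: Z0_def)
  with ZD[OF order_refl] show ?thesis
  proof eventually_elim
    fix \<omega> assume "Z \<omega> = (LINT \<theta>|\<Theta>. D N \<theta> \<omega> * complex_of_real (\<psi> \<theta>))" "cmod (Z0 \<omega>) = 0"
    then have "(LINT \<theta>|\<Theta>. complex_of_real (X \<theta> \<omega> * \<psi> \<theta>)) = complex_of_real (2 * pi) * bt N k \<omega>"
      by (simp add: Z_def Z0_def)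
    moreover have "(LINT \<theta>|\<Theta>. complex_of_real (X \<theta> \<omega> * \<psi> \<theta>)) = complex_of_real (LINT \<theta>|\<Theta>. X \<theta> \<omega> * \<psi> \<theta>)"
      by (rule integral_complex_of_real)
    ultimately have "complex_of_real (LINT \<theta>:{-pi..pi}|lborel. X \<theta> \<omega> * \<psi> \<theta>) = complex_of_real (2 * pi) * bt N k \<omega>"
      by (simp only: int\<Theta>r)
    then show "complex_of_real (beta X \<phi> N k \<omega>) = bt N k \<omega>"
      by (simp add: beta_def \<psi>_def t_def)
  qed
qed

end

lemma (in prob_space) gaussian_variable_cos:
  assumes Y: "gaussian_variable M Y" and sq: "integrable M (\<lambda>\<omega>. (Y \<omega>)\<^sup>2)" and mean: "expectation Y = 0"
  shows "expectation (\<lambda>\<omega>. cos (Y \<omega> + \<theta>)) = cos \<theta> * exp (- expectation (\<lambda>\<omega>. (Y \<omega>)\<^sup>2) / 2)"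
proof -
  have Ym[measurable]: "Y \<in> borel_measurable M" using Y by (simp add: gaussian_variable_def)
  obtain \<mu> \<sigma> where cases: "(\<sigma> > 0 \<and> distributed M lborel Y (\<lambda>x. ennreal (normal_density \<mu> \<sigma> x))) \<or> (AE \<omega> in M. Y \<omega> = \<mu>)"
    using Y by (auto simp: gaussian_variable_def)
  then show ?thesis
  proof (elim disjE conjE)
    assume \<sigma>: "0 < \<sigma>" and d: "distributed M lborel Y (\<lambda>x. ennreal (normal_density \<mu> \<sigma> x))"
    have \<mu>: "\<mu> = 0" using normal_distributed_expectation[OF \<sigma> d] mean by simp
    have v: "expectation (\<lambda>\<omega>. (Y \<omega>)\<^sup>2) = \<sigma>\<^sup>2"
      using normal_distributed_variance[OF \<sigma> d] mean by simp
    have "distributed M lborel (\<lambda>x. (Y x - \<mu>) / \<sigma>) (\<lambda>x. ennreal (std_normal_density x))"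
      using normal_standard_normal_convert[OF \<sigma>, of Y \<mu>] d by simp
    then have eq: "distr M lborel (\<lambda>x. Y x / \<sigma>) = std_normal_distribution"
      using distributed_distr_eq_density by (simp add: \<mu>)
    have "cos \<theta> * exp (- \<sigma>\<^sup>2 / 2) = (LINT x|distr M lborel (\<lambda>x. Y x / \<sigma>). cos (\<sigma> * x + \<theta>))"
      unfolding eq std_normal_cos ..
    also have "\<dots> = expectation (\<lambda>\<omega>. cos (\<sigma> * (Y \<omega> / \<sigma>) + \<theta>))"
      by (rule integral_distr) auto
    finally show ?thesis using \<sigma> by (simp add: v)
  next
    assume ae: "AE \<omega> in M. Y \<omega> = \<mu>"
    have "expectation Y = expectation (\<lambda>_. \<mu>)" using ae by (intro integral_cong_AE) auto
    then have \<mu>: "\<mu> = 0" using mean by (simp add: prob_space)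
    have "expectation (\<lambda>\<omega>. (Y \<omega>)\<^sup>2) = expectation (\<lambda>_. 0)"
      using ae by (intro integral_cong_AE) (auto simp: \<mu>)
    moreover have "expectation (\<lambda>\<omega>. cos (Y \<omega> + \<theta>)) = expectation (\<lambda>_. cos \<theta>)"
      using ae by (intro integral_cong_AE) (auto simp: \<mu>)
    ultimately show ?thesis by (simp add: prob_space)
  qed
qed

context wavelet_field
begin

text \<open>The explicit sum for the variance of a coefficient, with l and - l combined;
  \<open>sigma2_eq\<close> shows that it is that variance.\<close>

definition s2 :: "nat \<Rightarrow> real" where
  "s2 N = 2 / real N * (\<Sum>l\<in>{l::nat. 1 \<le> l \<and> 2 * l < N}. C (int l) * (aa N (int l))\<^sup>2)"

definition pw :: "nat \<Rightarrow> nat \<Rightarrow> real" where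
  "pw N l = C (int l) * (aa N (int l))\<^sup>2 / (real N * s2 N)"

lemma tuple_sum_finite:
  "tuple_sum M w C \<phi> N q \<omega> = (\<Sum>ls\<in>{ls. length ls = q \<and> set ls \<subseteq> band N}.
     1 / delta M w C ls * (\<Prod>l\<leftarrow>ls. (cmod (w l \<omega>))\<^sup>2 * (aa N l)\<^sup>2) * fejer N (2 * pi / real N * of_int (sum_list ls)))"
proof -
  let ?f = "\<lambda>ls. 1 / delta M w C ls * (\<Prod>l\<leftarrow>ls. (cmod (w l \<omega>))\<^sup>2 * (aa N l)\<^sup>2) * fejer N (2 * pi / real N * of_int (sum_list ls))"
  have "tuple_sum M w C \<phi> N q \<omega> = infsum ?f {ls. length ls = q \<and> 0 \<notin> set ls}"
    by (simp add: tuple_sum_def)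
  also have "\<dots> = infsum ?f {ls. length ls = q \<and> set ls \<subseteq> band N}"
  proof (rule infsum_cong_neutral)
    fix ls assume "ls \<in> {ls. length ls = q \<and> 0 \<notin> set ls} - {ls. length ls = q \<and> set ls \<subseteq> band N}"
    then obtain l where l: "l \<in> set ls" "l \<notin> band N" by auto
    then have "aa N l = 0" using aa_nonzero(1) by blast
    then have "(cmod (w l \<omega>))\<^sup>2 * (aa N l)\<^sup>2 = 0" by simp
    then have "0 \<in> set (map (\<lambda>l. (cmod (w l \<omega>))\<^sup>2 * (aa N l)\<^sup>2) ls)" using l(1) by force
    then show "?f ls = 0" by (simp add: prod_list_zero_iff)
  qed (auto simp: band_def)
  also have "\<dots> = sum ?f {ls. length ls = q \<and> set ls \<subseteq> band N}"
    using finite_lists_length_eq[OF finite_band, of N q] by (intro infsum_finite) (simp add: conj_commute)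
  finally show ?thesis .
qed

lemma beta_measurable: "beta X \<phi> N k \<in> borel_measurable M"
proof -
  have "(\<lambda>(\<omega>, \<theta>). indicator {-pi..pi} \<theta> *\<^sub>R (X \<theta> \<omega> * psi \<phi> N (\<theta> - of_int k * (2 * pi / real N)))) \<in> borel_measurable (M \<Otimes>\<^sub>M lborel)"
  proof -
    have "(\<lambda>p. (snd p, fst p)) \<in> measurable (M \<Otimes>\<^sub>M lborel) (borel \<Otimes>\<^sub>M M)" by measurable
    from measurable_compose[OF this X_meas] have [measurable]: "(\<lambda>p. X (snd p) (fst p)) \<in> borel_measurable (M \<Otimes>\<^sub>M lborel)"
      by simp
    have [measurable]: "(\<lambda>\<theta>. psi \<phi> N (\<theta> - of_int k * (2 * pi / real N))) \<in> borel_measurable borel"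
      by (intro borel_measurable_continuous_onI continuous_on_compose2[OF psi_continuous] continuous_intros) auto
    show ?thesis unfolding case_prod_beta' by measurable
  qed
  from lborel.borel_measurable_lebesgue_integral[OF this] show ?thesis
    unfolding beta_def[abs_def] set_lebesgue_integral_def by (intro borel_measurable_times) auto
qed

lemma skewness_measurable: "skewness_stat M X \<phi> N \<in> borel_measurable M"
  and kurtosis_measurable: "kurtosis_stat M X \<phi> N \<in> borel_measurable M"
proof -
  note [measurable] = beta_measurable
  show "skewness_stat M X \<phi> N \<in> borel_measurable M"
    unfolding skewness_stat_def[abs_def] beta_hat_def by measurable
  show "kurtosis_stat M X \<phi> N \<in> borel_measurable M"
    unfolding kurtosis_stat_def[abs_def] beta_hat_def by measurable
qed

lemma var_hat_measurable:
  "var_skewness_hat M w C \<phi> N \<in> borel_measurable M" "var_kurtosis_hat M w C \<phi> N \<in> borel_measurable M"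
proof -
  have w2[measurable]: "(\<lambda>\<omega>. (cmod (w l \<omega>))\<^sup>2) \<in> borel_measurable M" for l
    by (intro borel_measurable_power borel_measurable_norm_compose w_meas)
  have pl: "(\<lambda>\<omega>. \<Prod>l\<leftarrow>ls. (cmod (w l \<omega>))\<^sup>2 * (aa N l)\<^sup>2) \<in> borel_measurable M" for ls
    by (induction ls) (auto intro!: borel_measurable_times)
  have [measurable]: "tuple_sum M w C \<phi> N q \<in> borel_measurable M" for q
    unfolding tuple_sum_finite[abs_def]
    by (intro borel_measurable_sum borel_measurable_times borel_measurable_const pl)
  have [measurable]: "sigma2_hat w \<phi> N \<in> borel_measurable M"
    unfolding sigma2_hat_def[abs_def] by measurable
  show "var_skewness_hat M w C \<phi> N \<in> borel_measurable M" "var_kurtosis_hat M w C \<phi> N \<in> borel_measurable M"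
    unfolding var_skewness_hat_def[abs_def] var_kurtosis_hat_def[abs_def] var_kurtosis1_hat_def var_kurtosis2_hat_def
    by measurable
qed

end

section \<open>The Gaussian coordinates at a fixed level\<close>

locale wavelet_level = wavelet_field M \<phi> X w C
  for M :: "'a measure" and \<phi> X w C +
  fixes N :: nat and lam :: real
  assumes N4: "4 \<le> N" and s2_pos: "0 < s2 N"
    and pw_le: "\<And>l. 1 \<le> l \<Longrightarrow> 2 * l < N \<Longrightarrow> real N * pw N l \<le> lam"
begin

sublocale bm: band_model N "pw N" lam
proof
  show "4 \<le> N" by (rule N4)
  show "0 \<le> pw N l" for l using s2_pos C_nonneg by (simp add: pw_def)
  show "(\<Sum>l | 1 \<le> l \<and> 2 * l < N. 2 * pw N l) = 1"
  proof -
    let ?S = "\<Sum>l\<in>{l::nat. 1 \<le> l \<and> 2 * l < N}. C (int l) * (aa N (int l))\<^sup>2"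
    have "(\<Sum>l\<in>{l. 1 \<le> l \<and> 2 * l < N}. 2 * pw N l) = 2 * (?S / (real N * s2 N))"
      by (simp add: pw_def sum_distrib_left sum_divide_distrib)
    also have "\<dots> = s2 N / s2 N" using N4 by (simp add: s2_def)
    finally show ?thesis using s2_pos by simp
  qed
qed (use pw_le in auto)

text \<open>Real and imaginary parts of a coefficient have half its variance each, hence the 2 under
  the root.\<close>

definition xi :: "nat \<times> bool \<Rightarrow> 'a \<Rightarrow> real" where
  "xi i \<omega> = sqrt (2 / C (int (fst i))) * (if snd i then Re (w (int (fst i)) \<omega>) else Im (w (int (fst i)) \<omega>))"

definition xiv :: "'a \<Rightarrow> nat \<times> bool \<Rightarrow> real" where "xiv \<omega> = (\<lambda>i\<in>bm.I. xi i \<omega>)"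

lemma N_pos: "0 < N" using N4 by simp

lemma Cl_pos: "l \<in> bm.L \<Longrightarrow> 0 < C (int l)"
  by (intro C_pos) (auto simp: bm.L_def)

lemma xi_measurable: "xi i \<in> borel_measurable M"
proof -
  have "(\<lambda>\<omega>. Re (w l \<omega>)) \<in> borel_measurable M" "(\<lambda>\<omega>. Im (w l \<omega>)) \<in> borel_measurable M" for l
    using w_meas by measurable
  then show ?thesis unfolding xi_def[abs_def] by (cases "snd i") (auto intro!: borel_measurable_times)
qed

text \<open>\<open>w l'\<close> is the conjugate of \<open>w (- l')\<close>, and \<open>l\<close>
  differs from \<open>- l'\<close>, so orthogonality applies. This vanishing pseudo-covariance makes
  real and imaginary parts uncorrelated with equal variances.\<close>

lemma w_product_mean:
  assumes "1 \<le> l" "1 \<le> l'"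
  shows "(LINT \<omega>|M. w l \<omega> * w l' \<omega>) = 0"
proof -
  have "(LINT \<omega>|M. w l \<omega> * w l' \<omega>) = (LINT \<omega>|M. w l \<omega> * cnj (w (- l') \<omega>))"
    using w_neg[of l'] by (intro integral_cong_AE borel_measurable_times borel_measurable_cnj_compose w_meas) auto
  also have "\<dots> = 0" using assms by (intro w_orth) auto
  finally show ?thesis .
qed

text \<open>By joint Gaussianity a linear form in the coordinates is normal, so its variance
  decides. The form is Re Z for a complex combination Z, and in (Re Z)^2 = (|Z|^2 + Re (Z^2)) / 2
  the last term has mean 0.\<close>

lemma xi_cos:
  "expectation (\<lambda>\<omega>. cos ((\<Sum>i\<in>bm.I. t i * xi i \<omega>) + \<theta>)) = cos \<theta> * exp (- (\<Sum>i\<in>bm.I. (t i)\<^sup>2) / 2)"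
proof -
  define A where "A = int ` bm.L"
  define c where "c l = complex_of_real (sqrt (2 / C l)) * Complex (t (nat l, True)) (- t (nat l, False))" for l :: int
  define Z where "Z \<omega> = (\<Sum>l\<in>A. c l * w l \<omega>)" for \<omega>
  define Y where "Y \<omega> = (\<Sum>l\<in>A. Re (c l * w l \<omega>))" for \<omega>
  have finA: "finite A" unfolding A_def using bm.finite_L by simp
  have A1: "1 \<le> l" if "l \<in> A" for l using that by (auto simp: A_def bm.L_def)
  have Y_eq: "Y \<omega> = (\<Sum>i\<in>bm.I. t i * xi i \<omega>)" for \<omega>
    unfolding Y_def A_def bm.sum_I
    by (subst sum.reindex) (auto simp: c_def xi_def algebra_simps intro!: sum.cong)
  have YZ: "Y \<omega> = Re (Z \<omega>)" for \<omega> by (simp add: Y_def Z_def)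
  have g: "gaussian_variable M Y"
    using gaussian finA unfolding jointly_gaussian_def Y_def[abs_def] by blast
  have iZ: "integrable M Z" unfolding Z_def[abs_def] using integrable_w by simp
  have EZ: "(LINT \<omega>|M. Z \<omega>) = 0"
    unfolding Z_def using integrable_w w_mean by (subst Bochner_Integration.integral_sum) auto
  have mean: "expectation Y = 0"
    unfolding YZ[abs_def] using EZ iZ by simp
  have iZ2: "integrable M (\<lambda>\<omega>. (cmod (Z \<omega>))\<^sup>2)" and EZ2: "(LINT \<omega>|M. (cmod (Z \<omega>))\<^sup>2) = (\<Sum>l\<in>A. (cmod (c l))\<^sup>2 * C l)"
    unfolding Z_def by (rule linear_second_moment[OF finA])+
  have ZZ: "Z \<omega> * Z \<omega> = (\<Sum>l\<in>A. \<Sum>l'\<in>A. c l * c l' * (w l \<omega> * w l' \<omega>))" for \<omega>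
    unfolding Z_def sum_product by (simp add: mult_ac)
  have iZZ: "integrable M (\<lambda>\<omega>. Z \<omega> * Z \<omega>)"
    unfolding ZZ using integrable_ww by (intro Bochner_Integration.integrable_sum integrable_mult_right)
  have EZZ: "(LINT \<omega>|M. Z \<omega> * Z \<omega>) = 0"
  proof -
    have "(LINT \<omega>|M. Z \<omega> * Z \<omega>) = (\<Sum>l\<in>A. \<Sum>l'\<in>A. c l * c l' * (LINT \<omega>|M. w l \<omega> * w l' \<omega>))"
      unfolding ZZ using integrable_ww by (simp add: Bochner_Integration.integral_sum)
    also have "\<dots> = 0" using w_product_mean A1 by (intro sum.neutral ballI) auto
    finally show ?thesis .
  qed
  have Ysq: "(Y \<omega>)\<^sup>2 = ((cmod (Z \<omega>))\<^sup>2 + Re (Z \<omega> * Z \<omega>)) / 2" for \<omega>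
    unfolding YZ cmod_power2 by (simp add: power2_eq_square)
  have sq: "integrable M (\<lambda>\<omega>. (Y \<omega>)\<^sup>2)"
    unfolding Ysq using iZ2 iZZ by (intro integrable_divide Bochner_Integration.integrable_add integrable_Re)
  have "expectation (\<lambda>\<omega>. (Y \<omega>)\<^sup>2) = ((LINT \<omega>|M. (cmod (Z \<omega>))\<^sup>2) + (LINT \<omega>|M. Re (Z \<omega> * Z \<omega>))) / 2"
    unfolding Ysq using iZ2 integrable_Re[OF iZZ] by simp
  also have "(LINT \<omega>|M. Re (Z \<omega> * Z \<omega>)) = Re (LINT \<omega>|M. Z \<omega> * Z \<omega>)"
    by (rule integral_Re[OF iZZ])
  also have "((LINT \<omega>|M. (cmod (Z \<omega>))\<^sup>2) + Re (LINT \<omega>|M. Z \<omega> * Z \<omega>)) / 2 = (\<Sum>l\<in>A. (cmod (c l))\<^sup>2 * C l) / 2"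
    unfolding EZ2 EZZ by simp
  also have "\<dots> = (\<Sum>l\<in>A. (t (nat l, True))\<^sup>2 + (t (nat l, False))\<^sup>2)"
    unfolding sum_divide_distrib
  proof (rule sum.cong[OF refl])
    fix l assume "l \<in> A"
    then have "0 < C l" using A1 C_pos by auto
    then show "(cmod (c l))\<^sup>2 * C l / 2 = (t (nat l, True))\<^sup>2 + (t (nat l, False))\<^sup>2"
      by (simp add: c_def norm_mult power_mult_distrib complex_norm)
  qed
  also have "\<dots> = (\<Sum>i\<in>bm.I. (t i)\<^sup>2)"
    unfolding A_def bm.sum_I by (subst sum.reindex) auto
  finally have "expectation (\<lambda>\<omega>. (Y \<omega>)\<^sup>2) = (\<Sum>i\<in>bm.I. (t i)\<^sup>2)" .
  then show ?thesis
    using gaussian_variable_cos[OF g sq mean, of \<theta>] unfolding Y_eq by simp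
qed

lemma xiv_measurable: "xiv \<in> measurable M (gauss bm.I)"
  and xiv_distr: "distr M (gauss bm.I) xiv = gauss bm.I"
  unfolding xiv_def[abs_def]
  using gaussian_family_distr[OF bm.finite_I xi_measurable xi_cos] by auto

text \<open>Means over the original space become means over the canonical one, where integration by
  parts and the Poincare inequality are available.\<close>

lemma xiv_transfer:
  fixes f :: "(nat \<times> bool \<Rightarrow> real) \<Rightarrow> real"
  assumes "f \<in> borel_measurable (gauss bm.I)"
  shows "expectation (\<lambda>\<omega>. f (xiv \<omega>)) = (LINT x|gauss bm.I. f x)"
  using integral_distr[OF xiv_measurable assms] unfolding xiv_distr by simp

lemma Band_eq: "bm.Band = band N"
  by (simp add: bm.Band_def band_def)

lemma pp_eq: "bm.pp l = C l * (aa N l)\<^sup>2 / (real N * s2 N)"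
proof (cases "0 \<le> l")
  case True
  then show ?thesis by (simp add: bm.pp_def pw_def)
next
  case False
  then have e: "int (nat \<bar>l\<bar>) = - l" by simp
  show ?thesis unfolding bm.pp_def pw_def e C_neg aa_even ..
qed

lemma V_AE: "AE \<omega> in M. \<forall>l\<in>bm.Band. (cmod (w l \<omega>))\<^sup>2 = C l * bm.V (nat \<bar>l\<bar>) (xiv \<omega>)"
proof -
  have "AE \<omega> in M. (cmod (w l \<omega>))\<^sup>2 = C l * bm.V (nat \<bar>l\<bar>) (xiv \<omega>)" if l: "l \<in> bm.Band" for l
  proof -
    define m where "m = nat \<bar>l\<bar>"
    have m: "m \<in> bm.L" using l by (auto simp: m_def bm.Band_def bm.L_def)
    have pos: "(cmod (w (int m) \<omega>))\<^sup>2 = C (int m) * bm.V m (xiv \<omega>)" for \<omega>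
      using m Cl_pos[OF m]
      by (simp add: bm.V_def xiv_def xi_def bm.I_def cmod_power2 power_mult_distrib field_simps)
    have "l = int m \<or> l = - int m" by (auto simp: m_def)
    then show ?thesis
    proof
      assume "l = int m"
      then show ?thesis using pos by simp
    next
      assume l: "l = - int m"
      show ?thesis
        using w_neg[of "int m"]
      proof eventually_elim
        fix \<omega> assume "w (- int m) \<omega> = cnj (w (int m) \<omega>)"
        then show "(cmod (w l \<omega>))\<^sup>2 = C l * bm.V (nat \<bar>l\<bar>) (xiv \<omega>)"
          using pos[of \<omega>] by (simp add: l C_neg)
      qed
    qed
  qed
  then show ?thesis using bm.finite_Band by (intro AE_finite_allI) auto
qed

text \<open>The terms of l and - l are conjugate and add up to twice a real part, which is the share
  of frequency l in \<open>G k\<close>.\<close>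

lemma bt_AE: "AE \<omega> in M. \<forall>k. bt N k \<omega> = complex_of_real (sqrt (s2 N) * bm.G k (xiv \<omega>))"
proof -
  have "AE \<omega> in M. \<forall>l\<in>bm.L. w (- int l) \<omega> = cnj (w (int l) \<omega>)"
    using bm.finite_L w_neg by (intro AE_finite_allI) auto
  then show ?thesis
  proof eventually_elim
    fix \<omega> assume neg: "\<forall>l\<in>bm.L. w (- int l) \<omega> = cnj (w (int l) \<omega>)"
    show "\<forall>k. bt N k \<omega> = complex_of_real (sqrt (s2 N) * bm.G k (xiv \<omega>))"
    proof
      fix k
      have "bt N k \<omega> = (\<Sum>l\<in>bm.L. complex_of_real (1 / sqrt (real N)) * (complex_of_real (aa N (int l)) * (w (int l) \<omega> * cis (bm.freq l k))
          + complex_of_real (aa N (- int l)) * (w (- int l) \<omega> * cis (- bm.freq l k))))"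
        unfolding bt_def Band_eq[symmetric] bm.sum_Band sum_distrib_left
        by (simp add: bm.freq_def mult_ac)
      also have "\<dots> = (\<Sum>l\<in>bm.L. complex_of_real (sqrt (s2 N) * (bm.A k (l, True) * xiv \<omega> (l, True) + bm.A k (l, False) * xiv \<omega> (l, False))))"
      proof (rule sum.cong[OF refl])
        fix l assume l: "l \<in> bm.L"
        let ?a = "aa N (int l)" and ?w = "w (int l) \<omega>" and ?f = "bm.freq l k"
        have C: "0 < C (int l)" by (rule Cl_pos[OF l])
        have a: "0 \<le> ?a" by (rule a_nonneg)
        have sp: "sqrt (s2 N) * sqrt (2 * pw N l) * sqrt (2 / C (int l)) = 2 * ?a / sqrt (real N)"
        proof -
          have "sqrt (s2 N) * sqrt (2 * pw N l) * sqrt (2 / C (int l)) = sqrt (s2 N * (2 * pw N l) * (2 / C (int l)))"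
            by (simp only: real_sqrt_mult)
          also have "s2 N * (2 * pw N l) * (2 / C (int l)) = (2 * ?a)\<^sup>2 / real N"
            using C s2_pos N_pos by (simp add: pw_def power2_eq_square)
          finally show ?thesis using a by (simp only: real_sqrt_divide real_sqrt_abs)
        qed
        have "sqrt (s2 N) * (bm.A k (l, True) * xiv \<omega> (l, True) + bm.A k (l, False) * xiv \<omega> (l, False))
          = sqrt (s2 N) * sqrt (2 * pw N l) * sqrt (2 / C (int l)) * (Re ?w * cos ?f - Im ?w * sin ?f)"
          using l by (simp add: bm.A_def xiv_def xi_def bm.I_def algebra_simps)
        also have "\<dots> = 1 / sqrt (real N) * (?a * (2 * Re (?w * cis ?f)))"
          unfolding sp by simp
        finally have *: "sqrt (s2 N) * (bm.A k (l, True) * xiv \<omega> (l, True) + bm.A k (l, False) * xiv \<omega> (l, False))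
          = 1 / sqrt (real N) * (?a * (2 * Re (?w * cis ?f)))" .
        have cc: "?w * cis ?f + cnj ?w * cis (- ?f) = complex_of_real (2 * Re (?w * cis ?f))"
          by (simp add: complex_eq_iff)
        show "complex_of_real (1 / sqrt (real N)) * (complex_of_real (aa N (int l)) * (w (int l) \<omega> * cis (bm.freq l k))
          + complex_of_real (aa N (- int l)) * (w (- int l) \<omega> * cis (- bm.freq l k)))
          = complex_of_real (sqrt (s2 N) * (bm.A k (l, True) * xiv \<omega> (l, True) + bm.A k (l, False) * xiv \<omega> (l, False)))"
          unfolding * aa_even using neg l by (simp only: of_real_mult distrib_left[symmetric] cc)
      qed
      also have "\<dots> = complex_of_real (sqrt (s2 N) * bm.G k (xiv \<omega>))"
        unfolding bm.G_def bm.sum_I by (simp add: sum_distrib_left)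
      finally show "bt N k \<omega> = complex_of_real (sqrt (s2 N) * bm.G k (xiv \<omega>))" .
    qed
  qed
qed

lemma beta_G_AE: "AE \<omega> in M. \<forall>k\<in>bm.K. beta X \<phi> N k \<omega> = sqrt (s2 N) * bm.G k (xiv \<omega>)"
proof -
  have "AE \<omega> in M. \<forall>k\<in>bm.K. complex_of_real (beta X \<phi> N k \<omega>) = bt N k \<omega>"
    using beta_AE by (intro AE_finite_allI) (auto simp: bm.K_def)
  with bt_AE show ?thesis
  proof eventually_elim
    fix \<omega> assume 1: "\<forall>k. bt N k \<omega> = complex_of_real (sqrt (s2 N) * bm.G k (xiv \<omega>))"
      and 2: "\<forall>k\<in>bm.K. complex_of_real (beta X \<phi> N k \<omega>) = bt N k \<omega>"
    show "\<forall>k\<in>bm.K. beta X \<phi> N k \<omega> = sqrt (s2 N) * bm.G k (xiv \<omega>)"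
      using 1 2 by (metis of_real_eq_iff)
  qed
qed

lemma sigma2_eq:
  assumes k: "k \<in> bm.K"
  shows "sigma2 M X \<phi> N k = s2 N"
proof -
  have Gm: "(\<lambda>x. (sqrt (s2 N) * bm.G k x)\<^sup>2) \<in> borel_measurable (gauss bm.I)"
  proof -
    have "bm.G k \<in> borel_measurable (gauss bm.I)"
      using polyd_measurable[OF bm.polyd_G[of "[:0, 1:]" k]] by simp
    then show ?thesis by (intro borel_measurable_power borel_measurable_times borel_measurable_const)
  qed
  have m: "(\<lambda>\<omega>. (sqrt (s2 N) * bm.G k (xiv \<omega>))\<^sup>2) \<in> borel_measurable M"
    by (rule measurable_compose[OF xiv_measurable Gm])
  have "sigma2 M X \<phi> N k = expectation (\<lambda>\<omega>. (sqrt (s2 N) * bm.G k (xiv \<omega>))\<^sup>2)"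
    unfolding sigma2_def
  proof (rule integral_cong_AE)
    show "AE \<omega> in M. (beta X \<phi> N k \<omega>)\<^sup>2 = (sqrt (s2 N) * bm.G k (xiv \<omega>))\<^sup>2"
      using beta_G_AE by eventually_elim (use k in simp)
  qed (use m beta_measurable in \<open>auto intro: borel_measurable_power\<close>)
  also have "\<dots> = (LINT x|gauss bm.I. (sqrt (s2 N) * bm.G k x)\<^sup>2)"
    by (rule xiv_transfer[OF Gm])
  also have "\<dots> = s2 N * (LINT x|gauss bm.I. (bm.G k x) ^ 2)"
    using s2_pos by (simp add: power_mult_distrib)
  also have "\<dots> = s2 N" using bm.moment_G[OF k, of 2] by (simp add: numeral_2_eq_2)
  finally show ?thesis .
qed

lemma stats_AE: "AE \<omega> in M. skewness_stat M X \<phi> N \<omega> = bm.S (xiv \<omega>) \<and> kurtosis_stat M X \<phi> N \<omega> = bm.U (xiv \<omega>)"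
  using beta_G_AE
proof eventually_elim
  fix \<omega> assume b: "\<forall>k\<in>bm.K. beta X \<phi> N k \<omega> = sqrt (s2 N) * bm.G k (xiv \<omega>)"
  have "beta_hat M X \<phi> N k \<omega> = bm.G k (xiv \<omega>)" if "k \<in> bm.K" for k
    using b that s2_pos by (simp add: beta_hat_def sigma2_eq)
  then show "skewness_stat M X \<phi> N \<omega> = bm.S (xiv \<omega>) \<and> kurtosis_stat M X \<phi> N \<omega> = bm.U (xiv \<omega>)"
    unfolding skewness_stat_def kurtosis_stat_def bm.S_def bm.U_def bm.K_def[symmetric] by simp
qed

lemma prodV_AE: "AE \<omega> in M. \<forall>ls. set ls \<subseteq> bm.Band \<longrightarrow>
    (\<Prod>l\<leftarrow>ls. (cmod (w l \<omega>))\<^sup>2 / C l) = bm.prodV (bm.ab ls) (xiv \<omega>) \<and>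
    (\<Prod>l\<leftarrow>ls. (cmod (w l \<omega>))\<^sup>2 * (aa N l)\<^sup>2) = (real N * s2 N) ^ length ls * (\<Prod>l\<leftarrow>ls. bm.pp l) * bm.prodV (bm.ab ls) (xiv \<omega>)"
  using V_AE
proof eventually_elim
  fix \<omega> assume V: "\<forall>l\<in>bm.Band. (cmod (w l \<omega>))\<^sup>2 = C l * bm.V (nat \<bar>l\<bar>) (xiv \<omega>)"
  show "\<forall>ls. set ls \<subseteq> bm.Band \<longrightarrow>
    (\<Prod>l\<leftarrow>ls. (cmod (w l \<omega>))\<^sup>2 / C l) = bm.prodV (bm.ab ls) (xiv \<omega>) \<and>
    (\<Prod>l\<leftarrow>ls. (cmod (w l \<omega>))\<^sup>2 * (aa N l)\<^sup>2) = (real N * s2 N) ^ length ls * (\<Prod>l\<leftarrow>ls. bm.pp l) * bm.prodV (bm.ab ls) (xiv \<omega>)"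
  proof (intro allI impI)
    fix ls assume "set ls \<subseteq> bm.Band"
    then show "(\<Prod>l\<leftarrow>ls. (cmod (w l \<omega>))\<^sup>2 / C l) = bm.prodV (bm.ab ls) (xiv \<omega>) \<and>
      (\<Prod>l\<leftarrow>ls. (cmod (w l \<omega>))\<^sup>2 * (aa N l)\<^sup>2) = (real N * s2 N) ^ length ls * (\<Prod>l\<leftarrow>ls. bm.pp l) * bm.prodV (bm.ab ls) (xiv \<omega>)"
    proof (induction ls)
      case Nil
      show ?case by (simp add: bm.prodV_def bm.ab_def)
    next
      case (Cons l ls)
      have C: "C l \<noteq> 0"
      proof (cases "1 \<le> l")
        case False
        then have "1 \<le> - l" using Cons.prems by (auto simp: bm.Band_def)
        then show ?thesis using C_pos[of "- l"] by (simp add: C_neg)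
      qed (use C_pos[of l] in simp)
      have e: "bm.prodV (bm.ab (l # ls)) x = bm.V (nat \<bar>l\<bar>) x * bm.prodV (bm.ab ls) x" for x
        by (simp add: bm.prodV_def bm.ab_def)
      have v: "(cmod (w l \<omega>))\<^sup>2 = C l * bm.V (nat \<bar>l\<bar>) (xiv \<omega>)" using V Cons.prems by simp
      have pp: "C l * (aa N l)\<^sup>2 = real N * s2 N * bm.pp l"
        using N_pos s2_pos by (simp add: pp_eq)
      have vw: "(cmod (w l \<omega>))\<^sup>2 * (aa N l)\<^sup>2 = real N * s2 N * bm.pp l * bm.V (nat \<bar>l\<bar>) (xiv \<omega>)"
        unfolding v pp[symmetric] by (simp add: mult_ac)
      have IH1: "(\<Prod>l\<leftarrow>ls. (cmod (w l \<omega>))\<^sup>2 / C l) = bm.prodV (bm.ab ls) (xiv \<omega>)"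
        and IH2: "(\<Prod>l\<leftarrow>ls. (cmod (w l \<omega>))\<^sup>2 * (aa N l)\<^sup>2) = (real N * s2 N) ^ length ls * (\<Prod>l\<leftarrow>ls. bm.pp l) * bm.prodV (bm.ab ls) (xiv \<omega>)"
        using Cons by simp_all
      have "(\<Prod>l\<leftarrow>l # ls. (cmod (w l \<omega>))\<^sup>2 / C l) = bm.prodV (bm.ab (l # ls)) (xiv \<omega>)"
        using C by (simp add: IH1 v e)
      moreover have "(\<Prod>l\<leftarrow>l # ls. (cmod (w l \<omega>))\<^sup>2 * (aa N l)\<^sup>2)
         = real N * s2 N * bm.pp l * bm.V (nat \<bar>l\<bar>) (xiv \<omega>) * ((real N * s2 N) ^ length ls * (\<Prod>l\<leftarrow>ls. bm.pp l) * bm.prodV (bm.ab ls) (xiv \<omega>))"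
        by (simp only: list.map prod_list.Cons vw IH2)
      moreover have "\<dots> = (real N * s2 N) ^ length (l # ls) * (\<Prod>l\<leftarrow>l # ls. bm.pp l) * bm.prodV (bm.ab (l # ls)) (xiv \<omega>)"
        by (simp add: e mult_ac)
      ultimately show ?case by (simp only:)
    qed
  qed
qed

lemma delta_eq:
  assumes "ls \<in> bm.T q"
  shows "delta M w C ls = bm.dl ls"
proof -
  have sub: "set ls \<subseteq> bm.Band" using assms by (simp add: bm.T_def)
  have pm: "bm.prodV (bm.ab ls) \<in> borel_measurable (gauss bm.I)"
    using polyd_measurable[OF bm.polyd_prodV[OF bm.ab_L[OF assms]]] by simp
  have wl: "(\<lambda>\<omega>. \<Prod>l\<leftarrow>ls. (cmod (w l \<omega>))\<^sup>2 / C l) \<in> borel_measurable M" for ls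
    by (induction ls) (auto intro!: borel_measurable_times borel_measurable_divide borel_measurable_power borel_measurable_norm_compose w_meas)
  have "delta M w C ls = expectation (\<lambda>\<omega>. bm.prodV (bm.ab ls) (xiv \<omega>))"
    unfolding delta_def
  proof (rule integral_cong_AE[OF wl measurable_compose[OF xiv_measurable pm]])
    show "AE \<omega> in M. (\<Prod>l\<leftarrow>ls. (cmod (w l \<omega>))\<^sup>2 / C l) = bm.prodV (bm.ab ls) (xiv \<omega>)"
      using prodV_AE by eventually_elim (use sub in blast)
  qed
  also have "\<dots> = bm.dl ls" unfolding bm.dl_def by (rule xiv_transfer[OF pm])
  finally show ?thesis .
qed

lemma tuple_sum_AE: "AE \<omega> in M. \<forall>q. tuple_sum M w C \<phi> N q \<omega> = (real N * s2 N) ^ q / (2 * pi) * bm.What q (xiv \<omega>)"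
  using prodV_AE
proof eventually_elim
  fix \<omega> assume P: "\<forall>ls. set ls \<subseteq> bm.Band \<longrightarrow>
    (\<Prod>l\<leftarrow>ls. (cmod (w l \<omega>))\<^sup>2 / C l) = bm.prodV (bm.ab ls) (xiv \<omega>) \<and>
    (\<Prod>l\<leftarrow>ls. (cmod (w l \<omega>))\<^sup>2 * (aa N l)\<^sup>2) = (real N * s2 N) ^ length ls * (\<Prod>l\<leftarrow>ls. bm.pp l) * bm.prodV (bm.ab ls) (xiv \<omega>)"
  show "\<forall>q. tuple_sum M w C \<phi> N q \<omega> = (real N * s2 N) ^ q / (2 * pi) * bm.What q (xiv \<omega>)"
  proof
    fix q
    show "tuple_sum M w C \<phi> N q \<omega> = (real N * s2 N) ^ q / (2 * pi) * bm.What q (xiv \<omega>)"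
      unfolding tuple_sum_finite Band_eq[symmetric] bm.T_def[symmetric] bm.What_def sum_distrib_left
    proof (rule sum.cong[OF refl])
      fix ls assume ls: "ls \<in> bm.T q"
      then have "(\<Prod>l\<leftarrow>ls. (cmod (w l \<omega>))\<^sup>2 * (aa N l)\<^sup>2) = (real N * s2 N) ^ q * (\<Prod>l\<leftarrow>ls. bm.pp l) * bm.prodV (bm.ab ls) (xiv \<omega>)"
        using P by (auto simp: bm.T_def)
      then show "1 / delta M w C ls * (\<Prod>l\<leftarrow>ls. (cmod (w l \<omega>))\<^sup>2 * (aa N l)\<^sup>2) * fejer N (2 * pi / real N * of_int (sum_list ls))
        = (real N * s2 N) ^ q / (2 * pi) * ((\<Prod>l\<leftarrow>ls. bm.pp l) * bm.kap ls / bm.dl ls * bm.prodV (bm.ab ls) (xiv \<omega>))"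
        unfolding delta_eq[OF ls] bm.kap_def by simp
    qed
  qed
qed

text \<open>The closed range from N / 8 to N / 2 and the set \<open>L\<close> differ only in
  frequencies at which the wavelet weight vanishes.\<close>

lemma sigma2_hat_AE: "AE \<omega> in M. sigma2_hat w \<phi> N \<omega> = s2 N * bm.R (xiv \<omega>)"
  using V_AE
proof eventually_elim
  fix \<omega> assume V: "\<forall>l\<in>bm.Band. (cmod (w l \<omega>))\<^sup>2 = C l * bm.V (nat \<bar>l\<bar>) (xiv \<omega>)"
  let ?X = "{l::int. real N / 8 \<le> of_int l \<and> of_int l \<le> real N / 2}"
  have finX: "finite ?X"
  proof (rule finite_subset)
    show "?X \<subseteq> {0..int N}"
    proof
      fix l assume "l \<in> ?X"
      then have "0 \<le> real_of_int l" "real_of_int l \<le> real N" by auto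
      then show "l \<in> {0..int N}" by simp
    qed
  qed simp
  have "(\<Sum>l\<in>?X. (cmod (w l \<omega>))\<^sup>2 * (aa N l)\<^sup>2) = (\<Sum>l\<in>int ` bm.L. real N * s2 N * (bm.pp l * bm.V (nat \<bar>l\<bar>) (xiv \<omega>)))"
  proof (rule sum.mono_neutral_cong[OF _ finX])
    show "finite (int ` bm.L)" using bm.finite_L by simp
    fix l
    show "real N * s2 N * (bm.pp l * bm.V (nat \<bar>l\<bar>) (xiv \<omega>)) = 0" if "l \<in> int ` bm.L - ?X"
    proof -
      have "aa N l = 0"
      proof (rule ccontr)
        assume "aa N l \<noteq> 0"
        from aa_nonzero(2,3)[OF this] show False using that by auto
      qed
      then show ?thesis by (simp add: pp_eq)
    qed
    show "(cmod (w l \<omega>))\<^sup>2 * (aa N l)\<^sup>2 = 0" if l: "l \<in> ?X - int ` bm.L"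
    proof -
      have "aa N l = 0"
      proof (rule ccontr)
        assume "aa N l \<noteq> 0"
        then have b: "l \<in> band N" by (rule aa_nonzero(1))
        have "0 \<le> real_of_int l" using l N_pos by (auto intro: order_trans[of _ "real N / 8"])
        then have "0 \<le> l" by simp
        then have "l = int (nat l)" "nat l \<in> bm.L" using b by (auto simp: band_def bm.L_def)
        then show False using l by blast
      qed
      then show ?thesis by simp
    qed
    assume "l \<in> ?X \<inter> int ` bm.L"
    then have "l \<in> bm.Band" by (auto simp: bm.Band_def bm.L_def)
    then have v: "(cmod (w l \<omega>))\<^sup>2 = C l * bm.V (nat \<bar>l\<bar>) (xiv \<omega>)" using V by simp
    have pp: "C l * (aa N l)\<^sup>2 = real N * s2 N * bm.pp l"
      using N_pos s2_pos by (simp add: pp_eq)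
    show "(cmod (w l \<omega>))\<^sup>2 * (aa N l)\<^sup>2 = real N * s2 N * (bm.pp l * bm.V (nat \<bar>l\<bar>) (xiv \<omega>))"
      unfolding v mult.assoc[symmetric] pp[symmetric] by (simp add: mult_ac)
  qed
  also have "\<dots> = real N * s2 N * (\<Sum>l\<in>bm.L. pw N l * bm.V l (xiv \<omega>))"
    by (subst sum.reindex) (auto simp: bm.pp_def sum_distrib_left)
  finally show "sigma2_hat w \<phi> N \<omega> = s2 N * bm.R (xiv \<omega>)"
    using N_pos unfolding sigma2_hat_def bm.R_def by (simp add: sum_distrib_left mult_ac)
qed

text \<open>The estimators in Gaussian coordinates. The powers of N and of the true variance cancel
  against the estimated variance, and 12 pi / (2 pi) leaves the factor 6.\<close>

definition DS :: "(nat \<times> bool \<Rightarrow> real) \<Rightarrow> real" where "DS x = 6 * bm.What 3 x / bm.R x ^ 3"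
definition DU :: "(nat \<times> bool \<Rightarrow> real) \<Rightarrow> real" where "DU x = 72 * bm.What 2 x / bm.R x ^ 2 + 24 * bm.What 4 x / bm.R x ^ 4"

lemma var_hat_AE: "AE \<omega> in M. var_skewness_hat M w C \<phi> N \<omega> = DS (xiv \<omega>) \<and> var_kurtosis_hat M w C \<phi> N \<omega> = DU (xiv \<omega>)"
  using tuple_sum_AE sigma2_hat_AE
proof eventually_elim
  fix \<omega> assume T: "\<forall>q. tuple_sum M w C \<phi> N q \<omega> = (real N * s2 N) ^ q / (2 * pi) * bm.What q (xiv \<omega>)"
    and R: "sigma2_hat w \<phi> N \<omega> = s2 N * bm.R (xiv \<omega>)"
  have gen: "c / (real N ^ q * (s2 N * r) ^ q) * ((real N * s2 N) ^ q / (2 * pi) * W) = c / (2 * pi) * W / r ^ q" for c q r W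
    using N_pos s2_pos by (simp add: power_mult_distrib)
  have "var_skewness_hat M w C \<phi> N \<omega> = DS (xiv \<omega>)"
    unfolding var_skewness_hat_def T[rule_format] R gen DS_def by simp
  moreover have "var_kurtosis1_hat M w C \<phi> N \<omega> = 72 * bm.What 2 (xiv \<omega>) / bm.R (xiv \<omega>) ^ 2"
    using gen[of "72 * (2 * pi)" 2 "bm.R (xiv \<omega>)" "bm.What 2 (xiv \<omega>)"]
    unfolding var_kurtosis1_hat_def T[rule_format] R by (simp add: mult_ac)
  moreover have "var_kurtosis2_hat M w C \<phi> N \<omega> = 24 * bm.What 4 (xiv \<omega>) / bm.R (xiv \<omega>) ^ 4"
    using gen[of "24 * (2 * pi)" 4 "bm.R (xiv \<omega>)" "bm.What 4 (xiv \<omega>)"]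
    unfolding var_kurtosis2_hat_def T[rule_format] R by (simp add: mult_ac)
  ultimately show "var_skewness_hat M w C \<phi> N \<omega> = DS (xiv \<omega>) \<and> var_kurtosis_hat M w C \<phi> N \<omega> = DU (xiv \<omega>)"
    by (simp add: var_kurtosis_hat_def DU_def)
qed

end

section \<open>Replacing the variances by their estimators\<close>

text \<open>Both factors tend to 1 as \<kappa> tends to 0, and 1 / sqrt r is continuous at 1. The
  power 4 is the largest with which the estimated variance enters.\<close>

lemma sqrt_ratio_close:
  fixes m0 \<eta> :: real
  assumes m0: "0 < m0" and \<eta>: "0 < \<eta>"
  obtains \<kappa> where "0 < \<kappa>" "\<kappa> < 1" "2 * \<kappa> < m0"
    "\<And>V D. 0 < V \<Longrightarrow> (1 - 2 * \<kappa> / m0) / (1 + \<kappa>) ^ 4 * V \<le> D \<Longrightarrow> D \<le> (1 + 2 * \<kappa> / m0) / (1 - \<kappa>) ^ 4 * V \<Longrightarrow> \<bar>sqrt V / sqrt D - 1\<bar> \<le> \<eta>"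
proof -
  have "((\<lambda>r::real. 1 / sqrt r) \<longlongrightarrow> 1 / sqrt 1) (at 1)"
    by (intro tendsto_intros) auto
  then obtain d where d: "0 < d" "\<And>r. r \<noteq> 1 \<Longrightarrow> \<bar>r - 1\<bar> < d \<Longrightarrow> \<bar>1 / sqrt r - 1\<bar> < \<eta>"
    using \<eta> unfolding LIM_def by (auto simp: dist_real_def)
  have cl: "\<bar>1 / sqrt r - 1\<bar> \<le> \<eta>" if "\<bar>r - 1\<bar> < d" for r
    using d(2)[of r] that \<eta> by (cases "r = 1") auto
  have "((\<lambda>\<kappa>. (1 - 2 * \<kappa> / m0) / (1 + \<kappa>) ^ 4) \<longlongrightarrow> (1 - 2 * 0 / m0) / (1 + 0) ^ 4) (at_right 0)"
    using m0 by (intro tendsto_intros) auto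
  then have l1: "eventually (\<lambda>\<kappa>. dist ((1 - 2 * \<kappa> / m0) / (1 + \<kappa>) ^ 4) 1 < d) (at_right 0)"
    using d(1) by (auto dest: tendstoD)
  have "((\<lambda>\<kappa>. (1 + 2 * \<kappa> / m0) / (1 - \<kappa>) ^ 4) \<longlongrightarrow> (1 + 2 * 0 / m0) / (1 - 0) ^ 4) (at_right 0)"
    using m0 by (intro tendsto_intros) auto
  then have l2: "eventually (\<lambda>\<kappa>. dist ((1 + 2 * \<kappa> / m0) / (1 - \<kappa>) ^ 4) 1 < d) (at_right 0)"
    using d(1) by (auto dest: tendstoD)
  have l3: "eventually (\<lambda>\<kappa>::real. \<kappa> \<in> {0<..<min 1 (m0 / 2)}) (at_right 0)"
    using m0 by (intro eventually_at_right_real) auto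
  obtain \<kappa> where \<kappa>: "dist ((1 - 2 * \<kappa> / m0) / (1 + \<kappa>) ^ 4) 1 < d"
    "dist ((1 + 2 * \<kappa> / m0) / (1 - \<kappa>) ^ 4) 1 < d" "\<kappa> \<in> {0<..<min 1 (m0 / 2)}"
    using eventually_happens[OF eventually_conj[OF l1 eventually_conj[OF l2 l3]]] by auto
  show ?thesis
  proof (rule that[of \<kappa>])
    fix V D :: real
    assume V: "0 < V" and lo: "(1 - 2 * \<kappa> / m0) / (1 + \<kappa>) ^ 4 * V \<le> D" and hi: "D \<le> (1 + 2 * \<kappa> / m0) / (1 - \<kappa>) ^ 4 * V"
    have "(1 - 2 * \<kappa> / m0) / (1 + \<kappa>) ^ 4 \<le> D / V" using lo V by (simp add: pos_le_divide_eq)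
    moreover have "D / V \<le> (1 + 2 * \<kappa> / m0) / (1 - \<kappa>) ^ 4" using hi V by (simp add: pos_divide_le_eq)
    ultimately have "\<bar>D / V - 1\<bar> < d" using \<kappa>(1,2) unfolding dist_real_def by linarith
    from cl[OF this] show "\<bar>sqrt V / sqrt D - 1\<bar> \<le> \<eta>" by (simp add: real_sqrt_divide)
  qed (use \<kappa>(3) in auto)
qed

lemma inverse_power_bounds:
  fixes r \<kappa> :: real
  assumes "\<bar>r - 1\<bar> \<le> \<kappa>" "0 < \<kappa>" "\<kappa> < 1" "j \<le> 4"
  shows "1 / (1 + \<kappa>) ^ 4 \<le> 1 / r ^ j" "1 / r ^ j \<le> 1 / (1 - \<kappa>) ^ 4"
proof -
  have r: "1 - \<kappa> \<le> r" "r \<le> 1 + \<kappa>" "0 < r" using assms by auto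
  have "r ^ j \<le> (1 + \<kappa>) ^ j" using r by (intro power_mono) auto
  also have "\<dots> \<le> (1 + \<kappa>) ^ 4" using assms by (intro power_increasing) auto
  finally show "1 / (1 + \<kappa>) ^ 4 \<le> 1 / r ^ j" using r by (intro divide_left_mono) auto
  have "(1 - \<kappa>) ^ 4 \<le> (1 - \<kappa>) ^ j" using assms by (intro power_decreasing) auto
  also have "\<dots> \<le> r ^ j" using r assms by (intro power_mono) auto
  finally show "1 / r ^ j \<le> 1 / (1 - \<kappa>) ^ 4" using r assms by (intro divide_left_mono) auto
qed

lemma abs_cos_diff_le: "\<bar>cos x - cos y\<bar> \<le> \<bar>x - y\<bar>" for x y :: real
proof -
  have "norm (cos x - cos y) \<le> 1 * norm (x - y)"
    by (rule field_differentiable_bound[where S=UNIV and f'="\<lambda>z. - sin z"])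
       (auto intro!: derivative_eq_intros)
  then show ?thesis by simp
qed

definition var_const :: "real \<Rightarrow> nat \<Rightarrow> real" where
  "var_const lam m = 8 * real (Suc (Suc m)) ^ 4 * fact (2 * m + 3) * lam ^ (2 * m + 4)"

section \<open>Comparison of the studentised with the normalised statistics\<close>

context wavelet_level
begin

lemma What_nonneg: "0 \<le> bm.What q x"
  unfolding bm.What_def
proof (intro sum_nonneg mult_nonneg_nonneg divide_nonneg_nonneg)
  fix ls assume ls: "ls \<in> bm.T q"
  show "0 \<le> (\<Prod>l\<leftarrow>ls. bm.pp l)" using bm.prod_pp_bounds[of ls] ls by (simp add: bm.T_def)
  show "0 \<le> bm.kap ls" by (simp add: bm.kap_eq)
  show "0 \<le> bm.dl ls" using bm.dl_ge_1[OF ls] by linarith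
  show "0 \<le> bm.prodV (bm.ab ls) x" by (rule bm.prodV_nonneg)
qed

text \<open>The bound \<open>m0\<close> turns the additive error \<kappa> of the moment estimates
  into a relative one. Of \<open>mom 4\<close> only nonnegativity is at hand, so the whole error 72
  \<kappa> + 24 \<kappa> is charged to the term with \<open>mom 2\<close>; the 2 in 2 \<kappa> / m0
  makes 144 \<kappa> available there.\<close>

lemma estimator_bounds:
  assumes m0: "0 < m0" "m0 \<le> bm.mom 2" "m0 \<le> bm.mom 3" and \<kappa>: "0 < \<kappa>" "\<kappa> < 1" "2 * \<kappa> < m0"
    and close: "\<bar>bm.What 2 x - bm.mom 2\<bar> \<le> \<kappa>" "\<bar>bm.What 3 x - bm.mom 3\<bar> \<le> \<kappa>" "\<bar>bm.What 4 x - bm.mom 4\<bar> \<le> \<kappa>" "\<bar>bm.R x - 1\<bar> \<le> \<kappa>"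
  shows "(1 - 2 * \<kappa> / m0) / (1 + \<kappa>) ^ 4 * bm.VS \<le> DS x" "DS x \<le> (1 + 2 * \<kappa> / m0) / (1 - \<kappa>) ^ 4 * bm.VS"
    "(1 - 2 * \<kappa> / m0) / (1 + \<kappa>) ^ 4 * bm.VU \<le> DU x" "DU x \<le> (1 + 2 * \<kappa> / m0) / (1 - \<kappa>) ^ 4 * bm.VU"
proof -
  define lo where "lo = 1 / (1 + \<kappa>) ^ 4"
  define hi where "hi = 1 / (1 - \<kappa>) ^ 4"
  have lh: "0 \<le> lo" "0 \<le> hi" using \<kappa> by (auto simp: lo_def hi_def)
  have inv: "lo \<le> 1 / bm.R x ^ j" "1 / bm.R x ^ j \<le> hi" if "j \<le> 4" for j
    unfolding lo_def hi_def using inverse_power_bounds[OF close(4) \<kappa>(1,2) that] by auto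
  have up: "c * bm.What q x / bm.R x ^ j \<le> hi * (c * bm.What q x)"
    "lo * (c * bm.What q x) \<le> c * bm.What q x / bm.R x ^ j" if "j \<le> 4" "0 \<le> c" for c q j
    using mult_right_mono[OF inv(1)[OF that(1)], of "c * bm.What q x"] mult_right_mono[OF inv(2)[OF that(1)], of "c * bm.What q x"]
      What_nonneg[of q x] that(2) by simp_all
  have k3: "\<kappa> \<le> \<kappa> / m0 * bm.mom 3" and k2: "\<kappa> \<le> \<kappa> / m0 * bm.mom 2"
    using m0 \<kappa> by (simp_all add: field_simps)
  have mom4: "0 \<le> \<kappa> / m0 * bm.mom 4" using bm.mom_nonneg m0 \<kappa> by simp
  have kS: "6 * \<kappa> \<le> 2 * \<kappa> / m0 * bm.VS" 
  proof -
    have "2 * \<kappa> / m0 * bm.VS = 12 * (\<kappa> / m0 * bm.mom 3)" by (simp add: bm.VS_def)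
    then show ?thesis using k3 \<kappa> by linarith
  qed
  have kU: "96 * \<kappa> \<le> 2 * \<kappa> / m0 * bm.VU" 
  proof -
    have "2 * \<kappa> / m0 * bm.VU = 144 * (\<kappa> / m0 * bm.mom 2) + 48 * (\<kappa> / m0 * bm.mom 4)"
      by (simp add: bm.VU_def algebra_simps add_divide_distrib)
    then show ?thesis using k2 mom4 \<kappa> by linarith
  qed
  have "lo * ((1 - 2 * \<kappa> / m0) * bm.VS) \<le> lo * (6 * bm.What 3 x)"
    using close(2) kS by (intro mult_left_mono lh) (simp add: bm.VS_def algebra_simps)
  also have "\<dots> \<le> DS x" unfolding DS_def by (rule up) auto
  finally show "(1 - 2 * \<kappa> / m0) / (1 + \<kappa>) ^ 4 * bm.VS \<le> DS x" by (simp add: lo_def)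
  have "DS x \<le> hi * (6 * bm.What 3 x)" unfolding DS_def by (rule up) auto
  also have "\<dots> \<le> hi * ((1 + 2 * \<kappa> / m0) * bm.VS)"
    using close(2) kS by (intro mult_left_mono lh) (simp add: bm.VS_def algebra_simps)
  finally show "DS x \<le> (1 + 2 * \<kappa> / m0) / (1 - \<kappa>) ^ 4 * bm.VS" by (simp add: hi_def)
  have "lo * ((1 - 2 * \<kappa> / m0) * bm.VU) \<le> lo * (72 * bm.What 2 x + 24 * bm.What 4 x)"
    using close(1,3) kU by (intro mult_left_mono lh) (simp add: bm.VU_def algebra_simps)
  also have "\<dots> \<le> DU x"
    unfolding DU_def distrib_left by (intro add_mono up) auto
  finally show "(1 - 2 * \<kappa> / m0) / (1 + \<kappa>) ^ 4 * bm.VU \<le> DU x" by (simp add: lo_def)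
  have "DU x \<le> hi * (72 * bm.What 2 x + 24 * bm.What 4 x)"
    unfolding DU_def distrib_left by (intro add_mono up) auto
  also have "\<dots> \<le> hi * ((1 + 2 * \<kappa> / m0) * bm.VU)"
    using close(1,3) kU by (intro mult_left_mono lh) (simp add: bm.VU_def algebra_simps)
  finally show "DU x \<le> (1 + 2 * \<kappa> / m0) / (1 - \<kappa>) ^ 4 * bm.VU" by (simp add: hi_def)
qed

definition E2 :: "(nat \<times> bool \<Rightarrow> real) \<Rightarrow> real" where
  "E2 x = (bm.What 2 x - bm.mom 2)\<^sup>2 + (bm.What 3 x - bm.mom 3)\<^sup>2 + (bm.What 4 x - bm.mom 4)\<^sup>2 + (bm.R x - 1)\<^sup>2"

lemma
  shows S_meas: "bm.S \<in> borel_measurable (gauss bm.I)" and U_meas: "bm.U \<in> borel_measurable (gauss bm.I)"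
    and What_meas: "bm.What q \<in> borel_measurable (gauss bm.I)" and R_meas: "bm.R \<in> borel_measurable (gauss bm.I)"
    and S_int: "integrable (gauss bm.I) (\<lambda>x. (bm.S x)\<^sup>2)" and U_int: "integrable (gauss bm.I) (\<lambda>x. (bm.U x)\<^sup>2)"
    and What_int: "integrable (gauss bm.I) (\<lambda>x. (bm.What q x - c)\<^sup>2)" and R_int: "integrable (gauss bm.I) (\<lambda>x. (bm.R x - c)\<^sup>2)"
proof -
  obtain S' where S: "polyd bm.I bm.S S'" using bm.polyd_S_ex by blast
  obtain U' where U: "polyd bm.I bm.U U'" using bm.polyd_U_ex by blast
  have R: "polyd bm.I bm.R (\<lambda>i x. \<Sum>l\<in>bm.L. 2 * pw N l * (if fst i = l then x i else 0))"
    unfolding bm.R_def[abs_def] by (intro polyd_sum bm.finite_L polyd_cmult bm.polyd_V)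
  have sq: "integrable (gauss bm.I) (\<lambda>x. (f x - c)\<^sup>2)" if "polyd bm.I f f'" for f f' c
  proof -
    have "polyd bm.I (\<lambda>x. f x - c) f'"
      by (rule polyd_eq[OF polyd_add[OF that polyd_const[of _ "- c"]]]) auto
    from polyd_integrable[OF bm.finite_I polyd_mult[OF this this]] show ?thesis by (simp add: power2_eq_square)
  qed
  show "bm.S \<in> borel_measurable (gauss bm.I)" "bm.U \<in> borel_measurable (gauss bm.I)"
    "bm.What q \<in> borel_measurable (gauss bm.I)" "bm.R \<in> borel_measurable (gauss bm.I)"
    using polyd_measurable[OF S] polyd_measurable[OF U] polyd_measurable[OF bm.polyd_What] polyd_measurable[OF R] by auto
  show "integrable (gauss bm.I) (\<lambda>x. (bm.S x)\<^sup>2)" "integrable (gauss bm.I) (\<lambda>x. (bm.U x)\<^sup>2)"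
    using sq[OF S, of 0] sq[OF U, of 0] by simp_all
  show "integrable (gauss bm.I) (\<lambda>x. (bm.What q x - c)\<^sup>2)" "integrable (gauss bm.I) (\<lambda>x. (bm.R x - c)\<^sup>2)"
    by (rule sq[OF bm.polyd_What], rule sq[OF R])
qed

lemma E2_mean:
  "integrable (gauss bm.I) E2"
  "(LINT x|gauss bm.I. E2 x) \<le> (var_const lam 0 + var_const lam 1 + var_const lam 2 + 4 * lam) / real N"
proof -
  show "integrable (gauss bm.I) E2"
    unfolding E2_def[abs_def] by (intro Bochner_Integration.integrable_add What_int R_int)
  have v: "(LINT x|gauss bm.I. (bm.What (Suc (Suc m)) x - bm.mom (Suc (Suc m)))\<^sup>2) \<le> var_const lam m / real N" for m
    using bm.variance_What[of m] by (simp add: var_const_def)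
  have "(LINT x|gauss bm.I. E2 x) = (LINT x|gauss bm.I. (bm.What 2 x - bm.mom 2)\<^sup>2) + (LINT x|gauss bm.I. (bm.What 3 x - bm.mom 3)\<^sup>2)
     + (LINT x|gauss bm.I. (bm.What 4 x - bm.mom 4)\<^sup>2) + (LINT x|gauss bm.I. (bm.R x - 1)\<^sup>2)"
    unfolding E2_def using What_int R_int by simp
  also have "\<dots> \<le> var_const lam 0 / real N + var_const lam 1 / real N + var_const lam 2 / real N + 4 * lam / real N"
    using v[of 0] v[of 1] v[of 2] bm.variance_R
    by (intro add_mono) (simp_all add: numeral_2_eq_2 numeral_3_eq_3 eval_nat_numeral)
  finally show "(LINT x|gauss bm.I. E2 x) \<le> (var_const lam 0 + var_const lam 1 + var_const lam 2 + 4 * lam) / real N"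
    by (simp add: add_divide_distrib)
qed

text \<open>Where \<open>E2\<close> exceeds \<kappa>^2, two cosines differ by at most 2 <= 2 E2 /
  \<kappa>^2, a pointwise form of Chebyshev's inequality. Elsewhere the ratios of standard
  deviations are within \<eta> of 1, and the cosine is Lipschitz.\<close>

lemma studentized_cos_pointwise:
  assumes m0: "0 < m0" "m0 \<le> bm.mom 2" "m0 \<le> bm.mom 3" and \<kappa>: "0 < \<kappa>" "\<kappa> < 1" "2 * \<kappa> < m0" and \<eta>: "0 < \<eta>"
    and ratio: "\<And>V D. 0 < V \<Longrightarrow> (1 - 2 * \<kappa> / m0) / (1 + \<kappa>) ^ 4 * V \<le> D \<Longrightarrow> D \<le> (1 + 2 * \<kappa> / m0) / (1 - \<kappa>) ^ 4 * V \<Longrightarrow> \<bar>sqrt V / sqrt D - 1\<bar> \<le> \<eta>"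
  shows "\<bar>cos (s * (bm.S x / sqrt (DS x)) + t * (bm.U x / sqrt (DU x)) + \<theta>) - cos (s / sqrt bm.VS * bm.S x + t / sqrt bm.VU * bm.U x + \<theta>)\<bar>
    \<le> \<eta> * (\<bar>s\<bar> * ((1 + (bm.S x)\<^sup>2 / bm.VS) / 2) + \<bar>t\<bar> * ((1 + (bm.U x)\<^sup>2 / bm.VU) / 2)) + 2 / \<kappa>\<^sup>2 * E2 x"
    (is "?lhs \<le> ?a + ?b")
proof -
  have VS: "0 < bm.VS" using m0 by (simp add: bm.VS_def)
  have VU: "0 < bm.VU" using m0 bm.mom_nonneg[of 4] by (simp add: bm.VU_def)
  have a0: "0 \<le> ?a" using \<eta> VS VU by (intro mult_nonneg_nonneg add_nonneg_nonneg) auto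
  have b0: "0 \<le> ?b" using \<kappa> by (simp add: E2_def)
  show ?thesis
  proof (cases "E2 x \<le> \<kappa>\<^sup>2")
    case False
    have "?lhs \<le> 2"
      using cos_ge_minus_one[of "s * (bm.S x / sqrt (DS x)) + t * (bm.U x / sqrt (DU x)) + \<theta>"]
        cos_le_one[of "s * (bm.S x / sqrt (DS x)) + t * (bm.U x / sqrt (DU x)) + \<theta>"]
        cos_ge_minus_one[of "s / sqrt bm.VS * bm.S x + t / sqrt bm.VU * bm.U x + \<theta>"]
        cos_le_one[of "s / sqrt bm.VS * bm.S x + t / sqrt bm.VU * bm.U x + \<theta>"] by linarith
    also have "2 \<le> ?b" using False \<kappa> by (simp add: field_simps)
    finally show ?thesis using a0 by linarith
  next
    case True
    have sq: "\<bar>y\<bar> \<le> \<kappa>" if "y\<^sup>2 \<le> E2 x" for y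
    proof -
      have "y\<^sup>2 \<le> \<kappa>\<^sup>2" using that True by linarith
      then show ?thesis using \<kappa>(1) abs_le_square_iff[of y \<kappa>] by simp
    qed
    have close: "\<bar>bm.What 2 x - bm.mom 2\<bar> \<le> \<kappa>" "\<bar>bm.What 3 x - bm.mom 3\<bar> \<le> \<kappa>" "\<bar>bm.What 4 x - bm.mom 4\<bar> \<le> \<kappa>" "\<bar>bm.R x - 1\<bar> \<le> \<kappa>"
      by (rule sq, simp add: E2_def)+
    note eb = estimator_bounds[OF m0 \<kappa> close]
    have rS: "\<bar>sqrt bm.VS / sqrt (DS x) - 1\<bar> \<le> \<eta>" by (rule ratio[OF VS eb(1,2)])
    have rU: "\<bar>sqrt bm.VU / sqrt (DU x) - 1\<bar> \<le> \<eta>" by (rule ratio[OF VU eb(3,4)])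
    have gen: "\<bar>c * (y / sqrt D) - c / sqrt V * y\<bar> \<le> \<eta> * (\<bar>c\<bar> * ((1 + y\<^sup>2 / V) / 2))"
      if V: "0 < V" and r: "\<bar>sqrt V / sqrt D - 1\<bar> \<le> \<eta>" for c y D V
    proof -
      \<comment> \<open>The inequality |z| <= (1 + z^2) / 2 avoids absolute moments, since the
        normalised second moment is exactly 1.\<close>
      define z where "z = y / sqrt V"
      have y: "y = z * sqrt V" using V by (simp add: z_def)
      have "c * (y / sqrt D) - c / sqrt V * y = c * (z * (sqrt V / sqrt D - 1))"
        using V by (simp add: y algebra_simps)
      then have "\<bar>c * (y / sqrt D) - c / sqrt V * y\<bar> = \<bar>c\<bar> * (\<bar>z\<bar> * \<bar>sqrt V / sqrt D - 1\<bar>)" by (simp add: abs_mult)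
      also have "\<dots> \<le> \<bar>c\<bar> * ((1 + z\<^sup>2) / 2 * \<eta>)"
      proof (intro mult_left_mono mult_mono r)
        show "\<bar>z\<bar> \<le> (1 + z\<^sup>2) / 2" using sum_squares_bound[of 1 "\<bar>z\<bar>"] by simp
      qed auto
      also have "z\<^sup>2 = y\<^sup>2 / V" using V by (simp add: z_def power_divide)
      finally show ?thesis by (simp add: mult_ac)
    qed
    have "?lhs \<le> \<bar>(s * (bm.S x / sqrt (DS x)) - s / sqrt bm.VS * bm.S x) + (t * (bm.U x / sqrt (DU x)) - t / sqrt bm.VU * bm.U x)\<bar>"
      by (rule order_trans[OF abs_cos_diff_le]) (simp add: algebra_simps)
    also have "\<dots> \<le> \<bar>s * (bm.S x / sqrt (DS x)) - s / sqrt bm.VS * bm.S x\<bar> + \<bar>t * (bm.U x / sqrt (DU x)) - t / sqrt bm.VU * bm.U x\<bar>"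
      by (rule abs_triangle_ineq)
    also have "\<dots> \<le> ?a"
      unfolding distrib_left[of \<eta>] by (intro add_mono gen VS VU rS rU)
    finally show ?thesis using b0 by linarith
  qed
qed

text \<open>The three errors come from the ratios of standard deviations, from the event of bad
  estimation, and from the normal approximation. In the last one the coefficients
  \<open>s / sqrt VS\<close> and \<open>t / sqrt VU\<close> are bounded uniformly because both
  variances are at least 6 m0.\<close>

lemma studentized_cos_bound:
  assumes m0: "0 < m0" "m0 \<le> bm.mom 2" "m0 \<le> bm.mom 3" and \<kappa>: "0 < \<kappa>" "\<kappa> < 1" "2 * \<kappa> < m0" and \<eta>: "0 < \<eta>"
    and ratio: "\<And>V D. 0 < V \<Longrightarrow> (1 - 2 * \<kappa> / m0) / (1 + \<kappa>) ^ 4 * V \<le> D \<Longrightarrow> D \<le> (1 + 2 * \<kappa> / m0) / (1 - \<kappa>) ^ 4 * V \<Longrightarrow> \<bar>sqrt V / sqrt D - 1\<bar> \<le> \<eta>"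
  shows "\<bar>expectation (\<lambda>\<omega>. cos (s * (skewness_stat M X \<phi> N \<omega> / sqrt (var_skewness_hat M w C \<phi> N \<omega>)) +
      t * (kurtosis_stat M X \<phi> N \<omega> / sqrt (var_kurtosis_hat M w C \<phi> N \<omega>)) + \<theta>)) - cos \<theta> * exp (- (s\<^sup>2 + t\<^sup>2) / 2)\<bar>
    \<le> \<eta> * (\<bar>s\<bar> + \<bar>t\<bar>) + 2 / \<kappa>\<^sup>2 * ((var_const lam 0 + var_const lam 1 + var_const lam 2 + 4 * lam) / real N)
      + sqrt ((2 * lam) ^ 3 / sqrt (real N) * (4 * (18 * ((\<bar>s\<bar> + \<bar>t\<bar>) / sqrt (6 * m0))) ^ 4 * normal_mean ([:1, 0, 0, 0, 1:] ^ 4)))"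
proof -
  let ?y = "\<lambda>x. cos (s * (bm.S x / sqrt (DS x)) + t * (bm.U x / sqrt (DU x)) + \<theta>)"
  let ?z = "\<lambda>x. cos (s / sqrt bm.VS * bm.S x + t / sqrt bm.VU * bm.U x + \<theta>)"
  let ?E = "\<lambda>f. LINT x|gauss bm.I. f x"
  have VS: "0 < bm.VS" "6 * m0 \<le> bm.VS" using m0 by (auto simp: bm.VS_def)
  have VU: "0 < bm.VU" "6 * m0 \<le> bm.VU" using m0 bm.mom_nonneg[of 4] by (auto simp: bm.VU_def)
  note [measurable] = S_meas U_meas What_meas R_meas
  have ym[measurable]: "?y \<in> borel_measurable (gauss bm.I)"
    unfolding DS_def DU_def by measurable
  have y0m[measurable]: "?z \<in> borel_measurable (gauss bm.I)" by measurable
  have iy: "integrable (gauss bm.I) ?y" by (rule gaussp.integrable_const_bound[of _ 1, OF _ ym]) auto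
  have iy0: "integrable (gauss bm.I) ?z" by (rule gaussp.integrable_const_bound[of _ 1, OF _ y0m]) auto
  have "expectation (\<lambda>\<omega>. cos (s * (skewness_stat M X \<phi> N \<omega> / sqrt (var_skewness_hat M w C \<phi> N \<omega>)) +
      t * (kurtosis_stat M X \<phi> N \<omega> / sqrt (var_kurtosis_hat M w C \<phi> N \<omega>)) + \<theta>)) = expectation (\<lambda>\<omega>. ?y (xiv \<omega>))"
  proof (rule integral_cong_AE)
    note [measurable] = skewness_measurable kurtosis_measurable var_hat_measurable
    show "(\<lambda>\<omega>. cos (s * (skewness_stat M X \<phi> N \<omega> / sqrt (var_skewness_hat M w C \<phi> N \<omega>)) +
      t * (kurtosis_stat M X \<phi> N \<omega> / sqrt (var_kurtosis_hat M w C \<phi> N \<omega>)) + \<theta>)) \<in> borel_measurable M"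
      by measurable
    show "(\<lambda>\<omega>. ?y (xiv \<omega>)) \<in> borel_measurable M"
      by (rule measurable_compose[OF xiv_measurable ym])
    show "AE \<omega> in M. cos (s * (skewness_stat M X \<phi> N \<omega> / sqrt (var_skewness_hat M w C \<phi> N \<omega>)) +
      t * (kurtosis_stat M X \<phi> N \<omega> / sqrt (var_kurtosis_hat M w C \<phi> N \<omega>)) + \<theta>) = ?y (xiv \<omega>)"
      using stats_AE var_hat_AE by eventually_elim simp
  qed
  also have "\<dots> = ?E ?y" by (rule xiv_transfer[OF ym])
  finally have eq: "expectation (\<lambda>\<omega>. cos (s * (skewness_stat M X \<phi> N \<omega> / sqrt (var_skewness_hat M w C \<phi> N \<omega>)) +
      t * (kurtosis_stat M X \<phi> N \<omega> / sqrt (var_kurtosis_hat M w C \<phi> N \<omega>)) + \<theta>)) = ?E ?y" .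
  have ES: "?E (\<lambda>x. (bm.S x)\<^sup>2) = bm.VS" using bm.second_moment_SU[of 1 0] by simp
  have EU: "?E (\<lambda>x. (bm.U x)\<^sup>2) = bm.VU" using bm.second_moment_SU[of 0 1] by simp
  let ?B = "\<lambda>x. \<eta> * (\<bar>s\<bar> * ((1 + (bm.S x)\<^sup>2 / bm.VS) / 2) + \<bar>t\<bar> * ((1 + (bm.U x)\<^sup>2 / bm.VU) / 2)) + 2 / \<kappa>\<^sup>2 * E2 x"
  have iB1: "integrable (gauss bm.I) (\<lambda>x. (1 + (bm.S x)\<^sup>2 / bm.VS) / 2)" "integrable (gauss bm.I) (\<lambda>x. (1 + (bm.U x)\<^sup>2 / bm.VU) / 2)"
    using S_int U_int by simp_all
  have iB2: "integrable (gauss bm.I) (\<lambda>x. \<eta> * (\<bar>s\<bar> * ((1 + (bm.S x)\<^sup>2 / bm.VS) / 2) + \<bar>t\<bar> * ((1 + (bm.U x)\<^sup>2 / bm.VU) / 2)))"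
    by (intro integrable_mult_right Bochner_Integration.integrable_add iB1)
  have iB3: "integrable (gauss bm.I) (\<lambda>x. 2 / \<kappa>\<^sup>2 * E2 x)" by (intro integrable_mult_right E2_mean)
  have EB1: "?E (\<lambda>x. (1 + (bm.S x)\<^sup>2 / bm.VS) / 2) = 1" "?E (\<lambda>x. (1 + (bm.U x)\<^sup>2 / bm.VU) / 2) = 1"
    using S_int U_int VS(1) VU(1) by (simp_all add: ES EU gaussp.prob_space)
  have "\<bar>?E ?y - ?E ?z\<bar> = \<bar>?E (\<lambda>x. ?y x - ?z x)\<bar>" using iy iy0 by simp
  also have "\<dots> \<le> ?E (\<lambda>x. \<bar>?y x - ?z x\<bar>)" by (rule integral_abs_bound)
  also have "\<dots> \<le> ?E ?B"
    by (rule integral_mono[OF _ _ studentized_cos_pointwise[OF m0 \<kappa> \<eta> ratio]])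
       (use iy iy0 in simp, intro Bochner_Integration.integrable_add iB2 iB3)
  also have "\<dots> = \<eta> * (\<bar>s\<bar> * 1 + \<bar>t\<bar> * 1) + 2 / \<kappa>\<^sup>2 * ?E E2"
  proof -
    have "?E ?B = ?E (\<lambda>x. \<eta> * (\<bar>s\<bar> * ((1 + (bm.S x)\<^sup>2 / bm.VS) / 2) + \<bar>t\<bar> * ((1 + (bm.U x)\<^sup>2 / bm.VU) / 2))) + ?E (\<lambda>x. 2 / \<kappa>\<^sup>2 * E2 x)"
      by (rule Bochner_Integration.integral_add[OF iB2 iB3])
    also have "?E (\<lambda>x. \<eta> * (\<bar>s\<bar> * ((1 + (bm.S x)\<^sup>2 / bm.VS) / 2) + \<bar>t\<bar> * ((1 + (bm.U x)\<^sup>2 / bm.VU) / 2)))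
      = \<eta> * (\<bar>s\<bar> * 1 + \<bar>t\<bar> * 1)"
      by (simp only: integral_mult_right_zero Bochner_Integration.integral_add[OF integrable_mult_right[OF iB1(1)] integrable_mult_right[OF iB1(2)]] EB1)
    finally show ?thesis by (simp only: integral_mult_right_zero)
  qed
  also have "\<dots> \<le> \<eta> * (\<bar>s\<bar> + \<bar>t\<bar>) + 2 / \<kappa>\<^sup>2 * ((var_const lam 0 + var_const lam 1 + var_const lam 2 + 4 * lam) / real N)"
    unfolding mult_1_right using \<kappa> by (intro add_left_mono mult_left_mono E2_mean) auto
  finally have 1: "\<bar>?E ?y - ?E ?z\<bar> \<le> \<dots>" .
  have coef: "\<bar>c / sqrt V\<bar> \<le> (\<bar>s\<bar> + \<bar>t\<bar>) / sqrt (6 * m0)" if "6 * m0 \<le> V" "\<bar>c\<bar> \<le> \<bar>s\<bar> + \<bar>t\<bar>" for c V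
  proof -
    have "\<bar>c / sqrt V\<bar> = \<bar>c\<bar> / sqrt V" using that m0 by simp
    also have "\<dots> \<le> (\<bar>s\<bar> + \<bar>t\<bar>) / sqrt (6 * m0)"
      using that m0 by (intro frac_le) auto
    finally show ?thesis .
  qed
  have "(s / sqrt bm.VS)\<^sup>2 * bm.VS + (t / sqrt bm.VU)\<^sup>2 * bm.VU = s\<^sup>2 + t\<^sup>2"
    using VS VU by (simp add: power_divide)
  then have "\<bar>?E ?z - cos \<theta> * exp (- (s\<^sup>2 + t\<^sup>2) / 2)\<bar>
    \<le> sqrt ((2 * lam) ^ 3 / sqrt (real N) * (4 * (18 * ((\<bar>s\<bar> + \<bar>t\<bar>) / sqrt (6 * m0))) ^ 4 * normal_mean ([:1, 0, 0, 0, 1:] ^ 4)))"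
    using bm.characteristic_bound[OF coef[OF VS(2), of s] coef[OF VU(2), of t], of \<theta>] by simp
  then show ?thesis unfolding eq using 1 by linarith
qed

end

section \<open>The asymptotic regime\<close>

context wavelet
begin

text \<open>For \<open>1/2 \<le> x \<le> 1\<close> one has \<open>a\<^sup>2(x) = 1 - \<phi>(x)\<close> and \<open>a\<^sup>2(2 x) = \<phi>(x)\<close>. Near a point where
  \<open>\<phi> = 1/2\<close> both are bounded below, which provides many triples with \<open>l\<^sub>1 + l\<^sub>2 = l\<^sub>3\<close> and keeps the
  variance of the skewness statistic away from zero.\<close>
lemma half_point:
  obtains x0 \<delta> where "0 < \<delta>" "0 < x0" "\<And>x. \<bar>x - x0\<bar> < \<delta> \<Longrightarrow> 1 / 4 < \<phi> x \<and> \<phi> x < 3 / 4"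
proof -
  have "\<exists>x\<ge>1/2. x \<le> 1 \<and> \<phi> x = 1/2"
    by (rule IVT2') (use phi_one[of "1/2"] phi_zero[of 1] continuous_on_subset[OF phi_continuous] in auto)
  then obtain x0 where x0: "1/2 \<le> x0" "x0 \<le> 1" "\<phi> x0 = 1/2" by auto
  have "isCont \<phi> x0" using phi_continuous by (simp add: continuous_on_eq_continuous_at)
  then obtain \<delta> where "0 < \<delta>" "\<And>x. dist x x0 < \<delta> \<Longrightarrow> dist (\<phi> x) (\<phi> x0) < 1/4"
    unfolding continuous_at_eps_delta by (metis zero_less_divide_1_iff zero_less_numeral)
  note \<delta> = this
  have "1 / 4 < \<phi> x \<and> \<phi> x < 3 / 4" if "\<bar>x - x0\<bar> < \<delta>" for x
  proof -
    have "\<bar>\<phi> x - 1 / 2\<bar> < 1 / 4" using \<delta>(2)[of x] that x0(3) by (simp add: dist_real_def)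
    then show ?thesis by (intro conjI) linarith+
  qed
  then show ?thesis using that[of \<delta> x0] x0 \<delta>(1) by auto
qed

text \<open>The window of l contains at least \<delta> N / 4 - 1 integers to the right of its centre
  x0 N / 4, and 8 / \<delta> <= N lets half of \<delta> N / 4 absorb the rounding.\<close>

lemma card_window:
  fixes x0 \<delta> :: real
  assumes \<delta>: "0 < \<delta>" and x0: "0 < x0" and N: "8 / \<delta> \<le> real N" and fin: "finite {l::nat. \<bar>4 * real l / real N - x0\<bar> < \<delta>}"
  shows "\<delta> / 8 * real N \<le> real (card {l::nat. \<bar>4 * real l / real N - x0\<bar> < \<delta>})"
proof -
  have N0: "0 < real N" using N \<delta> by (smt (verit) divide_pos_pos)
  define a0 where "a0 = nat \<lceil>real N * x0 / 4\<rceil>"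
  define m where "m = nat \<lfloor>real N * \<delta> / 4\<rfloor>"
  have a0: "real N * x0 / 4 \<le> real a0" "real a0 < real N * x0 / 4 + 1"
    using N0 x0 unfolding a0_def by (auto simp: of_nat_nat; linarith)+
  have m: "real m \<le> real N * \<delta> / 4" "real N * \<delta> / 4 - 1 < real m"
    using N0 \<delta> unfolding m_def by (auto simp: of_nat_nat; linarith)+
  have sub: "(\<lambda>i. a0 + i) ` {..<m} \<subseteq> {l::nat. \<bar>4 * real l / real N - x0\<bar> < \<delta>}"
  proof
    fix l assume "l \<in> (\<lambda>i. a0 + i) ` {..<m}"
    then obtain i where i: "l = a0 + i" "i < m" by auto
    have "real i + 1 \<le> real m" using i(2) by simp
    then have "real N * x0 / 4 \<le> real l" "real l < real N * x0 / 4 + real N * \<delta> / 4"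
      using a0 m i by simp_all
    then have "0 \<le> 4 * real l / real N - x0" "4 * real l / real N - x0 < \<delta>"
      using N0 by (simp_all add: field_simps)
    then show "l \<in> {l::nat. \<bar>4 * real l / real N - x0\<bar> < \<delta>}" by simp
  qed
  have "m = card ((\<lambda>i. a0 + i) ` {..<m})" by (subst card_image) auto
  also have "\<dots> \<le> card {l::nat. \<bar>4 * real l / real N - x0\<bar> < \<delta>}" by (rule card_mono[OF fin sub])
  finally have "real m \<le> real (card {l::nat. \<bar>4 * real l / real N - x0\<bar> < \<delta>})" by simp
  moreover have "\<delta> / 8 * real N \<le> real N * \<delta> / 4 - 1"
    using N \<delta> by (simp add: field_simps)
  ultimately show ?thesis using m by linarith
qed

end

context wavelet_field
begin

text \<open>Over the band, from N / 8 to N / 2, the frequency changes by a factor 4. There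
  \<open>C\<close> stays between c1 q Q and c2 Q with q = 4^(- \<alpha>) and the scale Q = (N /
  8)^(- \<alpha>). The scale cancels in \<open>pw\<close>, so the constants are free of N although
  \<open>C\<close> decays.\<close>

lemma power_law_constants:
  fixes c1 c2 \<alpha> :: real and g :: "nat \<Rightarrow> real"
  assumes c: "0 < c1" "c1 \<le> c2" "0 < \<alpha>" and g: "\<And>n. c1 \<le> g n \<and> g n \<le> c2"
    and Cg: "\<And>l. 1 \<le> l \<Longrightarrow> C (int l) = g l * real l powr (- \<alpha>)"
  obtains lam m0 N0 where "0 < m0"
    "\<And>N. N0 \<le> N \<Longrightarrow> wavelet_level M \<phi> X w C N lam"
    "\<And>N. N0 \<le> N \<Longrightarrow> m0 \<le> band_model.mom N (pw N) 2 \<and> m0 \<le> band_model.mom N (pw N) 3"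
proof -
  obtain x0 \<delta> where \<delta>: "0 < \<delta>" and x0: "0 < x0" and half: "\<And>x. \<bar>x - x0\<bar> < \<delta> \<Longrightarrow> 1 / 4 < \<phi> x \<and> \<phi> x < 3 / 4"
    using half_point by metis
  define q where "q = 4 powr (- \<alpha>)"
  \<comment> \<open>\<open>lam\<close> compares the largest weight c2 Q with a lower bound of the
    total, in which at least \<delta> N / 8 frequencies have squared wavelet weight 1 / 4 or more.
    Conversely \<open>cc\<close> compares c1 Q q / 4 with the upper bound N c2 Q of the
    total.\<close>
  define lam where "lam = 16 * c2 / (\<delta> * c1 * q)"
  define cc where "cc = c1 * q / (4 * c2)"
  define d where "d = \<delta> / 8"
  define m0 where "m0 = min (d * cc\<^sup>2) (d\<^sup>2 * cc ^ 3)"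
  define N0 where "N0 = max 4 (nat \<lceil>8 / \<delta>\<rceil>)"
  have q: "0 < q" by (simp add: q_def)
  have c2: "0 < c2" using c by simp
  have pos: "0 < lam" "0 < cc" "0 < d" using \<delta> c c2 q by (auto simp: lam_def cc_def d_def)
  have m0: "0 < m0" using pos by (simp add: m0_def)
  have main: "wavelet_level M \<phi> X w C N lam \<and> m0 \<le> band_model.mom N (pw N) 2 \<and> m0 \<le> band_model.mom N (pw N) 3" if N: "N0 \<le> N" for N
  proof -
    have N4: "4 \<le> N" and N8: "8 / \<delta> \<le> real N" using N by (auto simp: N0_def)
    have Npos: "0 < real N" using N4 by simp
    define L where "L = {l::nat. 1 \<le> l \<and> 2 * l < N}"
    define L0 where "L0 = {l::nat. \<bar>4 * real l / real N - x0\<bar> < \<delta>}"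
    define Q where "Q = (real N / 8) powr (- \<alpha>)"
    have Q: "0 < Q" using Npos by (simp add: Q_def)
    have finL: "finite L" by (rule finite_subset[of _ "{..N}"]) (auto simp: L_def)
    have QC: "c1 * (Q * q) \<le> C (int l)" "C (int l) \<le> c2 * Q" if l: "real N / 8 < real l" "real l < real N / 2" for l
    proof -
      have l1: "1 \<le> l" using l(1) Npos by (cases l) auto
      have "real l powr (- \<alpha>) \<le> Q" unfolding Q_def using l Npos c by (intro powr_mono2') auto
      then have "g l * real l powr (- \<alpha>) \<le> c2 * Q" using g[of l] c2 by (intro mult_mono) auto
      then show "C (int l) \<le> c2 * Q" using Cg[OF l1] by simp
      have "(real N / 2) powr (- \<alpha>) \<le> real l powr (- \<alpha>)" using l Npos c l1 by (intro powr_mono2') auto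
      moreover have "(real N / 2) powr (- \<alpha>) = Q * q"
      proof -
        have "real N / 2 = (real N / 8) * 4" by simp
        then show ?thesis unfolding Q_def q_def using powr_mult[of "real N / 8" 4 "- \<alpha>"] by simp
      qed
      ultimately have "c1 * (Q * q) \<le> g l * real l powr (- \<alpha>)" using g[of l] c Q q by (intro mult_mono) auto
      then show "c1 * (Q * q) \<le> C (int l)" using Cg[OF l1] by simp
    qed
    have supp: "real N / 8 < real l" "real l < real N / 2" if "aa N (int l) \<noteq> 0" for l
      using aa_nonzero(2,3)[OF that] by auto
    have wL0: "l \<in> L \<and> 1 / 4 \<le> (aa N (int l))\<^sup>2" if l: "l \<in> L0" for l
    proof -
      define x where "x = 4 * real l / real N"
      have "1 / 4 < \<phi> x" "\<phi> x < 3 / 4" using half[of x] l by (auto simp: L0_def x_def)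
      then have x: "1 / 2 < x" "x < 1"
        using phi_one[of x] phi_zero[of x] by (force simp: x_def)+
      then have "1 \<le> l" "2 * l < N" using Npos by (cases l; auto simp: x_def field_simps)+
      moreover have "(aa N (int l))\<^sup>2 = 1 - \<phi> x"
        using a_sq[of x] phi_one[of "x / 2"] x by (simp add: x_def)
      ultimately show ?thesis using \<open>\<phi> x < 3 / 4\<close> by (simp add: L_def)
    qed
    \<comment> \<open>Here y / 2 is the midpoint of two points of the window and so lies in it, and
      for y > 1 the squared wavelet weight at y is \<phi>(y / 2).\<close>
    have wL00: "l + l' \<in> L \<and> 1 / 4 \<le> (aa N (int (l + l')))\<^sup>2" if l: "l \<in> L0" "l' \<in> L0" for l l'
    proof -
      define y where "y = 4 * real (l + l') / real N"
      have "y / 2 - x0 = ((4 * real l / real N - x0) + (4 * real l' / real N - x0)) / 2"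
        using Npos by (simp add: y_def field_simps)
      moreover have "\<bar>4 * real l / real N - x0\<bar> < \<delta>" "\<bar>4 * real l' / real N - x0\<bar> < \<delta>"
        using l by (simp_all add: L0_def)
      moreover have "\<bar>r\<bar> < \<delta>" if "r = (r1 + r2) / 2" "\<bar>r1\<bar> < \<delta>" "\<bar>r2\<bar> < \<delta>" for r r1 r2 :: real
        using that unfolding abs_less_iff by (auto simp: field_simps)
      ultimately have "\<bar>y / 2 - x0\<bar> < \<delta>" by blast
      from half[OF this] have h: "1 / 4 < \<phi> (y / 2)" "\<phi> (y / 2) < 3 / 4" by auto
      have y0: "0 \<le> y" using Npos by (simp add: y_def)
      have y: "1 < y" "y < 2"
        using phi_one[of "y / 2"] phi_zero[of "y / 2"] h y0 by force+
      have "2 * (l + l') < N" using y(2) Npos by (simp add: y_def field_simps)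
      moreover have "1 \<le> l + l'" using y(1) by (cases "l + l'") (auto simp: y_def)
      moreover have "(aa N (int (l + l')))\<^sup>2 = \<phi> (y / 2)"
        using a_sq[of y] phi_zero[of y] y by (simp add: y_def)
      ultimately show ?thesis using h by (simp add: L_def)
    qed
    have L0L: "L0 \<subseteq> L" using wL0 by auto
    have finL0: "finite L0" using L0L finL finite_subset by auto
    have card: "d * real N \<le> real (card L0)"
      unfolding d_def L0_def by (rule card_window[OF \<delta> x0 N8]) (use finL0 in \<open>simp add: L0_def\<close>)
    have cardL: "2 * real (card L) \<le> real N"
    proof -
      have "card L \<le> card {1..(N - 1) div 2}" by (rule card_mono) (auto simp: L_def)
      then have "2 * card L \<le> N" by simp
      then show ?thesis by linarith
    qed
    define W where "W = (\<Sum>l\<in>L. C (int l) * (aa N (int l))\<^sup>2)"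
    have Ns2: "real N * s2 N = 2 * W" using Npos by (simp add: s2_def W_def L_def)
    have Wlow: "\<delta> / 8 * real N * (c1 * (Q * q) * (1 / 4)) \<le> W"
    proof -
      have "\<delta> / 8 * real N * (c1 * (Q * q) * (1 / 4)) \<le> real (card L0) * (c1 * (Q * q) * (1 / 4))"
        using card c Q q by (intro mult_right_mono) (auto simp: d_def)
      also have "\<dots> = (\<Sum>l\<in>L0. c1 * (Q * q) * (1 / 4))" by simp
      also have "\<dots> \<le> (\<Sum>l\<in>L0. C (int l) * (aa N (int l))\<^sup>2)"
      proof (rule sum_mono)
        fix l assume l: "l \<in> L0"
        have a: "1 / 4 \<le> (aa N (int l))\<^sup>2" using wL0[OF l] by simp
        then have "aa N (int l) \<noteq> 0" by auto
        from QC(1)[OF supp[OF this]] a show "c1 * (Q * q) * (1 / 4) \<le> C (int l) * (aa N (int l))\<^sup>2"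
          using c Q q C_nonneg by (intro mult_mono) auto
      qed
      also have "\<dots> \<le> W" unfolding W_def using L0L finL C_nonneg by (intro sum_mono2) auto
      finally show ?thesis .
    qed
    have Wpos: "0 < W"
    proof -
      have "0 < \<delta> / 8 * real N * (c1 * (Q * q) * (1 / 4))" using \<delta> Npos c Q q by simp
      then show ?thesis using Wlow by linarith
    qed
    have Wup: "2 * W \<le> real N * (c2 * Q)"
    proof -
      have "W \<le> (\<Sum>l\<in>L. c2 * Q)"
        unfolding W_def
      proof (rule sum_mono)
        fix l
        show "C (int l) * (aa N (int l))\<^sup>2 \<le> c2 * Q"
        proof (cases "aa N (int l) = 0")
          case False
          have "C (int l) * (aa N (int l))\<^sup>2 \<le> (c2 * Q) * 1"
            using QC(2)[OF supp[OF False]] a_sq_le c2 Q by (intro mult_mono) auto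
          then show ?thesis by simp
        qed (use c2 Q in simp)
      qed
      then have "2 * W \<le> (2 * real (card L)) * (c2 * Q)" by simp
      also have "\<dots> \<le> real N * (c2 * Q)" using cardL c2 Q by (intro mult_right_mono) auto
      finally show ?thesis .
    qed
    have s2pos: "0 < s2 N" using Ns2 Wpos Npos by (metis mult_pos_pos zero_less_mult_pos zero_less_numeral)
    have pw_eq: "pw N l = C (int l) * (aa N (int l))\<^sup>2 / (2 * W)" for l
      unfolding pw_def Ns2 ..
    have lev: "wavelet_level M \<phi> X w C N lam"
    proof unfold_locales
      show "4 \<le> N" by (rule N4)
      show "0 < s2 N" by (rule s2pos)
      show "real N * pw N l \<le> lam" for l
      proof (cases "aa N (int l) = 0")
        case True
        then show ?thesis using pos by (simp add: pw_def)
      next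
        case False
        have "C (int l) * (aa N (int l))\<^sup>2 \<le> (c2 * Q) * 1"
          using QC(2)[OF supp[OF False]] a_sq_le c2 Q by (intro mult_mono) auto
        then have "real N * pw N l \<le> real N * (c2 * Q) / (2 * W)"
          using Wpos Npos unfolding pw_eq by (simp add: divide_right_mono)
        also have "\<dots> \<le> real N * (c2 * Q) / (2 * (\<delta> / 8 * real N * (c1 * (Q * q) * (1 / 4))))"
          using Wlow Wpos \<delta> Npos c c2 Q q by (intro divide_left_mono mult_left_mono) auto
        also have "\<dots> = lam"
          using \<delta> Npos c c2 Q q by (simp add: lam_def field_simps)
        finally show ?thesis .
      qed
    qed
    then interpret lv: wavelet_level M \<phi> X w C N lam .
    have low: "cc / real N \<le> pw N l" if "1 / 4 \<le> (aa N (int l))\<^sup>2" for l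
    proof -
      have "aa N (int l) \<noteq> 0" using that by auto
      from QC(1)[OF supp[OF this]] have "c1 * (Q * q) * (1 / 4) \<le> C (int l) * (aa N (int l))\<^sup>2"
        using that c Q q C_nonneg by (intro mult_mono) auto
      then have "c1 * (Q * q) * (1 / 4) / (real N * (c2 * Q)) \<le> pw N l"
        unfolding pw_eq using Wup Wpos c Q q C_nonneg[of "int l"] by (intro frac_le) auto
      moreover have "c1 * (Q * q) * (1 / 4) / (real N * (c2 * Q)) = cc / real N"
        using Q c2 Npos by (simp add: cc_def field_simps)
      ultimately show ?thesis by simp
    qed
    have LL: "lv.bm.L = L" by (simp add: lv.bm.L_def L_def)
    have "d * cc\<^sup>2 \<le> lv.bm.mom 2" "d\<^sup>2 * cc ^ 3 \<le> lv.bm.mom 3"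
      using lv.bm.mom_lower[of L0 cc d] L0L low wL0 wL00 card pos unfolding LL by auto
    then show ?thesis using lev by (auto simp: m0_def)
  qed
  show ?thesis by (rule that[of m0 N0 lam]) (use m0 main in auto)
qed

text \<open>The tolerance \<eta> is chosen from e, then \<kappa> from \<eta>, then the level. For
  fixed \<eta> and \<kappa> the two remaining errors tend to 0, while \<eta> accounts for at most e
  / 2.\<close>

lemma studentized_cos_limit:
  assumes A1: "assumption_A1 C"
  shows "(\<lambda>j. expectation (\<lambda>\<omega>. cos (a * (skewness_stat M X \<phi> (2 ^ (j + 2)) \<omega> / sqrt (var_skewness_hat M w C \<phi> (2 ^ (j + 2)) \<omega>)) +
      b * (kurtosis_stat M X \<phi> (2 ^ (j + 2)) \<omega> / sqrt (var_kurtosis_hat M w C \<phi> (2 ^ (j + 2)) \<omega>)) + \<theta>)))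
    \<longlonglongrightarrow> cos \<theta> * exp (- (a\<^sup>2 + b\<^sup>2) / 2)"
proof -
  obtain c1 c2 \<alpha> g where c: "0 < c1" "c1 \<le> c2" "1 < \<alpha>" and g: "\<And>n. g n \<in> {c1..c2}"
    and Cg: "\<And>l. 1 \<le> l \<Longrightarrow> C (int l) = g l * real l powr (- \<alpha>)"
    using A1 unfolding assumption_A1_def by blast
  have "\<exists>lam m0 N0. 0 < m0 \<and> (\<forall>N\<ge>N0. wavelet_level M \<phi> X w C N lam \<and>
      m0 \<le> band_model.mom N (pw N) 2 \<and> m0 \<le> band_model.mom N (pw N) 3)"
  proof (rule power_law_constants[of c1 c2 \<alpha> g])
    show "c1 \<le> g n \<and> g n \<le> c2" for n using g[of n] by simp
  qed (use c Cg in \<open>simp_all, blast\<close>)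
  then obtain lam m0 N0 where m0: "0 < m0" and lev: "\<And>N. N0 \<le> N \<Longrightarrow> wavelet_level M \<phi> X w C N lam"
    and mom: "\<And>N. N0 \<le> N \<Longrightarrow> m0 \<le> band_model.mom N (pw N) 2 \<and> m0 \<le> band_model.mom N (pw N) 3"
    by blast
  show ?thesis
  proof (rule LIMSEQ_I)
    fix e :: real assume e: "0 < e"
    define \<eta> where "\<eta> = e / (2 * (\<bar>a\<bar> + \<bar>b\<bar> + 1))"
    have \<eta>: "0 < \<eta>" using e by (simp add: \<eta>_def)
    have \<eta>e: "\<eta> * (\<bar>a\<bar> + \<bar>b\<bar>) < e"
    proof -
      have "\<eta> * (\<bar>a\<bar> + \<bar>b\<bar>) \<le> \<eta> * (\<bar>a\<bar> + \<bar>b\<bar> + 1)" using \<eta> by (intro mult_left_mono) auto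
      also have "\<dots> = e / 2"
      proof -
        have "e / (2 * r) * r = e / 2" if "0 < r" for r using that by simp
        from this[of "\<bar>a\<bar> + \<bar>b\<bar> + 1"] show ?thesis unfolding \<eta>_def by linarith
      qed
      finally show ?thesis using e by simp
    qed
    obtain \<kappa> where \<kappa>: "0 < \<kappa>" "\<kappa> < 1" "2 * \<kappa> < m0"
      and ratio: "\<And>V D. 0 < V \<Longrightarrow> (1 - 2 * \<kappa> / m0) / (1 + \<kappa>) ^ 4 * V \<le> D \<Longrightarrow> D \<le> (1 + 2 * \<kappa> / m0) / (1 - \<kappa>) ^ 4 * V \<Longrightarrow> \<bar>sqrt V / sqrt D - 1\<bar> \<le> \<eta>"
      using sqrt_ratio_close[OF m0 \<eta>] by metis
    define c3 where "c3 = var_const lam 0 + var_const lam 1 + var_const lam 2 + 4 * lam"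
    define c4 where "c4 = 4 * (18 * ((\<bar>a\<bar> + \<bar>b\<bar>) / sqrt (6 * m0))) ^ 4 * normal_mean ([:1, 0, 0, 0, 1:] ^ 4)"
    define err where "err N = \<eta> * (\<bar>a\<bar> + \<bar>b\<bar>) + 2 / \<kappa>\<^sup>2 * (c3 / N) + sqrt ((2 * lam) ^ 3 / sqrt N * c4)" for N :: real
    have lim: "(err \<longlongrightarrow> \<eta> * (\<bar>a\<bar> + \<bar>b\<bar>) + 2 / \<kappa>\<^sup>2 * 0 + sqrt (0 * c4)) at_top"
      unfolding err_def
    proof (intro tendsto_intros)
      show "((\<lambda>N::real. c3 / N) \<longlongrightarrow> 0) at_top"
        by (rule tendsto_divide_0[OF tendsto_const filterlim_at_top_imp_at_infinity[OF filterlim_ident]])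
      show "((\<lambda>N::real. (2 * lam) ^ 3 / sqrt N) \<longlongrightarrow> 0) at_top"
        by (rule tendsto_divide_0[OF tendsto_const filterlim_at_top_imp_at_infinity[OF sqrt_at_top]])
    qed
    have Ntop: "filterlim (\<lambda>j. real (2 ^ (j + 2))) at_top sequentially"
    proof (rule filterlim_at_top_mono[OF filterlim_real_sequentially])
      show "eventually (\<lambda>j. real j \<le> real (2 ^ (j + 2))) sequentially"
      proof (intro always_eventually allI)
        fix j :: nat
        have "j < 2 ^ j" by (rule less_exp)
        also have "(2::nat) ^ j \<le> 2 ^ (j + 2)" by (rule power_increasing) auto
        finally have "j \<le> 2 ^ (j + 2)" by simp
        then show "real j \<le> real (2 ^ (j + 2))" by (simp only: of_nat_le_iff)
      qed
    qed
    have "((\<lambda>j. err (real (2 ^ (j + 2)))) \<longlongrightarrow> \<eta> * (\<bar>a\<bar> + \<bar>b\<bar>)) sequentially"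
      using filterlim_compose[OF lim Ntop] by simp
    then have ev1: "eventually (\<lambda>j. err (real (2 ^ (j + 2))) < e) sequentially"
      using \<eta>e by (rule order_tendstoD(2))
    have ev2: "eventually (\<lambda>j. real N0 \<le> real (2 ^ (j + 2))) sequentially"
      using Ntop by (simp only: filterlim_at_top)
    from eventually_conj[OF ev1 ev2] obtain j0 where j0: "\<And>j. j0 \<le> j \<Longrightarrow> err (real (2 ^ (j + 2))) < e \<and> real N0 \<le> real (2 ^ (j + 2))"
      unfolding eventually_sequentially by blast
    show "\<exists>no. \<forall>j\<ge>no. norm (expectation (\<lambda>\<omega>. cos (a * (skewness_stat M X \<phi> (2 ^ (j + 2)) \<omega> / sqrt (var_skewness_hat M w C \<phi> (2 ^ (j + 2)) \<omega>)) +
      b * (kurtosis_stat M X \<phi> (2 ^ (j + 2)) \<omega> / sqrt (var_kurtosis_hat M w C \<phi> (2 ^ (j + 2)) \<omega>)) + \<theta>)) - cos \<theta> * exp (- (a\<^sup>2 + b\<^sup>2) / 2)) < e"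
    proof (intro exI[of _ j0] allI impI)
      fix j assume j: "j0 \<le> j"
      define N :: nat where "N = 2 ^ (j + 2)"
      have "real N0 \<le> real N" and er: "err (real N) < e" using j0[OF j] unfolding N_def by auto
      then have N: "N0 \<le> N" by simp
      interpret lv: wavelet_level M \<phi> X w C N lam by (rule lev[OF N])
      have "\<bar>expectation (\<lambda>\<omega>. cos (a * (skewness_stat M X \<phi> N \<omega> / sqrt (var_skewness_hat M w C \<phi> N \<omega>)) +
        b * (kurtosis_stat M X \<phi> N \<omega> / sqrt (var_kurtosis_hat M w C \<phi> N \<omega>)) + \<theta>)) - cos \<theta> * exp (- (a\<^sup>2 + b\<^sup>2) / 2)\<bar> \<le> err (real N)"
        using lv.studentized_cos_bound[OF m0 _ _ \<kappa> \<eta> ratio, of a b \<theta>] mom[OF N]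
        unfolding err_def c3_def c4_def by simp
      then show "norm (expectation (\<lambda>\<omega>. cos (a * (skewness_stat M X \<phi> (2 ^ (j + 2)) \<omega> / sqrt (var_skewness_hat M w C \<phi> (2 ^ (j + 2)) \<omega>)) +
        b * (kurtosis_stat M X \<phi> (2 ^ (j + 2)) \<omega> / sqrt (var_kurtosis_hat M w C \<phi> (2 ^ (j + 2)) \<omega>)) + \<theta>)) - cos \<theta> * exp (- (a\<^sup>2 + b\<^sup>2) / 2)) < e"
        using er unfolding N_def[symmetric] real_norm_def by linarith
    qed
  qed
qed

end

theorem theorem6p4:
  fixes M :: "'a measure"
    and X :: "real \<Rightarrow> 'a \<Rightarrow> real"
    and w :: "int \<Rightarrow> 'a \<Rightarrow> complex"
    and C :: "int \<Rightarrow> real"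
    and \<phi> :: "real \<Rightarrow> real"
  assumes "prob_space M"
    and "torus_field M X w C"
    and "assumption_A1 C"
    and "jointly_gaussian M w"
    and "wavelet_cutoff \<phi>"
  shows "converges_in_distribution M
           (\<lambda>j \<omega>. let N = 2 ^ (j + 2) in
              (skewness_stat M X \<phi> N \<omega> / sqrt (var_skewness_hat M w C \<phi> N \<omega>),
               kurtosis_stat M X \<phi> N \<omega> / sqrt (var_kurtosis_hat M w C \<phi> N \<omega>)))
           (standard_gaussian :: (real \<times> real) measure)"
proof -
  interpret prob_space M by fact
  have Cpos: "0 < C l" if "1 \<le> l" for l
  proof -
    obtain c1 \<alpha> g where c1: "0 < c1" "\<And>n. c1 \<le> g n" and Cg: "\<And>l. 1 \<le> l \<Longrightarrow> C (int l) = g l * real l powr (- \<alpha>)"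
      using assms(3) unfolding assumption_A1_def by (metis atLeastAtMost_iff)
    have "0 < g (nat l)" using c1 by (meson less_le_trans)
    then show ?thesis using Cg[of "nat l"] that by simp
  qed
  interpret wavelet_field M \<phi> X w C
    by unfold_locales (use assms Cpos in auto)
  define Y where "Y j \<omega> = (skewness_stat M X \<phi> (2 ^ (j + 2)) \<omega> / sqrt (var_skewness_hat M w C \<phi> (2 ^ (j + 2)) \<omega>),
    kurtosis_stat M X \<phi> (2 ^ (j + 2)) \<omega> / sqrt (var_kurtosis_hat M w C \<phi> (2 ^ (j + 2)) \<omega>))" for j \<omega>
  have Ym: "Y j \<in> borel_measurable M" for j
    unfolding Y_def[abs_def] using skewness_measurable kurtosis_measurable var_hat_measurable
    by (intro borel_measurable_Pair borel_measurable_divide borel_measurable_sqrt) auto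
  have conv: "(\<lambda>j. expectation (\<lambda>\<omega>. f (Y j \<omega>))) \<longlonglongrightarrow> (LINT y|gauss2. f y)"
    if f: "continuous_on UNIV f" "bounded (range f)" for f :: "real \<times> real \<Rightarrow> real"
  proof -
    obtain B where B: "\<And>x. \<bar>f x\<bar> \<le> B" using f(2) unfolding bounded_iff by auto
    have fm: "f \<in> borel_measurable borel" using f(1) by (rule borel_measurable_continuous_onI)
    have "(\<lambda>j. LINT z|distr M borel (Y j). f z) \<longlonglongrightarrow> (LINT z|gauss2. f z)"
    proof (rule weak_convergence_gauss2[OF _ _ _ f(1) B])
      show "prob_space (distr M borel (Y j))" for j using Ym by (rule prob_space_distr)
      fix a b \<theta>
      have "(\<lambda>z. cos (a * fst z + b * snd z + \<theta>)) \<in> borel_measurable (borel :: (real \<times> real) measure)"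
        by (intro borel_measurable_continuous_onI continuous_intros)
      from integral_distr[OF Ym this]
      have "(LINT z|distr M borel (Y j). cos (a * fst z + b * snd z + \<theta>)) = expectation (\<lambda>\<omega>. cos (a * fst (Y j \<omega>) + b * snd (Y j \<omega>) + \<theta>))" for j .
      then show "(\<lambda>j. LINT z|distr M borel (Y j). cos (a * fst z + b * snd z + \<theta>)) \<longlonglongrightarrow> cos \<theta> * exp (- (a\<^sup>2 + b\<^sup>2) / 2)"
        using studentized_cos_limit[OF assms(3), of a b \<theta>] by (simp add: Y_def)
    qed simp
    then show ?thesis unfolding integral_distr[OF Ym fm] .
  qed
  have "converges_in_distribution M Y gauss2"
    unfolding converges_in_distribution_def using Ym conv by auto
  then show ?thesis
    unfolding Let_def standard_gaussian_eq_gauss2 Y_def[abs_def] .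
qed

end
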